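(* In the variable-domain setting described in the context, let $\alpha_n,\alpha\in\mathcal U_{ad}$ with $\alpha_n\to\alpha$ in $C^1([0,1])$, let $(\mathbf u_n,p_n,\sigma^\nu_n,\sigma^\tau_n)$ be a solution of $(\mathcal M(\alpha_n))$ for each $n$, and assume $(\pi_{\alpha_n}\mathbf u_n,p_n^0)\rightharpoonup(\bar{\mathbf u},\bar p)$ weakly in $(H^1_0(\widehat\Omega))^2\times L^2_0(\widehat\Omega)$. Then there exist $\sigma^\nu(\alpha)\in H^{-1/2}(S(\alpha))$ and $\sigma^\tau(\alpha)\in L^2(S(\alpha))$ such that for every $\mathbf v\in(H^1_0(\widehat\Omega))^2$ $\langle\sigma^\nu_n,v_\nu\rangle_{\alpha_n}\to\langle\sigma^\nu(\alpha),v_\nu\rangle_\alpha$ and $(\sigma^\tau_n,v_\tau)_{0,S(\alpha_n)}\to(\sigma^\tau(\alpha),v_\tau)_{0,S(\alpha)}$, and the quadruplet $(\bar{\mathbf u}|_{\Omega(\alpha)},\bar p|_{\Omega(\alpha)},\sigma^\nu(\alpha),\sigma^\tau(\alpha))$ solves $(\mathcal M(\alpha))$.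
   Context: Let $\alpha_{min},\alpha_{max},C_1,C_2>0$ be given with $\alpha_{min}<\alpha_{max}$ and $\mathcal U_{ad}=\{\alpha\in C^{1,1}([0,1]):\ \alpha_{min}\le\alpha\le\alpha_{max}\text{ in }[0,1],\ |\alpha^{(j)}|\le C_j,\ j=1,2,\text{ a.e. in }(0,1)\}$. Let $\omega>\alpha_{max}$ be a constant and $\Omega(\alpha)=\{(x_1,x_2):x_1\in(0,1),\ \alpha(x_1)<x_2<\omega\}$, with slip part $S(\alpha)=\{(x_1,\alpha(x_1)):x_1\in(0,1)\}$ and $\Gamma(\alpha)=\partial\Omega(\alpha)\setminus\overline{S(\alpha)}$; $\boldsymbol\nu^\alpha,\boldsymbol\tau^\alpha$ are the unit outward normal and tangent on $S(\alpha)$; for $\mathbf v$ defined near $S(\alpha)$, $v_\nu=\mathbf v|_{S(\alpha)}\cdot\boldsymbol\nu^\alpha$, $v_\tau=\mathbf v|_{S(\alpha)}\cdot\boldsymbol\tau^\alpha$. Let $\mathbf f\in(L^2(\mathbb R^2))^2$ and $g:\mathbb R_+\to\mathbb R_+$ continuous with $0<g_{min}\le g\le g_{max}$. $W(\Omega(\alpha))=\{v\in H^1(\Omega(\alpha)):v=0\text{ on }\Gamma(\alpha)\}$, $\mathbf W(\Omega(\alpha))=W(\Omega(\alpha))^2$ (this equals the set of restrictions to $\Omega(\alpha)$ of $(H^1_0(\widehat\Omega))^2$), $\mathbf V(\Omega(\alpha))=\{\mathbf v\in\mathbf W(\Omega(\alpha)):v_\nu=0\text{ on }S(\alpha)\}$;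 $L^2_0$ = zero-mean $L^2$ functions; $H^{1/2}(S(\alpha))$ = traces on $S(\alpha)$ of elements of $W(\Omega(\alpha))$, $H^{-1/2}(S(\alpha))$ its dual, $\langle\cdot,\cdot\rangle_\alpha$ the duality pairing. $a_\alpha(\mathbf u,\mathbf v)=\int_{\Omega(\alpha)}\nabla\mathbf u:\nabla\mathbf v$, $b_\alpha(\mathbf v,q)=\int_{\Omega(\alpha)}q\,\mathrm{div}\,\mathbf v$; $K_\alpha(\varphi)=\{\mu^\tau\in L^2(S(\alpha)):|\mu^\tau|\le g(\varphi)\text{ a.e. on }S(\alpha)\}$. Problem $(\mathcal M(\alpha))$: find $(\mathbf u,p,\sigma^\nu,\sigma^\tau)\in\mathbf W(\Omega(\alpha))\times L^2_0(\Omega(\alpha))\times H^{-1/2}(S(\alpha))\times K_\alpha(|u_\tau|)$ with $a_\alpha(\mathbf u,\mathbf v)-b_\alpha(\mathbf v,p)-\langle\sigma^\nu,v_\nu\rangle_\alpha-(\sigma^\tau,v_\tau)_{0,S(\alpha)}=(\mathbf f,\mathbf v)_{0,\Omega(\alpha)}$ for all $\mathbf v\in\mathbf W(\Omega(\alpha))$; $b_\alpha(\mathbf u,q)=0$ for all $q\in L^2_0(\Omega(\alpha))$; $\langle\mu^\nu,u_\nu\rangle_\alpha=0$ for all $\mu^\nu\in H^{-1/2}(S(\alpha))$; $(\mu^\tau+\sigma^\tau,u_\tau)_{0,S(\alpha)}\le0$ for all $\mu^\tau\in K_\alpha(|u_\tau|)$. $\widehat\Omega$ is a bounded hold-all domain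 containing all $\Omega(\alpha)$; $\pi_\alpha:\mathbf V(\Omega(\alpha))\to(H^1_0(\widehat\Omega))^2$ are linear bounded extension operators with norms bounded independently of $\alpha$; the superscript $0$ denotes extension by zero to $\widehat\Omega$. *)

theory Defs
  imports "HOL-Analysis.Analysis"
begin

type_synonym R2 = "real \<times> real"

fun Cn :: "nat \<Rightarrow> (R2 \<Rightarrow> real) \<Rightarrow> bool" where
  "Cn 0 f = continuous_on UNIV f"
| "Cn (Suc n) f = ((\<forall>x. f differentiable (at x)) \<and>
                    (\<forall>v. Cn n (\<lambda>x. frechet_derivative f (at x) v)))"

definition smooth :: "(R2 \<Rightarrow> real) \<Rightarrow> bool" where
  "smooth f \<longleftrightarrow> (\<forall>n. Cn n f)"

definition supp :: "(R2 \<Rightarrow> real) \<Rightarrow> R2 set" where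
  "supp f = closure {x. f x \<noteq> 0}"

definition Cc :: "(R2 \<Rightarrow> real) \<Rightarrow> bool" where
  "Cc f \<longleftrightarrow> smooth f \<and> compact (supp f)"

definition testfn :: "R2 set \<Rightarrow> (R2 \<Rightarrow> real) \<Rightarrow> bool" where
  "testfn U f \<longleftrightarrow> Cc f \<and> supp f \<subseteq> U"

definition pd :: "R2 \<Rightarrow> (R2 \<Rightarrow> real) \<Rightarrow> R2 \<Rightarrow> real" where
  "pd e f x = frechet_derivative f (at x) e"

definition L2 :: "R2 set \<Rightarrow> (R2 \<Rightarrow> real) \<Rightarrow> bool" where
  "L2 U f \<longleftrightarrow> set_borel_measurable lborel U f \<and> set_integrable lborel U (\<lambda>x. (f x)\<^sup>2)"

definition intg :: "R2 set \<Rightarrow> (R2 \<Rightarrow> real) \<Rightarrow> real" where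
  "intg U f = set_lebesgue_integral lborel U f"

definition L20 :: "R2 set \<Rightarrow> (R2 \<Rightarrow> real) \<Rightarrow> bool" where
  "L20 U f \<longleftrightarrow> L2 U f \<and> intg U f = 0"

definition wdrel :: "R2 set \<Rightarrow> (R2 \<Rightarrow> real) \<Rightarrow> R2 \<Rightarrow> (R2 \<Rightarrow> real) \<Rightarrow> bool" where
  "wdrel U u e g \<longleftrightarrow> L2 U g \<and>
     (\<forall>\<phi>. testfn U \<phi> \<longrightarrow> intg U (\<lambda>x. u x * pd e \<phi> x) = - intg U (\<lambda>x. g x * \<phi> x))"

definition wd :: "R2 set \<Rightarrow> (R2 \<Rightarrow> real) \<Rightarrow> R2 \<Rightarrow> R2 \<Rightarrow> real" where
  "wd U u e = (SOME g. wdrel U u e g)"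

abbreviation "e1 \<equiv> ((1::real), (0::real))"
abbreviation "e2 \<equiv> ((0::real), (1::real))"

definition H1 :: "R2 set \<Rightarrow> (R2 \<Rightarrow> real) \<Rightarrow> bool" where
  "H1 U u \<longleftrightarrow> L2 U u \<and> (\<exists>g. wdrel U u e1 g) \<and> (\<exists>g. wdrel U u e2 g)"

definition H1ip :: "R2 set \<Rightarrow> (R2 \<Rightarrow> real) \<Rightarrow> (R2 \<Rightarrow> real) \<Rightarrow> real" where
  "H1ip U u w = intg U (\<lambda>x. u x * w x + wd U u e1 x * wd U w e1 x + wd U u e2 x * wd U w e2 x)"

definition H1sq :: "R2 set \<Rightarrow> (R2 \<Rightarrow> real) \<Rightarrow> real" where
  "H1sq U u = H1ip U u u"

(* H^1_0(U): H^1-limits of C_c^\<infinity>(U) functions; elements are taken extended by 0 outside U *)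
definition H10 :: "R2 set \<Rightarrow> (R2 \<Rightarrow> real) \<Rightarrow> bool" where
  "H10 U u \<longleftrightarrow> H1 U u \<and> (\<forall>x. x \<notin> U \<longrightarrow> u x = 0) \<and>
     (\<exists>\<phi>. (\<forall>k. testfn U (\<phi> k)) \<and> (\<lambda>k. H1sq U (\<lambda>x. \<phi> k x - u x)) \<longlonglongrightarrow> 0)"

definition c1 :: "(R2 \<Rightarrow> R2) \<Rightarrow> R2 \<Rightarrow> real" where "c1 v = (\<lambda>x. fst (v x))"
definition c2 :: "(R2 \<Rightarrow> R2) \<Rightarrow> R2 \<Rightarrow> real" where "c2 v = (\<lambda>x. snd (v x))"

definition H1ipv :: "R2 set \<Rightarrow> (R2 \<Rightarrow> R2) \<Rightarrow> (R2 \<Rightarrow> R2) \<Rightarrow> real" where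
  "H1ipv U u w = H1ip U (c1 u) (c1 w) + H1ip U (c2 u) (c2 w)"

definition H1sqv :: "R2 set \<Rightarrow> (R2 \<Rightarrow> R2) \<Rightarrow> real" where
  "H1sqv U u = H1ipv U u u"

definition H10v :: "R2 set \<Rightarrow> (R2 \<Rightarrow> R2) \<Rightarrow> bool" where
  "H10v U u \<longleftrightarrow> H10 U (c1 u) \<and> H10 U (c2 u)"

definition adv :: "(real \<Rightarrow> real) \<Rightarrow> real \<Rightarrow> real" where
  "adv \<alpha> x = (SOME d. (\<alpha> has_real_derivative d) (at x within {0..1}))"

definition Uad :: "real \<Rightarrow> real \<Rightarrow> real \<Rightarrow> real \<Rightarrow> (real \<Rightarrow> real) set" where
  "Uad amin amax C1 C2 = {\<alpha>. \<exists>\<alpha>'.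
      (\<forall>x\<in>{0..1}. (\<alpha> has_real_derivative \<alpha>' x) (at x within {0..1})) \<and>
      (\<exists>L. L-lipschitz_on {0..1} \<alpha>') \<and>
      (\<forall>x\<in>{0..1}. amin \<le> \<alpha> x \<and> \<alpha> x \<le> amax) \<and>
      (AE x in lborel. x \<in> {0<..<1} \<longrightarrow> \<bar>\<alpha>' x\<bar> \<le> C1) \<and>
      (AE x in lborel. x \<in> {0<..<1} \<longrightarrow>
          (\<exists>d. (\<alpha>' has_real_derivative d) (at x) \<and> \<bar>d\<bar> \<le> C2))}"

definition Om :: "real \<Rightarrow> (real \<Rightarrow> real) \<Rightarrow> R2 set" where
  "Om \<omega> \<alpha> = {(x1, x2). 0 < x1 \<and> x1 < 1 \<and> \<alpha> x1 < x2 \<and> x2 < \<omega>}"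

definition Sl :: "(real \<Rightarrow> real) \<Rightarrow> R2 set" where
  "Sl \<alpha> = {(x1, \<alpha> x1) | x1. 0 < x1 \<and> x1 < 1}"

definition Gam :: "real \<Rightarrow> (real \<Rightarrow> real) \<Rightarrow> R2 set" where
  "Gam \<omega> \<alpha> = frontier (Om \<omega> \<alpha>) - closure (Sl \<alpha>)"

(* W(\<Omega>(\<alpha>)) = {v \<in> H^1 : v = 0 on \<Gamma>(\<alpha>)}, "v = 0 on \<Gamma>" expressed as: H^1(\<Omega>(\<alpha>))-limit of
   smooth functions whose support does not meet \<Gamma>(\<alpha>) *)
definition W :: "real \<Rightarrow> (real \<Rightarrow> real) \<Rightarrow> (R2 \<Rightarrow> real) \<Rightarrow> bool" where
  "W \<omega> \<alpha> u \<longleftrightarrow> H1 (Om \<omega> \<alpha>) u \<and>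
     (\<exists>\<phi>. (\<forall>k. Cc (\<phi> k) \<and> supp (\<phi> k) \<inter> Gam \<omega> \<alpha> = {}) \<and>
          (\<lambda>k. H1sq (Om \<omega> \<alpha>) (\<lambda>x. \<phi> k x - u x)) \<longlonglongrightarrow> 0)"

definition Wv :: "real \<Rightarrow> (real \<Rightarrow> real) \<Rightarrow> (R2 \<Rightarrow> R2) \<Rightarrow> bool" where
  "Wv \<omega> \<alpha> v \<longleftrightarrow> W \<omega> \<alpha> (c1 v) \<and> W \<omega> \<alpha> (c2 v)"

section \<open>Functions on S(\<alpha>), parametrised by x1 \<in> (0,1)\<close>

definition L2S :: "(real \<Rightarrow> real) \<Rightarrow> bool" where
  "L2S \<mu> \<longleftrightarrow> set_borel_measurable lborel {0<..<1} \<mu> \<and>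
              set_integrable lborel {0<..<1} (\<lambda>s. (\<mu> s)\<^sup>2)"

(* (\<mu>, v)_{0,S(\<alpha>)} with arc-length measure *)
definition ipS :: "(real \<Rightarrow> real) \<Rightarrow> (real \<Rightarrow> real) \<Rightarrow> (real \<Rightarrow> real) \<Rightarrow> real" where
  "ipS \<alpha> \<mu> v = set_lebesgue_integral lborel {0<..<1}
        (\<lambda>s. \<mu> s * v s * sqrt (1 + (adv \<alpha> s)\<^sup>2))"

definition trace_rel :: "real \<Rightarrow> (real \<Rightarrow> real) \<Rightarrow> (R2 \<Rightarrow> real) \<Rightarrow> (real \<Rightarrow> real) \<Rightarrow> bool" where
  "trace_rel \<omega> \<alpha> u t \<longleftrightarrow> L2S t \<and>
     (\<exists>\<phi>. (\<forall>k. Cc (\<phi> k)) \<and> (\<lambda>k. H1sq (Om \<omega> \<alpha>) (\<lambda>x. \<phi> k x - u x)) \<longlonglongrightarrow> 0 \<and>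
          (\<lambda>k. set_lebesgue_integral lborel {0<..<1} (\<lambda>s. (\<phi> k (s, \<alpha> s) - t s)\<^sup>2)) \<longlonglongrightarrow> 0)"

definition tr :: "real \<Rightarrow> (real \<Rightarrow> real) \<Rightarrow> (R2 \<Rightarrow> real) \<Rightarrow> real \<Rightarrow> real" where
  "tr \<omega> \<alpha> u = (SOME t. trace_rel \<omega> \<alpha> u t)"

(* normal and tangential components v_\<nu>, v_\<tau>; \<nu> = (\<alpha>',-1)/\<surd>(1+\<alpha>'^2) outward, \<tau> = (1,\<alpha>')/\<surd>(1+\<alpha>'^2) *)
definition vnu :: "real \<Rightarrow> (real \<Rightarrow> real) \<Rightarrow> (R2 \<Rightarrow> R2) \<Rightarrow> real \<Rightarrow> real" where
  "vnu \<omega> \<alpha> v s = (tr \<omega> \<alpha> (c1 v) s * adv \<alpha> s - tr \<omega> \<alpha> (c2 v) s) / sqrt (1 + (adv \<alpha> s)\<^sup>2)"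

definition vtau :: "real \<Rightarrow> (real \<Rightarrow> real) \<Rightarrow> (R2 \<Rightarrow> R2) \<Rightarrow> real \<Rightarrow> real" where
  "vtau \<omega> \<alpha> v s = (tr \<omega> \<alpha> (c1 v) s + tr \<omega> \<alpha> (c2 v) s * adv \<alpha> s) / sqrt (1 + (adv \<alpha> s)\<^sup>2)"

(* H^{-1/2}(S(\<alpha>)): bounded linear functionals on H^{1/2}(S(\<alpha>)) = traces of W(\<Omega>(\<alpha>)),
   with the quotient (trace) norm; represented as functionals on functions of x1
   that do not distinguish a.e.-equal functions *)
definition Hm12 :: "real \<Rightarrow> (real \<Rightarrow> real) \<Rightarrow> ((real \<Rightarrow> real) \<Rightarrow> real) \<Rightarrow> bool" where
  "Hm12 \<omega> \<alpha> \<sigma> \<longleftrightarrow>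
     (\<forall>t1 t2. (AE s in lborel. s \<in> {0<..<1} \<longrightarrow> t1 s = t2 s) \<longrightarrow> \<sigma> t1 = \<sigma> t2) \<and>
     (\<forall>w1 w2 a b. W \<omega> \<alpha> w1 \<longrightarrow> W \<omega> \<alpha> w2 \<longrightarrow>
        \<sigma> (\<lambda>s. a * tr \<omega> \<alpha> w1 s + b * tr \<omega> \<alpha> w2 s) = a * \<sigma> (tr \<omega> \<alpha> w1) + b * \<sigma> (tr \<omega> \<alpha> w2)) \<and>
     (\<exists>C. \<forall>w. W \<omega> \<alpha> w \<longrightarrow> \<bar>\<sigma> (tr \<omega> \<alpha> w)\<bar> \<le> C * sqrt (H1sq (Om \<omega> \<alpha>) w))"

definition Kset :: "(real \<Rightarrow> real) \<Rightarrow> (real \<Rightarrow> real) \<Rightarrow> (real \<Rightarrow> real) set" where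
  "Kset g \<phi> = {\<mu>. L2S \<mu> \<and> (AE s in lborel. s \<in> {0<..<1} \<longrightarrow> \<bar>\<mu> s\<bar> \<le> g (\<phi> s))}"

definition aform :: "R2 set \<Rightarrow> (R2 \<Rightarrow> R2) \<Rightarrow> (R2 \<Rightarrow> R2) \<Rightarrow> real" where
  "aform U u v = intg U (\<lambda>x.
      wd U (c1 u) e1 x * wd U (c1 v) e1 x + wd U (c1 u) e2 x * wd U (c1 v) e2 x +
      wd U (c2 u) e1 x * wd U (c2 v) e1 x + wd U (c2 u) e2 x * wd U (c2 v) e2 x)"

definition bform :: "R2 set \<Rightarrow> (R2 \<Rightarrow> R2) \<Rightarrow> (R2 \<Rightarrow> real) \<Rightarrow> real" where
  "bform U v q = intg U (\<lambda>x. q x * (wd U (c1 v) e1 x + wd U (c2 v) e2 x))"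

definition fform :: "R2 set \<Rightarrow> (R2 \<Rightarrow> R2) \<Rightarrow> (R2 \<Rightarrow> R2) \<Rightarrow> real" where
  "fform U f v = intg U (\<lambda>x. fst (f x) * fst (v x) + snd (f x) * snd (v x))"

definition Msol :: "real \<Rightarrow> (R2 \<Rightarrow> R2) \<Rightarrow> (real \<Rightarrow> real) \<Rightarrow> (real \<Rightarrow> real) \<Rightarrow>
    (R2 \<Rightarrow> R2) \<Rightarrow> (R2 \<Rightarrow> real) \<Rightarrow> ((real \<Rightarrow> real) \<Rightarrow> real) \<Rightarrow> (real \<Rightarrow> real) \<Rightarrow> bool" where
  "Msol \<omega> f g \<alpha> u p \<sigma>n \<sigma>t \<longleftrightarrow>
     Wv \<omega> \<alpha> u \<and> L20 (Om \<omega> \<alpha>) p \<and> Hm12 \<omega> \<alpha> \<sigma>n \<and>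
     \<sigma>t \<in> Kset g (\<lambda>s. \<bar>vtau \<omega> \<alpha> u s\<bar>) \<and>
     (\<forall>v. Wv \<omega> \<alpha> v \<longrightarrow>
        aform (Om \<omega> \<alpha>) u v - bform (Om \<omega> \<alpha>) v p - \<sigma>n (vnu \<omega> \<alpha> v) - ipS \<alpha> \<sigma>t (vtau \<omega> \<alpha> v)
        = fform (Om \<omega> \<alpha>) f v) \<and>
     (\<forall>q. L20 (Om \<omega> \<alpha>) q \<longrightarrow> bform (Om \<omega> \<alpha>) u q = 0) \<and>
     (\<forall>\<mu>. Hm12 \<omega> \<alpha> \<mu> \<longrightarrow> \<mu> (vnu \<omega> \<alpha> u) = 0) \<and>
     (\<forall>\<mu> \<in> Kset g (\<lambda>s. \<bar>vtau \<omega> \<alpha> u s\<bar>). ipS \<alpha> (\<lambda>s. \<mu> s + \<sigma>t s) (vtau \<omega> \<alpha> u) \<le> 0)"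

definition Vsp :: "real \<Rightarrow> (real \<Rightarrow> real) \<Rightarrow> (R2 \<Rightarrow> R2) \<Rightarrow> bool" where
  "Vsp \<omega> \<alpha> v \<longleftrightarrow> Wv \<omega> \<alpha> v \<and> (AE s in lborel. s \<in> {0<..<1} \<longrightarrow> vnu \<omega> \<alpha> v s = 0)"

definition C1conv :: "(nat \<Rightarrow> real \<Rightarrow> real) \<Rightarrow> (real \<Rightarrow> real) \<Rightarrow> bool" where
  "C1conv \<alpha>s \<alpha> \<longleftrightarrow> (\<forall>\<epsilon>>0. \<forall>\<^sub>F n in sequentially. \<forall>x\<in>{0..1}.
      \<bar>\<alpha>s n x - \<alpha> x\<bar> \<le> \<epsilon> \<and> \<bar>adv (\<alpha>s n) x - adv \<alpha> x\<bar> \<le> \<epsilon>)"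

end

theory Submission
  imports Defs
begin

text \<open>
  Testing the equation with fields tangential to \<open>S(\<alpha>\<^sub>n)\<close> eliminates \<open>\<sigma>\<^sup>\<nu>\<^sub>n\<close>. A field \<open>v\<close> tangential to \<open>S(\<alpha>)\<close> is not
  tangential to \<open>S(\<alpha>\<^sub>n)\<close>, but subtracting its normal defect, cut off in a thin strip around \<open>S(\<alpha>)\<close>, repairs this;
  by Hardy's inequality the correction tends to zero in \<open>H\<^sup>1(\<Omega>(\<alpha>\<^sub>n))\<close>, because the defect has zero trace in the limit and
  its derivatives are controlled by the bound on \<open>\<alpha>\<^sub>n''\<close>. Hence the functional \<open>v \<mapsto> \<langle>\<sigma>\<^sup>\<nu>\<^sub>n, v\<^sub>\<nu>\<rangle>\<close>, expressed through the
  remaining terms of the equation, vanishes in the limit on such \<open>v\<close>. For \<open>v = (w, \<alpha>'w)\<close> this makes \<open>\<sigma>\<^sup>\<tau>\<^sub>n\<close> converge against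
  a dense set, so \<open>\<sigma>\<^sup>\<tau>\<^sub>n\<close> converges weakly in \<open>L\<^sup>2(0,1)\<close>; the limit of the functionals then factors through \<open>v\<^sub>\<nu>\<close> and is
  \<open>\<sigma>\<^sup>\<nu>\<close>. Compactness of the trace gives strong convergence of \<open>u\<^sub>\<tau>\<close> on the moving curves, hence along a subsequence
  a.e. convergence of the thresholds \<open>g(|u\<^sub>\<tau>|)\<close>, which passes the slip condition to the limit.
\<close>

section \<open>Square integrable functions\<close>

text \<open>All integrals are taken over the fixed hold-all set, and a moving domain enters only
  through its indicator. Indicators times a fixed L2 function converge strongly, so weak limits on
  the hold-all pass to integrals over moving domains. Elements of H^1_0 are treated as jets, i.e. as
  L2 functions with three components, and a trace is paired with a jet by a closed relation. The
  chosen objects \<open>wd\<close> and \<open>tr\<close> are determined only up to null sets, and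
  this keeps the choices out of the limits. The shaping obstacle is that \<alpha>_n'' is bounded but
  need not converge. The part of the corrector that contains \<alpha>_n'' - \<alpha>'' is small only
  because it multiplies a fixed L2 function on a thin strip. The strip is therefore chosen first,
  which fixes the large gradient of the cutoff, and n is chosen afterwards. The bound on the
  pressures comes from their assumed weak convergence by the uniform boundedness principle. The
  bound on the velocities comes from the energy identity and the uniform norms of the
  extensions.\<close>

definition sqi :: "'a measure => ('a => 'b::euclidean_space) => bool" where
  "sqi M f \<longleftrightarrow> f \<in> borel_measurable M \<and> integrable M (%x. (norm (f x))\<^sup>2)"

definition l2n :: "'a measure => ('a => 'b::euclidean_space) => real" where
  "l2n M f = sqrt (LINT x|M. (norm (f x))\<^sup>2)"

abbreviation l2conv :: "'a measure => (nat => 'a => 'b::euclidean_space) => ('a => 'b) => bool" where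
  "l2conv M F f \<equiv> (%n. l2n M (%x. F n x - f x)) \<longlonglongrightarrow> 0"

lemma sqi_measurable[measurable_dest]: "sqi M f ==> f \<in> borel_measurable M"
  by (simp add: sqi_def)

lemma sqi_integrable: "sqi M f ==> integrable M (%x. (norm (f x))\<^sup>2)"
  by (simp add: sqi_def)

lemma l2n_nonneg[simp]: "0 <= l2n M f"
  by (simp add: l2n_def)

lemma l2n_power2: "(l2n M f)\<^sup>2 = (LINT x|M. (norm (f x))\<^sup>2)"
  by (simp add: l2n_def)

lemma norm_add_power2_le: "(norm (a + b :: 'b::real_normed_vector))\<^sup>2 <= 2 * (norm a)\<^sup>2 + 2 * (norm b)\<^sup>2"
proof -
  have "(norm (a + b))\<^sup>2 <= (norm a + norm b)\<^sup>2"
    by (simp add: norm_triangle_ineq power_mono)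
  also have "\<dots> <= 2 * (norm a)\<^sup>2 + 2 * (norm b)\<^sup>2"
    using zero_le_power2[of "norm a - norm b"] by (simp add: power2_eq_square algebra_simps)
  finally show ?thesis .
qed

lemma sqi_bound:
  assumes "g \<in> borel_measurable M" "sqi M f" "AE x in M. norm (g x) <= K * norm (f x)"
  shows "sqi M g"
  unfolding sqi_def
proof
  have [measurable]: "f \<in> borel_measurable M" using assms by (simp add: sqi_def)
  show "integrable M (%x. (norm (g x))\<^sup>2)"
  proof (rule Bochner_Integration.integrable_bound)
    show "integrable M (%x. K\<^sup>2 * (norm (f x))\<^sup>2)"
      using assms(2) by (simp add: sqi_def)
    show "AE x in M. norm ((norm (g x))\<^sup>2) <= norm (K\<^sup>2 * (norm (f x))\<^sup>2)"
      using assms(3)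
    proof eventually_elim
      case (elim x)
      have "(norm (g x))\<^sup>2 <= (K * norm (f x))\<^sup>2"
        using elim by (intro power_mono) auto
      then show ?case by (simp add: power_mult_distrib)
    qed
  qed (use assms in measurable)
qed (use assms in auto)

lemma sqi_add: assumes "sqi M f" "sqi M g" shows "sqi M (%x. f x + g x)"
  unfolding sqi_def
proof
  show "(%x. f x + g x) \<in> borel_measurable M" using assms by (auto simp: sqi_def)
  show "integrable M (%x. (norm (f x + g x))\<^sup>2)"
  proof (rule Bochner_Integration.integrable_bound)
    show "integrable M (%x. 2 * (norm (f x))\<^sup>2 + 2 * (norm (g x))\<^sup>2)"
      using assms by (simp add: sqi_def)
    show "AE x in M. norm ((norm (f x + g x))\<^sup>2) <= norm (2 * (norm (f x))\<^sup>2 + 2 * (norm (g x))\<^sup>2)"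
      using norm_add_power2_le by auto
  qed (use assms in \<open>auto simp: sqi_def\<close>)
qed

lemma sqi_scaleR: "sqi M f ==> sqi M (%x. c *\<^sub>R f x)"
  by (rule sqi_bound[of _ M f "\<bar>c\<bar>"]) (auto simp: sqi_def)

lemma sqi_cmult: "sqi M f ==> sqi M (%x. c * f x :: real)"
  using sqi_scaleR[of M f c] by simp

lemma sqi_uminus: "sqi M f ==> sqi M (%x. - f x)"
  by (auto simp: sqi_def)

lemma sqi_diff: "sqi M f ==> sqi M g ==> sqi M (%x. f x - g x)"
  using sqi_add[OF _ sqi_uminus, of M f g] by simp

lemma sqi_zero[simp]: "sqi M (%x. 0)"
  by (simp add: sqi_def)

lemma l2n_cong_AE:
  assumes "f \<in> borel_measurable M" "g \<in> borel_measurable M" "AE x in M. f x = g x"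
  shows "l2n M f = l2n M g"
  unfolding l2n_def by (intro arg_cong[where f=sqrt] integral_cong_AE) (use assms in auto)

lemma l2n_scaleR: "l2n M (%x. c *\<^sub>R f x) = \<bar>c\<bar> * l2n M f"
  by (simp add: l2n_def power_mult_distrib real_sqrt_mult)

lemma l2n_cmult: "l2n M (%x. c * f x :: real) = \<bar>c\<bar> * l2n M f"
  using l2n_scaleR[of M c f] by simp

lemma l2n_minus_commute: "l2n M (%x. f x - g x) = l2n M (%x. g x - f x)"
  by (simp add: l2n_def norm_minus_commute)

lemma l2n_zero[simp]: "l2n M (%x. 0) = 0"
  by (simp add: l2n_def)

lemma l2n_eq_0_iff: "sqi M f ==> l2n M f = 0 \<longleftrightarrow> (AE x in M. f x = 0)"
  by (simp add: l2n_def integral_nonneg_eq_0_iff_AE sqi_def)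

lemma l2n_le:
  assumes "g \<in> borel_measurable M" "sqi M f" "AE x in M. norm (g x) <= K * norm (f x)" "0 <= K"
  shows "l2n M g <= K * l2n M f"
proof -
  have "(LINT x|M. (norm (g x))\<^sup>2) <= (LINT x|M. K\<^sup>2 * (norm (f x))\<^sup>2)"
  proof (rule integral_mono_AE)
    show "integrable M (%x. (norm (g x))\<^sup>2)" "integrable M (%x. K\<^sup>2 * (norm (f x))\<^sup>2)"
      using sqi_bound[OF assms(1-3)] assms(2) by (auto simp: sqi_def)
    show "AE x in M. (norm (g x))\<^sup>2 <= K\<^sup>2 * (norm (f x))\<^sup>2"
      using assms(3) by eventually_elim (simp add: power_mono flip: power_mult_distrib)
  qed
  then have "l2n M g <= sqrt (K\<^sup>2 * (LINT x|M. (norm (f x))\<^sup>2))"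
    by (simp add: l2n_def)
  then show ?thesis using assms(4) by (simp add: real_sqrt_mult l2n_def)
qed

lemma sqi_inner:
  assumes "sqi M f" "sqi M g" shows "integrable M (%x. f x \<bullet> g x)"
proof (rule Bochner_Integration.integrable_bound)
  show "integrable M (%x. (norm (f x))\<^sup>2 + (norm (g x))\<^sup>2)"
    using assms by (simp add: sqi_def)
  have "\<bar>a \<bullet> b\<bar> <= (norm a)\<^sup>2 + (norm b)\<^sup>2" for a b :: 'b
  proof -
    have "\<bar>a \<bullet> b\<bar> <= norm a * norm b" by (rule Cauchy_Schwarz_ineq2)
    also have "\<dots> <= (norm a)\<^sup>2 + (norm b)\<^sup>2"
      using zero_le_power2[of "norm a - norm b"] mult_nonneg_nonneg[OF norm_ge_zero[of a] norm_ge_zero[of b]]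
      unfolding power2_eq_square by (simp only: algebra_simps)
    finally show ?thesis .
  qed
  then show "AE x in M. norm (f x \<bullet> g x) <= norm ((norm (f x))\<^sup>2 + (norm (g x))\<^sup>2)"
    by auto
qed (use assms in \<open>auto simp: sqi_def\<close>)

lemma sqi_mult: "sqi M f ==> sqi M g ==> integrable M (%x. f x * g x :: real)"
  using sqi_inner[of M f g] by simp

lemma l2n_add_power2:
  assumes "sqi M f" "sqi M g"
  shows "(l2n M (%x. f x + c *\<^sub>R g x))\<^sup>2 = (l2n M f)\<^sup>2 + 2 * c * (LINT x|M. f x \<bullet> g x) + c\<^sup>2 * (l2n M g)\<^sup>2"
proof -
  have "(norm (f x + c *\<^sub>R g x))\<^sup>2 = (norm (f x))\<^sup>2 + 2 * c * (f x \<bullet> g x) + c\<^sup>2 * (norm (g x))\<^sup>2" for x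
    unfolding power2_norm_eq_inner
    by (simp add: inner_add_left inner_add_right inner_commute[of "g x" "f x"] algebra_simps power2_eq_square)
  then show ?thesis
    unfolding l2n_power2 using assms sqi_inner[OF assms] by (simp add: sqi_def)
qed

lemma real_quadratic_nonneg_imp:
  fixes A B C :: real
  assumes "!!t. 0 <= A + 2 * t * B + t\<^sup>2 * C" "0 <= C"
  shows "B\<^sup>2 <= A * C"
proof (cases "C = 0")
  case True
  have "B = 0"
  proof (rule ccontr)
    assume "B \<noteq> 0"
    then show False using assms(1)[of "- (A + 1) / (2 * B)"] True by (simp add: field_simps)
  qed
  then show ?thesis using True by simp
next
  case False
  have "0 <= A + 2 * (- B / C) * B + (- B / C)\<^sup>2 * C" by (rule assms(1))
  also have "\<dots> = A - B\<^sup>2 / C"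
    using False by (simp add: field_simps power2_eq_square)
  finally show ?thesis using False assms(2) by (simp add: field_simps)
qed

lemma l2_Cauchy_Schwarz:
  assumes "sqi M f" "sqi M g"
  shows "\<bar>LINT x|M. f x \<bullet> g x\<bar> <= l2n M f * l2n M g"
proof -
  have "(LINT x|M. f x \<bullet> g x)\<^sup>2 <= (l2n M f)\<^sup>2 * (l2n M g)\<^sup>2"
    by (rule real_quadratic_nonneg_imp) (use l2n_add_power2[OF assms] in \<open>metis zero_le_power2\<close>)+
  then have "\<bar>LINT x|M. f x \<bullet> g x\<bar>\<^sup>2 <= (l2n M f * l2n M g)\<^sup>2" by (simp add: power_mult_distrib)
  then show ?thesis by (rule power2_le_imp_le) simp
qed

lemma l2_Cauchy_Schwarz_real:
  "sqi M f ==> sqi M g ==> \<bar>LINT x|M. f x * g x\<bar> <= l2n M f * l2n M g" for f g :: "'a => real"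
  using l2_Cauchy_Schwarz[of M f g] by simp

lemma l2n_triangle:
  assumes "sqi M f" "sqi M g"
  shows "l2n M (%x. f x + g x) <= l2n M f + l2n M g"
proof (rule power2_le_imp_le)
  show "(l2n M (%x. f x + g x))\<^sup>2 <= (l2n M f + l2n M g)\<^sup>2"
    using l2n_add_power2[OF assms, of 1] l2_Cauchy_Schwarz[OF assms]
    by (simp add: power2_eq_square algebra_simps)
qed simp

lemma l2n_triangle_diff:
  assumes "sqi M f" "sqi M g"
  shows "l2n M (%x. f x - g x) <= l2n M f + l2n M g"
  using l2n_triangle[OF assms(1) sqi_uminus[OF assms(2)]] by (simp add: l2n_def)

lemma l2n_triangle3:
  assumes "sqi M f" "sqi M g" "sqi M h"
  shows "l2n M (%x. f x - h x) <= l2n M (%x. f x - g x) + l2n M (%x. g x - h x)"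
  using l2n_triangle[OF sqi_diff[OF assms(1,2)] sqi_diff[OF assms(2,3)]] by simp

lemma l2n_diff_le:
  assumes "sqi M f" "sqi M g"
  shows "\<bar>l2n M f - l2n M g\<bar> <= l2n M (%x. f x - g x)"
  using l2n_triangle3[OF assms(1,2) sqi_zero] l2n_triangle3[OF assms(2,1) sqi_zero]
  by (simp add: l2n_minus_commute[of M g f] abs_le_iff)

lemma l2n_tendsto:
  assumes "!!n. sqi M (f n)" "sqi M g" "l2conv M f g"
  shows "(%n. l2n M (f n)) \<longlonglongrightarrow> l2n M g"
proof -
  have "(%n. l2n M (f n) - l2n M g) \<longlonglongrightarrow> 0"
    by (rule Lim_null_comparison[OF _ assms(3)]) (use l2n_diff_le[OF assms(1,2)] in auto)
  then show ?thesis by (rule LIM_zero_cancel)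
qed

section \<open>Completeness, Riesz representation and uniform boundedness in L2\<close>

lemma integrable_L1_of_sqi:
  assumes "finite_measure M" "sqi M f"
  shows "integrable M f" "(LINT x|M. norm (f x)) <= sqrt (measure M (space M)) * l2n M f"
proof -
  interpret finite_measure M by fact
  have one: "sqi M (%x. 1::real)" by (simp add: sqi_def)
  have [measurable]: "f \<in> borel_measurable M" using assms(2) by (simp add: sqi_def)
  have nf: "sqi M (%x. norm (f x))" using sqi_integrable[OF assms(2)] by (simp add: sqi_def)
  have "integrable M (%x. norm (f x))" using sqi_mult[OF nf one] by simp
  then show "integrable M f" by (rule integrable_norm_cancel) measurable
  show "(LINT x|M. norm (f x)) <= sqrt (measure M (space M)) * l2n M f"
  proof -
    have "(LINT x|M. norm (f x)) <= \<bar>LINT x|M. norm (f x) * 1\<bar>" by simp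
    also have "\<dots> <= l2n M (%x. norm (f x)) * l2n M (%x. 1::real)"
      by (rule l2_Cauchy_Schwarz_real[OF nf one])
    also have "l2n M (%x. norm (f x)) = l2n M f" by (simp add: l2n_def)
    also have "l2n M (%x. 1::real) = sqrt (measure M (space M))" by (simp add: l2n_def)
    finally show ?thesis by (simp only: mult.commute)
  qed
qed

text \<open>Riesz-Fischer: on a finite measure space an L2-Cauchy sequence is L1-Cauchy and has an
  a.e. convergent subsequence. Fatou's lemma makes the pointwise limit the L2 limit of the whole
  sequence.\<close>

lemma l2_complete:
  fixes F :: "nat => 'a => 'b::euclidean_space"
  assumes fm: "finite_measure M" and F: "!!k. sqi M (F k)"
    and C: "!!e. 0 < e ==> \<exists>N. \<forall>i\<ge>N. \<forall>j\<ge>N. l2n M (%x. F i x - F j x) < e"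
  obtains f where "sqi M f" "l2conv M F f"
proof -
  interpret finite_measure M by fact
  \<comment> \<open>The summand 1 keeps the factor positive on a null space, so that
    \<open>e / m\<close> can serve as a tolerance.\<close>
  define m where "m = sqrt (measure M (space M)) + 1"
  have m: "m > 0" "sqrt (measure M (space M)) <= m" by (auto simp: m_def add_nonneg_pos)
  have [measurable]: "F k \<in> borel_measurable M" for k using F by (simp add: sqi_def)
  obtain r where r: "strict_mono r" "AE x in M. Cauchy (%i. F (r i) x)"
  proof (rule cauchy_L1_AE_cauchy_subseq[of M F])
    show "integrable M (F n)" for n using integrable_L1_of_sqi[OF fm F] by blast
    fix e :: real assume "e > 0"
    then obtain N where N: "\<forall>i\<ge>N. \<forall>j\<ge>N. l2n M (%x. F i x - F j x) < e / m"
      using C[of "e / m"] m by auto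
    have "LINT x|M. norm (F i x - F j x) < e" if "i \<ge> N" "j \<ge> N" for i j
    proof -
      have "(LINT x|M. norm (F i x - F j x)) <= m * l2n M (%x. F i x - F j x)"
        using integrable_L1_of_sqi(2)[OF fm sqi_diff[OF F[of i] F[of j]]] m(2)
        by (meson l2n_nonneg mult_right_mono order_trans)
      also have "\<dots> < m * (e / m)" using N that m by (intro mult_strict_left_mono) auto
      finally show ?thesis using m by simp
    qed
    then show "\<exists>N. \<forall>i\<ge>N. \<forall>j\<ge>N. LINT x|M. norm (F i x - F j x) < e" by blast
  qed
  define f where "f x = lim (%i. F (r i) x)" for x
  have [measurable]: "f \<in> borel_measurable M" unfolding f_def by (rule borel_measurable_lim_metric) simp
  have lim: "AE x in M. (%i. F (r i) x) \<longlonglongrightarrow> f x"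
    using r(2) by eventually_elim (simp add: f_def Cauchy_convergent_iff convergent_LIMSEQ_iff)
  \<comment> \<open>Fatou's lemma, applied to \<open>F i - F (r j)\<close> as j grows.\<close>
  have key: "sqi M (%x. F i x - f x) \<and> l2n M (%x. F i x - f x) <= e"
    if N: "\<forall>i\<ge>N. \<forall>j\<ge>N. l2n M (%x. F i x - F j x) < e" and i: "i \<ge> N" for N i e
  proof -
    have e0: "0 < e" using N i l2n_nonneg[of M "%x. F i x - F i x"] by (meson le_less_trans)
    have "(\<integral>\<^sup>+x. ennreal ((norm (F i x - f x))\<^sup>2) \<partial>M) = (\<integral>\<^sup>+x. liminf (%j. ennreal ((norm (F i x - F (r j) x))\<^sup>2)) \<partial>M)"
    proof (rule nn_integral_cong_AE)
      show "AE x in M. ennreal ((norm (F i x - f x))\<^sup>2) = liminf (%j. ennreal ((norm (F i x - F (r j) x))\<^sup>2))"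
        using lim
      proof eventually_elim
        case (elim x)
        then have "(%j. ennreal ((norm (F i x - F (r j) x))\<^sup>2)) \<longlonglongrightarrow> ennreal ((norm (F i x - f x))\<^sup>2)"
          by (intro tendsto_ennrealI tendsto_intros)
        then show ?case by (intro lim_imp_Liminf[symmetric] trivial_limit_sequentially)
      qed
    qed
    also have "\<dots> <= liminf (%j. (\<integral>\<^sup>+x. ennreal ((norm (F i x - F (r j) x))\<^sup>2) \<partial>M))"
      by (rule nn_integral_liminf) measurable
    also have "\<dots> <= liminf (%j. ennreal (e\<^sup>2))"
    proof (rule Liminf_mono)
      have "eventually (%j. r j \<ge> N) sequentially"
        using r(1) by (meson eventually_sequentially le_trans seq_suble)
      then show "\<forall>\<^sub>F j in sequentially. (\<integral>\<^sup>+x. ennreal ((norm (F i x - F (r j) x))\<^sup>2) \<partial>M) <= ennreal (e\<^sup>2)"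
      proof eventually_elim
        case (elim j)
        have "(l2n M (%x. F i x - F (r j) x))\<^sup>2 <= e\<^sup>2"
          using N i elim by (intro power_mono) (auto intro: less_imp_le)
        then show ?case
          using sqi_diff[OF F[of i] F[of "r j"]]
          by (subst nn_integral_eq_integral) (auto simp: sqi_def l2n_power2 ennreal_leI)
      qed
    qed
    also have "\<dots> = ennreal (e\<^sup>2)" by (simp add: Liminf_const)
    finally have le: "(\<integral>\<^sup>+x. ennreal ((norm (F i x - f x))\<^sup>2) \<partial>M) <= ennreal (e\<^sup>2)" .
    have s: "sqi M (%x. F i x - f x)"
      unfolding sqi_def integrable_iff_bounded using le by (auto intro: le_less_trans)
    have "ennreal ((l2n M (%x. F i x - f x))\<^sup>2) <= ennreal (e\<^sup>2)"
      using le nn_integral_eq_integral[OF sqi_integrable[OF s]] by (simp add: l2n_power2)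
    then have "(l2n M (%x. F i x - f x))\<^sup>2 <= e\<^sup>2" by (subst (asm) ennreal_le_iff) auto
    then have "l2n M (%x. F i x - f x) <= e"
      using e0 by (rule power2_le_imp_le[OF _ less_imp_le])
    with s show ?thesis by simp
  qed
  obtain N0 where N0: "\<forall>i\<ge>N0. \<forall>j\<ge>N0. l2n M (%x. F i x - F j x) < 1" using C[of 1] by auto
  have "sqi M f"
    using sqi_diff[OF F[of N0] conjunct1[OF key[OF N0 order_refl]]] by simp
  moreover have "l2conv M F f"
  proof (rule LIMSEQ_I)
    fix e :: real assume "0 < e"
    then obtain N where "\<forall>i\<ge>N. \<forall>j\<ge>N. l2n M (%x. F i x - F j x) < e / 2" using C[of "e/2"] by auto
    then have "\<forall>i\<ge>N. l2n M (%x. F i x - f x) <= e / 2" using key by blast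
    then show "\<exists>no. \<forall>n\<ge>no. norm (l2n M (%x. F n x - f x) - 0) < e"
      using \<open>0 < e\<close> by (intro exI[of _ N]) (smt (verit) l2n_nonneg real_norm_def field_sum_of_halves)
  qed
  ultimately show ?thesis by (rule that)
qed

text \<open>Ritz method: almost minimisers of the energy over D form a Cauchy sequence whose limit
  represents l. D is just a set of functions closed under combinations, not a quotient space. The
  approximating sequence from D is part of the result because it shows that w lies in the closure of
  D.\<close>

lemma l2_Riesz:
  fixes D :: "('a => 'b::euclidean_space) set" and l :: "('a => 'b) => real"
  assumes fm: "finite_measure M" and ne: "D \<noteq> {}" and D: "!!f. f \<in> D ==> sqi M f"
    and comb: "!!f g c. f \<in> D ==> g \<in> D ==> (%x. f x + c *\<^sub>R g x) \<in> D"
    and lin: "!!f g c. f \<in> D ==> g \<in> D ==> l (%x. f x + c *\<^sub>R g x) = l f + c * l g"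
    and bd: "!!f. f \<in> D ==> \<bar>l f\<bar> <= C * l2n M f"
  obtains w W where "!!k::nat. W k \<in> D" "sqi M w" "l2conv M W w"
    "!!v. v \<in> D ==> (LINT x|M. w x \<bullet> v x) = l v"
proof -
  \<comment> \<open>Its Euler-Lagrange equation over D says that w represents l; completing the
    square bounds it below by -C^2.\<close>
  define I where "I f = (l2n M f)\<^sup>2 - 2 * l f" for f
  have Ilow: "- C\<^sup>2 <= I f" if "f \<in> D" for f
    using bd[OF that] zero_le_power2[of "l2n M f - C"] by (simp add: I_def power2_eq_square algebra_simps)
  define m where "m = Inf (I ` D)"
  have mle: "m <= I f" if "f \<in> D" for f
    unfolding m_def using that Ilow by (intro cInf_lower) (auto intro!: bdd_belowI[of _ "- C\<^sup>2"])
  have "\<exists>f\<in>D. I f < m + 1 / real (Suc k)" for k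
    using cInf_lessD[of "I ` D" "m + 1 / real (Suc k)"] ne by (auto simp: m_def)
  then obtain W where W: "!!k. W k \<in> D" "!!k. I (W k) < m + 1 / real (Suc k)" by metis
  \<comment> \<open>The Euler-Lagrange defect of the k-th almost minimiser. Moving it by t v lowers
    the energy by at most 1/(k+1), and the discriminant of this quadratic in t bounds the
    defect.\<close>
  define B where "B k v = (LINT x|M. W k x \<bullet> v x) - l v" for k v
  have B2: "(B k v)\<^sup>2 <= (1 / real (Suc k)) * (l2n M v)\<^sup>2" if v: "v \<in> D" for k v
  proof (rule real_quadratic_nonneg_imp)
    fix t
    have "m <= I (%x. W k x + t *\<^sub>R v x)" by (rule mle[OF comb[OF W(1) v]])
    also have "\<dots> = I (W k) + 2 * t * B k v + t\<^sup>2 * (l2n M v)\<^sup>2"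
      unfolding I_def lin[OF W(1) v] l2n_add_power2[OF D[OF W(1)] D[OF v]] B_def by (simp add: algebra_simps)
    finally show "0 <= 1 / real (Suc k) + 2 * t * B k v + t\<^sup>2 * (l2n M v)\<^sup>2" using W(2)[of k] by linarith
  qed simp
  have Babs: "\<bar>B k v\<bar> <= sqrt (1 / real (Suc k)) * l2n M v" if v: "v \<in> D" for k v
    using real_sqrt_le_mono[OF B2[OF v, of k]] unfolding real_sqrt_mult real_sqrt_abs by simp
  have s0: "(%k. sqrt (1 / real (Suc k))) \<longlonglongrightarrow> 0"
    using tendsto_real_sqrt[OF LIMSEQ_inverse_real_of_nat] by (simp add: inverse_eq_divide)
  have cau: "l2n M (%x. W i x - W j x) <= sqrt (1 / real (Suc i)) + sqrt (1 / real (Suc j))" for i j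
  proof -
    let ?v = "%x. W i x - W j x"
    have v: "?v \<in> D" using comb[OF W(1)[of i] W(1)[of j], of "-1"] by simp
    \<comment> \<open>In the direction of \<open>W i - W j\<close> itself the two defects differ by
      exactly the squared norm of that difference.\<close>
    have "B i ?v - B j ?v = (LINT x|M. W i x \<bullet> ?v x - W j x \<bullet> ?v x)"
      unfolding B_def by (subst Bochner_Integration.integral_diff) (auto intro!: sqi_inner D W v)
    also have "\<dots> = (l2n M ?v)\<^sup>2"
      unfolding l2n_power2 by (simp add: power2_norm_eq_inner inner_diff_left)
    finally have "(l2n M ?v)\<^sup>2 <= \<bar>B i ?v\<bar> + \<bar>B j ?v\<bar>" by linarith
    also have "\<dots> <= (sqrt (1 / real (Suc i)) + sqrt (1 / real (Suc j))) * l2n M ?v"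
      using Babs[OF v, of i] Babs[OF v, of j] by (simp add: algebra_simps)
    finally have *: "l2n M ?v * l2n M ?v <= (sqrt (1 / real (Suc i)) + sqrt (1 / real (Suc j))) * l2n M ?v"
      by (simp add: power2_eq_square)
    show ?thesis
    proof (cases "l2n M ?v = 0")
      case False
      then have "l2n M ?v > 0" using l2n_nonneg[of M ?v] by linarith
      then show ?thesis using * by (rule mult_right_le_imp_le[rotated])
    qed simp
  qed
  obtain w where w: "sqi M w" "l2conv M W w"
  proof (rule l2_complete[OF fm, of W])
    show "sqi M (W k)" for k by (rule D[OF W(1)])
    fix e :: real assume "0 < e"
    then have "eventually (%k. sqrt (1 / real (Suc k)) < e / 2) sequentially"
      using order_tendstoD(2)[OF s0, of "e/2"] by auto
    then obtain N where N: "\<forall>k\<ge>N. sqrt (1 / real (Suc k)) < e / 2" by (auto simp: eventually_sequentially)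
    have "l2n M (%x. W i x - W j x) < e" if "i \<ge> N" "j \<ge> N" for i j
      using cau[of i j] N[rule_format, OF that(1)] N[rule_format, OF that(2)] by linarith
    then show "\<exists>N. \<forall>i\<ge>N. \<forall>j\<ge>N. l2n M (%x. W i x - W j x) < e" by blast
  qed
  have "(LINT x|M. w x \<bullet> v x) = l v" if v: "v \<in> D" for v
  proof -
    have "(%k. B k v) \<longlonglongrightarrow> 0"
      by (rule Lim_null_comparison[OF _ tendsto_mult_left_zero[OF s0, of "l2n M v"]]) (use Babs[OF v] in auto)
    moreover have "(%k. B k v - ((LINT x|M. w x \<bullet> v x) - l v)) \<longlonglongrightarrow> 0"
    proof (rule Lim_null_comparison[OF _ tendsto_mult_left_zero[OF w(2), of "l2n M v"]])
      have "B k v - ((LINT x|M. w x \<bullet> v x) - l v) = (LINT x|M. (W k x - w x) \<bullet> v x)" for k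
        unfolding B_def inner_diff_left
        by (subst Bochner_Integration.integral_diff) (auto intro!: sqi_inner D W v w)
      then show "\<forall>\<^sub>F k in sequentially. norm (B k v - ((LINT x|M. w x \<bullet> v x) - l v)) <= l2n M (%x. W k x - w x) * l2n M v"
        using l2_Cauchy_Schwarz[OF sqi_diff[OF D[OF W(1)] w(1)] D[OF v]] by simp
    qed
    ultimately have "(%k. (LINT x|M. w x \<bullet> v x) - l v) \<longlonglongrightarrow> 0"
      using tendsto_diff by fastforce
    then show ?thesis by (simp add: LIMSEQ_const_iff)
  qed
  then show ?thesis using that W(1) w by blast
qed

text \<open>Uniform boundedness by a gliding hump. If the norms were unbounded, a series with steps
  of norm 3^-k along ever larger members would sum to a single x against which the integrals are
  unbounded.\<close>

lemma l2_weak_bounded: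
  fixes p :: "nat => 'a => 'b::euclidean_space"
  assumes fm: "finite_measure M" and p: "!!n. sqi M (p n)"
    and bd: "!!q. sqi M q ==> Bseq (%n. LINT x|M. p n x \<bullet> q x)"
  obtains K where "0 < K" "!!n. l2n M (p n) <= K"
proof (rule ccontr)
  assume nt: "\<not> thesis"
  \<comment> \<open>Norms above 6^k against steps of norm 3^-k leave pairings of order 2^k.\<close>
  have "\<exists>n. l2n M (p n) > 6 ^ k" for k :: nat
  proof (rule ccontr)
    assume "\<not> (\<exists>n. l2n M (p n) > 6 ^ k)"
    then show False using nt that[of "6 ^ k"] by (auto simp: not_less)
  qed
  then obtain n where n: "!!k. l2n M (p (n k)) > 6 ^ k" by metis
  define N where "N k = l2n M (p (n k))" for k
  have N: "N k > 6 ^ k" "N k > 0" for k using n[of k] by (auto simp: N_def intro: less_trans[OF _ n])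
  \<comment> \<open>Since |a + h| and |a - h| cannot both be below h, one of the two signs brings
    the pairing up to \<open>N k / 3 ^ k\<close>. The scaling gives the step norm 3^-k.\<close>
  define c where "c k y = (if \<bar>(LINT x|M. p (n k) x \<bullet> y x) + N k / 3 ^ k\<bar> \<ge> N k / 3 ^ k then 1 / (3 ^ k * N k) else - (1 / (3 ^ k * N k)))"
    for k :: nat and y
  define X where "X = rec_nat (%x. 0) (%k y x. y x + c k y *\<^sub>R p (n k) x)"
  have X0: "X 0 = (%x. 0)" and XS: "X (Suc k) = (%x. X k x + c k (X k) *\<^sub>R p (n k) x)" for k
    by (simp_all add: X_def)
  have sX: "sqi M (X k)" for k
    by (induction k) (auto simp: X0 XS intro!: sqi_add sqi_scaleR p)
  have cabs: "\<bar>c k y\<bar> = 1 / (3 ^ k * N k)" for k y using N[of k] by (auto simp: c_def)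
  have step: "l2n M (%x. X (Suc k) x - X k x) = 1 / 3 ^ k" for k
    using N[of k] by (simp add: XS l2n_scaleR cabs flip: N_def)
  have big: "\<bar>LINT x|M. p (n k) x \<bullet> X (Suc k) x\<bar> \<ge> N k / 3 ^ k" for k
  proof -
    have "(LINT x|M. p (n k) x \<bullet> X (Suc k) x) = (LINT x|M. p (n k) x \<bullet> X k x) + c k (X k) * (N k)\<^sup>2"
      unfolding XS N_def l2n_power2 power2_norm_eq_inner inner_add_right inner_scaleR_right
      using sqi_inner[OF p[of "n k"] sX[of k]] sqi_inner[OF p[of "n k"] p[of "n k"]] by simp
    then show ?thesis using N[of k] by (auto simp: c_def power2_eq_square)
  qed
  have tail: "l2n M (%x. X (k + j) x - X k x) <= (3/2) * (1 / 3 ^ k - 1 / 3 ^ (k + j))" for k j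
  proof (induction j)
    case (Suc j)
    have "l2n M (%x. X (k + Suc j) x - X k x) <= 1 / 3 ^ (k + j) + l2n M (%x. X (k + j) x - X k x)"
      using l2n_triangle3[OF sX[of "Suc (k + j)"] sX[of "k + j"] sX[of k]] step[of "k + j"] by simp
    then show ?case using Suc by (simp add: algebra_simps)
  qed simp
  have tail': "l2n M (%x. X i x - X j x) <= (3/2) * (1 / 3 ^ k)" if "i \<ge> k" "j = k" for i j k
  proof -
    have "l2n M (%x. X i x - X j x) <= (3/2) * (1 / 3 ^ k - 1 / 3 ^ i)"
      using tail[of k "i - k"] that by simp
    also have "\<dots> <= (3/2) * (1 / 3 ^ k)" by (intro mult_left_mono) auto
    finally show ?thesis .
  qed
  obtain x where x: "sqi M x" "l2conv M X x"
  proof (rule l2_complete[OF fm, of X])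
    show "sqi M (X k)" for k by (rule sX)
    fix e :: real assume "0 < e"
    have "(%k. 3 * (1/3) ^ k :: real) \<longlonglongrightarrow> 0"
      by (intro tendsto_mult_right_zero LIMSEQ_power_zero) simp
    then have "eventually (%k. 3 * (1/3) ^ k < e) sequentially"
      using order_tendstoD(2) \<open>0 < e\<close> by blast
    then obtain k where k: "3 * (1/3) ^ k < e" by (auto simp: eventually_sequentially)
    have "l2n M (%x. X i x - X j x) < e" if "i \<ge> k" "j \<ge> k" for i j
    proof -
      have "l2n M (%x. X i x - X j x) <= l2n M (%x. X i x - X k x) + l2n M (%x. X k x - X j x)"
        by (rule l2n_triangle3[OF sX sX sX])
      also have "\<dots> <= (3/2) * (1 / 3 ^ k) + (3/2) * (1 / 3 ^ k)"
        using tail'[OF that(1) refl] tail'[OF that(2) refl] unfolding l2n_minus_commute[of M "X k" "X j"] by linarith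
      also have "\<dots> < e" using k by (simp add: power_one_over)
      finally show ?thesis .
    qed
    then show "\<exists>N. \<forall>i\<ge>N. \<forall>j\<ge>N. l2n M (%x. X i x - X j x) < e" by blast
  qed
  \<comment> \<open>All later steps together have at most half the norm of step k, so they cannot
    undo more than half of the pairing gained there.\<close>
  have dist: "l2n M (%t. x t - X (Suc k) t) <= (1/2) * (1 / 3 ^ k)" for k
  proof (rule LIMSEQ_le_const)
    show "(%i. l2n M (%t. X i t - x t) + (1/2) * (1 / 3 ^ k)) \<longlonglongrightarrow> (1/2) * (1 / 3 ^ k)"
      using tendsto_add[OF x(2) tendsto_const[of "(1/2) * (1 / 3 ^ k)"]] by (simp only: add_0)
    have "l2n M (%t. x t - X (Suc k) t) <= l2n M (%t. X i t - x t) + (1/2) * (1 / 3 ^ k)" if "i \<ge> Suc k" for i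
      using l2n_triangle3[OF x(1) sX[of i] sX[of "Suc k"]] tail'[OF that refl]
      unfolding l2n_minus_commute[of M x "X i"] by simp
    then show "\<exists>N. \<forall>i\<ge>N. l2n M (%t. x t - X (Suc k) t) <= l2n M (%t. X i t - x t) + (1/2) * (1 / 3 ^ k)" by blast
  qed
  have grow: "\<bar>LINT t|M. p (n k) t \<bullet> x t\<bar> \<ge> 2 ^ k / 2" for k
  proof -
    have "\<bar>(LINT t|M. p (n k) t \<bullet> x t) - (LINT t|M. p (n k) t \<bullet> X (Suc k) t)\<bar> = \<bar>LINT t|M. p (n k) t \<bullet> (x t - X (Suc k) t)\<bar>"
      unfolding inner_diff_right by (subst Bochner_Integration.integral_diff) (auto intro!: sqi_inner p x sX)
    also have "\<dots> <= N k * ((1/2) * (1 / 3 ^ k))"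
      using l2_Cauchy_Schwarz[OF p sqi_diff[OF x(1) sX], of "n k" "Suc k"] mult_left_mono[OF dist[of k], of "N k"] N[of k]
      by (simp add: N_def)
    also have "\<dots> = N k / 3 ^ k / 2" by simp
    finally have d: "\<bar>(LINT t|M. p (n k) t \<bullet> x t) - (LINT t|M. p (n k) t \<bullet> X (Suc k) t)\<bar> <= N k / 3 ^ k / 2" .
    have "\<bar>a\<bar> \<ge> h / 2" if "\<bar>a - b\<bar> <= h / 2" "\<bar>b\<bar> \<ge> h" for a b h :: real
      using that by linarith
    from this[OF d big[of k]] have "\<bar>LINT t|M. p (n k) t \<bullet> x t\<bar> \<ge> N k / 3 ^ k / 2" .
    moreover have "2 ^ k / 2 <= N k / 3 ^ k / 2"
    proof (rule divide_right_mono)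
      have "(2::real) ^ k = 6 ^ k / 3 ^ k" by (simp flip: power_divide)
      also have "\<dots> <= N k / 3 ^ k" using N(1)[of k] by (intro divide_right_mono) auto
      finally show "2 ^ k <= N k / 3 ^ k" .
    qed simp
    ultimately show ?thesis by (rule order_trans[rotated])
  qed
  from bd[OF x(1)] obtain K where K: "!!n. \<bar>LINT t|M. p n t \<bullet> x t\<bar> <= K" by (auto simp: Bseq_def)
  obtain k :: nat where "2 * K < 2 ^ k" using real_arch_pow[of 2 "2 * K"] by auto
  then show False using grow[of k] K[of "n k"] by linarith
qed

lemma l2_weak_strong:
  fixes f g :: "nat => 'a => 'b::euclidean_space"
  assumes f: "!!n. sqi M (f n)" and K: "!!n. l2n M (f n) <= K"
    and w: "(%n. LINT x|M. f n x \<bullet> g0 x) \<longlonglongrightarrow> L"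
    and g: "!!n. sqi M (g n)" "sqi M g0" "l2conv M g g0"
  shows "(%n. LINT x|M. f n x \<bullet> g n x) \<longlonglongrightarrow> L"
proof -
  have "(%n. (LINT x|M. f n x \<bullet> g n x) - (LINT x|M. f n x \<bullet> g0 x)) \<longlonglongrightarrow> 0"
  proof (rule Lim_null_comparison[OF _ tendsto_mult_right_zero[OF g(3), of K]])
    have "(LINT x|M. f n x \<bullet> g n x) - (LINT x|M. f n x \<bullet> g0 x) = (LINT x|M. f n x \<bullet> (g n x - g0 x))" for n
      unfolding inner_diff_right by (subst Bochner_Integration.integral_diff) (auto intro!: sqi_inner f g)
    moreover have "\<bar>LINT x|M. f n x \<bullet> (g n x - g0 x)\<bar> <= K * l2n M (%x. g n x - g0 x)" for n
      using l2_Cauchy_Schwarz[OF f sqi_diff[OF g(1,2)], of n n] mult_right_mono[OF K[of n], of "l2n M (%x. g n x - g0 x)"]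
      by simp
    ultimately show "\<forall>\<^sub>F n in sequentially. norm ((LINT x|M. f n x \<bullet> g n x) - (LINT x|M. f n x \<bullet> g0 x)) <= K * l2n M (%x. g n x - g0 x)"
      by simp
  qed
  from tendsto_add[OF this w] show ?thesis by simp
qed

lemma l2_AE_subseq:
  fixes f :: "nat => 'a => 'b::euclidean_space"
  assumes "!!n. sqi M (f n)" "sqi M g" "l2conv M f g"
  obtains r :: "nat => nat" where "strict_mono r" "AE x in M. (%n. f (r n) x) \<longlonglongrightarrow> g x"
proof -
  have "\<exists>r::nat=>nat. strict_mono r \<and> (AE x in M. (%n. (norm (f (r n) x - g x))\<^sup>2) \<longlonglongrightarrow> 0)"
  proof (rule tendsto_L1_AE_subseq)
    show "integrable M (%x. (norm (f n x - g x))\<^sup>2)" for n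
      using sqi_diff[OF assms(1,2)] by (simp add: sqi_def)
    show "(%n. LINT x|M. norm ((norm (f n x - g x))\<^sup>2)) \<longlonglongrightarrow> 0"
      using tendsto_power[OF assms(3), of 2] by (simp add: l2n_power2)
  qed
  then obtain r where r: "strict_mono (r::nat=>nat)" "AE x in M. (%n. (norm (f (r n) x - g x))\<^sup>2) \<longlonglongrightarrow> 0" by blast
  have "AE x in M. (%n. f (r n) x) \<longlonglongrightarrow> g x"
    using r(2)
  proof eventually_elim
    case (elim x)
    then have "(%n. norm (f (r n) x - g x)) \<longlonglongrightarrow> 0"
      using tendsto_real_sqrt[OF elim] by simp
    then show ?case by (simp add: LIM_zero_iff tendsto_norm_zero_iff)
  qed
  with r(1) show ?thesis by (rule that)
qed

lemma l2n_dominated: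
  fixes f :: "nat => 'a => 'b::euclidean_space"
  assumes [measurable]: "!!n. f n \<in> borel_measurable M" and h: "sqi M h"
    and le: "!!n. AE x in M. norm (f n x) <= norm (h x)"
    and lim: "AE x in M. (%n. f n x) \<longlonglongrightarrow> 0"
  shows "(%n. l2n M (f n)) \<longlonglongrightarrow> 0"
proof -
  have [measurable]: "h \<in> borel_measurable M" using h by (simp add: sqi_def)
  have "(%n. LINT x|M. (norm (f n x))\<^sup>2) \<longlonglongrightarrow> (LINT x|M. 0)"
  proof (rule integral_dominated_convergence)
    show "integrable M (%x. (norm (h x))\<^sup>2)" using h by (simp add: sqi_def)
    show "AE x in M. (%n. (norm (f n x))\<^sup>2) \<longlonglongrightarrow> 0"
      using lim
    proof eventually_elim
      case (elim x)
      show ?case using tendsto_power[OF tendsto_norm_zero[OF elim], of 2] by simp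
    qed
    show "AE x in M. norm ((norm (f n x))\<^sup>2) <= (norm (h x))\<^sup>2" for n
      using le[of n] by eventually_elim (simp add: power_mono)
  qed measurable
  then show ?thesis using tendsto_real_sqrt unfolding l2n_def by fastforce
qed

section \<open>Smooth functions and the fundamental lemma\<close>

lemma Cn_SucI:
  assumes "!!x. (f has_derivative f' x) (at x)" "!!v. Cn n (%x. f' x v)"
  shows "Cn (Suc n) f"
proof -
  have "f' x = frechet_derivative f (at x)" for x using frechet_derivative_at[OF assms(1)] .
  then have "Cn n (%x. frechet_derivative f (at x) v)" for v using assms(2)[of v] by simp
  moreover have "f differentiable (at x)" for x using assms(1) differentiableI by blast
  ultimately show ?thesis by (simp del: split_paired_All)
qed

lemma Cn_SucD:
  assumes "Cn (Suc n) f"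
  shows "(f has_derivative frechet_derivative f (at x)) (at x)" "Cn n (%x. frechet_derivative f (at x) v)"
proof -
  have "\<forall>x. f differentiable (at x)" "\<forall>v. Cn n (%x. frechet_derivative f (at x) v)"
    using assms by (simp_all del: split_paired_All)
  then show "(f has_derivative frechet_derivative f (at x)) (at x)" "Cn n (%x. frechet_derivative f (at x) v)"
    using frechet_derivative_works by blast+
qed

lemma Cn_continuous: "Cn n f ==> continuous_on UNIV f"
proof (cases n)
  case (Suc m)
  assume "Cn n f"
  then have "!!x. f differentiable (at x)" using Suc by auto
  then show ?thesis by (simp add: continuous_on_eq_continuous_at differentiable_imp_continuous_within)
qed auto

lemma Cn_lower: "Cn (Suc n) f ==> Cn n f"
proof (induction n arbitrary: f)
  case 0 then show ?case using Cn_continuous[of "Suc 0" f] by simp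
next
  case (Suc n)
  show ?case
    by (rule Cn_SucI[OF Cn_SucD(1)[OF Suc.prems]]) (rule Suc.IH[OF Cn_SucD(2)[OF Suc.prems]])
qed

lemma Cn_const: "Cn n (%x. c)"
proof (induction n arbitrary: c)
  case (Suc n)
  show ?case by (rule Cn_SucI[of _ "%x v. 0"]) (auto simp: Suc)
qed auto

lemma Cn_bounded_linear: assumes "bounded_linear l" shows "Cn n l"
proof (cases n)
  case 0 then show ?thesis using assms by (simp add: linear_continuous_on)
next
  case (Suc m)
  show ?thesis unfolding Suc
    by (rule Cn_SucI[of _ "%x. l"]) (auto intro: bounded_linear_imp_has_derivative assms Cn_const)
qed

lemma Cn_add: "Cn n f ==> Cn n g ==> Cn n (%x. f x + g x)"
proof (induction n arbitrary: f g)
  case (Suc n)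
  show ?case
    by (rule Cn_SucI[OF has_derivative_add[OF Cn_SucD(1)[OF Suc.prems(1)] Cn_SucD(1)[OF Suc.prems(2)]]])
      (rule Suc.IH[OF Cn_SucD(2)[OF Suc.prems(1)] Cn_SucD(2)[OF Suc.prems(2)]])
qed (auto intro: continuous_intros)

lemma Cn_mult: "Cn n f ==> Cn n g ==> Cn n (%x. f x * g x)"
proof (induction n arbitrary: f g)
  case (Suc n)
  show ?case
    by (rule Cn_SucI[OF has_derivative_mult[OF Cn_SucD(1)[OF Suc.prems(1)] Cn_SucD(1)[OF Suc.prems(2)]]])
      (intro Cn_add Suc.IH Cn_lower[OF Suc.prems(1)] Cn_lower[OF Suc.prems(2)] Cn_SucD(2)[OF Suc.prems(1)] Cn_SucD(2)[OF Suc.prems(2)])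
qed (auto intro: continuous_intros)

text \<open>The induction on n needs the claim for the derivative of h as well, hence a whole family
  closed under differentiation.\<close>

lemma Cn_compose:
  assumes F: "!!h. h \<in> F ==> \<exists>h'\<in>F. \<forall>x. (h has_real_derivative h' x) (at x)"
  shows "h \<in> F ==> Cn n f ==> Cn n (%x. h (f x))"
proof (induction n arbitrary: h)
  case 0
  from F[OF 0(1)] have "continuous_on UNIV h"
    by (meson DERIV_continuous_on has_field_derivative_at_within)
  then show ?case using 0(2) continuous_on_compose2[of UNIV h UNIV f] by auto
next
  case (Suc n)
  from F[OF Suc.prems(1)] obtain h' where h': "h' \<in> F" "!!x. (h has_real_derivative h' x) (at x)" by blast
  have "((%x. h (f x)) has_derivative (%v. h' (f x) * frechet_derivative f (at x) v)) (at x)" for x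
    using has_derivative_compose[OF Cn_SucD(1)[OF Suc.prems(2)], of h "(*) (h' (f x))" x] h'(2)[of "f x"]
    by (simp add: has_field_derivative_def)
  then show ?case
  proof (rule Cn_SucI)
    fix v
    show "Cn n (%x. h' (f x) * frechet_derivative f (at x) v)"
      by (rule Cn_mult[OF Suc.IH[OF h'(1) Cn_lower[OF Suc.prems(2)]] Cn_SucD(2)[OF Suc.prems(2)]])
  qed
qed

lemma smooth_const: "smooth (%x. c)" by (simp add: smooth_def Cn_const)
lemma smooth_fst: "smooth fst" by (simp add: smooth_def Cn_bounded_linear bounded_linear_fst)
lemma smooth_snd: "smooth snd" by (simp add: smooth_def Cn_bounded_linear bounded_linear_snd)
lemma smooth_add: "smooth f ==> smooth g ==> smooth (%x. f x + g x)" by (simp add: smooth_def Cn_add)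
lemma smooth_mult: "smooth f ==> smooth g ==> smooth (%x. f x * g x)" by (simp add: smooth_def Cn_mult)
lemma smooth_cmult: "smooth f ==> smooth (%x. c * f x)" by (intro smooth_mult smooth_const)
lemma smooth_diff: "smooth f ==> smooth g ==> smooth (%x. f x - g x)"
  using smooth_add[OF _ smooth_cmult[of g "-1"], of f] by simp
lemma smooth_power: "smooth f ==> smooth (%x. f x ^ n)"
proof (induction n)
  case 0 then show ?case using smooth_const[of 1] by simp
next
  case (Suc n) then show ?case using smooth_mult[of f "%x. f x ^ n"] by simp
qed

lemma smooth_polynomial:
  assumes "real_polynomial_function p" "smooth f" shows "smooth (%x. p (f x))"
  using assms(1)
proof (induction p rule: real_polynomial_function.induct)
  case (linear p)
  then obtain c where "p = (%x. x * c)" by (auto simp: real_bounded_linear)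
  then show ?case using smooth_mult[OF assms(2) smooth_const[of c]] by simp
next
  case (const c) show ?case by (rule smooth_const)
next
  case (add p q) show ?case by (rule smooth_add[OF add.IH])
next
  case (mult p q) show ?case by (rule smooth_mult[OF mult.IH])
qed

section \<open>Bumps, cutoffs and plateaus\<close>

definition flat :: "(real => real) => real => real" where
  "flat q t = (if 0 < t then q (1 / t) * exp (- (1 / t)) else 0)"

abbreviation "ef \<equiv> flat (%s. 1)"

lemma polynomial_times_exp_tendsto_0:
  assumes "real_polynomial_function q"
  shows "((%s. q s * exp (- s)) \<longlongrightarrow> 0) at_top"
proof -
  obtain a n where q: "q = (%x. \<Sum>i\<le>n. a i * x ^ i)" using assms by (auto simp: real_polynomial_function_iff_sum)
  have "((%s. \<Sum>i\<le>n. a i * (s ^ i / exp s)) \<longlongrightarrow> (\<Sum>i\<le>n. a i * 0)) at_top"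
    by (intro tendsto_sum tendsto_mult tendsto_const tendsto_power_div_exp_0)
  moreover have "q s * exp (- s) = (\<Sum>i\<le>n. a i * (s ^ i / exp s))" for s
    by (simp add: q sum_distrib_right exp_minus divide_inverse mult.assoc)
  ultimately show ?thesis by simp
qed

text \<open>With s = 1/t the chain rule turns q(s) exp(-s) into s^2 (q(s) - q'(s)) exp(-s), which is
  of the same form. This closedness is what \<open>Cn_compose\<close> needs to make
  \<open>ef\<close> smooth.\<close>

lemma flat_has_derivative:
  assumes "real_polynomial_function q"
  obtains q' where "real_polynomial_function q'" "!!t. (flat q has_real_derivative flat q' t) (at t)"
proof -
  obtain p where p: "real_polynomial_function p" "!!x. (q has_real_derivative p x) (at x)"
    using has_real_derivative_polynomial_function[OF assms] by blast
  define q' where "q' = (%s. s * s * (q s + (-1) * p s))"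
  have id: "real_polynomial_function (%s::real. s)" by (rule real_polynomial_function.intros(1)) (rule bounded_linear_ident)
  have q': "real_polynomial_function q'" unfolding q'_def
    by (rule real_polynomial_function.intros(4)[OF real_polynomial_function.intros(4)[OF id id]
          real_polynomial_function.intros(3)[OF assms real_polynomial_function.intros(4)[OF real_polynomial_function.intros(2) p(1)]]])
  have "(flat q has_real_derivative flat q' t) (at t)" for t
  proof -
    consider "t > 0" | "t < 0" | "t = 0" by linarith
    then show ?thesis
    proof cases
      case 1
      have "((%t. q (1 / t) * exp (- (1 / t))) has_real_derivative flat q' t) (at t)"
        using 1 by (auto intro!: derivative_eq_intros DERIV_chain2[OF p(2)] simp: flat_def q'_def power2_eq_square field_simps)
      then show ?thesis
        by (rule has_field_derivative_transform_within_open[of _ _ _ "{0<..}"]) (use 1 in \<open>auto simp: flat_def\<close>)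
    next
      case 2
      have "((%t. 0) has_real_derivative flat q' t) (at t)" using 2 by (simp add: flat_def)
      then show ?thesis
        by (rule has_field_derivative_transform_within_open[of _ _ _ "{..<0}"]) (use 2 in \<open>auto simp: flat_def\<close>)
    next
      case 3
      have "((%h. flat q h / h) \<longlongrightarrow> 0) (at 0)"
      proof (rule filterlim_split_at)
        show "((%h. flat q h / h) \<longlongrightarrow> 0) (at_left 0)"
          by (rule tendsto_eventually) (auto simp: flat_def eventually_at_filter)
        \<comment> \<open>With s = 1/h the right-hand difference quotient at 0 is s q(s) exp(-s),
          and the exponential beats the polynomial.\<close>
        have "((%h. (%s. (s * q s) * exp (- s)) (inverse h)) \<longlongrightarrow> 0) (at_right 0)"
          by (rule filterlim_compose[OF polynomial_times_exp_tendsto_0 filterlim_inverse_at_top_right])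
             (rule real_polynomial_function.intros(4)[OF id assms])
        then show "((%h. flat q h / h) \<longlongrightarrow> 0) (at_right 0)"
          by (rule Lim_transform_eventually)
             (auto simp: flat_def eventually_at_filter divide_inverse mult_ac)
      qed
      then show ?thesis using 3 by (simp add: has_field_derivative_iff flat_def)
    qed
  qed
  with q' show ?thesis by (rule that)
qed

lemma smooth_ef: assumes "smooth f" shows "smooth (%x. ef (f x))"
proof -
  let ?F = "{flat q |q. real_polynomial_function q}"
  have "Cn n (%x. ef (f x))" for n
  proof (rule Cn_compose[of ?F ef n f])
    show "!!h. h \<in> ?F ==> \<exists>h'\<in>?F. \<forall>x. (h has_real_derivative h' x) (at x)"
      using flat_has_derivative by blast
    show "ef \<in> ?F" using real_polynomial_function.intros(2)[of 1] by (intro CollectI exI[of _ "%s. 1"]) simp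
    show "Cn n f" using assms by (simp add: smooth_def)
  qed
  then show ?thesis by (simp add: smooth_def)
qed

lemma ef_eq_0: "t <= 0 ==> ef t = 0" by (simp add: flat_def)
lemma ef_nonneg: "0 <= ef t" by (simp add: flat_def)
lemma ef_le_1: "ef t <= 1" by (simp add: flat_def)
lemma ef_mono: "s <= t ==> ef s <= ef t"
  using divide_left_mono[of s t 1] by (auto simp: flat_def)
lemma ef_1: "ef 1 = exp (- 1)" by (simp add: flat_def)

lemma ef_C1: obtains d where "!!t. (ef has_real_derivative d t) (at t)" "continuous_on UNIV d"
proof -
  obtain q where q: "real_polynomial_function q" "!!t. (ef has_real_derivative flat q t) (at t)"
    using flat_has_derivative[of "%s. 1"] by blast
  obtain q' where q': "!!t. (flat q has_real_derivative flat q' t) (at t)"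
    using flat_has_derivative[OF q(1)] by blast
  have "continuous_on UNIV (flat q)" by (rule DERIV_continuous_on[OF has_field_derivative_at_within[OF q']])
  with q(2) show ?thesis by (rule that)
qed

lemma smooth_cutoff_exists:
  obtains \<theta> d C where "!!t. (\<theta> has_real_derivative d t) (at t)" "!!t. \<bar>d t\<bar> <= C" "0 < C"
    "!!t. 0 <= \<theta> t" "!!t. \<theta> t <= 1" "!!t. \<bar>t\<bar> <= 1 ==> \<theta> t = 1" "!!t. 2 <= \<bar>t\<bar> ==> \<theta> t = 0"
    "!!t. 2 <= \<bar>t\<bar> ==> d t = 0"
    "!!f. smooth f ==> smooth (%x. \<theta> (f x))"
proof -
  obtain e' where e': "!!t. (ef has_real_derivative e' t) (at t)" "continuous_on UNIV e'"
    using ef_C1 by blast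
  have ce: "continuous_on UNIV ef" by (rule DERIV_continuous_on[OF has_field_derivative_at_within[OF e'(1)]])
  \<comment> \<open>The inner term \<open>exp 1 * ef (t^2 - 1)\<close> is 0 for |t| \<le> 1 and at
    least 1 for |t| \<ge> 2. The factors \<open>exp 1\<close> compensate
    \<open>ef 1 = exp (-1)\<close>.\<close>
  define \<theta> where "\<theta> t = exp 1 * ef (1 - exp 1 * ef (t\<^sup>2 - 1))" for t
  define d where "d t = exp 1 * (e' (1 - exp 1 * ef (t\<^sup>2 - 1)) * (- (exp 1 * (e' (t\<^sup>2 - 1) * (2 * t)))))" for t
  have D: "(\<theta> has_real_derivative d t) (at t)" for t
    unfolding \<theta>_def d_def
    by (auto intro!: derivative_eq_intros DERIV_chain2[OF e'(1)])
  have z: "\<theta> t = 0" if "2 <= \<bar>t\<bar>" for t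
  proof -
    have "2\<^sup>2 <= \<bar>t\<bar>\<^sup>2" using that by (intro power_mono) auto
    then have "ef 1 <= ef (t\<^sup>2 - 1)" by (intro ef_mono) auto
    then have "exp 1 * exp (- 1) <= exp 1 * ef (t\<^sup>2 - 1)" by (intro mult_left_mono) (auto simp: ef_1)
    then have "1 - exp 1 * ef (t\<^sup>2 - 1) <= 0" by (simp flip: exp_add)
    then show ?thesis by (simp add: \<theta>_def ef_eq_0)
  qed
  have dz: "d t = 0" if "2 < \<bar>t\<bar>" for t
  proof -
    have "((%t. 0) has_real_derivative d t) (at t)"
      by (rule has_field_derivative_transform_within_open[OF D, of "{t. 2 < \<bar>t\<bar>}"])
         (use that z in \<open>auto intro!: open_Collect_less continuous_intros\<close>)
    then show ?thesis using DERIV_unique[OF _ DERIV_const] by blast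
  qed
  have cd: "continuous_on UNIV d"
    unfolding d_def by (intro continuous_intros continuous_on_compose2[OF e'(2)] continuous_on_compose2[OF ce]) auto
  have "compact (d ` {-3..3})" by (intro compact_continuous_image continuous_on_subset[OF cd]) auto
  then obtain C where "\<forall>y\<in>d ` {-3..3}. norm y <= C" using compact_imp_bounded bounded_iff by blast
  then have C: "!!t. t \<in> {-3..3} ==> \<bar>d t\<bar> <= C" by simp
  \<comment> \<open>The boundary points |t| = 2 are reached by continuity of d.\<close>
  have dz2: "d t = 0" if "2 <= \<bar>t\<bar>" for t
  proof (cases "2 < \<bar>t\<bar>")
    case False
    then have "t = 2 \<or> t = - 2" using that by linarith
    then have "t \<in> closure {t. 2 < \<bar>t\<bar>}"
    proof
      assume t: "t = 2"
      have "2 \<in> closure {2<..(3::real)}" by simp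
      then show ?thesis using closure_mono[of "{2<..(3::real)}" "{t. 2 < \<bar>t\<bar>}"] t by (auto simp: subset_iff)
    next
      assume t: "t = - 2"
      have "-2 \<in> closure {-3..<(-2::real)}" by simp
      then show ?thesis using closure_mono[of "{-3..<(-2::real)}" "{t. 2 < \<bar>t\<bar>}"] t by (auto simp: subset_iff)
    qed
    then show ?thesis using continuous_constant_on_closure[of "{t. 2 < \<bar>t\<bar>}" d 0 t]
      continuous_on_subset[OF cd subset_UNIV] dz by auto
  qed (use dz in auto)
  show ?thesis
  proof (rule that[of \<theta> d "max C 1"])
    show "\<bar>d t\<bar> <= max C 1" for t
    proof (cases "2 < \<bar>t\<bar>")
      case False
      then have "t \<in> {-3..3}" by auto
      then show ?thesis using C[of t] by simp
    qed (use dz in auto)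
    show "\<theta> t <= 1" for t
    proof -
      have "ef (1 - exp 1 * ef (t\<^sup>2 - 1)) <= ef 1" by (intro ef_mono) (simp add: ef_nonneg)
      then have "\<theta> t <= exp 1 * exp (-1)" unfolding \<theta>_def ef_1[symmetric] by (intro mult_left_mono) auto
      then show ?thesis by (simp flip: exp_add)
    qed
    show "\<theta> t = 1" if "\<bar>t\<bar> <= 1" for t
    proof -
      have "t\<^sup>2 <= 1" using that by (simp add: abs_square_le_1)
      then show ?thesis by (simp add: \<theta>_def ef_eq_0 ef_1 flip: exp_add)
    qed
    show "smooth (%x. \<theta> (f x))" if "smooth f" for f
      unfolding \<theta>_def by (intro smooth_cmult smooth_ef smooth_diff smooth_const smooth_power that)
  qed (use D z dz2 in \<open>auto simp: \<theta>_def ef_nonneg\<close>)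
qed

definition bmp :: "real => real => real => real" where
  "bmp a b t = ef (t - a) * ef (b - t)"

lemma bmp_pos_iff: "0 < bmp a b t \<longleftrightarrow> a < t \<and> t < b"
  by (auto simp: bmp_def flat_def)

lemma bmp_nonneg: "0 <= bmp a b t"
  by (simp add: bmp_def ef_nonneg)

lemma smooth_bmp: "smooth f ==> smooth (%x. bmp a b (f x))"
  unfolding bmp_def by (intro smooth_mult smooth_ef smooth_diff smooth_const)

text \<open>Applied to a bump that is positive exactly on a box, it vanishes where the bump is at
  most 1/k. This gives compact support inside the box, while the limit in k is the indicator of the
  box.\<close>

definition plateau :: "nat => real => real" where
  "plateau k t = ef (real k * (real k * t - 1))"

lemma plateau_tendsto: "0 <= t ==> (%k. plateau k t) \<longlonglongrightarrow> (if 0 < t then 1 else 0)"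
proof (cases "0 < t")
  case True
  have "LIM k sequentially. t * real k :> at_top"
    by (rule filterlim_tendsto_pos_mult_at_top[OF tendsto_const True filterlim_real_sequentially])
  then have "LIM k sequentially. - 1 + t * real k :> at_top"
    by (rule filterlim_tendsto_add_at_top[OF tendsto_const])
  from filterlim_at_top_mult_at_top[OF filterlim_real_sequentially this]
  have "LIM k sequentially. real k * (real k * t + - 1) :> at_top" by (simp add: algebra_simps)
  then have at: "LIM k sequentially. real k * (real k * t - 1) :> at_top" by simp
  have "((%s::real. exp (- (1 / s))) \<longlongrightarrow> exp (- 0)) at_top"
    by (rule tendsto_exp[OF tendsto_minus[OF tendsto_divide_0[OF tendsto_const filterlim_at_top_imp_at_infinity[OF filterlim_ident]]]])
  from filterlim_compose[OF this at]
  have "(%k. exp (- (1 / (real k * (real k * t - 1))))) \<longlonglongrightarrow> 1" by simp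
  moreover have "eventually (%k. exp (- (1 / (real k * (real k * t - 1)))) = plateau k t) sequentially"
    using filterlim_at_top_dense[THEN iffD1, OF at, rule_format, of 0]
    by eventually_elim (simp add: plateau_def flat_def)
  ultimately have "(%k. plateau k t) \<longlonglongrightarrow> 1" by (rule Lim_transform_eventually)
  then show ?thesis using True by simp
next
  case False
  assume "0 <= t"
  then have "t = 0" using False by simp
  then show ?thesis by (simp add: plateau_def ef_eq_0)
qed

lemma smooth_plateau: "smooth f ==> smooth (%x. plateau k (f x))"
  unfolding plateau_def by (intro smooth_ef smooth_cmult smooth_diff smooth_const)

lemma plateau_bounds: "0 <= plateau k t" "plateau k t <= 1"
  by (simp_all add: plateau_def ef_nonneg ef_le_1)

lemma plateau_nonzero: "plateau k t \<noteq> 0 ==> 0 < k \<and> 1 / real k < t"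
proof -
  assume "plateau k t \<noteq> 0"
  then have "0 < real k * (real k * t - 1)" using ef_eq_0 unfolding plateau_def by (metis not_less)
  moreover from this have "0 < k" by (auto intro: Suc_leI gr0I)
  ultimately show ?thesis by (auto simp: zero_less_mult_iff field_simps)
qed

section \<open>The fundamental lemma of the calculus of variations\<close>

lemma testfn_box:
  assumes "box (a, c) (b, d) \<subseteq> U"
  shows "testfn U (%x. plateau k (bmp a b (fst x) * bmp c d (snd x)))" (is "testfn U ?\<phi>")
proof -
  let ?\<beta> = "%x. bmp a b (fst x) * bmp c d (snd x)"
  have sm\<beta>: "smooth ?\<beta>" by (intro smooth_mult smooth_bmp smooth_fst smooth_snd)
  then have cont: "continuous_on UNIV ?\<beta>" unfolding smooth_def using Cn_continuous by blast
  have pos: "0 < ?\<beta> x \<longleftrightarrow> x \<in> box (a, c) (b, d)" for x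
    using bmp_nonneg[of a b "fst x"] bmp_nonneg[of c d "snd x"] bmp_pos_iff[of a b "fst x"] bmp_pos_iff[of c d "snd x"]
    by (cases x) (auto simp: zero_less_mult_iff mem_box Basis_prod_def)
  let ?K = "{x. 0 < k \<and> 1 / real k <= ?\<beta> x}"
  have cl: "closed ?K" by (intro closed_Collect_conj closed_Collect_const closed_Collect_le continuous_intros cont)
  have sub: "supp ?\<phi> \<subseteq> ?K"
    unfolding supp_def by (rule closure_minimal[OF _ cl]) (auto dest!: plateau_nonzero)
  have "?K \<subseteq> box (a, c) (b, d)"
  proof
    fix x assume "x \<in> ?K"
    then have "0 < ?\<beta> x" by (auto intro: less_le_trans[of 0 "1 / real k" "?\<beta> x"])
    then show "x \<in> box (a, c) (b, d)" using pos by blast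
  qed
  with sub have s: "supp ?\<phi> \<subseteq> box (a, c) (b, d)" by blast
  have "compact (supp ?\<phi>)"
    using bounded_subset[OF bounded_box s] by (simp add: compact_eq_bounded_closed supp_def)
  moreover have "smooth ?\<phi>" by (rule smooth_plateau[OF sm\<beta>])
  ultimately show ?thesis using s assms by (auto simp: testfn_def Cc_def)
qed

text \<open>Boxes are an intersection-stable generator of the Borel sets, so Dynkin's argument
  carries the vanishing to every Borel set.\<close>

lemma AE_zero_of_box_integrals:
  fixes f :: "'a::euclidean_space => real"
  assumes f: "integrable lborel f" and z: "!!a b. (LINT x:box a b|lborel. f x) = 0"
  shows "AE x in lborel. f x = 0"
proof (rule density_unique_real[OF f])
  show "integrable lborel (%x::'a. 0::real)" by simp
  fix A :: "'a set" assume A: "A \<in> sets lborel"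
  let ?G = "range (%(a, b). box a b :: 'a set)"
  have sb: "sigma_sets UNIV ?G = sets borel" unfolding borel_eq_box by (simp add: sets_measure_of_conv)
  have int: "set_integrable lborel B f" if "B \<in> sets borel" for B
    using f integrable_mult_indicator[of B lborel f] that by (simp add: set_integrable_def)
  \<comment> \<open>The complement step of the induction needs the integral over the whole space,
    which is exhausted by growing boxes.\<close>
  have tot: "(LINT x:UNIV|lborel. f x) = 0"
  proof -
    have "(%k. LINT x|lborel. indicator (box (- real k *\<^sub>R One) (real k *\<^sub>R One)) x *\<^sub>R f x) \<longlonglongrightarrow> (LINT x|lborel. f x)"
    proof (rule integral_dominated_convergence[where w="%x. norm (f x)"])
      show "AE x in lborel. (%k. indicator (box (- real k *\<^sub>R One) (real k *\<^sub>R One)) x *\<^sub>R f x) \<longlonglongrightarrow> f x"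
      proof (rule AE_I2)
        fix x :: 'a
        obtain n where n: "norm x < real n" using reals_Archimedean2 by blast
        have "eventually (%k. indicator (box (- real k *\<^sub>R One) (real k *\<^sub>R One)) x *\<^sub>R f x = f x) sequentially"
          using eventually_ge_at_top[of n]
        proof eventually_elim
          case (elim k)
          have "x \<in> box (- real k *\<^sub>R One) (real k *\<^sub>R One)"
            unfolding mem_box
          proof
            fix i :: 'a assume "i \<in> Basis"
            then have "\<bar>x \<bullet> i\<bar> < real k" using Basis_le_norm[of i x] n elim by linarith
            then show "(- real k *\<^sub>R One) \<bullet> i < x \<bullet> i \<and> x \<bullet> i < (real k *\<^sub>R One) \<bullet> i"
              using \<open>i \<in> Basis\<close> by (auto simp: abs_less_iff)
          qed
          then show ?case by simp
        qed
        then show "(%k. indicator (box (- real k *\<^sub>R One) (real k *\<^sub>R One)) x *\<^sub>R f x) \<longlonglongrightarrow> f x"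
          by (rule tendsto_eventually)
      qed
    qed (use f in \<open>auto simp: indicator_def\<close>)
    then have "(LINT x|lborel. f x) = 0"
      using z unfolding set_lebesgue_integral_def by (simp add: LIMSEQ_const_iff)
    then show ?thesis by (simp add: set_lebesgue_integral_def)
  qed
  have st: "Int_stable ?G" unfolding Int_stable_def by (auto simp: box_Int_box)
  have "?G \<subseteq> Pow UNIV" "A \<in> sigma_sets UNIV ?G" using A sb by auto
  with st have "(LINT x:A|lborel. f x) = 0"
  proof (induction rule: sigma_sets_induct_disjoint)
    case (basic A) then show ?case using z by auto
  next
    case empty then show ?case by (simp add: set_lebesgue_integral_def)
  next
    case (compl A)
    then have A: "A \<in> sets borel" using sb by simp
    have "(LINT x:A \<union> (UNIV - A)|lborel. f x) = (LINT x:A|lborel. f x) + (LINT x:UNIV - A|lborel. f x)"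
      by (rule set_integral_Un) (use int A in auto)
    then show ?case using tot compl by simp
  next
    case (union B)
    then have "!!i. B i \<in> sets borel" using sb by auto
    then show ?case
      using lebesgue_integral_countable_add[of B lborel f] union(1) int[of "\<Union>(range B)"] union(3)
      by (auto simp: disjoint_family_on_def)
  qed
  then show "(LINT x:A|lborel. f x) = (LINT x:A|lborel. 0)" by (simp add: set_lebesgue_integral_def)
qed

abbreviation RS :: "R2 set => R2 measure" where "RS U \<equiv> restrict_space lborel U"

lemma RS_L2: "U \<in> sets borel ==> L2 U f \<longleftrightarrow> sqi (RS U) f"
  unfolding L2_def sqi_def set_borel_measurable_def set_integrable_def
  by (simp add: borel_measurable_restrict_space_iff integrable_restrict_space)

lemma RS_intg: "U \<in> sets borel ==> intg U f = (LINT x|RS U. f x)"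
  unfolding intg_def set_lebesgue_integral_def by (simp add: integral_restrict_space)

lemma RS_finite:
  assumes "U \<in> sets borel" "bounded U" shows "finite_measure (RS U)"
proof
  have "emeasure lborel U < \<infinity>" using emeasure_bounded_finite[OF assms(2)] .
  then show "emeasure (RS U) (space (RS U)) \<noteq> \<infinity>"
    using assms(1) by (simp add: emeasure_restrict_space space_restrict_space)
qed

lemma RS_measurable:
  fixes f :: "R2 => 'b::real_normed_vector"
  assumes "f \<in> borel_measurable borel" shows "f \<in> borel_measurable (RS U)"
  using assms by (simp add: measurable_restrict_space1)

lemma RS_AE: "U \<in> sets borel ==> (AE x in RS U. P x) \<longleftrightarrow> (AE x in lborel. x \<in> U --> P x)"
  by (simp add: AE_restrict_space_iff)

lemma smooth_continuous: "smooth f ==> continuous_on UNIV f"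
  unfolding smooth_def using Cn_continuous by blast

text \<open>Plateau test functions tend to the indicator of a box, so g has integral zero over every
  box inside U. An open set is a countable union of boxes with rational corners.\<close>

lemma fundamental_lemma:
  assumes U: "open U" and g: "sqi (RS U) g"
    and z: "!!\<phi>. testfn U \<phi> ==> (LINT x|RS U. g x * \<phi> x) = 0"
  shows "AE x in RS U. g x = (0::real)"
proof -
  have Ub: "U \<in> sets borel" using U by simp
  have gm: "(%x. indicator U x * g x) \<in> borel_measurable lborel"
    using g Ub by (simp add: sqi_def borel_measurable_restrict_space_iff)
  have g2: "integrable lborel (%x. indicator U x * (g x)\<^sup>2)"
    using g Ub by (simp add: sqi_def integrable_restrict_space)
  \<comment> \<open>U may have infinite measure; on a box, |y| \<le> 1 + y^2 turns square
    integrability into integrability.\<close>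
  have ib: "integrable lborel (%x. indicator B x * g x)" if B: "B \<subseteq> U" "B = box a b" for B a b
  proof (rule Bochner_Integration.integrable_bound)
    show "integrable lborel (%x. indicator B x + indicator U x * (g x)\<^sup>2)"
      using g2 B emeasure_bounded_finite[OF bounded_box, of a b]
      by (intro Bochner_Integration.integrable_add integrable_real_indicator) (auto simp: top.not_eq_extremum)
    have "(%x. indicator B x * (indicator U x * g x)) \<in> borel_measurable lborel"
      by (rule borel_measurable_times[OF borel_measurable_indicator gm]) (simp add: B)
    moreover have "(%x. indicator B x * (indicator U x * g x)) = (%x. indicator B x * g x)"
      using B by (auto simp: indicator_def fun_eq_iff)
    ultimately show "(%x. indicator B x * g x) \<in> borel_measurable lborel" by simp
    have "\<bar>y\<bar> <= 1 + y\<^sup>2" for y :: real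
      using zero_le_power2[of "\<bar>y\<bar> - 1"] by (simp add: power2_eq_square algebra_simps)
    then show "AE x in lborel. norm (indicator B x * g x) <= norm (indicator B x + indicator U x * (g x)\<^sup>2)"
      using B by (auto simp: indicator_def subset_eq)
  qed
  have zb: "(LINT x|lborel. indicator (box a b) x * g x) = 0" if B: "box a b \<subseteq> U" for a b :: R2
  proof -
    obtain a1 a2 b1 b2 where ab: "a = (a1, a2)" "b = (b1, b2)" by fastforce
    let ?\<beta> = "%x. bmp a1 b1 (fst x) * bmp a2 b2 (snd x)"
    have pos: "0 < ?\<beta> x \<longleftrightarrow> x \<in> box a b" for x
      using bmp_nonneg[of a1 b1 "fst x"] bmp_nonneg[of a2 b2 "snd x"] bmp_pos_iff[of a1 b1 "fst x"] bmp_pos_iff[of a2 b2 "snd x"]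
      by (cases x) (auto simp: ab zero_less_mult_iff mem_box Basis_prod_def)
    have nn: "0 <= ?\<beta> x" for x by (simp add: bmp_nonneg)
    have pz: "plateau k (?\<beta> x) = indicator (box a b) x * plateau k (?\<beta> x)" for k x
      using pos[of x] plateau_nonzero[of k "?\<beta> x"] by (auto simp: indicator_def intro: less_trans[of 0 "1 / real k"])
    have lim: "(%k. plateau k (?\<beta> x)) \<longlonglongrightarrow> indicator (box a b) x" for x
      using plateau_tendsto[OF nn, of x] pos[of x] by (auto simp: indicator_def)
    have sm: "(%x. plateau k (?\<beta> x)) \<in> borel_measurable borel" for k
      by (intro borel_measurable_continuous_onI smooth_continuous smooth_plateau smooth_mult smooth_bmp smooth_fst smooth_snd)
    have "(%k. LINT x|lborel. plateau k (?\<beta> x) * (indicator (box a b) x * g x)) \<longlonglongrightarrow> (LINT x|lborel. indicator (box a b) x * g x)"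
    proof (rule integral_dominated_convergence[where w="%x. norm (indicator (box a b) x * g x)"])
      show "(%x. indicator (box a b) x * g x) \<in> borel_measurable lborel" using ib[OF B refl] by auto
      then show "(%x. plateau k (?\<beta> x) * (indicator (box a b) x * g x)) \<in> borel_measurable lborel" for k using sm[of k] by simp
      show "integrable lborel (%x. norm (indicator (box a b) x * g x))" using ib[OF B refl] by (rule integrable_norm)
      show "AE x in lborel. (%k. plateau k (?\<beta> x) * (indicator (box a b) x * g x)) \<longlonglongrightarrow> indicator (box a b) x * g x"
      proof (rule AE_I2)
        fix x
        show "(%k. plateau k (?\<beta> x) * (indicator (box a b) x * g x)) \<longlonglongrightarrow> indicator (box a b) x * g x"
          using tendsto_mult_right[OF lim[of x], of "indicator (box a b) x * g x"] by (cases "x \<in> box a b") auto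
      qed
      show "AE x in lborel. norm (plateau k (?\<beta> x) * (indicator (box a b) x * g x)) <= norm (indicator (box a b) x * g x)" for k
        using plateau_bounds[of k] by (auto simp: abs_mult intro!: mult_left_le_one_le)
    qed
    moreover have "(LINT x|lborel. plateau k (?\<beta> x) * (indicator (box a b) x * g x)) = 0" for k
    proof -
      have "(LINT x|lborel. plateau k (?\<beta> x) * (indicator (box a b) x * g x)) = (LINT x|lborel. indicator U x *\<^sub>R (g x * plateau k (?\<beta> x)))"
      proof (intro Bochner_Integration.integral_cong refl)
        fix x
        show "plateau k (?\<beta> x) * (indicator (box a b) x * g x) = indicator U x *\<^sub>R (g x * plateau k (?\<beta> x))"
          using B pz[of k x] by (cases "x \<in> box a b") auto
      qed
      also have "\<dots> = (LINT x|RS U. g x * plateau k (?\<beta> x))" using Ub by (simp add: integral_restrict_space)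
      also have "\<dots> = 0" using B by (intro z testfn_box) (simp add: ab)
      finally show ?thesis .
    qed
    ultimately show ?thesis by (simp add: LIMSEQ_const_iff)
  qed
  have zae: "AE x in lborel. x \<in> box a b --> g x = 0" if B: "box a b \<subseteq> U" for a b
  proof -
    have "AE x in lborel. indicator (box a b) x * g x = 0"
    proof (rule AE_zero_of_box_integrals[OF ib[OF B refl]])
      fix c d :: R2
      have "(LINT x:box c d|lborel. indicator (box a b) x * g x) = (LINT x|lborel. indicator (box c d \<inter> box a b) x * g x)"
        unfolding set_lebesgue_integral_def by (intro Bochner_Integration.integral_cong refl) (auto simp: indicator_def)
      also have "\<dots> = 0" using B unfolding box_Int_box by (intro zb) (auto simp: box_Int_box[symmetric])
      finally show "(LINT x:box c d|lborel. indicator (box a b) x * g x) = 0" .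
    qed
    then show ?thesis by eventually_elim (auto simp: indicator_def)
  qed
  obtain D where D: "countable D" "!!X. X \<in> D ==> \<exists>a b. X = box a b" "!!X. X \<in> D ==> X \<subseteq> U" "\<Union>D = U"
  proof -
    let ?a' = "%f::R2=>real\<times>real. \<Sum>i\<in>Basis. fst (f i) *\<^sub>R i"
    let ?b' = "%f::R2=>real\<times>real. \<Sum>i\<in>Basis. snd (f i) *\<^sub>R i"
    let ?I = "{f\<in>Basis \<rightarrow>\<^sub>E \<rat> \<times> \<rat>. box (?a' f) (?b' f) \<subseteq> U}"
    have "countable ?I"
      by (rule countable_subset[OF _ countable_PiE[of Basis "%_. \<rat> \<times> \<rat>"]]) (auto intro: countable_rat)
    moreover have "U = (\<Union>f\<in>?I. box (?a' f) (?b' f))" by (rule open_UNION_box[OF U])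
    ultimately show ?thesis
      by (intro that[of "(%f. box (?a' f) (?b' f)) ` ?I"]) blast+
  qed
  have "AE x in lborel. \<forall>X\<in>D. x \<in> X --> g x = 0"
    unfolding AE_ball_countable[OF D(1)]
  proof
    fix X assume X: "X \<in> D"
    then obtain a b where "X = box a b" "X \<subseteq> U" using D(2,3) by meson
    then show "AE x in lborel. x \<in> X --> g x = 0" using zae by simp
  qed
  then have "AE x in lborel. x \<in> U --> g x = 0"
    by eventually_elim (use D(4) in blast)
  then show ?thesis by (simp add: RS_AE[OF Ub])
qed

section \<open>Weak derivatives and jets\<close>

text \<open>The 1-jet: the H^1 norm of f becomes the L2 norm of one vector-valued function, and H^1
  arguments become L2 arguments.\<close>

definition J :: "(R2 => real) => R2 => real \<times> real \<times> real" where
  "J f x = (f x, pd e1 f x, pd e2 f x)"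

text \<open>Built from the chosen weak derivatives, hence meaningful only up to null sets.\<close>

definition JW :: "R2 set => (R2 => real) => R2 => real \<times> real \<times> real" where
  "JW U u x = (u x, wd U u e1 x, wd U u e2 x)"

lemma smooth_has_derivative:
  assumes "smooth f" shows "(f has_derivative (%v. pd v f x)) (at x)"
proof -
  have "Cn (Suc 0) f" using assms by (simp add: smooth_def del: Cn.simps)
  from Cn_SucD(1)[OF this] show ?thesis unfolding pd_def .
qed

lemma pd_eqI: "(f has_derivative f') (at x) ==> pd e f x = f' e"
  unfolding pd_def using frechet_derivative_at by metis

lemma smooth_pd: assumes "smooth f" shows "smooth (pd e f)"
proof -
  have "Cn (Suc n) f" for n using assms by (simp add: smooth_def del: Cn.simps)
  from Cn_SucD(2)[OF this] show ?thesis unfolding smooth_def pd_def by simp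
qed

lemma J_continuous: "smooth f ==> continuous_on UNIV (J f)"
  unfolding J_def by (intro continuous_on_Pair smooth_continuous smooth_pd)

lemma pd_comb:
  assumes "smooth f" "smooth g"
  shows "pd e (%x. f x + c * g x) x = pd e f x + c * pd e g x"
  by (rule pd_eqI[OF has_derivative_add[OF smooth_has_derivative[OF assms(1)]
        has_derivative_mult_right[OF smooth_has_derivative[OF assms(2)]]]])

lemma pd_mult:
  assumes "smooth f" "smooth g"
  shows "pd e (%x. f x * g x) x = f x * pd e g x + pd e f x * g x"
  by (rule pd_eqI[OF has_derivative_mult[OF smooth_has_derivative[OF assms(1)] smooth_has_derivative[OF assms(2)]]])

lemma J_comb: "smooth f ==> smooth g ==> J (%x. f x + c * g x) x = J f x + c *\<^sub>R J g x"
  by (simp add: J_def pd_comb)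

lemma J_diff: "smooth f ==> smooth g ==> J (%x. f x - g x) x = J f x - J g x"
  using J_comb[of f g "-1" x] by simp

lemma supp_zero: "x \<notin> supp f ==> f x = 0"
  unfolding supp_def using closure_subset[of "{x. f x \<noteq> 0}"] by blast

lemma pd_supp_zero: assumes "x \<notin> supp f" shows "pd e f x = 0"
proof -
  have "((%x. 0) has_derivative (%v. 0)) (at x)" by simp
  then have "(f has_derivative (%v. 0)) (at x)"
  proof (rule has_derivative_transform_within_open)
    show "open (- supp f)" unfolding supp_def by (rule open_Compl[OF closed_closure])
    show "x \<in> - supp f" using assms by simp
    show "!!y. y \<in> - supp f ==> 0 = f y" using supp_zero by force
  qed
  from pd_eqI[OF this] show ?thesis .
qed

lemma J_supp_zero: "x \<notin> supp f ==> J f x = 0"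
  by (simp add: J_def supp_zero pd_supp_zero zero_prod_def)

lemma testfn_smooth: "testfn U f ==> smooth f"
  by (simp add: testfn_def Cc_def)

lemma Cc_smooth: "Cc f ==> smooth f"
  by (simp add: Cc_def)

lemma compact_supp_subset: "{x. h x \<noteq> 0} \<subseteq> S ==> compact S ==> compact (supp h) \<and> supp h \<subseteq> S"
proof -
  assume a: "{x. h x \<noteq> 0} \<subseteq> S" "compact S"
  then have "supp h \<subseteq> S" unfolding supp_def by (simp add: closure_minimal compact_imp_closed)
  with a(2) show ?thesis by (metis closed_closure compact_Int_closed inf.absorb_iff2 supp_def)
qed

lemma testfn_comb:
  assumes "testfn U f" "testfn U g" shows "testfn U (%x. f x + c * g x)"
proof -
  have "compact (supp f \<union> supp g)" using assms by (auto simp: testfn_def Cc_def)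
  moreover have "{x. f x + c * g x \<noteq> 0} \<subseteq> supp f \<union> supp g" using supp_zero[of _ f] supp_zero[of _ g] by fastforce
  ultimately have "compact (supp (%x. f x + c * g x))" "supp (%x. f x + c * g x) \<subseteq> supp f \<union> supp g"
    using compact_supp_subset[of "%x. f x + c * g x"] by auto
  then show ?thesis
    using assms by (auto simp: testfn_def Cc_def intro!: smooth_add smooth_cmult)
qed

lemma Cc_mult:
  assumes "Cc f" "smooth g" shows "Cc (%x. g x * f x)" "supp (%x. g x * f x) \<subseteq> supp f"
proof -
  have "{x. g x * f x \<noteq> 0} \<subseteq> supp f" using supp_zero[of _ f] by fastforce
  with compact_supp_subset[OF this] assms
  show "Cc (%x. g x * f x)" "supp (%x. g x * f x) \<subseteq> supp f" by (auto simp: Cc_def intro!: smooth_mult)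
qed

lemma testfn_mult: "testfn U f ==> smooth g ==> testfn U (%x. g x * f x)"
  using Cc_mult[of f g] by (auto simp: testfn_def)

lemma testfn_zero: "testfn U (%x. 0)"
  by (simp add: testfn_def Cc_def smooth_const supp_def)

lemma sqi_continuous:
  fixes F :: "R2 => 'b::euclidean_space"
  assumes "U \<in> sets borel" "bounded U" "continuous_on UNIV F"
  shows "sqi (RS U) F"
proof -
  interpret finite_measure "RS U" by (rule RS_finite[OF assms(1,2)])
  have [measurable]: "F \<in> borel_measurable (RS U)"
    by (rule RS_measurable[OF borel_measurable_continuous_onI[OF assms(3)]])
  have "compact (closure U)" using assms(2) by simp
  then have "bounded (F ` closure U)"
    by (intro compact_imp_bounded compact_continuous_image continuous_on_subset[OF assms(3)]) auto
  then obtain B where B: "!!x. x \<in> U ==> norm (F x) <= B"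
    unfolding bounded_iff using closure_subset by fastforce
  have "sqi (RS U) (%x. 1::real)" by (simp add: sqi_def)
  then show ?thesis
    by (rule sqi_bound[rotated, of _ _ _ B]) (auto simp: AE_restrict_space_iff assms(1) B intro!: AE_I2)
qed

lemma sqi_J: "U \<in> sets borel ==> bounded U ==> smooth f ==> sqi (RS U) (J f)"
  by (intro sqi_continuous J_continuous)

section \<open>Integration by parts\<close>

lemma integrable_compact_support:
  fixes F :: "R2 => real"
  assumes "continuous_on UNIV F" "compact K" "!!x. x \<notin> K ==> F x = 0"
  shows "integrable lborel F"
proof -
  have "integrable lborel (%x. if x \<in> K then F x else 0)"
    using borel_integrable_compact[OF assms(2) continuous_on_subset[OF assms(1)]]
    by (simp add: indicator_def of_bool_def if_distrib[where f="%c. c * _"] cong: if_cong)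
  moreover have "(%x. if x \<in> K then F x else 0) = F" using assms(3) by auto
  ultimately show ?thesis by simp
qed

lemma FTC_line_zero:
  fixes h h' :: "real => real"
  assumes "!!t. (h has_real_derivative h' t) (at t)" "continuous_on UNIV h'"
    and "!!t. R <= \<bar>t\<bar> ==> h t = 0" "!!t. R < \<bar>t\<bar> ==> h' t = 0" "0 <= R"
  shows "(LINT t|lborel. h' t) = 0"
proof -
  have "(LINT t|lborel. h' t * indicator {-R..R} t) = h R - h (-R)"
    by (rule integral_FTC_Icc_real) (use assms in \<open>auto simp: continuous_on_eq_continuous_at\<close>)
  moreover have "(%t. h' t * indicator {-R..R} t) = h'"
  proof
    fix t show "h' t * indicator {-R..R} t = h' t"
      using assms(4)[of t] by (cases "R < \<bar>t\<bar>") (auto simp: indicator_def)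
  qed
  ultimately show ?thesis using assms(3)[of R] assms(3)[of "-R"] assms(5) by simp
qed

lemma has_derivative_slice2:
  assumes "smooth f" shows "((%y. f (s, y)) has_real_derivative pd e2 f (s, y)) (at y)"
proof -
  have "((%y. (s, y)) has_derivative (%h. (0, h))) (at y)" by (auto intro!: derivative_eq_intros)
  from has_derivative_compose[OF this smooth_has_derivative[OF assms]]
  have "((%y. f (s, y)) has_derivative (%h. pd (0, h) f (s, y))) (at y)" .
  moreover have "(%h. pd (0, h) f (s, y)) = (*) (pd e2 f (s, y))"
  proof
    fix h
    show "pd (0, h) f (s, y) = pd e2 f (s, y) * h"
      using linear_cmul[OF bounded_linear.linear[OF has_derivative_bounded_linear[OF smooth_has_derivative[OF assms, of "(s, y)"]]], of h e2]
      by (simp add: mult.commute)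
  qed
  ultimately show ?thesis unfolding has_field_derivative_def by (simp only:)
qed

lemma has_derivative_slice1:
  assumes "smooth f" shows "((%s. f (s, y)) has_real_derivative pd e1 f (s, y)) (at s)"
proof -
  have "((%s. (s, y)) has_derivative (%h. (h, 0))) (at s)" by (auto intro!: derivative_eq_intros)
  from has_derivative_compose[OF this smooth_has_derivative[OF assms]]
  have "((%s. f (s, y)) has_derivative (%h. pd (h, 0) f (s, y))) (at s)" .
  moreover have "(%h. pd (h, 0) f (s, y)) = (*) (pd e1 f (s, y))"
  proof
    fix h
    show "pd (h, 0) f (s, y) = pd e1 f (s, y) * h"
      using linear_cmul[OF bounded_linear.linear[OF has_derivative_bounded_linear[OF smooth_has_derivative[OF assms, of "(s, y)"]]], of h e1]
      by (simp add: mult.commute)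
  qed
  ultimately show ?thesis unfolding has_field_derivative_def by (simp only:)
qed

lemma continuous_slice:
  fixes F :: "R2 => real"
  assumes "continuous_on UNIV F"
  shows "continuous_on A (%y. F (s, y))" "continuous_on A (%s. F (s, y))"
  by (rule continuous_on_compose2[OF assms]; auto intro!: continuous_intros)+

lemma integral_pd_zero:
  assumes "Cc f" shows "(LINT x|lborel. pd e1 f x) = 0" "(LINT x|lborel. pd e2 f x) = 0"
proof -
  have sm: "smooth f" and K: "compact (supp f)" using assms by (auto simp: Cc_def)
  obtain R where R: "0 < R" "!!x. x \<in> supp f ==> norm x < R"
    using compact_imp_bounded[OF K] by (auto simp: bounded_pos_less)
  have fz: "f (s, y) = 0" "pd e f (s, y) = 0" if "R <= \<bar>s\<bar> \<or> R <= \<bar>y\<bar>" for e s y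
  proof -
    have "(s, y) \<notin> supp f" using R(2)[of "(s, y)"] norm_fst_le[of s y] norm_snd_le[of y s] that by auto
    then show "f (s, y) = 0" "pd e f (s, y) = 0" by (simp_all add: supp_zero pd_supp_zero)
  qed
  have int: "integrable lborel (pd e f)" for e
    by (rule integrable_compact_support[OF smooth_continuous[OF smooth_pd[OF sm]] K]) (simp add: pd_supp_zero)
  have c: "continuous_on UNIV (%t. pd e f (t, y))" "continuous_on UNIV (%t. pd e f (s, t))" for e s y
    using continuous_slice[OF smooth_continuous[OF smooth_pd[OF sm]]] by auto
  have "(LINT s|lborel. pd e1 f (s, y)) = 0" for y
    by (rule FTC_line_zero[OF has_derivative_slice1[OF sm] c(1), of R]) (use fz R in auto)
  then show "(LINT x|lborel. pd e1 f x) = 0"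
    using lborel_pair.integral_snd[of "%s y. pd e1 f (s, y)"] int[of e1] by (simp add: lborel_prod)
  have "(LINT y|lborel. pd e2 f (s, y)) = 0" for s
    by (rule FTC_line_zero[OF has_derivative_slice2[OF sm] c(2), of R]) (use fz R in auto)
  then show "(LINT x|lborel. pd e2 f x) = 0"
    using lborel_pair.integral_fst'[of "pd e2 f"] int[of e2] by (simp add: lborel_prod)
qed

lemma RS_integral_supp:
  fixes F :: "R2 => real"
  assumes "U \<in> sets borel" "!!x. x \<notin> U ==> F x = 0"
  shows "(LINT x|RS U. F x) = (LINT x|lborel. F x)"
proof -
  have "(%x. indicator U x *\<^sub>R F x) = F" using assms(2) by (auto simp: indicator_def fun_eq_iff)
  then show ?thesis using assms(1) by (simp add: integral_restrict_space)
qed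

text \<open>The product f g has compact support, so by Fubini and the fundamental theorem on lines
  its derivative integrates to zero.\<close>

lemma integration_by_parts:
  assumes U: "U \<in> sets borel" and f: "smooth f" and g: "testfn U g" and e: "e = e1 \<or> e = e2"
  shows "(LINT x|RS U. f x * pd e g x) = - (LINT x|RS U. pd e f x * g x)"
proof -
  have g': "Cc g" "supp g \<subseteq> U" "smooth g" "compact (supp g)" using g by (auto simp: testfn_def Cc_def)
  have z: "x \<notin> supp g ==> f x * pd e g x = 0" "x \<notin> supp g ==> pd e f x * g x = 0" for x
    by (simp_all add: supp_zero pd_supp_zero)
  have int: "integrable lborel (%x. f x * pd e g x)" "integrable lborel (%x. pd e f x * g x)"
    by (rule integrable_compact_support[OF smooth_continuous[OF smooth_mult[OF f smooth_pd[OF g'(3)]]] g'(4)], erule z(1))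
       (rule integrable_compact_support[OF smooth_continuous[OF smooth_mult[OF smooth_pd[OF f] g'(3)]] g'(4)], erule z(2))
  have "(LINT x|lborel. pd e (%x. f x * g x) x) = 0"
    using integral_pd_zero[OF Cc_mult(1)[OF g'(1) f]] e by auto
  then have "(LINT x|lborel. f x * pd e g x) + (LINT x|lborel. pd e f x * g x) = 0"
    using int by (simp add: pd_mult[OF f g'(3)])
  moreover have "(LINT x|RS U. f x * pd e g x) = (LINT x|lborel. f x * pd e g x)"
    "(LINT x|RS U. pd e f x * g x) = (LINT x|lborel. pd e f x * g x)"
    by (rule RS_integral_supp[OF U]; use z g'(2) in blast)+
  ultimately show ?thesis by simp
qed

section \<open>Weak derivatives, H^1 and the closure of test functions\<close>

lemma wdrel_RS:
  "U \<in> sets borel ==> wdrel U u e g \<longleftrightarrow> sqi (RS U) g \<and>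
     (\<forall>\<phi>. testfn U \<phi> --> (LINT x|RS U. u x * pd e \<phi> x) = - (LINT x|RS U. g x * \<phi> x))"
  by (simp add: wdrel_def RS_L2 RS_intg)

lemma sqi_testfn:
  assumes "U \<in> sets borel" "bounded U" "testfn V \<phi>" shows "sqi (RS U) \<phi>" "sqi (RS U) (pd e \<phi>)"
  by (rule sqi_continuous[OF assms(1,2) smooth_continuous[OF testfn_smooth[OF assms(3)]]])
     (rule sqi_continuous[OF assms(1,2) smooth_continuous[OF smooth_pd[OF testfn_smooth[OF assms(3)]]]])

lemma wdrel_unique:
  assumes U: "open U" "bounded U" and g: "wdrel U u e g" and h: "wdrel U u e h"
  shows "AE x in RS U. g x = h x"
proof -
  have Ub: "U \<in> sets borel" using U by simp
  have gs: "sqi (RS U) g" "sqi (RS U) h" using g h by (auto simp: wdrel_RS[OF Ub])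
  have "AE x in RS U. g x - h x = 0"
  proof (rule fundamental_lemma[OF U(1) sqi_diff[OF gs]])
    fix \<phi> assume t: "testfn U \<phi>"
    note s = sqi_testfn[OF Ub U(2) t]
    have "(LINT x|RS U. (g x - h x) * \<phi> x) = (LINT x|RS U. g x * \<phi> x) - (LINT x|RS U. h x * \<phi> x)"
      unfolding left_diff_distrib by (rule Bochner_Integration.integral_diff) (intro sqi_mult gs s)+
    also have "\<dots> = 0" using g h t unfolding wdrel_RS[OF Ub] by (metis neg_equal_iff_equal diff_self)
    finally show "(LINT x|RS U. (g x - h x) * \<phi> x) = 0" .
  qed
  then show ?thesis by simp
qed

text \<open>Stated as an equality of relations: choices made from equal relations are literally
  equal, so functions agreeing on U share their chosen derivatives.\<close>

lemma wdrel_cong: assumes "!!x. x \<in> U ==> u x = w x" shows "wdrel U u = wdrel U w"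
proof (intro ext)
  fix e g
  have "intg U (%x. u x * h x) = intg U (%x. w x * h x)" for h
    unfolding intg_def set_lebesgue_integral_def
    by (intro Bochner_Integration.integral_cong refl) (use assms in \<open>auto simp: indicator_def\<close>)
  then show "wdrel U u e g = wdrel U w e g" by (simp add: wdrel_def)
qed

lemma wd_cong: "(!!x. x \<in> U ==> u x = w x) ==> wd U u = wd U w"
  unfolding wd_def using wdrel_cong[of U u w] by presburger

lemma wd_wdrel: "\<exists>g. wdrel U u e g ==> wdrel U u e (wd U u e)"
  unfolding wd_def by (erule someI_ex)

lemma wd_AE: "open U ==> bounded U ==> wdrel U u e g ==> AE x in RS U. wd U u e x = g x"
  using wdrel_unique wd_wdrel by blast

lemma H1_sqi_JW:
  assumes "U \<in> sets borel" "H1 U u" shows "sqi (RS U) (JW U u)" "sqi (RS U) u" "wdrel U u e1 (wd U u e1)" "wdrel U u e2 (wd U u e2)"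
proof -
  show w: "wdrel U u e1 (wd U u e1)" "wdrel U u e2 (wd U u e2)" "sqi (RS U) u"
    using assms wd_wdrel by (auto simp: H1_def RS_L2)
  then have s: "sqi (RS U) (wd U u e1)" "sqi (RS U) (wd U u e2)" using assms(1) by (auto simp: wdrel_RS)
  have "(norm (JW U u x))\<^sup>2 = (u x)\<^sup>2 + (wd U u e1 x)\<^sup>2 + (wd U u e2 x)\<^sup>2" for x
    by (simp add: JW_def norm_Pair)
  then show "sqi (RS U) (JW U u)"
    using w(3) s unfolding sqi_def JW_def by (auto intro!: borel_measurable_Pair)
qed

lemma JW_AE:
  assumes U: "open U" "bounded U" and "wdrel U u e1 g1" "wdrel U u e2 g2"
  shows "AE x in RS U. JW U u x = (u x, g1 x, g2 x)"
  using wd_AE[OF U assms(3)] wd_AE[OF U assms(4)] by eventually_elim (simp add: JW_def)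

lemma H1ip_JW:
  assumes "U \<in> sets borel"
  shows "H1ip U u w = (LINT x|RS U. JW U u x \<bullet> JW U w x)"
  unfolding H1ip_def RS_intg[OF assms] JW_def by (simp add: algebra_simps)

lemma H1sq_JW: "U \<in> sets borel ==> H1sq U u = (l2n (RS U) (JW U u))\<^sup>2"
  unfolding H1sq_def by (simp add: H1ip_JW l2n_power2 power2_norm_eq_inner)

lemma wdrel_comb:
  assumes U: "open U" "bounded U" and s: "sqi (RS U) u" "sqi (RS U) w" and "wdrel U u e g" "wdrel U w e h"
  shows "wdrel U (%x. u x + c * w x) e (%x. g x + c * h x)"
proof -
  have Ub: "U \<in> sets borel" using U by simp
  have gs: "sqi (RS U) g" "sqi (RS U) h" using assms by (auto simp: wdrel_RS[OF Ub])
  have "(LINT x|RS U. (u x + c * w x) * pd e \<phi> x) = - (LINT x|RS U. (g x + c * h x) * \<phi> x)" if t: "testfn U \<phi>" for \<phi>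
  proof -
    note st = sqi_testfn(1)[OF Ub U(2) t] sqi_testfn(2)[OF Ub U(2) t, of e]
    have "(LINT x|RS U. (u x + c * w x) * pd e \<phi> x) = (LINT x|RS U. u x * pd e \<phi> x + c * (w x * pd e \<phi> x))"
      by (simp add: algebra_simps)
    also have "\<dots> = (LINT x|RS U. u x * pd e \<phi> x) + c * (LINT x|RS U. w x * pd e \<phi> x)"
      using sqi_mult[OF s(1) st(2)] sqi_mult[OF s(2) st(2)] by simp
    also have "\<dots> = - ((LINT x|RS U. g x * \<phi> x) + c * (LINT x|RS U. h x * \<phi> x))"
      using assms(5,6) t unfolding wdrel_RS[OF Ub] by simp
    also have "\<dots> = - (LINT x|RS U. g x * \<phi> x + c * (h x * \<phi> x))"
      using sqi_mult[OF gs(1) st(1)] sqi_mult[OF gs(2) st(1)] by simp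
    finally show ?thesis by (simp add: algebra_simps)
  qed
  then show ?thesis using gs by (simp add: wdrel_RS[OF Ub] sqi_add sqi_cmult)
qed

lemma H1_comb:
  assumes U: "open U" "bounded U" and "H1 U u" "H1 U w"
  shows "H1 U (%x. u x + c * w x)" "AE x in RS U. JW U (%x. u x + c * w x) x = JW U u x + c *\<^sub>R JW U w x"
proof -
  have Ub: "U \<in> sets borel" using U by simp
  note a = H1_sqi_JW[OF Ub assms(3)] and b = H1_sqi_JW[OF Ub assms(4)]
  note d = wdrel_comb[OF U a(2) b(2) a(3) b(3)] wdrel_comb[OF U a(2) b(2) a(4) b(4)]
  show "H1 U (%x. u x + c * w x)"
    using d a b by (auto simp: H1_def RS_L2[OF Ub] sqi_add sqi_cmult)
  show "AE x in RS U. JW U (%x. u x + c * w x) x = JW U u x + c *\<^sub>R JW U w x"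
    using JW_AE[OF U d] by eventually_elim (simp add: JW_def)
qed

lemma smooth_wdrel:
  assumes U: "open U" "bounded U" and "smooth f" and e: "e = e1 \<or> e = e2"
  shows "wdrel U f e (pd e f)"
  using integration_by_parts[OF _ assms(3) _ e, of U] U sqi_continuous[of U "pd e f"] smooth_continuous[OF smooth_pd[OF assms(3)]]
  by (simp add: wdrel_RS)

lemma smooth_H1:
  assumes U: "open U" "bounded U" and "smooth f"
  shows "H1 U f" "AE x in RS U. JW U f x = J f x"
proof -
  note d = smooth_wdrel[OF assms, of e1] smooth_wdrel[OF assms, of e2]
  show "H1 U f" using d U sqi_continuous[of U f] smooth_continuous[OF assms(3)] by (auto simp: H1_def RS_L2)
  show "AE x in RS U. JW U f x = J f x" using JW_AE[OF U, of f] d by (simp add: J_def)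
qed

text \<open>Translates the \<open>H1sq\<close> limits in the definitions of \<open>H10\<close>,
  \<open>W\<close> and \<open>trace_rel\<close> into L2 limits of jets.\<close>

lemma H1sq_diff:
  assumes U: "open U" "bounded U" and "smooth f" "H1 U u"
  shows "H1sq U (%x. f x - u x) = (l2n (RS U) (%x. J f x - JW U u x))\<^sup>2"
proof -
  have Ub: "U \<in> sets borel" using U by simp
  note h = H1_comb[OF U smooth_H1(1)[OF assms(1-3)] assms(4), of "-1"]
  have "AE x in RS U. JW U (%x. f x - u x) x = J f x - JW U u x"
    using h(2) smooth_H1(2)[OF assms(1-3)] by eventually_elim simp
  moreover have "sqi (RS U) (JW U (%x. f x - u x))" using H1_sqi_JW(1)[OF Ub h(1)] by simp
  moreover have "sqi (RS U) (%x. J f x - JW U u x)"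
    by (intro sqi_diff sqi_J Ub assms H1_sqi_JW(1))
  ultimately have "l2n (RS U) (JW U (%x. f x - u x)) = l2n (RS U) (%x. J f x - JW U u x)"
    by (intro l2n_cong_AE) (auto simp: sqi_def)
  then show ?thesis by (simp add: H1sq_JW[OF Ub])
qed

text \<open>H^1_0 as the L2 closure of the jets of test functions. Its members carry their
  derivatives with them, so no choice of weak derivatives is involved.\<close>

definition HH :: "R2 set => (R2 => real \<times> real \<times> real) => bool" where
  "HH O' V \<longleftrightarrow> sqi (RS O') V \<and> (\<forall>\<epsilon>>0. \<exists>\<phi>. testfn O' \<phi> \<and> l2n (RS O') (%x. J \<phi> x - V x) < \<epsilon>)"

lemma HH_seq:
  assumes "HH O' V"
  obtains \<phi> where "!!k::nat. testfn O' (\<phi> k)" "l2conv (RS O') (%k. J (\<phi> k)) V"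
proof -
  have "\<exists>\<phi>. testfn O' \<phi> \<and> l2n (RS O') (%x. J \<phi> x - V x) < 1 / real (Suc k)" for k :: nat
    using assms unfolding HH_def by simp
  then obtain \<phi> where p: "!!k. testfn O' (\<phi> k)" "!!k. l2n (RS O') (%x. J (\<phi> k) x - V x) < 1 / real (Suc k)" by metis
  have "l2conv (RS O') (%k. J (\<phi> k)) V"
    by (rule Lim_null_comparison[OF _ LIMSEQ_inverse_real_of_nat])
       (use p(2) in \<open>auto simp: inverse_eq_divide intro!: always_eventually less_imp_le\<close>)
  with p(1) show ?thesis by (rule that)
qed

lemma HH_I:
  assumes "sqi (RS O') V" "!!k::nat. testfn O' (\<phi> k)" "l2conv (RS O') (%k. J (\<phi> k)) V"
  shows "HH O' V"
  unfolding HH_def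
proof (intro conjI allI impI assms(1))
  fix \<epsilon> :: real assume "0 < \<epsilon>"
  then have "eventually (%k. l2n (RS O') (%x. J (\<phi> k) x - V x) < \<epsilon>) sequentially"
    using order_tendstoD(2)[OF assms(3)] by blast
  then show "\<exists>\<phi>. testfn O' \<phi> \<and> l2n (RS O') (%x. J \<phi> x - V x) < \<epsilon>"
    using assms(2) by (auto simp: eventually_sequentially)
qed

lemma sqi_subset:
  assumes "U \<in> sets borel" "O' \<in> sets borel" "U \<subseteq> O'" "sqi (RS O') f"
  shows "sqi (RS U) f" "l2n (RS U) f <= l2n (RS O') f"
proof -
  have e: "indicator U x *\<^sub>R f x = indicator U x *\<^sub>R (indicator O' x *\<^sub>R f x)" for x
    using assms(3) by (auto simp: indicator_def)
  have m: "(%x. indicator O' x *\<^sub>R f x) \<in> borel_measurable lborel"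
    and i: "integrable lborel (%x. indicator O' x *\<^sub>R (norm (f x))\<^sup>2)"
    using assms(2,4) by (simp_all add: sqi_def borel_measurable_restrict_space_iff integrable_restrict_space)
  have m': "(%x. indicator U x *\<^sub>R f x) \<in> borel_measurable lborel"
    unfolding e by (rule borel_measurable_scaleR[OF borel_measurable_indicator m]) (use assms in simp)
  have e2: "indicator U x *\<^sub>R (norm (f x))\<^sup>2 = indicator U x *\<^sub>R (indicator O' x *\<^sub>R (norm (f x))\<^sup>2)" for x
    using assms(3) by (auto simp: indicator_def)
  have i': "integrable lborel (%x. indicator U x *\<^sub>R (norm (f x))\<^sup>2)"
    unfolding e2 by (rule integrable_mult_indicator[OF _ i]) (use assms in simp)
  show "sqi (RS U) f" using m' i' assms(1)
    by (simp add: sqi_def borel_measurable_restrict_space_iff integrable_restrict_space)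
  have "(LINT x|lborel. indicator U x *\<^sub>R (norm (f x))\<^sup>2) <= (LINT x|lborel. indicator O' x *\<^sub>R (norm (f x))\<^sup>2)"
    by (rule integral_mono[OF i' i]) (use assms(3) in \<open>auto simp: indicator_def\<close>)
  then show "l2n (RS U) f <= l2n (RS O') f"
    using assms(1,2) by (simp add: l2n_def integral_restrict_space)
qed

lemma tendsto_integral_l2:
  fixes f :: "nat => 'a => 'b::euclidean_space"
  assumes "!!k. sqi M (f k)" "sqi M g" "l2conv M f g" "sqi M h"
  shows "(%k. LINT x|M. f k x \<bullet> h x) \<longlonglongrightarrow> (LINT x|M. g x \<bullet> h x)"
  using l2_weak_strong[of M "%n. h" "l2n M h" g "(LINT x|M. h x \<bullet> g x)" f] assms by (simp add: inner_commute)

lemma l2n_compose_le: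
  assumes "sqi M f" "h \<in> borel_measurable borel" "!!y. norm (h y) <= norm y"
  shows "sqi M (%x. h (f x))" "l2n M (%x. h (f x)) <= l2n M f"
proof -
  have m: "(%x. h (f x)) \<in> borel_measurable M"
    using measurable_compose[OF sqi_measurable[OF assms(1)] assms(2)] .
  show "sqi M (%x. h (f x))" by (rule sqi_bound[OF m assms(1), of 1]) (use assms(3) in auto)
  show "l2n M (%x. h (f x)) <= l2n M f" using l2n_le[OF m assms(1), of 1] assms(3) by simp
qed

definition pr0 :: "real \<times> real \<times> real => real" where "pr0 y = fst y"
definition pr1 :: "real \<times> real \<times> real => real" where "pr1 y = fst (snd y)"
definition pr2 :: "real \<times> real \<times> real => real" where "pr2 y = snd (snd y)"

lemma pr_simps[simp]: "pr0 (a, b, c) = a" "pr1 (a, b, c) = b" "pr2 (a, b, c) = c"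
  by (simp_all add: pr0_def pr1_def pr2_def)

lemma pr_J: "pr0 (J f x) = f x" "pr1 (J f x) = pd e1 f x" "pr2 (J f x) = pd e2 f x"
  by (simp_all add: J_def)

lemma pr_bl: "bounded_linear pr0" "bounded_linear pr1" "bounded_linear pr2"
  unfolding pr0_def pr1_def pr2_def
  by (auto intro!: bounded_linear_compose[OF bounded_linear_fst] bounded_linear_compose[OF bounded_linear_snd]
      bounded_linear_fst bounded_linear_snd)

lemma pr_lin: "pr0 (x - y) = pr0 x - pr0 y" "pr1 (x - y) = pr1 x - pr1 y" "pr2 (x - y) = pr2 x - pr2 y"
  "pr0 (x + y) = pr0 x + pr0 y" "pr1 (x + y) = pr1 x + pr1 y" "pr2 (x + y) = pr2 x + pr2 y"
  "pr0 (c *\<^sub>R x) = c * pr0 x" "pr1 (c *\<^sub>R x) = c * pr1 x" "pr2 (c *\<^sub>R x) = c * pr2 x"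
  by (simp_all add: pr0_def pr1_def pr2_def)

lemma pr_norm: "\<bar>pr0 y\<bar> <= norm y" "\<bar>pr1 y\<bar> <= norm y" "\<bar>pr2 y\<bar> <= norm y"
proof -
  obtain a b c where y: "y = (a, b, c)" by (metis prod.exhaust)
  have "norm (b, c) <= norm y" "\<bar>a\<bar> <= norm y" "\<bar>b\<bar> <= norm (b, c)" "\<bar>c\<bar> <= norm (b, c)"
    using norm_fst_le[of a "(b, c)"] norm_snd_le[of "(b, c)" a] norm_fst_le[of b c] norm_snd_le[of c b] by (simp_all add: y)
  then show "\<bar>pr0 y\<bar> <= norm y" "\<bar>pr1 y\<bar> <= norm y" "\<bar>pr2 y\<bar> <= norm y" by (simp_all add: y)
qed

lemma pr_measurable[measurable]: "pr0 \<in> borel_measurable borel" "pr1 \<in> borel_measurable borel" "pr2 \<in> borel_measurable borel"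
  using pr_bl by (auto intro!: borel_measurable_continuous_onI linear_continuous_on)

lemma sqi_pr:
  assumes "sqi M f" shows "sqi M (%x. pr0 (f x))" "sqi M (%x. pr1 (f x))" "sqi M (%x. pr2 (f x))"
    "l2n M (%x. pr0 (f x)) <= l2n M f" "l2n M (%x. pr1 (f x)) <= l2n M f" "l2n M (%x. pr2 (f x)) <= l2n M f"
  using l2n_compose_le[OF assms, of pr0] l2n_compose_le[OF assms, of pr1] l2n_compose_le[OF assms, of pr2] pr_norm by auto

text \<open>Against a fixed test function both sides of the integration by parts formula are
  continuous in the L2 norm of the jet. Restricting to an open subset costs nothing, since test
  functions of U see only U.\<close>

lemma HH_wdrel:
  assumes V: "HH O' V" and O: "O' \<in> sets borel" "bounded O'" and U: "open U" "U \<subseteq> O'"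
  shows "wdrel U (%x. pr0 (V x)) e1 (%x. pr1 (V x))" "wdrel U (%x. pr0 (V x)) e2 (%x. pr2 (V x))"
proof -
  have Ub: "U \<in> sets borel" "bounded U" using U O by (auto intro: bounded_subset)
  obtain \<phi> where p: "!!k::nat. testfn O' (\<phi> k)" "l2conv (RS O') (%k. J (\<phi> k)) V"
    using HH_seq[OF V] by blast
  have VS: "sqi (RS O') V" using V by (simp add: HH_def)
  have d: "sqi (RS O') (%x. J (\<phi> k) x - V x)" for k
    by (intro sqi_diff VS sqi_J O testfn_smooth[OF p(1)])
  have VU: "sqi (RS U) V" using sqi_subset(1)[OF Ub(1) O(1) U(2) VS] .
  have JU: "sqi (RS U) (J (\<phi> k))" for k by (intro sqi_J Ub testfn_smooth[OF p(1)])
  have lim: "l2conv (RS U) (%k. J (\<phi> k)) V"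
    by (rule Lim_null_comparison[OF _ p(2)]) (use sqi_subset(2)[OF Ub(1) O(1) U(2) d] in auto)
  have lp: "l2conv (RS U) (%k x. q (J (\<phi> k) x)) (%x. q (V x))" "!!k. sqi (RS U) (%x. q (J (\<phi> k) x))" "sqi (RS U) (%x. q (V x))"
    if "q = pr0 \<or> q = pr1 \<or> q = pr2" for q
  proof -
    have "l2n (RS U) (%x. q (J (\<phi> k) x) - q (V x)) <= l2n (RS U) (%x. J (\<phi> k) x - V x)" for k
      using that sqi_pr(4-6)[OF sqi_diff[OF JU[of k] VU]] by (auto simp: pr_lin)
    then show "l2conv (RS U) (%k x. q (J (\<phi> k) x)) (%x. q (V x))"
      by (intro Lim_null_comparison[OF _ lim]) auto
    show "!!k. sqi (RS U) (%x. q (J (\<phi> k) x))" "sqi (RS U) (%x. q (V x))"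
      using that sqi_pr(1-3)[OF JU] sqi_pr(1-3)[OF VU] by auto
  qed
  have main: "wdrel U (%x. pr0 (V x)) e (%x. q (V x))"
    if q: "q = pr1 \<and> e = e1 \<or> q = pr2 \<and> e = e2" for q e
    unfolding wdrel_RS[OF Ub(1)]
  proof (intro conjI allI impI)
    have q': "q = pr0 \<or> q = pr1 \<or> q = pr2" using q by auto
    show "sqi (RS U) (%x. q (V x))" using lp(3)[OF q'] .
    fix \<psi> assume t: "testfn U \<psi>"
    note st = sqi_testfn(1)[OF Ub t] sqi_testfn(2)[OF Ub t, of e]
    have A: "(%k. LINT x|RS U. pr0 (J (\<phi> k) x) \<bullet> pd e \<psi> x) \<longlonglongrightarrow> (LINT x|RS U. pr0 (V x) \<bullet> pd e \<psi> x)"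
      by (rule tendsto_integral_l2[OF lp(2) lp(3) lp(1) st(2)]) auto
    have B: "(%k. LINT x|RS U. q (J (\<phi> k) x) \<bullet> \<psi> x) \<longlonglongrightarrow> (LINT x|RS U. q (V x) \<bullet> \<psi> x)"
      by (rule tendsto_integral_l2[OF lp(2)[OF q'] lp(3)[OF q'] lp(1)[OF q'] st(1)])
    have C: "(LINT x|RS U. pr0 (J (\<phi> k) x) \<bullet> pd e \<psi> x) = - (LINT x|RS U. q (J (\<phi> k) x) \<bullet> \<psi> x)" for k
      using integration_by_parts[OF Ub(1) testfn_smooth[OF p(1)] t, of e k] q by (auto simp: pr_J)
    have "(LINT x|RS U. pr0 (V x) \<bullet> pd e \<psi> x) = - (LINT x|RS U. q (V x) \<bullet> \<psi> x)"
      by (rule LIMSEQ_unique[OF A[unfolded C] tendsto_minus[OF B]])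
    then show "(LINT x|RS U. pr0 (V x) * pd e \<psi> x) = - (LINT x|RS U. q (V x) * \<psi> x)" by simp
  qed
  show "wdrel U (%x. pr0 (V x)) e1 (%x. pr1 (V x))" "wdrel U (%x. pr0 (V x)) e2 (%x. pr2 (V x))"
    using main by auto
qed

lemma HH_JW:
  assumes V: "HH O' V" and O: "O' \<in> sets borel" "bounded O'" and U: "open U" "U \<subseteq> O'"
    and u: "!!x. x \<in> U ==> u x = pr0 (V x)"
  shows "H1 U u" "AE x in RS U. JW U u x = V x"
proof -
  have Ub: "U \<in> sets borel" "bounded U" using U O by (auto intro: bounded_subset)
  have c: "wdrel U u = wdrel U (%x. pr0 (V x))" by (rule wdrel_cong) (rule u)
  note d = HH_wdrel[OF V O U, folded c]
  have s: "sqi (RS U) (%x. pr0 (V x))"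
    using sqi_pr(1) sqi_subset(1)[OF Ub(1) O(1) U(2), of V] V by (auto simp: HH_def)
  have "L2 U u \<longleftrightarrow> L2 U (%x. pr0 (V x))"
  proof -
    have "(%x. indicator U x *\<^sub>R u x) = (%x. indicator U x *\<^sub>R pr0 (V x))"
      "(%x. indicator U x *\<^sub>R (u x)\<^sup>2) = (%x. indicator U x *\<^sub>R (pr0 (V x))\<^sup>2)"
      using u by (auto simp: indicator_def fun_eq_iff)
    then show ?thesis unfolding L2_def set_borel_measurable_def set_integrable_def by simp
  qed
  then show "H1 U u" using d s by (auto simp: H1_def RS_L2[OF Ub(1)])
  have "AE x in RS U. x \<in> U" using Ub(1) by (simp add: AE_restrict_space_iff)
  with JW_AE[OF U(1) Ub(2) d] show "AE x in RS U. JW U u x = V x"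
  proof eventually_elim
    case (elim x)
    then show ?case using u[of x] by (simp add: prod_eq_iff pr0_def pr1_def pr2_def)
  qed
qed

lemma sqrt_tendsto_0: "(%k. (a k)\<^sup>2) \<longlonglongrightarrow> 0 ==> (!!k. 0 <= a k) ==> a \<longlonglongrightarrow> (0::real)"
  using tendsto_real_sqrt[of "%k. (a k)\<^sup>2" 0 sequentially] by simp

lemma H10_HH:
  assumes "open O'" "bounded O'" "H10 O' u" shows "HH O' (JW O' u)" "H1 O' u"
proof -
  show h: "H1 O' u" using assms(3) by (simp add: H10_def)
  obtain \<phi> where p: "!!k. testfn O' (\<phi> k)" "(%k. H1sq O' (%x. \<phi> k x - u x)) \<longlonglongrightarrow> 0"
    using assms(3) by (auto simp: H10_def)
  show "HH O' (JW O' u)"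
  proof (rule HH_I[OF _ p(1)])
    show "sqi (RS O') (JW O' u)" using H1_sqi_JW(1)[OF _ h] assms by simp
    show "l2conv (RS O') (%k. J (\<phi> k)) (JW O' u)"
      by (rule sqrt_tendsto_0) (use p(2) H1sq_diff[OF assms(1,2) testfn_smooth[OF p(1)] h] in auto)
  qed
qed

text \<open>The converse passage from jets to functions. The value component is cut off outside
  \<open>O'\<close> because \<open>H10\<close> prescribes zero there.\<close>

lemma HH_H10:
  assumes "open O'" "bounded O'" "HH O' V" and u: "u = (%x. if x \<in> O' then pr0 (V x) else 0)"
  shows "H10 O' u" "AE x in RS O'. JW O' u x = V x"
proof -
  have Ob: "O' \<in> sets borel" using assms(1) by simp
  have ux: "x \<in> O' ==> u x = pr0 (V x)" for x by (simp add: u)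
  have h: "H1 O' u" "AE x in RS O'. JW O' u x = V x"
    by (rule HH_JW[OF assms(3) Ob assms(2,1) order_refl], erule ux)+
  show "AE x in RS O'. JW O' u x = V x" by (rule h(2))
  obtain \<phi> where p: "!!k::nat. testfn O' (\<phi> k)" "l2conv (RS O') (%k. J (\<phi> k)) V"
    using HH_seq[OF assms(3)] by blast
  have "l2n (RS O') (%x. J (\<phi> k) x - V x) = l2n (RS O') (%x. J (\<phi> k) x - JW O' u x)" for k
  proof (rule l2n_cong_AE)
    have "sqi (RS O') (J (\<phi> k))" by (rule sqi_J[OF Ob assms(2) testfn_smooth[OF p(1)]])
    then show "(%x. J (\<phi> k) x - V x) \<in> borel_measurable (RS O')" "(%x. J (\<phi> k) x - JW O' u x) \<in> borel_measurable (RS O')"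
      using assms(3) H1_sqi_JW(1)[OF Ob h(1)] by (auto simp: HH_def sqi_def)
    show "AE x in RS O'. J (\<phi> k) x - V x = J (\<phi> k) x - JW O' u x" using h(2) by eventually_elim simp
  qed
  with p(2) have "(%k. H1sq O' (%x. \<phi> k x - u x)) \<longlonglongrightarrow> 0"
    using H1sq_diff[OF assms(1,2) testfn_smooth[OF p(1)] h(1)] tendsto_power[of _ 0 sequentially 2] by (auto simp: power2_eq_square intro!: tendsto_mult_zero)
  then show "H10 O' u" using h(1) p(1) by (auto simp: H10_def u)
qed

section \<open>Traces on the slip boundary\<close>

abbreviation M1 :: "real measure" where "M1 \<equiv> restrict_space lborel {0<..<1}"

lemma M1_finite: "finite_measure M1"
proof
  show "emeasure M1 (space M1) \<noteq> \<infinity>" by (simp add: emeasure_restrict_space space_restrict_space)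
qed

lemma M1_L2S: "L2S f \<longleftrightarrow> sqi M1 f"
  unfolding L2S_def sqi_def set_borel_measurable_def set_integrable_def
  by (simp add: borel_measurable_restrict_space_iff integrable_restrict_space)

lemma M1_integral: "set_lebesgue_integral lborel {0<..<1} f = (LINT s|M1. f s)" for f :: "real => real"
  unfolding set_lebesgue_integral_def by (simp add: integral_restrict_space)

lemma M1_AE: "(AE s in M1. P s) \<longleftrightarrow> (AE s in lborel. s \<in> {0<..<1} --> P s)"
  by (simp add: AE_restrict_space_iff)

lemma M1_AE_I: "(!!s. 0 < s ==> s < 1 ==> P s) ==> AE s in M1. P s"
  by (simp add: M1_AE)

lemma M1_bounded_sqi:
  assumes "f \<in> borel_measurable M1" "AE s in M1. norm (f s) <= B" shows "sqi M1 f"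
proof -
  interpret finite_measure M1 by (rule M1_finite)
  have "sqi M1 (%s. 1::real)" by (simp add: sqi_def)
  then show ?thesis by (rule sqi_bound[OF assms(1), of _ B]) (use assms(2) in simp)
qed

lemma M1_continuous_measurable:
  fixes f :: "real => 'b::real_normed_vector"
  assumes "continuous_on {0..1} f" shows "f \<in> borel_measurable M1"
proof -
  have "f \<in> borel_measurable (restrict_space borel {0<..<1})"
    by (rule borel_measurable_continuous_on_restrict) (rule continuous_on_subset[OF assms], auto)
  then show ?thesis by (simp add: measurable_def space_restrict_space sets_restrict_space)
qed

lemma M1_continuous_sqi:
  fixes f :: "real => 'b::euclidean_space"
  assumes "continuous_on {0..1} f" shows "sqi M1 f"
proof -
  have "compact (f ` {0..1})" by (intro compact_continuous_image assms) simp
  then obtain B where "\<forall>y\<in>f ` {0..1}. norm y <= B" using compact_imp_bounded bounded_iff by blast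
  then have "AE s in M1. norm (f s) <= B" by (intro M1_AE_I) auto
  then show ?thesis by (rule M1_bounded_sqi[OF M1_continuous_measurable[OF assms]])
qed

section \<open>Estimates on segments and integration over vertical slices\<close>

lemma segment_Cauchy_Schwarz:
  fixes h h' :: "real => real"
  assumes d: "!!t. (h has_real_derivative h' t) (at t)" and c: "continuous_on UNIV h'" and ab: "a <= b"
  shows "(h b - h a)\<^sup>2 <= (b - a) * (LINT t|lborel. indicator {a<..<b} t * (h' t)\<^sup>2)"
proof -
  let ?i = "indicator {a<..<b} :: real => real"
  have [measurable]: "h' \<in> borel_measurable borel" using c by (rule borel_measurable_continuous_onI)
  have F: "(LINT t|lborel. h' t * indicator {a..b} t) = h b - h a"
    by (rule integral_FTC_Icc_real) (use assms in \<open>auto simp: continuous_on_eq_continuous_at\<close>)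
  have ae: "AE t in lborel. t \<noteq> a \<and> t \<noteq> b" using AE_lborel_singleton[of a] AE_lborel_singleton[of b] by eventually_elim auto
  have "(LINT t|lborel. h' t * indicator {a..b} t) = (LINT t|lborel. ?i t * (?i t * h' t))"
  proof (rule integral_cong_AE)
    show "AE t in lborel. h' t * indicator {a..b} t = ?i t * (?i t * h' t)"
      using ae by eventually_elim (auto simp: indicator_def)
  qed measurable
  then have e: "(LINT t|lborel. ?i t * (?i t * h' t)) = h b - h a" using F by simp
  have "(%t. (norm (?i t))\<^sup>2) = ?i" by (auto simp: indicator_def)
  then have s1: "sqi lborel ?i" by (simp add: sqi_def integrable_indicator_iff emeasure_lborel_Ioo[OF ab])
  have i2: "integrable lborel (%t. indicator {a..b} t *\<^sub>R (h' t)\<^sup>2)"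
    by (rule borel_integrable_compact) (auto intro!: continuous_intros continuous_on_subset[OF c])
  have s2: "sqi lborel (%t. ?i t * h' t)"
    unfolding sqi_def
  proof
    show "integrable lborel (%t. (norm (?i t * h' t))\<^sup>2)"
      by (rule Bochner_Integration.integrable_bound[OF i2]) (auto simp: indicator_def)
  qed measurable
  have n1: "(l2n lborel ?i)\<^sup>2 = b - a"
  proof -
    have "(%t. (norm (?i t))\<^sup>2) = ?i" by (auto simp: indicator_def)
    then show ?thesis using ab by (simp add: l2n_power2)
  qed
  have n2: "(l2n lborel (%t. ?i t * h' t))\<^sup>2 = (LINT t|lborel. ?i t * (h' t)\<^sup>2)"
    unfolding l2n_power2 by (intro Bochner_Integration.integral_cong) (auto simp: indicator_def)
  have "(h b - h a)\<^sup>2 <= (l2n lborel ?i * l2n lborel (%t. ?i t * h' t))\<^sup>2"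
    using l2_Cauchy_Schwarz_real[OF s1 s2] unfolding e by (rule power2_le_iff_abs_le[THEN iffD2, rotated]) simp
  then show ?thesis by (simp only: power_mult_distrib n1 n2)
qed

text \<open>The form of Fubini behind the trace, Hardy, shift and Poincare estimates: a bound on
  every vertical slice over (0,1) integrates to a bound in the plane.\<close>

lemma slice_bound:
  fixes G :: "R2 => real"
  assumes G: "integrable lborel G" "!!x. 0 <= G x" and k: "integrable M1 k"
    and le: "!!s. 0 < s ==> s < 1 ==> k s <= (LINT y|lborel. G (s, y))"
  shows "(LINT s|M1. k s) <= (LINT x|lborel. G x)"
proof -
  have Gi: "integrable (lborel \<Otimes>\<^sub>M lborel) G" using G by (simp add: lborel_prod)
  have "(LINT s|M1. k s) = (LINT s|lborel. indicator {0<..<1} s *\<^sub>R k s)"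
    by (simp add: integral_restrict_space)
  also have "\<dots> <= (LINT s|lborel. (LINT y|lborel. G (s, y)))"
  proof (rule integral_mono)
    show "integrable lborel (%s. indicator {0<..<1} s *\<^sub>R k s)" using k by (simp add: integrable_restrict_space)
    show "integrable lborel (%s. LINT y|lborel. G (s, y))" by (rule lborel_pair.integrable_fst'[OF Gi])
    show "indicator {0<..<1} s *\<^sub>R k s <= (LINT y|lborel. G (s, y))" for s
      using le[of s] G(2) by (auto simp: indicator_def)
  qed
  also have "\<dots> = (LINT x|lborel. G x)" using lborel_pair.integral_fst'[OF Gi] by (simp add: lborel_prod)
  finally show ?thesis .
qed

lemma integrable_indicator_continuous:
  fixes F :: "R2 => real"
  assumes "U \<in> sets borel" "bounded U" "continuous_on UNIV F"
  shows "integrable lborel (%x. indicator U x * F x)"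
  using integrable_L1_of_sqi(1)[OF RS_finite[OF assms(1,2)] sqi_continuous[OF assms]] assms(1)
  by (simp add: integrable_restrict_space)

lemma integrable_interval_continuous:
  fixes F :: "real => real"
  assumes "continuous_on UNIV F"
  shows "integrable lborel (%y. indicator {a<..<b} y * F y)"
proof (rule Bochner_Integration.integrable_bound)
  show "integrable lborel (%y. indicator {a..b} y *\<^sub>R F y)"
    by (rule borel_integrable_compact) (auto intro: continuous_on_subset[OF assms])
  show "(%y. indicator {a<..<b} y * F y) \<in> borel_measurable lborel"
    using borel_measurable_continuous_onI[OF assms] by simp
qed (auto simp: indicator_def)

text \<open>Leibniz rule for the jets \<open>(v, \<partial>\<^sub>1v, \<partial>\<^sub>2v)\<close>.\<close>

definition mulT :: "real \<times> real \<times> real => real \<times> real \<times> real => real \<times> real \<times> real" where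
  "mulT m w = (pr0 m * pr0 w, pr0 m * pr1 w + pr1 m * pr0 w, pr0 m * pr2 w + pr2 m * pr0 w)"

lemma J_mult: "smooth M ==> smooth f ==> J (%x. M x * f x) x = mulT (J M x) (J f x)"
  by (simp add: J_def mulT_def pd_mult)

lemma mulT_alt: "mulT m w = pr0 m *\<^sub>R w + (0, pr1 m * pr0 w, pr2 m * pr0 w)"
  by (simp add: mulT_def prod_eq_iff pr0_def pr1_def pr2_def)

lemma mulT_norm: "norm (mulT m w) <= 3 * norm m * norm w"
proof -
  have "norm (mulT m w) <= \<bar>pr0 m\<bar> * norm w + (\<bar>pr1 m * pr0 w\<bar> + \<bar>pr2 m * pr0 w\<bar>)"
    unfolding mulT_alt
    using norm_triangle_ineq[of "pr0 m *\<^sub>R w" "(0, pr1 m * pr0 w, pr2 m * pr0 w)"]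
      norm_Pair_le[of 0 "(pr1 m * pr0 w, pr2 m * pr0 w)"] norm_Pair_le[of "pr1 m * pr0 w" "pr2 m * pr0 w"]
    by simp
  also have "\<dots> <= norm m * norm w + (norm m * norm w + norm m * norm w)"
    unfolding abs_mult by (intro add_mono mult_mono pr_norm) auto
  finally show ?thesis by simp
qed

lemma mulT_diff: "mulT m (w - w') = mulT m w - mulT m w'" "mulT (m - m') w = mulT m w - mulT m' w"
  by (simp_all add: mulT_def pr_lin algebra_simps)

lemma mulT_measurable:
  assumes "m \<in> borel_measurable M" "w \<in> borel_measurable M"
  shows "(%x. mulT (m x) (w x)) \<in> borel_measurable M"
proof -
  have [measurable]: "m \<in> borel_measurable M" "w \<in> borel_measurable M" by fact+
  show ?thesis unfolding mulT_def by (intro borel_measurable_Pair) measurable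
qed

section \<open>Traces on the graph of a continuous curve\<close>

locale holdall =
  fixes amin amax \<omega> :: real and O' :: "R2 set"
  assumes amax_\<omega>: "amax < \<omega>" and openO: "open O'" and bddO: "bounded O'"
begin

abbreviation "RO \<equiv> RS O'"
abbreviation "Om' \<equiv> Om \<omega>"
abbreviation "tr' \<equiv> tr \<omega>"
abbreviation "vnu' \<equiv> vnu \<omega>"
abbreviation "vtau' \<equiv> vtau \<omega>"

text \<open>Traces, slices and strips see only continuity, bounds and position of the curve;
  information on derivatives stays in \<open>Uad\<close>.\<close>

definition adm :: "(real => real) => bool" where
  "adm \<alpha> \<longleftrightarrow> continuous_on {0..1} \<alpha> \<and> (\<forall>x\<in>{0..1}. amin <= \<alpha> x \<and> \<alpha> x <= amax) \<and> Om' \<alpha> \<subseteq> O'"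

lemma O_borel[simp]: "O' \<in> sets borel"
  using openO by simp

lemma Om_open: assumes "adm \<alpha>" shows "open (Om' \<alpha>)"
proof -
  \<comment> \<open>Clamping the argument to [0,1] makes \<alpha> continuous on the whole line
    without changing the set, which is then cut out by strict inequalities between continuous
    functions.\<close>
  define c where "c x = max 0 (min 1 x)" for x :: real
  have "continuous_on UNIV (%x. \<alpha> (c x))"
    by (rule continuous_on_compose2[of "{0..1}" \<alpha>])
       (use assms in \<open>auto simp: adm_def c_def intro!: continuous_intros\<close>)
  then have cc: "continuous_on UNIV (%x::R2. \<alpha> (c (fst x)))"
    by (rule continuous_on_compose2[of UNIV _ UNIV fst]) (auto intro: continuous_intros)
  have "Om' \<alpha> = {x. 0 < fst x} \<inter> {x. fst x < 1} \<inter> {x. \<alpha> (c (fst x)) < snd x} \<inter> {x. snd x < \<omega>}"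
    by (auto simp: Om_def c_def max_def min_def)
  also have "open \<dots>" by (intro open_Int open_Collect_less cc continuous_intros)
  finally show ?thesis .
qed

lemma Om_borel: "adm \<alpha> ==> Om' \<alpha> \<in> sets borel"
  using Om_open by auto

lemma Om_bounded: "adm \<alpha> ==> bounded (Om' \<alpha>)"
  using bddO by (auto simp: adm_def intro: bounded_subset)

lemma Om_sub: "adm \<alpha> ==> Om' \<alpha> \<subseteq> O'"
  by (simp add: adm_def)

lemma trace_continuous:
  assumes "adm \<alpha>" "continuous_on UNIV F" shows "continuous_on {0..1} (%s. F (s, \<alpha> s))"
  by (rule continuous_on_compose2[OF assms(2)]) (use assms(1) in \<open>auto simp: adm_def intro!: continuous_intros\<close>)

lemma trace_sqi:
  fixes F :: "R2 => real"
  shows "adm \<alpha> ==> continuous_on UNIV F ==> sqi M1 (%s. F (s, \<alpha> s))"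
  by (intro M1_continuous_sqi trace_continuous)

text \<open>The trace differs from f at a point above the curve by an integral of the vertical
  derivative; averaging over heights below h gives the bound. The free parameter h matters: the full
  height gives boundedness of traces, a small h gives their compactness.\<close>

lemma trace_estimate:
  assumes a: "adm \<alpha>" and f: "smooth f" and h: "0 < h" "h <= \<omega> - amax"
  shows "h * (l2n M1 (%s. f (s, \<alpha> s)))\<^sup>2 <= 2 * (l2n (RS (Om' \<alpha>)) f)\<^sup>2 + 2 * h\<^sup>2 * (l2n (RS (Om' \<alpha>)) (pd e2 f))\<^sup>2"
proof -
  let ?U = "Om' \<alpha>"
  let ?F = "%x. 2 * (f x)\<^sup>2 + 2 * h\<^sup>2 * (pd e2 f x)\<^sup>2"
  have cf: "continuous_on UNIV f" and cd: "continuous_on UNIV (pd e2 f)"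
    using f by (auto intro: smooth_continuous smooth_pd)
  have cF: "continuous_on UNIV ?F" by (intro continuous_intros cf cd)
  have sl: "continuous_on UNIV (%y. f (s, y))" "continuous_on UNIV (%y. pd e2 f (s, y))" for s
    using continuous_slice(1)[OF cf] continuous_slice(1)[OF cd] by auto
  have "(LINT s|M1. h * (f (s, \<alpha> s))\<^sup>2) <= (LINT x|lborel. indicator ?U x * ?F x)"
  proof (rule slice_bound)
    show "integrable lborel (%x. indicator ?U x * ?F x)"
      by (rule integrable_indicator_continuous[OF Om_borel[OF a] Om_bounded[OF a] cF])
    show "integrable M1 (%s. h * (f (s, \<alpha> s))\<^sup>2)" using sqi_integrable[OF trace_sqi[OF a cf]] by simp
    fix s :: real assume s: "0 < s" "s < 1"
    let ?a = "\<alpha> s" and ?b = "\<alpha> s + h"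
    have al: "\<alpha> s <= amax" using a s by (auto simp: adm_def)
    define D where "D = (LINT y|lborel. indicator {?a<..<?b} y * (pd e2 f (s, y))\<^sup>2)"
    have iD: "integrable lborel (%y. indicator {?a<..<?b} y * (pd e2 f (s, y))\<^sup>2)"
      by (rule integrable_interval_continuous) (intro continuous_intros sl)
    have i1: "integrable lborel (%y. indicator {?a<..<?b} y * c)" for c :: real
      by (rule integrable_interval_continuous) (rule continuous_on_const)
    have pt: "(f (s, \<alpha> s))\<^sup>2 <= 2 * (f (s, y))\<^sup>2 + 2 * h * D" if y: "y \<in> {?a<..<?b}" for y
    proof -
      have "(f (s, y) - f (s, ?a))\<^sup>2 <= (y - ?a) * (LINT t|lborel. indicator {?a<..<y} t * (pd e2 f (s, t))\<^sup>2)"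
        by (rule segment_Cauchy_Schwarz[OF has_derivative_slice2[OF f] sl(2)]) (use y in auto)
      also have "\<dots> <= h * D"
        unfolding D_def
      proof (intro mult_mono integral_mono)
        show "integrable lborel (%t. indicator {?a<..<y} t * (pd e2 f (s, t))\<^sup>2)"
          by (rule integrable_interval_continuous) (intro continuous_intros sl)
      qed (use y iD h in \<open>auto simp: indicator_def\<close>)
      finally have A: "(f (s, y) - f (s, ?a))\<^sup>2 <= h * D" .
      have "(f (s, ?a))\<^sup>2 <= 2 * (f (s, y))\<^sup>2 + 2 * (f (s, y) - f (s, ?a))\<^sup>2"
        using norm_add_power2_le[of "f (s, y)" "f (s, ?a) - f (s, y)"] by (simp add: power2_commute)
      with A show ?thesis by linarith
    qed
    have "h * (f (s, \<alpha> s))\<^sup>2 = (LINT y|lborel. indicator {?a<..<?b} y * (f (s, \<alpha> s))\<^sup>2)" using h by simp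
    also have "\<dots> <= (LINT y|lborel. indicator {?a<..<?b} y * (2 * (f (s, y))\<^sup>2) + indicator {?a<..<?b} y * (2 * h * D))"
    proof (rule integral_mono)
      show "integrable lborel (%y. indicator {?a<..<?b} y * (2 * (f (s, y))\<^sup>2) + indicator {?a<..<?b} y * (2 * h * D))"
        by (intro Bochner_Integration.integrable_add i1 integrable_interval_continuous continuous_intros sl)
    qed (use i1 pt in \<open>auto simp: indicator_def\<close>)
    also have "\<dots> = (LINT y|lborel. indicator {?a<..<?b} y * (2 * (f (s, y))\<^sup>2)) + (LINT y|lborel. indicator {?a<..<?b} y * (2 * h * D))"
      by (intro Bochner_Integration.integral_add i1 integrable_interval_continuous continuous_intros sl)
    also have "(LINT y|lborel. indicator {?a<..<?b} y * (2 * h * D)) = (LINT y|lborel. indicator {?a<..<?b} y * (2 * h\<^sup>2 * (pd e2 f (s, y))\<^sup>2))"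
    proof -
      have "(LINT y|lborel. indicator {?a<..<?b} y * (2 * h * D)) = 2 * h\<^sup>2 * D" using h by (simp add: power2_eq_square)
      also have "\<dots> = (LINT y|lborel. (2 * h\<^sup>2) * (indicator {?a<..<?b} y * (pd e2 f (s, y))\<^sup>2))" by (simp add: D_def)
      finally show ?thesis by (simp add: mult_ac)
    qed
    also have "(LINT y|lborel. indicator {?a<..<?b} y * (2 * (f (s, y))\<^sup>2)) + \<dots> = (LINT y|lborel. indicator {?a<..<?b} y * ?F (s, y))"
      unfolding distrib_left
      by (rule Bochner_Integration.integral_add[symmetric]) (intro integrable_interval_continuous continuous_intros sl)+
    also have "\<dots> <= (LINT y|lborel. indicator ?U (s, y) * ?F (s, y))"
    proof (rule integral_mono)
      show "integrable lborel (%y. indicator {?a<..<?b} y * ?F (s, y))"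
        by (intro integrable_interval_continuous continuous_intros sl)
      have "(%y. indicator ?U (s, y) * ?F (s, y)) = (%y. indicator {?a<..<\<omega>} y * ?F (s, y))"
        using s by (auto simp: Om_def indicator_def fun_eq_iff)
      moreover have "integrable lborel (%y. indicator {?a<..<\<omega>} y * ?F (s, y))"
        by (intro integrable_interval_continuous continuous_intros sl)
      ultimately show "integrable lborel (%y. indicator ?U (s, y) * ?F (s, y))" by simp
    qed (use s al h in \<open>auto simp: Om_def indicator_def\<close>)
    finally show "h * (f (s, \<alpha> s))\<^sup>2 <= (LINT y|lborel. indicator ?U (s, y) * ?F (s, y))" .
  qed (auto simp: indicator_def)
  also have "(LINT x|lborel. indicator ?U x * ?F x) = (LINT x|RS ?U. ?F x)"
    using Om_borel[OF a] by (simp add: integral_restrict_space)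
  also have "\<dots> = 2 * (l2n (RS ?U) f)\<^sup>2 + 2 * h\<^sup>2 * (l2n (RS ?U) (pd e2 f))\<^sup>2"
    unfolding l2n_power2
    using sqi_integrable[OF sqi_continuous[OF Om_borel[OF a] Om_bounded[OF a] cf]]
      sqi_integrable[OF sqi_continuous[OF Om_borel[OF a] Om_bounded[OF a] cd]] by simp
  finally show ?thesis by (simp add: l2n_power2)
qed

text \<open>The constant of \<open>trace_estimate\<close> at the full height
  \<open>\<omega> - amax\<close>, with both norms bounded by that of the jet; it is the same for all
  admissible curves.\<close>

definition Ct :: real where "Ct = sqrt ((2 + 2 * (\<omega> - amax)\<^sup>2) / (\<omega> - amax))"

lemma Ct_pos: "0 < Ct"
  unfolding Ct_def using amax_\<omega> by (intro real_sqrt_gt_zero divide_pos_pos) (auto simp: add_pos_nonneg)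

lemma trace_bound:
  assumes a: "adm \<alpha>" and f: "smooth f"
  shows "l2n M1 (%s. f (s, \<alpha> s)) <= Ct * l2n (RS (Om' \<alpha>)) (J f)"
proof -
  let ?h = "\<omega> - amax" and ?N = "l2n (RS (Om' \<alpha>)) (J f)"
  have h: "0 < ?h" using amax_\<omega> by simp
  have j: "sqi (RS (Om' \<alpha>)) (J f)" by (rule sqi_J[OF Om_borel[OF a] Om_bounded[OF a] f])
  have "l2n (RS (Om' \<alpha>)) f <= ?N" "l2n (RS (Om' \<alpha>)) (pd e2 f) <= ?N"
    using sqi_pr(4,6)[OF j] by (simp_all add: pr_J)
  then have "(l2n (RS (Om' \<alpha>)) f)\<^sup>2 <= ?N\<^sup>2" "(l2n (RS (Om' \<alpha>)) (pd e2 f))\<^sup>2 <= ?N\<^sup>2"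
    by (auto intro!: power_mono)
  then have "2 * (l2n (RS (Om' \<alpha>)) f)\<^sup>2 + 2 * ?h\<^sup>2 * (l2n (RS (Om' \<alpha>)) (pd e2 f))\<^sup>2 <= 2 * ?N\<^sup>2 + 2 * ?h\<^sup>2 * ?N\<^sup>2"
    by (intro add_mono mult_left_mono) auto
  then have "?h * (l2n M1 (%s. f (s, \<alpha> s)))\<^sup>2 <= (2 + 2 * ?h\<^sup>2) * ?N\<^sup>2"
    using trace_estimate[OF a f h] by (simp add: algebra_simps)
  then have "(l2n M1 (%s. f (s, \<alpha> s)))\<^sup>2 <= (2 + 2 * ?h\<^sup>2) / ?h * ?N\<^sup>2"
    using h by (simp add: field_simps)
  then have "sqrt ((l2n M1 (%s. f (s, \<alpha> s)))\<^sup>2) <= sqrt ((2 + 2 * ?h\<^sup>2) / ?h * ?N\<^sup>2)" by (rule real_sqrt_le_mono)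
  then show ?thesis by (simp only: real_sqrt_mult real_sqrt_abs Ct_def abs_of_nonneg[OF l2n_nonneg])
qed

text \<open>\<open>V = (v, \<partial>\<^sub>1v, \<partial>\<^sub>2v)\<close> for some \<open>v \<in> H\<^sup>1\<^sub>0(O')\<close>, and \<open>t\<close> is the trace of \<open>v\<close> on the graph of \<open>\<alpha>\<close>.\<close>

definition TT :: "(real => real) => (R2 => real \<times> real \<times> real) => (real => real) => bool" where
  "TT \<alpha> V t \<longleftrightarrow> sqi RO V \<and> sqi M1 t \<and>
     (\<forall>\<epsilon>>0. \<exists>\<phi>. testfn O' \<phi> \<and> l2n RO (%x. J \<phi> x - V x) < \<epsilon> \<and> l2n M1 (%s. \<phi> (s, \<alpha> s) - t s) < \<epsilon>)"

lemma TT_HH: "TT \<alpha> V t ==> HH O' V"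
  unfolding TT_def HH_def by blast

lemma J_sqi: "testfn O' \<phi> ==> sqi RO (J \<phi>)"
  by (rule sqi_J[OF O_borel bddO testfn_smooth])

lemma test_trace_sqi: "adm \<alpha> ==> testfn O' \<phi> ==> sqi M1 (%s. \<phi> (s, \<alpha> s))"
  by (rule trace_sqi[OF _ smooth_continuous[OF testfn_smooth]])

lemma TT_J: "adm \<alpha> ==> testfn O' \<phi> ==> TT \<alpha> (J \<phi>) (%s. \<phi> (s, \<alpha> s))"
  unfolding TT_def using J_sqi test_trace_sqi by (auto intro!: exI[of _ \<phi>])

lemma TT_closed:
  assumes a: "adm \<alpha>" and V: "sqi RO V" "sqi M1 t"
    and ap: "!!\<epsilon>. 0 < \<epsilon> ==> \<exists>V' t'. TT \<alpha> V' t' \<and> l2n RO (%x. V' x - V x) < \<epsilon> \<and> l2n M1 (%s. t' s - t s) < \<epsilon>"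
  shows "TT \<alpha> V t"
  unfolding TT_def
proof (intro conjI allI impI V)
  fix \<epsilon> :: real assume "0 < \<epsilon>"
  then obtain V' t' where V': "TT \<alpha> V' t'" "l2n RO (%x. V' x - V x) < \<epsilon>/2" "l2n M1 (%s. t' s - t s) < \<epsilon>/2"
    using ap[of "\<epsilon>/2"] by auto
  have s: "sqi RO V'" "sqi M1 t'" using V'(1) by (auto simp: TT_def)
  obtain \<phi> where p: "testfn O' \<phi>" "l2n RO (%x. J \<phi> x - V' x) < \<epsilon>/2" "l2n M1 (%s. \<phi> (s, \<alpha> s) - t' s) < \<epsilon>/2"
    using V'(1) \<open>0 < \<epsilon>\<close> unfolding TT_def by (meson half_gt_zero)
  have "l2n RO (%x. J \<phi> x - V x) < \<epsilon>"
    using l2n_triangle3[OF J_sqi[OF p(1)] s(1) V(1)] V'(2) p(2) by linarith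
  moreover have "l2n M1 (%s. \<phi> (s, \<alpha> s) - t s) < \<epsilon>"
    using l2n_triangle3[OF test_trace_sqi[OF a p(1)] s(2) V(2)] V'(3) p(3) by linarith
  ultimately show "\<exists>\<phi>. testfn O' \<phi> \<and> l2n RO (%x. J \<phi> x - V x) < \<epsilon> \<and> l2n M1 (%s. \<phi> (s, \<alpha> s) - t s) < \<epsilon>"
    using p(1) by blast
qed

lemma TT_seq:
  assumes "TT \<alpha> V t"
  obtains \<phi> where "!!k::nat. testfn O' (\<phi> k)" "l2conv RO (%k. J (\<phi> k)) V"
    "l2conv M1 (%k s. \<phi> k (s, \<alpha> s)) t"
proof -
  have "\<exists>\<phi>. testfn O' \<phi> \<and> l2n RO (%x. J \<phi> x - V x) < 1 / real (Suc k) \<and> l2n M1 (%s. \<phi> (s, \<alpha> s) - t s) < 1 / real (Suc k)" for k :: nat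
    using assms unfolding TT_def by simp
  then have "\<forall>k::nat. \<exists>\<phi>. testfn O' \<phi> \<and> l2n RO (%x. J \<phi> x - V x) < 1 / real (Suc k) \<and> l2n M1 (%s. \<phi> (s, \<alpha> s) - t s) < 1 / real (Suc k)" by blast
  from choice[OF this] obtain \<phi> where p: "!!k. testfn O' (\<phi> k)" "!!k. l2n RO (%x. J (\<phi> k) x - V x) < 1 / real (Suc k)"
    "!!k. l2n M1 (%s. \<phi> k (s, \<alpha> s) - t s) < 1 / real (Suc k)" by blast
  have "l2conv RO (%k. J (\<phi> k)) V" "l2conv M1 (%k s. \<phi> k (s, \<alpha> s)) t"
    by (rule Lim_null_comparison[OF _ LIMSEQ_inverse_real_of_nat],
       use p in \<open>auto simp: inverse_eq_divide intro!: always_eventually less_imp_le\<close>)+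
  with p(1) show ?thesis by (rule that)
qed

lemma J_diff_lim_sub:
  assumes "adm \<alpha>" "!!k::nat. testfn O' (\<phi> k)" "l2conv RO (%k. J (\<phi> k)) V" "sqi RO V"
  shows "l2conv (RS (Om' \<alpha>)) (%k. J (\<phi> k)) V"
  by (rule Lim_null_comparison[OF _ assms(3)])
     (use sqi_subset(2)[OF Om_borel[OF assms(1)] O_borel Om_sub[OF assms(1)] sqi_diff[OF J_sqi[OF assms(2)] assms(4)]] in auto)

text \<open>The norm on the right is taken over the domain alone; this is the norm in which the
  correctors are estimated.\<close>

lemma TT_bound:
  assumes a: "adm \<alpha>" and T: "TT \<alpha> V t" shows "l2n M1 t <= Ct * l2n (RS (Om' \<alpha>)) V"
proof -
  obtain \<phi> where p: "!!k::nat. testfn O' (\<phi> k)" "l2conv RO (%k. J (\<phi> k)) V"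
    "l2conv M1 (%k s. \<phi> k (s, \<alpha> s)) t" using TT_seq[OF T] by blast
  have s: "sqi RO V" "sqi M1 t" using T by (auto simp: TT_def)
  have sU: "sqi (RS (Om' \<alpha>)) V" by (rule sqi_subset(1)[OF Om_borel[OF a] O_borel Om_sub[OF a] s(1)])
  have jU: "sqi (RS (Om' \<alpha>)) (J (\<phi> k))" for k by (rule sqi_J[OF Om_borel[OF a] Om_bounded[OF a] testfn_smooth[OF p(1)]])
  have "(%k. l2n M1 (%s. \<phi> k (s, \<alpha> s))) \<longlonglongrightarrow> l2n M1 t"
    by (rule l2n_tendsto[OF test_trace_sqi[OF a p(1)] s(2) p(3)])
  moreover have "(%k. Ct * l2n (RS (Om' \<alpha>)) (J (\<phi> k))) \<longlonglongrightarrow> Ct * l2n (RS (Om' \<alpha>)) V"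
    by (intro tendsto_mult tendsto_const l2n_tendsto[OF jU sU J_diff_lim_sub[OF a p(1,2) s(1)]])
  ultimately show ?thesis
    by (rule LIMSEQ_le) (use trace_bound[OF a testfn_smooth[OF p(1)]] in auto)
qed

lemma TT_comb:
  assumes a: "adm \<alpha>" and T: "TT \<alpha> V t" "TT \<alpha> V' t'"
  shows "TT \<alpha> (%x. V x + c *\<^sub>R V' x) (%s. t s + c * t' s)"
  unfolding TT_def
proof (intro conjI allI impI)
  have s: "sqi RO V" "sqi M1 t" "sqi RO V'" "sqi M1 t'" using T by (auto simp: TT_def)
  show "sqi RO (%x. V x + c *\<^sub>R V' x)" "sqi M1 (%s. t s + c * t' s)"
    using s by (auto intro: sqi_add sqi_scaleR sqi_cmult)
  fix \<epsilon> :: real assume e: "0 < \<epsilon>"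
  define \<delta> where "\<delta> = \<epsilon> / (1 + \<bar>c\<bar>)"
  have c1: "0 < 1 + \<bar>c\<bar>" by (simp add: add_pos_nonneg)
  then have "(1 + \<bar>c\<bar>) * \<delta> = \<epsilon>" by (simp add: \<delta>_def)
  then have d: "0 < \<delta>" "\<delta> + \<bar>c\<bar> * \<delta> = \<epsilon>" using e c1 by (simp add: \<delta>_def, simp only: distrib_right mult_1)
  obtain \<phi> where p: "testfn O' \<phi>" "l2n RO (%x. J \<phi> x - V x) < \<delta>" "l2n M1 (%s. \<phi> (s, \<alpha> s) - t s) < \<delta>"
    using T(1) d(1) unfolding TT_def by meson
  obtain \<psi> where q: "testfn O' \<psi>" "l2n RO (%x. J \<psi> x - V' x) < \<delta>" "l2n M1 (%s. \<psi> (s, \<alpha> s) - t' s) < \<delta>"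
    using T(2) d(1) unfolding TT_def by meson
  have "l2n RO (%x. J (%x. \<phi> x + c * \<psi> x) x - (V x + c *\<^sub>R V' x)) = l2n RO (%x. (J \<phi> x - V x) + c *\<^sub>R (J \<psi> x - V' x))"
    by (simp add: J_comb[OF testfn_smooth[OF p(1)] testfn_smooth[OF q(1)]] algebra_simps)
  also have "\<dots> <= l2n RO (%x. J \<phi> x - V x) + \<bar>c\<bar> * l2n RO (%x. J \<psi> x - V' x)"
    using l2n_triangle[OF sqi_diff[OF J_sqi[OF p(1)] s(1)] sqi_scaleR[OF sqi_diff[OF J_sqi[OF q(1)] s(3)], of c]]
    by (simp add: l2n_scaleR)
  also have "\<dots> < \<epsilon>" using p(2) q(2) mult_left_mono[of "l2n RO (%x. J \<psi> x - V' x)" \<delta> "\<bar>c\<bar>"] d(2) by linarith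
  finally have A: "l2n RO (%x. J (%x. \<phi> x + c * \<psi> x) x - (V x + c *\<^sub>R V' x)) < \<epsilon>" .
  have "l2n M1 (%s. \<phi> (s, \<alpha> s) + c * \<psi> (s, \<alpha> s) - (t s + c * t' s)) = l2n M1 (%s. (\<phi> (s, \<alpha> s) - t s) + c * (\<psi> (s, \<alpha> s) - t' s))"
    by (simp add: algebra_simps)
  also have "\<dots> <= l2n M1 (%s. \<phi> (s, \<alpha> s) - t s) + \<bar>c\<bar> * l2n M1 (%s. \<psi> (s, \<alpha> s) - t' s)"
    using l2n_triangle[OF sqi_diff[OF test_trace_sqi[OF a p(1)] s(2)] sqi_cmult[OF sqi_diff[OF test_trace_sqi[OF a q(1)] s(4)], of c]]
    by (simp add: l2n_cmult)
  also have "\<dots> < \<epsilon>" using p(3) q(3) mult_left_mono[of "l2n M1 (%s. \<psi> (s, \<alpha> s) - t' s)" \<delta> "\<bar>c\<bar>"] d(2) by linarith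
  finally have B: "l2n M1 (%s. \<phi> (s, \<alpha> s) + c * \<psi> (s, \<alpha> s) - (t s + c * t' s)) < \<epsilon>" .
  from A B testfn_comb[OF p(1) q(1), of c]
  show "\<exists>\<phi>. testfn O' \<phi> \<and> l2n RO (%x. J \<phi> x - (V x + c *\<^sub>R V' x)) < \<epsilon> \<and> l2n M1 (%s. \<phi> (s, \<alpha> s) - (t s + c * t' s)) < \<epsilon>"
    by (intro exI[of _ "%x. \<phi> x + c * \<psi> x"]) simp
qed

lemma TT_exists:
  assumes a: "adm \<alpha>" and V: "HH O' V" obtains t where "TT \<alpha> V t"
proof -
  obtain \<phi> where p: "!!k::nat. testfn O' (\<phi> k)" "l2conv RO (%k. J (\<phi> k)) V"
    using HH_seq[OF V] by blast
  have s: "sqi RO V" using V by (simp add: HH_def)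
  have cau: "l2n M1 (%s. \<phi> i (s, \<alpha> s) - \<phi> j (s, \<alpha> s)) <= Ct * (l2n RO (%x. J (\<phi> i) x - V x) + l2n RO (%x. J (\<phi> j) x - V x))" for i j
  proof -
    have sm: "smooth (%x. \<phi> i x - \<phi> j x)" by (rule smooth_diff[OF testfn_smooth[OF p(1)] testfn_smooth[OF p(1)]])
    have "l2n M1 (%s. \<phi> i (s, \<alpha> s) - \<phi> j (s, \<alpha> s)) <= Ct * l2n (RS (Om' \<alpha>)) (J (%x. \<phi> i x - \<phi> j x))"
      by (rule trace_bound[OF a sm])
    also have "\<dots> <= Ct * l2n RO (J (%x. \<phi> i x - \<phi> j x))"
      using Ct_pos sqi_subset(2)[OF Om_borel[OF a] O_borel Om_sub[OF a] sqi_J[OF O_borel bddO sm]] by simp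
    also have "l2n RO (J (%x. \<phi> i x - \<phi> j x)) = l2n RO (%x. J (\<phi> i) x - J (\<phi> j) x)"
      by (simp add: J_diff[OF testfn_smooth[OF p(1)] testfn_smooth[OF p(1)]] l2n_def)
    also have "Ct * \<dots> <= Ct * (l2n RO (%x. J (\<phi> i) x - V x) + l2n RO (%x. J (\<phi> j) x - V x))"
      using Ct_pos l2n_triangle3[OF J_sqi[OF p(1)[of i]] s J_sqi[OF p(1)[of j]]] l2n_minus_commute[of "RO" V "J (\<phi> j)"] by simp
    finally show ?thesis .
  qed
  obtain t where t: "sqi M1 t" "l2conv M1 (%k s. \<phi> k (s, \<alpha> s)) t"
  proof (rule l2_complete[OF M1_finite, of "%k s. \<phi> k (s, \<alpha> s)"])
    show "sqi M1 (%s. \<phi> k (s, \<alpha> s))" for k by (rule test_trace_sqi[OF a p(1)])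
    fix e :: real assume e: "0 < e"
    then have "eventually (%k. l2n RO (%x. J (\<phi> k) x - V x) < e / (2 * Ct)) sequentially"
      using order_tendstoD(2)[OF p(2), of "e / (2 * Ct)"] Ct_pos by simp
    then obtain N where N: "!!k. k \<ge> N ==> l2n RO (%x. J (\<phi> k) x - V x) < e / (2 * Ct)" by (auto simp: eventually_sequentially)
    have "l2n M1 (%s. \<phi> i (s, \<alpha> s) - \<phi> j (s, \<alpha> s)) < e" if "i \<ge> N" "j \<ge> N" for i j
    proof -
      have "Ct * (l2n RO (%x. J (\<phi> i) x - V x) + l2n RO (%x. J (\<phi> j) x - V x)) < Ct * (e / (2 * Ct) + e / (2 * Ct))"
        using N[OF that(1)] N[OF that(2)] Ct_pos by (intro mult_strict_left_mono) auto
      also have "\<dots> = e" using Ct_pos by (simp add: field_simps)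
      finally show ?thesis using cau[of i j] by linarith
    qed
    then show "\<exists>N. \<forall>i\<ge>N. \<forall>j\<ge>N. l2n M1 (%s. \<phi> i (s, \<alpha> s) - \<phi> j (s, \<alpha> s)) < e" by blast
  qed
  have "TT \<alpha> V t"
  proof (rule TT_closed[OF a s t(1)])
    fix \<epsilon> :: real assume "0 < \<epsilon>"
    then have "eventually (%k. l2n RO (%x. J (\<phi> k) x - V x) < \<epsilon> \<and> l2n M1 (%s. \<phi> k (s, \<alpha> s) - t s) < \<epsilon>) sequentially"
      using order_tendstoD(2)[OF p(2)] order_tendstoD(2)[OF t(2)] by (intro eventually_conj) auto
    then obtain k where "l2n RO (%x. J (\<phi> k) x - V x) < \<epsilon>" "l2n M1 (%s. \<phi> k (s, \<alpha> s) - t s) < \<epsilon>"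
      by (auto simp: eventually_sequentially)
    then show "\<exists>V' t'. TT \<alpha> V' t' \<and> l2n RO (%x. V' x - V x) < \<epsilon> \<and> l2n M1 (%s. t' s - t s) < \<epsilon>"
      using TT_J[OF a p(1)] by blast
  qed
  then show ?thesis by (rule that)
qed

lemma TT_test_diff:
  assumes a: "adm \<alpha>" and T: "TT \<alpha> V t" and p: "testfn O' \<phi>"
  shows "l2n M1 (%s. \<phi> (s, \<alpha> s) - t s) <= Ct * l2n RO (%x. J \<phi> x - V x)"
proof -
  have s: "sqi RO V" using T by (simp add: TT_def)
  have "l2n M1 (%s. \<phi> (s, \<alpha> s) - t s) <= Ct * l2n (RS (Om' \<alpha>)) (%x. J \<phi> x - V x)"
    using TT_bound[OF a TT_comb[OF a TT_J[OF a p] T, of "-1"]] by simp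
  also have "\<dots> <= Ct * l2n RO (%x. J \<phi> x - V x)"
    using Ct_pos sqi_subset(2)[OF Om_borel[OF a] O_borel Om_sub[OF a] sqi_diff[OF J_sqi[OF p] s]] by simp
  finally show ?thesis .
qed

text \<open>Two smooth approximations of the same H^1 function have jets that approach each other,
  so by \<open>trace_bound\<close> their traces do too. This is what makes the chosen trace
  meaningful a.e.\<close>

lemma trace_rel_unique:
  assumes a: "adm \<alpha>" and u: "H1 (Om' \<alpha>) u" and t: "trace_rel \<omega> \<alpha> u t" "trace_rel \<omega> \<alpha> u t'"
  shows "AE s in M1. t s = t' s"
proof -
  let ?U = "Om' \<alpha>"
  note U = Om_open[OF a] Om_bounded[OF a] and Ub = Om_borel[OF a]
  have conv: "\<exists>\<phi>. (\<forall>k::nat. smooth (\<phi> k)) \<and> (%k. l2n (RS ?U) (%x. J (\<phi> k) x - JW ?U u x)) \<longlonglongrightarrow> 0 \<and>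
     l2conv M1 (%k s. \<phi> k (s, \<alpha> s)) t" if tr0: "trace_rel \<omega> \<alpha> u t" for t
  proof -
    obtain \<phi> where p: "!!k. Cc (\<phi> k)" "(%k. H1sq ?U (%x. \<phi> k x - u x)) \<longlonglongrightarrow> 0"
      "(%k. set_lebesgue_integral lborel {0<..<1} (%s. (\<phi> k (s, \<alpha> s) - t s)\<^sup>2)) \<longlonglongrightarrow> 0"
      using tr0 unfolding trace_rel_def by blast
    have "l2conv (RS ?U) (%k. J (\<phi> k)) (JW ?U u)"
      by (rule sqrt_tendsto_0) (use p(2) H1sq_diff[OF U Cc_smooth[OF p(1)] u] in auto)
    moreover have "l2conv M1 (%k s. \<phi> k (s, \<alpha> s)) t"
      by (rule sqrt_tendsto_0) (use p(3) in \<open>auto simp: M1_integral l2n_power2\<close>)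
    ultimately show ?thesis using Cc_smooth[OF p(1)] by blast
  qed
  obtain \<phi> where p: "!!k::nat. smooth (\<phi> k)" "l2conv (RS ?U) (%k. J (\<phi> k)) (JW ?U u)"
     "l2conv M1 (%k s. \<phi> k (s, \<alpha> s)) t" using conv[OF t(1)] by blast
  obtain \<psi> where q: "!!k::nat. smooth (\<psi> k)" "l2conv (RS ?U) (%k. J (\<psi> k)) (JW ?U u)"
     "l2conv M1 (%k s. \<psi> k (s, \<alpha> s)) t'" using conv[OF t(2)] by blast
  have st: "sqi M1 t" "sqi M1 t'" using t by (auto simp: trace_rel_def M1_L2S)
  have sw: "sqi (RS ?U) (JW ?U u)" by (rule H1_sqi_JW(1)[OF Ub u])
  have tp: "sqi M1 (%s. \<phi> k (s, \<alpha> s))" "sqi M1 (%s. \<psi> k (s, \<alpha> s))" for k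
    by (rule trace_sqi[OF a smooth_continuous[OF p(1)]], rule trace_sqi[OF a smooth_continuous[OF q(1)]])
  have jp: "sqi (RS ?U) (J (\<phi> k))" "sqi (RS ?U) (J (\<psi> k))" for k
    by (rule sqi_J[OF Ub U(2) p(1)], rule sqi_J[OF Ub U(2) q(1)])
  have b: "l2n M1 (%s. t s - t' s) <= l2n M1 (%s. \<phi> k (s, \<alpha> s) - t s) +
      Ct * (l2n (RS ?U) (%x. J (\<phi> k) x - JW ?U u x) + l2n (RS ?U) (%x. J (\<psi> k) x - JW ?U u x)) +
      l2n M1 (%s. \<psi> k (s, \<alpha> s) - t' s)" for k
  proof -
    have "l2n M1 (%s. \<phi> k (s, \<alpha> s) - \<psi> k (s, \<alpha> s)) <= Ct * l2n (RS ?U) (J (%x. \<phi> k x - \<psi> k x))"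
      by (rule trace_bound[OF a smooth_diff[OF p(1) q(1)]])
    also have "l2n (RS ?U) (J (%x. \<phi> k x - \<psi> k x)) = l2n (RS ?U) (%x. J (\<phi> k) x - J (\<psi> k) x)"
      by (simp add: J_diff p(1) q(1) l2n_def)
    also have "Ct * \<dots> <= Ct * (l2n (RS ?U) (%x. J (\<phi> k) x - JW ?U u x) + l2n (RS ?U) (%x. J (\<psi> k) x - JW ?U u x))"
      using Ct_pos l2n_triangle3[OF jp(1) sw jp(2), of k k] l2n_minus_commute[of "RS ?U" "JW ?U u" "J (\<psi> k)"] by simp
    finally show ?thesis
      using l2n_triangle3[OF st(1) tp(1) st(2), of k] l2n_triangle3[OF tp(1) tp(2) st(2), of k k]
        l2n_minus_commute[of M1 t "%s. \<phi> k (s, \<alpha> s)"] by linarith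
  qed
  have "(%k. l2n M1 (%s. \<phi> k (s, \<alpha> s) - t s) +
      Ct * (l2n (RS ?U) (%x. J (\<phi> k) x - JW ?U u x) + l2n (RS ?U) (%x. J (\<psi> k) x - JW ?U u x)) +
      l2n M1 (%s. \<psi> k (s, \<alpha> s) - t' s)) \<longlonglongrightarrow> 0 + Ct * (0 + 0) + 0"
    by (intro tendsto_add tendsto_mult tendsto_const p q)
  then have "l2n M1 (%s. t s - t' s) <= 0 + Ct * (0 + 0) + 0"
    by (rule LIMSEQ_le_const) (use b in auto)
  then have "l2n M1 (%s. t s - t' s) = 0" by (simp add: antisym)
  then show ?thesis using l2n_eq_0_iff[OF sqi_diff[OF st]] by simp
qed

lemma TT_trace_rel:
  assumes a: "adm \<alpha>" and T: "TT \<alpha> V t" and u: "!!x. x \<in> Om' \<alpha> ==> u x = pr0 (V x)"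
  shows "trace_rel \<omega> \<alpha> u t" "H1 (Om' \<alpha>) u" "AE x in RS (Om' \<alpha>). JW (Om' \<alpha>) u x = V x"
proof -
  let ?U = "Om' \<alpha>"
  note U = Om_open[OF a] Om_bounded[OF a] and Ub = Om_borel[OF a]
  show h: "H1 ?U u" "AE x in RS ?U. JW ?U u x = V x"
    by (rule HH_JW[OF TT_HH[OF T] O_borel bddO U(1) Om_sub[OF a]], erule u)+
  obtain \<phi> where p: "!!k::nat. testfn O' (\<phi> k)" "l2conv RO (%k. J (\<phi> k)) V"
    "l2conv M1 (%k s. \<phi> k (s, \<alpha> s)) t" using TT_seq[OF T] by blast
  have s: "sqi RO V" "sqi M1 t" using T by (auto simp: TT_def)
  have sU: "sqi (RS ?U) V" by (rule sqi_subset(1)[OF Ub O_borel Om_sub[OF a] s(1)])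
  have eq: "l2n (RS ?U) (%x. J (\<phi> k) x - V x) = l2n (RS ?U) (%x. J (\<phi> k) x - JW ?U u x)" for k
  proof (rule l2n_cong_AE)
    have j: "sqi (RS ?U) (J (\<phi> k))" by (rule sqi_J[OF Ub U(2) testfn_smooth[OF p(1)]])
    show "(%x. J (\<phi> k) x - V x) \<in> borel_measurable (RS ?U)" "(%x. J (\<phi> k) x - JW ?U u x) \<in> borel_measurable (RS ?U)"
      using sqi_diff[OF j sU] sqi_diff[OF j H1_sqi_JW(1)[OF Ub h(1)]] by (auto simp: sqi_def)
    show "AE x in RS ?U. J (\<phi> k) x - V x = J (\<phi> k) x - JW ?U u x" using h(2) by eventually_elim simp
  qed
  have l: "l2conv (RS ?U) (%k. J (\<phi> k)) (JW ?U u)"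
    using J_diff_lim_sub[OF a p(1,2) s(1)] unfolding eq .
  have "(%k. H1sq ?U (%x. \<phi> k x - u x)) \<longlonglongrightarrow> 0"
    unfolding H1sq_diff[OF U testfn_smooth[OF p(1)] h(1)] using tendsto_power[OF l, of 2] by simp
  moreover have "(%k. set_lebesgue_integral lborel {0<..<1} (%s. (\<phi> k (s, \<alpha> s) - t s)\<^sup>2)) \<longlonglongrightarrow> 0"
    using tendsto_power[OF p(3), of 2] by (simp add: M1_integral l2n_power2)
  ultimately show "trace_rel \<omega> \<alpha> u t"
    using s(2) p(1) unfolding trace_rel_def M1_L2S testfn_def by blast
qed

text \<open>The bridge from the relation \<open>TT\<close>, which is stable under limits, to the
  trace \<open>tr\<close> obtained by choice.\<close>

lemma TT_tr:
  assumes a: "adm \<alpha>" and T: "TT \<alpha> V t" and u: "!!x. x \<in> Om' \<alpha> ==> u x = pr0 (V x)"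
  shows "AE s in M1. tr' \<alpha> u s = t s" "trace_rel \<omega> \<alpha> u (tr' \<alpha> u)" "TT \<alpha> V (tr' \<alpha> u)"
proof -
  have r: "trace_rel \<omega> \<alpha> u t" "H1 (Om' \<alpha>) u" by (rule TT_trace_rel[OF a T], erule u)+
  show r': "trace_rel \<omega> \<alpha> u (tr' \<alpha> u)" unfolding tr_def by (rule someI[of "trace_rel \<omega> \<alpha> u", OF r(1)])
  show ae: "AE s in M1. tr' \<alpha> u s = t s" by (rule trace_rel_unique[OF a r(2) r' r(1)])
  have st: "sqi M1 (tr' \<alpha> u)" "sqi M1 t" using r r' by (auto simp: trace_rel_def M1_L2S)
  show "TT \<alpha> V (tr' \<alpha> u)"
  proof (rule TT_closed[OF a _ st(1)])
    show "sqi RO V" using T by (simp add: TT_def)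
    have "l2n M1 (%s. t s - tr' \<alpha> u s) = 0"
      using ae by (subst l2n_eq_0_iff[OF sqi_diff[OF st(2,1)]]) auto
    then show "!!\<epsilon>. 0 < \<epsilon> ==> \<exists>V' t'. TT \<alpha> V' t' \<and> l2n RO (%x. V' x - V x) < \<epsilon> \<and> l2n M1 (%s. t' s - tr' \<alpha> u s) < \<epsilon>"
      using T by (intro exI[of _ V] exI[of _ t]) auto
  qed
qed

text \<open>Admits multipliers that are merely bounded pointwise limits of smooth ones together with
  their jets, such as a Lipschitz slope. Smooth multipliers preserve test functions; dominated
  convergence and closedness of \<open>TT\<close> do the rest.\<close>

lemma TT_mult_limit:
  assumes a: "adm \<alpha>" and T: "TT \<alpha> V t"
    and M: "!!k::nat. smooth (M k)" and m: "m \<in> borel_measurable RO" "m0 \<in> borel_measurable M1"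
    and K: "!!k x. x \<in> O' ==> norm (J (M k) x) <= K" "!!k s. 0 < s ==> s < 1 ==> \<bar>M k (s, \<alpha> s)\<bar> <= K"
    and lim: "AE x in RO. (%k. J (M k) x) \<longlonglongrightarrow> m x" "AE s in M1. (%k. M k (s, \<alpha> s)) \<longlonglongrightarrow> m0 s"
  shows "TT \<alpha> (%x. mulT (m x) (V x)) (%s. m0 s * t s)"
proof -
  have K0: "0 <= K" using K(2)[of "1/2" 0] by (smt (verit) divide_pos_pos half_gt_zero_iff field_sum_of_halves)
  have s: "sqi RO V" "sqi M1 t" using T by (auto simp: TT_def)
  have AEO: "AE x in RO. x \<in> O'" by (simp add: RS_AE)
  have mJ: "J (M k) \<in> borel_measurable RO" for k
    by (rule RS_measurable[OF borel_measurable_continuous_onI[OF J_continuous[OF M]]])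
  have mt: "(%s. M k (s, \<alpha> s)) \<in> borel_measurable M1" for k
    by (rule sqi_measurable[OF trace_sqi[OF a smooth_continuous[OF M]]])
  have K1: "AE x in RO. norm (m x) <= K" using lim(1) AEO
  proof eventually_elim
    case (elim x)
    show ?case by (rule LIMSEQ_le_const2[OF tendsto_norm[OF elim(1)]]) (use K(1)[OF elim(2)] in auto)
  qed
  have K2: "AE s in M1. \<bar>m0 s\<bar> <= K"
  proof -
    have "AE s in M1. 0 < s \<and> s < 1" by (rule M1_AE_I) auto
    with lim(2) show ?thesis
    proof eventually_elim
      case (elim s)
      show ?case by (rule LIMSEQ_le_const2[OF tendsto_rabs[OF elim(1)]]) (use K(2) elim(2) in auto)
    qed
  qed
  have bd: "norm (mulT c v) <= norm ((3 * K) *\<^sub>R v)" if "norm c <= K" for c v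
    using mulT_norm[of c v] mult_right_mono[OF that, of "3 * norm v"] K0 by (simp add: mult_ac)
  have bd': "norm (mulT c v) <= (3 * K) * norm v" if "norm c <= K" for c v
    using bd[OF that, of v] K0 by simp
  \<comment> \<open>A fixed smooth multiplier, acting on the test functions that approximate
    V.\<close>
  have base: "TT \<alpha> (%x. mulT (J (M k) x) (V x)) (%s. M k (s, \<alpha> s) * t s)" for k
  proof (rule TT_closed[OF a])
    show "sqi RO (%x. mulT (J (M k) x) (V x))"
      by (rule sqi_bound[OF mulT_measurable[OF mJ[of k] sqi_measurable[OF s(1)]] s(1), of "3 * K"])
         (use AEO in eventually_elim, erule bd'[OF K(1)])
    show "sqi M1 (%s. M k (s, \<alpha> s) * t s)"
      by (rule sqi_bound[OF borel_measurable_times[OF mt[of k] sqi_measurable[OF s(2)]] s(2), of K])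
         (rule M1_AE_I, use K(2) in \<open>auto simp: abs_mult intro!: mult_right_mono\<close>)
    fix \<epsilon> :: real assume e: "0 < \<epsilon>"
    define \<delta> where "\<delta> = \<epsilon> / (3 * K + 1)"
    have d: "0 < \<delta>" "(3 * K) * \<delta> < \<epsilon>" "K * \<delta> < \<epsilon>" using e K0 by (auto simp: \<delta>_def field_simps add_pos_nonneg)
    obtain \<phi> where p: "testfn O' \<phi>" "l2n RO (%x. J \<phi> x - V x) < \<delta>" "l2n M1 (%s. \<phi> (s, \<alpha> s) - t s) < \<delta>"
      using T d(1) unfolding TT_def by meson
    have tp: "testfn O' (%x. M k x * \<phi> x)" by (rule testfn_mult[OF p(1) M])
    have dj: "sqi RO (%x. J \<phi> x - V x)" by (rule sqi_diff[OF J_sqi[OF p(1)] s(1)])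
    have "l2n RO (%x. J (%x. M k x * \<phi> x) x - mulT (J (M k) x) (V x)) <= (3 * K) * l2n RO (%x. J \<phi> x - V x)"
      unfolding J_mult[OF M testfn_smooth[OF p(1)]] mulT_diff(1)[symmetric]
      by (rule l2n_le[OF mulT_measurable[OF mJ[of k] sqi_measurable[OF dj]] dj])
         (use AEO in eventually_elim, erule bd'[OF K(1)], use K0 in simp)
    also have "\<dots> <= (3 * K) * \<delta>" using p(2) K0 by (intro mult_left_mono) auto
    finally have A: "l2n RO (%x. J (%x. M k x * \<phi> x) x - mulT (J (M k) x) (V x)) < \<epsilon>" using d by linarith
    have dt: "sqi M1 (%s. \<phi> (s, \<alpha> s) - t s)" by (rule sqi_diff[OF test_trace_sqi[OF a p(1)] s(2)])
    have "l2n M1 (%s. M k (s, \<alpha> s) * \<phi> (s, \<alpha> s) - M k (s, \<alpha> s) * t s) <= K * l2n M1 (%s. \<phi> (s, \<alpha> s) - t s)"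
      unfolding right_diff_distrib[symmetric]
      by (rule l2n_le[OF borel_measurable_times[OF mt[of k] sqi_measurable[OF dt]] dt _ K0])
         (rule M1_AE_I, use K(2) in \<open>auto simp: abs_mult intro!: mult_right_mono\<close>)
    also have "\<dots> <= K * \<delta>" using p(3) K0 by (intro mult_left_mono) auto
    finally have B: "l2n M1 (%s. M k (s, \<alpha> s) * \<phi> (s, \<alpha> s) - M k (s, \<alpha> s) * t s) < \<epsilon>" using d by linarith
    show "\<exists>V' t'. TT \<alpha> V' t' \<and> l2n RO (%x. V' x - mulT (J (M k) x) (V x)) < \<epsilon> \<and> l2n M1 (%s. t' s - M k (s, \<alpha> s) * t s) < \<epsilon>"
      using TT_J[OF a tp] A B by (intro exI conjI) auto
  qed
  have sm: "sqi RO (%x. mulT (m x) (V x))"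
    by (rule sqi_bound[OF mulT_measurable[OF m(1) sqi_measurable[OF s(1)]] s(1), of "3 * K"])
       (use K1 in eventually_elim, erule bd')
  have st: "sqi M1 (%s. m0 s * t s)"
    by (rule sqi_bound[OF borel_measurable_times[OF m(2) sqi_measurable[OF s(2)]] s(2), of K])
       (use K2 in eventually_elim, auto simp: abs_mult intro!: mult_right_mono)
  \<comment> \<open>The bound 6 K arises from the factor 3 in \<open>mulT_norm\<close> for each of
    the two products.\<close>
  have L1: "l2conv RO (%k x. mulT (J (M k) x) (V x)) (%x. mulT (m x) (V x))"
  proof (rule l2n_dominated[where h="%x. (6 * K) *\<^sub>R V x"])
    show "(%x. mulT (J (M k) x) (V x) - mulT (m x) (V x)) \<in> borel_measurable RO" for k
      by (intro borel_measurable_diff mulT_measurable mJ m(1) sqi_measurable[OF s(1)])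
    show "sqi RO (%x. (6 * K) *\<^sub>R V x)" by (rule sqi_scaleR[OF s(1)])
    show "AE x in RO. norm (mulT (J (M k) x) (V x) - mulT (m x) (V x)) <= norm ((6 * K) *\<^sub>R V x)" for k
      using AEO K1
    proof eventually_elim
      case (elim x)
      have "norm (mulT (J (M k) x) (V x) - mulT (m x) (V x)) <= norm ((3 * K) *\<^sub>R V x) + norm ((3 * K) *\<^sub>R V x)"
        using norm_triangle_ineq4[of "mulT (J (M k) x) (V x)" "mulT (m x) (V x)"] bd[OF K(1)[OF elim(1)]] bd[OF elim(2)] by (meson add_mono order_trans)
      then show ?case using K0 by simp
    qed
    show "AE x in RO. (%k. mulT (J (M k) x) (V x) - mulT (m x) (V x)) \<longlonglongrightarrow> 0"
      using lim(1)
    proof eventually_elim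
      case (elim x)
      have "(%k. 3 * norm (J (M k) x - m x) * norm (V x)) \<longlonglongrightarrow> 3 * 0 * norm (V x)"
        by (intro tendsto_mult tendsto_const tendsto_norm_zero) (rule LIM_zero[OF elim])
      then have "(%k. 3 * norm (J (M k) x - m x) * norm (V x)) \<longlonglongrightarrow> 0" by simp
      then show ?case
        by (rule Lim_null_comparison[rotated]) (use mulT_norm in \<open>auto simp: mulT_diff(2)[symmetric]\<close>)
    qed
  qed
  have L2: "l2conv M1 (%k s. M k (s, \<alpha> s) * t s) (%s. m0 s * t s)"
  proof (rule l2n_dominated[where h="%s. (2 * K) * t s"])
    show "(%s. M k (s, \<alpha> s) * t s - m0 s * t s) \<in> borel_measurable M1" for k
      by (intro borel_measurable_diff borel_measurable_times mt m(2) sqi_measurable[OF s(2)])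
    show "sqi M1 (%s. (2 * K) * t s)" by (rule sqi_cmult[OF s(2)])
    have Mb: "AE s in M1. \<bar>M k (s, \<alpha> s)\<bar> <= K" for k by (rule M1_AE_I) (rule K(2))
    show "AE s in M1. norm (M k (s, \<alpha> s) * t s - m0 s * t s) <= norm ((2 * K) * t s)" for k
      using Mb[of k] K2
    proof eventually_elim
      case (elim s)
      have "\<bar>M k (s, \<alpha> s) - m0 s\<bar> * \<bar>t s\<bar> <= (2 * K) * \<bar>t s\<bar>" using elim by (intro mult_right_mono) auto
      then show ?case using K0 by (simp add: abs_mult flip: left_diff_distrib)
    qed
    show "AE s in M1. (%k. M k (s, \<alpha> s) * t s - m0 s * t s) \<longlonglongrightarrow> 0"
      using lim(2)
    proof eventually_elim
      case (elim s)
      show ?case by (rule LIM_zero[OF tendsto_mult_right[OF elim]])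
    qed
  qed
  show ?thesis
  proof (rule TT_closed[OF a sm st])
    fix \<epsilon> :: real assume "0 < \<epsilon>"
    then have "eventually (%k. l2n RO (%x. mulT (J (M k) x) (V x) - mulT (m x) (V x)) < \<epsilon> \<and> l2n M1 (%s. M k (s, \<alpha> s) * t s - m0 s * t s) < \<epsilon>) sequentially"
      using order_tendstoD(2)[OF L1] order_tendstoD(2)[OF L2] by (intro eventually_conj) auto
    then obtain k where "l2n RO (%x. mulT (J (M k) x) (V x) - mulT (m x) (V x)) < \<epsilon>" "l2n M1 (%s. M k (s, \<alpha> s) * t s - m0 s * t s) < \<epsilon>"
      by (auto simp: eventually_sequentially)
    then show "\<exists>V' t'. TT \<alpha> V' t' \<and> l2n RO (%x. V' x - mulT (m x) (V x)) < \<epsilon> \<and> l2n M1 (%s. t' s - m0 s * t s) < \<epsilon>"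
      using base by blast
  qed
qed

end

section \<open>Rellich compactness\<close>

lemma slice_integral:
  fixes F :: "R2 => real"
  assumes F: "integrable lborel F" and z: "!!s y. \<not> (0 < s \<and> s < 1) ==> F (s, y) = 0"
  shows "integrable M1 (%s. LINT y|lborel. F (s, y))" "(LINT s|M1. (LINT y|lborel. F (s, y))) = (LINT x|lborel. F x)"
proof -
  have Fi: "integrable (lborel \<Otimes>\<^sub>M lborel) F" using F by (simp add: lborel_prod)
  have e: "(%s. indicator {0<..<1} s *\<^sub>R (LINT y|lborel. F (s, y))) = (%s. LINT y|lborel. F (s, y))"
  proof
    fix s
    show "indicator {0<..<1} s *\<^sub>R (LINT y|lborel. F (s, y)) = (LINT y|lborel. F (s, y))"
      by (cases "0 < s \<and> s < 1") (simp_all add: z)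
  qed
  show "integrable M1 (%s. LINT y|lborel. F (s, y))"
    using lborel_pair.integrable_fst'[OF Fi] integrable_restrict_space[of "{0<..<1}" lborel "%s. LINT y|lborel. F (s, y)"]
    unfolding e by simp
  show "(LINT s|M1. (LINT y|lborel. F (s, y))) = (LINT x|lborel. F x)"
    using lborel_pair.integral_fst'[OF Fi] integral_restrict_space[of "{0<..<1}" lborel "%s. LINT y|lborel. F (s, y)"]
    unfolding e by (simp add: lborel_prod)
qed

lemma AE_lborel_fst:
  assumes "AE x in lborel. P x" shows "AE p in (lborel :: R2 measure). P (fst p)"
proof -
  obtain N where N: "N \<in> null_sets lborel" "{x. \<not> P x} \<subseteq> N" using assms by (auto simp: eventually_ae_filter)
  have "N \<times> (UNIV :: real set) \<in> null_sets (lborel \<Otimes>\<^sub>M lborel)"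
  proof (rule null_setsI)
    show "N \<times> (UNIV :: real set) \<in> sets (lborel \<Otimes>\<^sub>M lborel)" using N by (auto intro!: pair_measureI)
    have "emeasure (lborel \<Otimes>\<^sub>M lborel) (N \<times> (UNIV :: real set)) = emeasure lborel N * emeasure lborel (UNIV :: real set)"
      using N by (intro lborel.emeasure_pair_measure_Times) auto
    then show "emeasure (lborel \<Otimes>\<^sub>M lborel) (N \<times> (UNIV :: real set)) = 0" using N by auto
  qed
  then have "N \<times> UNIV \<in> null_sets (lborel :: R2 measure)" by (simp add: lborel_prod)
  then show ?thesis by (rule AE_I') (use N in auto)
qed

section \<open>Polynomial approximation of Lipschitz functions\<close>

lemma real_poly_antiderivative:
  assumes "real_polynomial_function q"
  obtains P where "real_polynomial_function P" "!!x::real. (P has_real_derivative q x) (at x)"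
proof -
  obtain a n where q: "q = (%x. \<Sum>i\<le>n. a i * x ^ i)" using assms by (auto simp: real_polynomial_function_iff_sum)
  define P where "P = (%x::real. \<Sum>i\<le>n. (a i / real (Suc i)) * x ^ Suc i)"
  have "(P has_real_derivative q x) (at x)" for x
    unfolding P_def q
  proof (rule DERIV_sum)
    fix i
    have "((%x. (a i / real (Suc i)) * x ^ Suc i) has_real_derivative (a i / real (Suc i)) * (real (Suc i) * x ^ i)) (at x)"
      by (auto intro!: derivative_eq_intros simp del: power_Suc of_nat_Suc)
    then show "((%x. (a i / real (Suc i)) * x ^ Suc i) has_real_derivative a i * x ^ i) (at x)"
      by (simp del: power_Suc of_nat_Suc)
  qed
  moreover have "real_polynomial_function P" unfolding P_def
    by (intro real_polynomial_function_sum real_polynomial_function.intros(4) real_polynomial_function.intros(2)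
        real_polynomial_function_power real_polynomial_function.intros(1) bounded_linear_ident) auto
  ultimately show ?thesis using that by blast
qed

text \<open>The derivatives q of the approximants follow the difference quotients of m, so they
  converge wherever these quotients do. To this end a Steklov average, whose derivative is exactly a
  difference quotient, is approximated in C^1 by a polynomial.\<close>

lemma lipschitz_smooth_approx:
  fixes m :: "real => real"
  assumes lip: "!!x y. \<bar>m x - m y\<bar> <= L * \<bar>x - y\<bar>" and R: "0 <= R"
  obtains N q where "!!k::nat. real_polynomial_function (N k)" "!!k x. (N k has_real_derivative q k x) (at x)"
    "!!k x. x \<in> {-R..R} ==> \<bar>N k x - m x\<bar> <= (2 * R + L) / real (Suc k)"
    "!!k x. x \<in> {-R..R} ==> \<bar>q k x - real (Suc k) * (m (x + 1 / real (Suc k)) - m x)\<bar> <= 1 / real (Suc k)"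
proof -
  have "0 <= \<bar>m 0 - m 1\<bar>" by simp
  also have "\<dots> <= L * \<bar>0 - 1\<bar>" by (rule lip)
  finally have L0: "0 <= L" by simp
  have cm: "continuous_on A m" for A
    by (rule lipschitz_on_continuous_on[of L]) (use lip L0 in \<open>auto simp: lipschitz_on_def dist_real_def\<close>)
  \<comment> \<open>The margins around [-R, R] leave room for the shift by h \<le> 1 and for
    two-sided derivatives at the end points.\<close>
  obtain \<mu> where \<mu>0: "!!x. x \<in> {-R-1..R+2} ==> (\<mu> has_vector_derivative m x) (at x within {-R-1..R+2})"
    using antiderivative_continuous[OF cm] by blast
  have \<mu>: "(\<mu> has_real_derivative m x) (at x)" if "x \<in> {-R-1<..<R+2}" for x
  proof -
    have "x \<in> interior {-R-1..R+2}" using that by (simp add: interior_atLeastAtMost_real)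
    moreover have "(\<mu> has_vector_derivative m x) (at x within {-R-1..R+2})" by (rule \<mu>0) (use that in auto)
    ultimately show ?thesis unfolding has_real_derivative_iff_has_vector_derivative using at_within_interior by metis
  qed
  have step: "\<exists>N q. real_polynomial_function N \<and> (\<forall>x. (N has_real_derivative q x) (at x)) \<and>
    (\<forall>x\<in>{-R..R}. \<bar>N x - m x\<bar> <= (2 * R + L) / real (Suc k)) \<and>
    (\<forall>x\<in>{-R..R}. \<bar>q x - real (Suc k) * (m (x + 1 / real (Suc k)) - m x)\<bar> <= 1 / real (Suc k))" for k :: nat
  proof -
    define h where "h = 1 / real (Suc k)"
    have h: "0 < h" "h <= 1" "real (Suc k) = 1 / h" by (auto simp: h_def)
    define D where "D x = (m (x + h) - m x) / h" for x
    have cD: "continuous_on {-R..R} D" unfolding D_def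
      by (intro continuous_intros continuous_on_compose2[OF cm[of UNIV]] cm) (use h in auto)
    obtain q where q: "real_polynomial_function q" "!!x. x \<in> {-R..R} ==> \<bar>D x - q x\<bar> < h"
      using Stone_Weierstrass_real_polynomial_function[OF compact_Icc cD h(1)] by blast
    obtain P where P: "real_polynomial_function P" "!!x. (P has_real_derivative q x) (at x)"
      using real_poly_antiderivative[OF q(1)] by blast
    \<comment> \<open>The Steklov average of m over [x, x + h]; its derivative is D.\<close>
    define A where "A x = (\<mu> (x + h) - \<mu> x) / h" for x
    have dA: "(A has_real_derivative D x) (at x)" if "x \<in> {-R..R}" for x
    proof -
      have "((%x. \<mu> (x + h)) has_real_derivative m (x + h)) (at x)"
        by (rule DERIV_chain2[of \<mu>, where g="%x. x + h" and Db=1, simplified]) (use \<mu>[of "x + h"] that h in \<open>auto intro!: derivative_eq_intros\<close>)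
      moreover have "(\<mu> has_real_derivative m x) (at x)" using \<mu>[of x] that h by auto
      ultimately show ?thesis unfolding A_def D_def by (intro DERIV_cdivide DERIV_diff)
    qed
    have Am: "\<bar>A x - m x\<bar> <= L * h" if x: "x \<in> {-R..R}" for x
    proof -
      have "\<exists>z. x < z \<and> z < x + h \<and> \<mu> (x + h) - \<mu> x = (x + h - x) * m z"
        by (rule MVT2) (use \<mu> x h in auto)
      then obtain z where z: "x < z" "z < x + h" "\<mu> (x + h) - \<mu> x = h * m z" by auto
      then have "A x = m z" using h by (simp add: A_def)
      then have "\<bar>A x - m x\<bar> <= L * \<bar>z - x\<bar>" using lip by simp
      also have "\<dots> <= L * h" using z L0 by (intro mult_left_mono) auto
      finally show ?thesis .
    qed
    \<comment> \<open>Matched to A at the left end, so that the error of the derivatives accumulates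
      over a length of at most 2 R.\<close>
    define N where "N x = P x + (A (-R) - P (-R))" for x
    have rN: "real_polynomial_function N" unfolding N_def
      by (rule real_polynomial_function.intros(3)[OF P(1) real_polynomial_function.intros(2)])
    have dN: "(N has_real_derivative q x) (at x)" for x unfolding N_def
      using DERIV_add[OF P(2) DERIV_const] by simp
    have NA: "\<bar>N x - A x\<bar> <= 2 * R * h" if x: "x \<in> {-R..R}" for x
    proof (cases "x = -R")
      case True then show ?thesis using R h by (simp add: N_def)
    next
      case False
      have "\<exists>z. -R < z \<and> z < x \<and> (N x - A x) - (N (-R) - A (-R)) = (x - (-R)) * (q z - D z)"
        by (rule MVT2[where f="%x. N x - A x"]) (use False x dN dA in \<open>auto intro!: DERIV_diff\<close>)
      then obtain z where z: "-R < z" "z < x" "N x - A x = (x + R) * (q z - D z)" by (auto simp: N_def)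
      have "\<bar>N x - A x\<bar> = (x + R) * \<bar>q z - D z\<bar>" using z x by (simp add: abs_mult)
      also have "\<dots> <= (2 * R) * h" using q(2)[of z] z x h by (intro mult_mono) auto
      finally show ?thesis .
    qed
    have "\<bar>N x - m x\<bar> <= (2 * R + L) / real (Suc k)" if x: "x \<in> {-R..R}" for x
      using NA[OF x] Am[OF x] unfolding h(3) by (simp add: algebra_simps)
    moreover have "\<bar>q x - real (Suc k) * (m (x + 1 / real (Suc k)) - m x)\<bar> <= 1 / real (Suc k)" if x: "x \<in> {-R..R}" for x
      using q(2)[OF x] unfolding D_def h(3) by simp
    ultimately show ?thesis using rN dN by blast
  qed
  then have "\<forall>k::nat. \<exists>Nq. real_polynomial_function (fst Nq) \<and> (\<forall>x. (fst Nq has_real_derivative snd Nq x) (at x)) \<and>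
    (\<forall>x\<in>{-R..R}. \<bar>fst Nq x - m x\<bar> <= (2 * R + L) / real (Suc k)) \<and>
    (\<forall>x\<in>{-R..R}. \<bar>snd Nq x - real (Suc k) * (m (x + 1 / real (Suc k)) - m x)\<bar> <= 1 / real (Suc k))" by simp
  from choice[OF this] obtain f where "\<forall>k. real_polynomial_function (fst (f k)) \<and> (\<forall>x. (fst (f k) has_real_derivative snd (f k) x) (at x)) \<and>
    (\<forall>x\<in>{-R..R}. \<bar>fst (f k) x - m x\<bar> <= (2 * R + L) / real (Suc k)) \<and>
    (\<forall>x\<in>{-R..R}. \<bar>snd (f k) x - real (Suc k) * (m (x + 1 / real (Suc k)) - m x)\<bar> <= 1 / real (Suc k))" ..
  then show ?thesis by (intro that[of "%k. fst (f k)" "%k. snd (f k)"]) auto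
qed

lemma smooth_poly_fst_J:
  assumes "real_polynomial_function N" "!!x. (N has_real_derivative q x) (at x)"
  shows "smooth (%x. N (fst x))" "J (%x. N (fst x)) x = (N (fst x), q (fst x), 0)"
proof -
  show "smooth (%x. N (fst x))" by (rule smooth_polynomial[OF assms(1) smooth_fst])
  have "((%x. N (fst x)) has_derivative (%v. q (fst x) * fst v)) (at x)"
    using has_derivative_compose[OF bounded_linear_imp_has_derivative[OF bounded_linear_fst], of N "(*) (q (fst x))" x] assms(2)[of "fst x"]
    by (simp add: has_field_derivative_def)
  then have "pd e (%x. N (fst x)) x = q (fst x) * fst e" for e using pd_eqI by blast
  then show "J (%x. N (fst x)) x = (N (fst x), q (fst x), 0)" by (simp add: J_def)
qed

section \<open>Translations, averages and compactness\<close>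

lemma translation_estimate:
  assumes f: "Cc f"
  shows "(\<integral>\<^sup>+p. ennreal ((f (p + \<tau>) - f p)\<^sup>2) \<partial>lborel) <= ennreal ((norm \<tau>)\<^sup>2) * (\<integral>\<^sup>+p. ennreal ((norm (J f p))\<^sup>2) \<partial>lborel)"
proof -
  have sm: "smooth f" using f by (simp add: Cc_def)
  have [measurable]: "J f \<in> borel_measurable borel" "f \<in> borel_measurable borel"
    by (rule borel_measurable_continuous_onI[OF J_continuous[OF sm]], rule borel_measurable_continuous_onI[OF smooth_continuous[OF sm]])
  \<comment> \<open>Cauchy-Schwarz along the segment from p to p + \<tau>. Nonnegative integrals let
    Tonelli exchange the order without integrability conditions.\<close>
  have pt: "ennreal ((f (p + \<tau>) - f p)\<^sup>2) <= (\<integral>\<^sup>+r. indicator {0<..<1} r * (ennreal ((norm \<tau>)\<^sup>2) * ennreal ((norm (J f (p + r *\<^sub>R \<tau>)))\<^sup>2)) \<partial>lborel)" for p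
  proof -
    let ?h = "%r. f (p + r *\<^sub>R \<tau>)" and ?h' = "%r. pd \<tau> f (p + r *\<^sub>R \<tau>)"
    have d: "(?h has_real_derivative ?h' r) (at r)" for r
    proof -
      have "((%r. p + r *\<^sub>R \<tau>) has_derivative (%t. t *\<^sub>R \<tau>)) (at r)" by (auto intro!: derivative_eq_intros)
      from has_derivative_compose[OF this smooth_has_derivative[OF sm]]
      have "(?h has_derivative (%t. pd (t *\<^sub>R \<tau>) f (p + r *\<^sub>R \<tau>))) (at r)" .
      moreover have "(%t. pd (t *\<^sub>R \<tau>) f (p + r *\<^sub>R \<tau>)) = (*) (?h' r)"
      proof
        fix t
        show "pd (t *\<^sub>R \<tau>) f (p + r *\<^sub>R \<tau>) = ?h' r * t"
          using linear_cmul[OF bounded_linear.linear[OF has_derivative_bounded_linear[OF smooth_has_derivative[OF sm, of "p + r *\<^sub>R \<tau>"]]], of t \<tau>]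
          by (simp add: mult.commute)
      qed
      ultimately show ?thesis unfolding has_field_derivative_def by (simp only:)
    qed
    have c: "continuous_on UNIV ?h'"
      by (rule continuous_on_compose2[OF smooth_continuous[OF smooth_pd[OF sm]]]) (auto intro!: continuous_intros)
    have le: "(?h' r)\<^sup>2 <= (norm \<tau>)\<^sup>2 * (norm (J f (p + r *\<^sub>R \<tau>)))\<^sup>2" for r
    proof -
      let ?x = "p + r *\<^sub>R \<tau>"
      interpret l: linear "%v. pd v f ?x"
        by (rule bounded_linear.linear[OF has_derivative_bounded_linear[OF smooth_has_derivative[OF sm]]])
      have "\<tau> = fst \<tau> *\<^sub>R e1 + snd \<tau> *\<^sub>R e2" by (simp add: prod_eq_iff)
      then have "pd \<tau> f ?x = fst \<tau> * pd e1 f ?x + snd \<tau> * pd e2 f ?x"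
        by (metis l.add l.scale real_scaleR_def)
      also have "\<dots> = \<tau> \<bullet> (pd e1 f ?x, pd e2 f ?x)" by (simp add: inner_prod_def)
      finally have "\<bar>pd \<tau> f ?x\<bar> <= norm \<tau> * norm (pd e1 f ?x, pd e2 f ?x)" using Cauchy_Schwarz_ineq2 by metis
      also have "\<dots> <= norm \<tau> * norm (J f ?x)" unfolding J_def by (intro mult_left_mono norm_snd_le) auto
      finally have "\<bar>pd \<tau> f ?x\<bar>\<^sup>2 <= (norm \<tau> * norm (J f ?x))\<^sup>2" by (intro power_mono) auto
      then show ?thesis by (simp add: power_mult_distrib)
    qed
    have "(f (p + \<tau>) - f p)\<^sup>2 = (?h 1 - ?h 0)\<^sup>2" by simp
    also have "\<dots> <= (1 - 0) * (LINT r|lborel. indicator {0<..<1} r * (?h' r)\<^sup>2)"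
      by (rule segment_Cauchy_Schwarz[OF d c]) simp
    finally have "(f (p + \<tau>) - f p)\<^sup>2 <= (LINT r|lborel. indicator {0<..<1} r * (?h' r)\<^sup>2)" by simp
    then have "ennreal ((f (p + \<tau>) - f p)\<^sup>2) <= ennreal (LINT r|lborel. indicator {0<..<1} r * (?h' r)\<^sup>2)"
      by (rule ennreal_leI)
    also have "\<dots> = (\<integral>\<^sup>+r. ennreal (indicator {0<..<1} r * (?h' r)\<^sup>2) \<partial>lborel)"
      by (rule nn_integral_eq_integral[symmetric]) (auto intro!: integrable_interval_continuous continuous_intros c)
    also have "\<dots> <= (\<integral>\<^sup>+r. indicator {0<..<1} r * (ennreal ((norm \<tau>)\<^sup>2) * ennreal ((norm (J f (p + r *\<^sub>R \<tau>)))\<^sup>2)) \<partial>lborel)"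
      by (intro nn_integral_mono) (use le in \<open>auto simp: indicator_def ennreal_leI simp flip: ennreal_mult\<close>)
    finally show ?thesis .
  qed
  have tr: "(\<integral>\<^sup>+p. ennreal ((norm (J f (p + c)))\<^sup>2) \<partial>lborel) = (\<integral>\<^sup>+p. ennreal ((norm (J f p))\<^sup>2) \<partial>lborel)" for c
  proof -
    have "(\<integral>\<^sup>+p. ennreal ((norm (J f p))\<^sup>2) \<partial>lborel) = (\<integral>\<^sup>+p. ennreal ((norm (J f p))\<^sup>2) \<partial>distr lborel borel ((+) c))"
      by (simp only: lborel_distr_plus)
    also have "\<dots> = (\<integral>\<^sup>+p. ennreal ((norm (J f (c + p)))\<^sup>2) \<partial>lborel)"
      by (subst nn_integral_distr) auto
    finally show ?thesis by (simp add: add.commute)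
  qed
  have "(\<integral>\<^sup>+p. ennreal ((f (p + \<tau>) - f p)\<^sup>2) \<partial>lborel) \<le>
      (\<integral>\<^sup>+p. (\<integral>\<^sup>+r. indicator {0<..<1} r * (ennreal ((norm \<tau>)\<^sup>2) * ennreal ((norm (J f (p + r *\<^sub>R \<tau>)))\<^sup>2)) \<partial>lborel) \<partial>lborel)"
    by (intro nn_integral_mono pt)
  also have "\<dots> = (\<integral>\<^sup>+r. (\<integral>\<^sup>+p. indicator {0<..<1::real} r * (ennreal ((norm \<tau>)\<^sup>2) * ennreal ((norm (J f (p + r *\<^sub>R \<tau>)))\<^sup>2)) \<partial>lborel) \<partial>lborel)"
    by (rule lborel_pair.Fubini'[symmetric]) measurable
  also have "\<dots> = (\<integral>\<^sup>+r. indicator {0<..<1::real} r * (ennreal ((norm \<tau>)\<^sup>2) * (\<integral>\<^sup>+p. ennreal ((norm (J f p))\<^sup>2) \<partial>lborel)) \<partial>lborel)"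
    by (intro nn_integral_cong) (simp add: nn_integral_cmult tr)
  also have "\<dots> = ennreal ((norm \<tau>)\<^sup>2) * (\<integral>\<^sup>+p. ennreal ((norm (J f p))\<^sup>2) \<partial>lborel)"
    by (subst mult.commute) (simp add: nn_integral_cmult_indicator)
  finally show ?thesis .
qed

lemma RS_l2n_supp:
  fixes F :: "R2 => 'b::euclidean_space"
  assumes "U \<in> sets borel" "!!x. x \<notin> U ==> F x = 0"
  shows "l2n (RS U) F = l2n lborel F"
  unfolding l2n_def using RS_integral_supp[OF assms(1), of "%x. (norm (F x))\<^sup>2"] assms(2) by simp

text \<open>Averaging over boxes of side h moves the functions by at most 2 h K in L2, uniformly in
  n. The averages of a weakly null sequence tend to zero pointwise and are dominated, hence tend to
  zero in L2. First n grows, then h shrinks.\<close>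

lemma Rellich_testfn:
  assumes O: "O' \<in> sets borel" "bounded O'" and p: "!!n::nat. testfn O' (\<phi> n)"
    and K: "!!n. l2n (RS O') (J (\<phi> n)) <= K"
    and w: "!!q. sqi (RS O') q ==> (%n. LINT x|RS O'. \<phi> n x * q x) \<longlonglongrightarrow> 0"
  shows "(%n. l2n (RS O') (\<phi> n)) \<longlonglongrightarrow> 0"
proof -
  have K0: "0 <= K" using K[of 0] l2n_nonneg order_trans by blast
  have sm: "smooth (\<phi> n)" "Cc (\<phi> n)" "supp (\<phi> n) \<subseteq> O'" for n using p[of n] by (auto simp: testfn_def Cc_def)
  have z: "x \<notin> O' ==> J (\<phi> n) x = 0" "x \<notin> O' ==> \<phi> n x = 0" for n x
    using sm(3)[of n] J_supp_zero[of x "\<phi> n"] supp_zero[of x "\<phi> n"] by auto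
  have [measurable]: "\<phi> n \<in> borel_measurable borel" "J (\<phi> n) \<in> borel_measurable borel" for n
    by (rule borel_measurable_continuous_onI[OF smooth_continuous[OF sm(1)]], rule borel_measurable_continuous_onI[OF J_continuous[OF sm(1)]])
  have sJ: "sqi lborel (J (\<phi> n))" for n
    unfolding sqi_def
    by (auto intro!: integrable_compact_support[of _ "supp (\<phi> n)"] continuous_intros J_continuous sm simp: J_supp_zero)
       (use sm(2) in \<open>simp add: Cc_def\<close>)
  have s\<phi>: "sqi lborel (\<phi> n)" for n using sqi_pr(1)[OF sJ[of n]] by (simp add: pr_J)
  have nJ: "(\<integral>\<^sup>+p. ennreal ((norm (J (\<phi> n) p))\<^sup>2) \<partial>lborel) <= ennreal (K\<^sup>2)" for n
  proof -
    have "(\<integral>\<^sup>+p. ennreal ((norm (J (\<phi> n) p))\<^sup>2) \<partial>lborel) = ennreal ((l2n lborel (J (\<phi> n)))\<^sup>2)"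
      using nn_integral_eq_integral[OF sqi_integrable[OF sJ[of n]]] by (simp add: l2n_power2)
    also have "\<dots> = ennreal ((l2n (RS O') (J (\<phi> n)))\<^sup>2)" using RS_l2n_supp[OF O(1), of "J (\<phi> n)"] z by simp
    also have "\<dots> <= ennreal (K\<^sup>2)" using K[of n] by (intro ennreal_leI power_mono) auto
    finally show ?thesis .
  qed
  have main: "\<exists>m. m \<longlonglongrightarrow> 0 \<and> (\<forall>n. l2n lborel (\<phi> n) <= 2 * h * K + m n)" if h: "0 < h" "h <= 1" for h :: real
  proof -
    let ?B = "box (0, 0) (h, h) :: R2 set"
    have Bmeas: "emeasure lborel ?B = ennreal (h\<^sup>2)" "measure lborel ?B = h\<^sup>2"
    proof -
      have "box (0, 0) (h, h) = {0<..<h} \<times> {0<..<h}" by (auto simp: box_def Basis_prod_def)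
      then have "emeasure lborel ?B = emeasure (lborel \<Otimes>\<^sub>M lborel) ({0<..<h} \<times> {0<..<h})" by (simp add: lborel_prod)
      also have "\<dots> = ennreal h * ennreal h" using h by (subst lborel.emeasure_pair_measure_Times) auto
      finally show "emeasure lborel ?B = ennreal (h\<^sup>2)" using h by (simp add: power2_eq_square ennreal_mult)
      then show "measure lborel ?B = h\<^sup>2" by (simp add: measure_def)
    qed
    have Bn: "norm \<tau> <= 2 * h" if "\<tau> \<in> ?B" for \<tau>
      using that norm_Pair_le[of "fst \<tau>" "snd \<tau>"] by (cases \<tau>) (auto simp: box_def Basis_prod_def)
    \<comment> \<open>The average over the box with lower left corner p. For fixed p it pairs
      \<open>\<phi> n\<close> with a fixed indicator, so weak convergence sends it to zero.\<close>
    define m where "m n p = (LINT \<tau>|lborel. indicator ?B \<tau> * \<phi> n (p + \<tau>)) / h\<^sup>2" for n and p :: R2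
    have [measurable]: "m n \<in> borel_measurable borel" for n unfolding m_def by measurable
    have ci: "integrable lborel (%\<tau>. indicator ?B \<tau> * F \<tau>)" if "continuous_on UNIV F" for F :: "R2 => real"
      by (rule integrable_indicator_continuous[OF _ bounded_box that]) simp
    have cp: "continuous_on UNIV (%\<tau>. \<phi> n (p + \<tau>))" for n p
      by (rule continuous_on_compose2[OF smooth_continuous[OF sm(1)]]) (auto intro!: continuous_intros)
    have pt: "ennreal ((\<phi> n p - m n p)\<^sup>2) <= (\<integral>\<^sup>+\<tau>. indicator ?B \<tau> * ennreal ((\<phi> n (p + \<tau>) - \<phi> n p)\<^sup>2 / h\<^sup>2) \<partial>lborel)" for n p
    proof -
      have one: "(LINT \<tau>|lborel. indicator ?B \<tau> * c) = h\<^sup>2 * c" for c :: real using Bmeas by simp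
      have "\<phi> n p - m n p = (LINT \<tau>|lborel. indicator ?B \<tau> * (\<phi> n p - \<phi> n (p + \<tau>))) / h\<^sup>2"
        unfolding right_diff_distrib
        by (subst Bochner_Integration.integral_diff) (use h in \<open>auto intro!: ci cp continuous_intros simp: m_def one diff_divide_distrib Bmeas\<close>)
      moreover have "(LINT \<tau>|lborel. indicator ?B \<tau> * (\<phi> n p - \<phi> n (p + \<tau>)))\<^sup>2 <= h\<^sup>2 * (LINT \<tau>|lborel. indicator ?B \<tau> * (\<phi> n p - \<phi> n (p + \<tau>))\<^sup>2)"
      proof -
        let ?i = "indicator ?B :: R2 => real"
        have ii: "(%t. (norm (?i t))\<^sup>2) = ?i" by (auto simp: indicator_def)
        have s1: "sqi lborel ?i" unfolding sqi_def ii using Bmeas by (simp add: integrable_indicator_iff)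
        have e2: "(%\<tau>. (norm (?i \<tau> * (\<phi> n p - \<phi> n (p + \<tau>))))\<^sup>2) = (%\<tau>. ?i \<tau> * (\<phi> n p - \<phi> n (p + \<tau>))\<^sup>2)"
          by (auto simp: indicator_def)
        have s2: "sqi lborel (%\<tau>. ?i \<tau> * (\<phi> n p - \<phi> n (p + \<tau>)))"
          unfolding sqi_def e2 by (auto intro!: ci continuous_intros cp)
        have n1: "(l2n lborel ?i)\<^sup>2 = h\<^sup>2" unfolding l2n_power2 ii using Bmeas by simp
        have e3: "(%\<tau>. ?i \<tau> * (?i \<tau> * (\<phi> n p - \<phi> n (p + \<tau>)))) = (%\<tau>. ?i \<tau> * (\<phi> n p - \<phi> n (p + \<tau>)))"
          by (auto simp: indicator_def)
        have "\<bar>LINT \<tau>|lborel. ?i \<tau> * (\<phi> n p - \<phi> n (p + \<tau>))\<bar>\<^sup>2 <= (l2n lborel ?i * l2n lborel (%\<tau>. ?i \<tau> * (\<phi> n p - \<phi> n (p + \<tau>))))\<^sup>2"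
          using l2_Cauchy_Schwarz_real[OF s1 s2] unfolding e3 by (intro power_mono) auto
        also have "\<dots> = h\<^sup>2 * (LINT \<tau>|lborel. ?i \<tau> * (\<phi> n p - \<phi> n (p + \<tau>))\<^sup>2)"
          unfolding power_mult_distrib n1 unfolding l2n_power2 e2 ..
        finally show ?thesis by simp
      qed
      moreover have "x\<^sup>2 <= Q / c" if "x = I / c" "I\<^sup>2 <= c * Q" "0 < c" for x I Q c :: real
      proof -
        have "I = c * x" using that by simp
        then have "c * (c * x\<^sup>2) <= c * Q" using that(2) by (simp add: power2_eq_square mult_ac)
        then have "c * x\<^sup>2 <= Q" using that(3) by (rule mult_left_le_imp_le)
        then show ?thesis using that(3) by (simp add: pos_le_divide_eq mult.commute)
      qed
      ultimately have "(\<phi> n p - m n p)\<^sup>2 <= (LINT \<tau>|lborel. indicator ?B \<tau> * (\<phi> n p - \<phi> n (p + \<tau>))\<^sup>2) / h\<^sup>2"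
        using h by (meson zero_less_power)
      also have "\<dots> = (LINT \<tau>|lborel. indicator ?B \<tau> * ((\<phi> n (p + \<tau>) - \<phi> n p)\<^sup>2 / h\<^sup>2))"
        by (simp add: power2_commute[of "\<phi> n p"] flip: Bochner_Integration.integral_divide_zero)
      finally have "ennreal ((\<phi> n p - m n p)\<^sup>2) <= ennreal (LINT \<tau>|lborel. indicator ?B \<tau> * ((\<phi> n (p + \<tau>) - \<phi> n p)\<^sup>2 / h\<^sup>2))"
        by (rule ennreal_leI)
      also have "\<dots> = (\<integral>\<^sup>+\<tau>. ennreal (indicator ?B \<tau> * ((\<phi> n (p + \<tau>) - \<phi> n p)\<^sup>2 / h\<^sup>2)) \<partial>lborel)"
        by (rule nn_integral_eq_integral[symmetric]) (use h in \<open>auto intro!: ci continuous_intros cp\<close>)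
      also have "\<dots> = (\<integral>\<^sup>+\<tau>. indicator ?B \<tau> * ennreal ((\<phi> n (p + \<tau>) - \<phi> n p)\<^sup>2 / h\<^sup>2) \<partial>lborel)"
        by (intro nn_integral_cong) (auto simp: indicator_def)
      finally show ?thesis .
    qed
    have diff: "(\<integral>\<^sup>+p. ennreal ((\<phi> n p - m n p)\<^sup>2) \<partial>lborel) <= ennreal ((2 * h * K)\<^sup>2)" for n
    proof -
      have "(\<integral>\<^sup>+p. ennreal ((\<phi> n p - m n p)\<^sup>2) \<partial>lborel) <= (\<integral>\<^sup>+p. (\<integral>\<^sup>+\<tau>. indicator ?B \<tau> * ennreal ((\<phi> n (p + \<tau>) - \<phi> n p)\<^sup>2 / h\<^sup>2) \<partial>lborel) \<partial>lborel)"
        by (intro nn_integral_mono pt)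
      also have "\<dots> = (\<integral>\<^sup>+\<tau>. (\<integral>\<^sup>+p. indicator ?B \<tau> * ennreal ((\<phi> n (p + \<tau>) - \<phi> n p)\<^sup>2 / h\<^sup>2) \<partial>lborel) \<partial>lborel)"
        by (rule lborel_pair.Fubini'[symmetric]) measurable
      also have "\<dots> <= (\<integral>\<^sup>+\<tau>. ennreal ((2 * h * K)\<^sup>2 / h\<^sup>2) * indicator ?B \<tau> \<partial>lborel)"
      proof (rule nn_integral_mono)
        fix \<tau> :: R2
        have "(\<integral>\<^sup>+p. ennreal ((\<phi> n (p + \<tau>) - \<phi> n p)\<^sup>2 / h\<^sup>2) \<partial>lborel) <= ennreal ((2 * h * K)\<^sup>2 / h\<^sup>2)" if t: "\<tau> \<in> ?B"
        proof -
          have "(\<integral>\<^sup>+p. ennreal ((\<phi> n (p + \<tau>) - \<phi> n p)\<^sup>2 / h\<^sup>2) \<partial>lborel) = (\<integral>\<^sup>+p. ennreal (1 / h\<^sup>2) * ennreal ((\<phi> n (p + \<tau>) - \<phi> n p)\<^sup>2) \<partial>lborel)"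
            by (intro nn_integral_cong) (simp flip: ennreal_mult)
          also have "\<dots> = ennreal (1 / h\<^sup>2) * (\<integral>\<^sup>+p. ennreal ((\<phi> n (p + \<tau>) - \<phi> n p)\<^sup>2) \<partial>lborel)"
            by (rule nn_integral_cmult) measurable
          also have "\<dots> <= ennreal (1 / h\<^sup>2) * (ennreal ((2 * h)\<^sup>2) * ennreal (K\<^sup>2))"
            by (intro mult_left_mono order_trans[OF translation_estimate[OF sm(2)]] mult_mono nJ ennreal_leI power_mono Bn[OF t]) auto
          also have "\<dots> = ennreal ((2 * h * K)\<^sup>2 / h\<^sup>2)"
            using h K0 by (simp add: power_mult_distrib flip: ennreal_mult)
          finally show ?thesis .
        qed
        then show "(\<integral>\<^sup>+p. indicator ?B \<tau> * ennreal ((\<phi> n (p + \<tau>) - \<phi> n p)\<^sup>2 / h\<^sup>2) \<partial>lborel) <= ennreal ((2 * h * K)\<^sup>2 / h\<^sup>2) * indicator ?B \<tau>"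
          by (cases "\<tau> \<in> ?B") auto
      qed
      also have "\<dots> = ennreal ((2 * h * K)\<^sup>2 / h\<^sup>2) * ennreal (h\<^sup>2)"
        using Bmeas by (subst nn_integral_cmult_indicator) auto
      also have "\<dots> = ennreal ((2 * h * K)\<^sup>2)" using h by (simp flip: ennreal_mult)
      finally show ?thesis .
    qed
    have sd: "sqi lborel (%p. \<phi> n p - m n p)" for n
      unfolding sqi_def integrable_iff_bounded using le_less_trans[OF diff[of n]] by auto
    have nd: "l2n lborel (%p. \<phi> n p - m n p) <= 2 * h * K" for n
    proof -
      have "ennreal ((l2n lborel (%p. \<phi> n p - m n p))\<^sup>2) <= ennreal ((2 * h * K)\<^sup>2)"
        using diff[of n] nn_integral_eq_integral[OF sqi_integrable[OF sd[of n]]] by (simp add: l2n_power2)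
      then have "(l2n lborel (%p. \<phi> n p - m n p))\<^sup>2 <= (2 * h * K)\<^sup>2" by (subst (asm) ennreal_le_iff) auto
      then show ?thesis by (rule power2_le_imp_le) (use h K0 in simp)
    qed
    have smn: "sqi lborel (m n)" for n using sqi_diff[OF s\<phi>[of n] sd[of n]] by simp
    obtain R where R: "!!x. x \<in> O' ==> norm x <= R" using O(2) by (auto simp: bounded_iff)
    \<comment> \<open>Vectors in the box have norm at most 2 h \<le> 2, so the averages vanish
      outside this ball; a multiple of its indicator dominates them.\<close>
    let ?S = "cball 0 (R + 2) :: R2 set"
    have bS: "sqi lborel (%p. (K / h) * indicator ?S p :: real)"
    proof (rule sqi_cmult)
      have "(%t. (norm (indicator ?S t :: real))\<^sup>2) = indicator ?S" by (auto simp: indicator_def)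
      then show "sqi lborel (indicator ?S :: R2 => real)"
        using emeasure_bounded_finite[OF bounded_cball, of 0 "R+2"]
        by (auto simp: sqi_def integrable_indicator_iff intro!: borel_measurable_indicator)
    qed
    have shift: "m n p = (LINT x|RS O'. \<phi> n x * indicator ?B (x - p)) / h\<^sup>2" for n p
    proof -
      have "(LINT \<tau>|lborel. indicator ?B \<tau> * \<phi> n (p + \<tau>)) = (LINT x|distr lborel borel ((+) p). indicator ?B (x - p) * \<phi> n x)"
        by (subst integral_distr) auto
      also have "\<dots> = (LINT x|lborel. \<phi> n x * indicator ?B (x - p))" by (simp add: lborel_distr_plus mult.commute)
      also have "\<dots> = (LINT x|RS O'. \<phi> n x * indicator ?B (x - p))"
        by (rule RS_integral_supp[OF O(1), symmetric]) (simp add: z)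
      finally show ?thesis by (simp add: m_def)
    qed
    have qB: "sqi (RS O') (%x. indicator ?B (x - p) :: real)" "l2n (RS O') (%x. indicator ?B (x - p) :: real) <= h" for p
    proof -
      interpret finite_measure "RS O'" by (rule RS_finite[OF O])
      have mm: "(%x. indicator ?B (x - p) :: real) \<in> borel_measurable (RS O')"
        by (rule RS_measurable) measurable
      show s: "sqi (RS O') (%x. indicator ?B (x - p) :: real)"
        by (rule sqi_bound[OF mm, of "%x. 1::real" 1]) (auto simp: sqi_def indicator_def)
      have e: "(%x. (norm (indicator ?B (x - p) :: real))\<^sup>2) = (%x. indicator ?B (x - p))" by (auto simp: indicator_def)
      have "(l2n (RS O') (%x. indicator ?B (x - p) :: real))\<^sup>2 = (LINT x|lborel. indicator O' x * indicator ?B (x - p))"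
        unfolding l2n_power2 e using O(1) by (simp add: integral_restrict_space)
      also have "\<dots> <= (LINT x|lborel. indicator ?B (x - p))"
      proof (rule integral_mono)
        have i: "integrable lborel (%x. indicator ((+) p ` ?B) x :: real)"
          using emeasure_bounded_finite[OF bounded_translation[OF bounded_box], of p "(0,0)" "(h,h)"]
            open_translation[OF open_box, of p "(0,0)" "(h,h)"] by (simp add: integrable_indicator_iff)
        have e': "indicator ?B (x - p) = (indicator ((+) p ` ?B) x :: real)" for x
          by (auto simp: indicator_def image_iff algebra_simps intro!: bexI[of _ "x - p"])
        show "integrable lborel (%x. indicator ?B (x - p) :: real)" unfolding e' by (rule i)
        then show "integrable lborel (%x. indicator O' x * indicator ?B (x - p) :: real)"
          using integrable_mult_indicator[of O' lborel "%x. indicator ?B (x - p) :: real"] O(1) by simp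
      qed (auto simp: indicator_def)
      also have "\<dots> = (LINT x|distr lborel borel ((+) p). indicator ?B (x - p))" by (simp add: lborel_distr_plus)
      also have "\<dots> = (LINT x|lborel. indicator ?B x)" by (subst integral_distr) auto
      also have "\<dots> = h\<^sup>2" using Bmeas by simp
      finally show "l2n (RS O') (%x. indicator ?B (x - p) :: real) <= h" by (rule power2_le_imp_le) (use h in simp)
    qed
    have s\<phi>O: "sqi (RS O') (\<phi> n)" and n\<phi>O: "l2n (RS O') (\<phi> n) <= K" for n
      using sqi_pr(1,4)[OF sqi_J[OF O sm(1)[of n]]] K[of n] by (auto simp: pr_J intro: order_trans)
    have mb: "\<bar>m n p\<bar> <= (K / h) * indicator ?S p" for n p
    proof (cases "p \<in> ?S")
      case True
      have "\<bar>m n p\<bar> <= (K * h) / h\<^sup>2"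
        unfolding shift abs_divide using h
        by (intro divide_mono order_trans[OF l2_Cauchy_Schwarz_real[OF s\<phi>O qB(1)]] mult_mono n\<phi>O qB(2)) (auto simp: K0)
      then show ?thesis using True h by (simp add: power2_eq_square)
    next
      case False
      have "indicator ?B \<tau> * \<phi> n (p + \<tau>) = 0" for \<tau>
      proof (cases "\<tau> \<in> ?B")
        case True
        have "norm \<tau> <= 2" using Bn[OF True] h by linarith
        then have "norm (p + \<tau>) > R" using False norm_triangle_ineq4[of "p + \<tau>" \<tau>] by auto
        then have "p + \<tau> \<notin> O'" using R[of "p + \<tau>"] by linarith
        then show ?thesis using z(2)[of "p + \<tau>" n] by simp
      qed simp
      then have "(%\<tau>. indicator ?B \<tau> * \<phi> n (p + \<tau>)) = (%\<tau>. 0)" by (rule ext)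
      then show ?thesis using False by (simp only: m_def) simp
    qed
    have "(%n. l2n lborel (m n)) \<longlonglongrightarrow> 0"
    proof (rule l2n_dominated[OF _ bS])
      show "AE x in lborel. norm (m n x) <= norm ((K / h) * indicator ?S x :: real)" for n
        using mb[of n] h K0 by (auto simp: abs_mult)
      show "AE x in lborel. (%n. m n x) \<longlonglongrightarrow> 0"
        unfolding shift using tendsto_divide[OF w[OF qB(1)] tendsto_const[of "h\<^sup>2"]] h by auto
    qed measurable
    moreover have "l2n lborel (\<phi> n) <= 2 * h * K + l2n lborel (m n)" for n
      using l2n_triangle[OF sd[of n] smn[of n]] nd[of n] by simp
    ultimately show ?thesis by blast
  qed
  have eq: "l2n (RS O') (\<phi> n) = l2n lborel (\<phi> n)" for n by (rule RS_l2n_supp[OF O(1)]) (rule z(2))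
  show ?thesis
  proof (rule LIMSEQ_I)
    fix e :: real assume e: "0 < e"
    \<comment> \<open>Makes the averaging error 2 h K at most e / 2; K + 1 stands in for K to
      exclude division by zero.\<close>
    define h where "h = min 1 (e / (4 * (K + 1)))"
    have h: "0 < h" "h <= 1" using e K0 by (auto simp: h_def add_nonneg_pos)
    have "2 * h * K <= 2 * (e / (4 * (K + 1))) * K" using K0 by (intro mult_right_mono mult_left_mono) (auto simp: h_def)
    also have "\<dots> <= e / 2" using e K0 by (simp add: field_simps)
    finally have hK: "2 * h * K <= e / 2" .
    obtain m where m: "m \<longlonglongrightarrow> 0" "!!n. l2n lborel (\<phi> n) <= 2 * h * K + m n" using main[OF h] by blast
    have "eventually (%n. m n < e / 2) sequentially" using order_tendstoD(2)[OF m(1), of "e/2"] e by simp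
    then obtain N where N: "!!n. n \<ge> N ==> m n < e / 2" by (auto simp: eventually_sequentially)
    have "norm (l2n (RS O') (\<phi> n) - 0) < e" if "n \<ge> N" for n
      using m(2)[of n] N[OF that] hK unfolding eq by simp
    then show "\<exists>no. \<forall>n\<ge>no. norm (l2n (RS O') (\<phi> n) - 0) < e" by blast
  qed
qed

text \<open>Weak convergence is given only against \<open>H10\<close> functions in the H^1 product.
  On the closure of the test jets, pairing with an arbitrary q equals pairing with the Riesz
  representative, which is the jet of some \<open>wh\<close> in \<open>H10\<close>.\<close>

lemma H10_weak_convergence:
  assumes O: "open O'" "bounded O'" and v: "!!n. H10 O' (v n)" "H10 O' v0"
    and w: "!!w. H10 O' w ==> (%n. H1ip O' (v n) w) \<longlonglongrightarrow> H1ip O' v0 w" and q: "sqi (RS O') q"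
  shows "(%n. LINT x|RS O'. JW O' (v n) x \<bullet> q x) \<longlonglongrightarrow> (LINT x|RS O'. JW O' v0 x \<bullet> q x)"
proof -
  have Ob: "O' \<in> sets borel" using O by simp
  let ?D = "{J \<phi> |\<phi>. testfn O' \<phi>}" and ?l = "%f. LINT x|RS O'. q x \<bullet> f x"
  have sD: "sqi (RS O') f" if "f \<in> ?D" for f using that sqi_J[OF Ob O(2) testfn_smooth] by auto
  obtain w W where W: "!!k::nat. W k \<in> ?D" "sqi (RS O') w" "l2conv (RS O') W w"
    "!!f. f \<in> ?D ==> (LINT x|RS O'. w x \<bullet> f x) = ?l f"
  proof (rule l2_Riesz[OF RS_finite[OF Ob O(2)], of ?D ?l "l2n (RS O') q"])
    show "?D \<noteq> {}" using testfn_zero by blast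
    show "(%x. f x + c *\<^sub>R g x) \<in> ?D" if "f \<in> ?D" "g \<in> ?D" for f g c
    proof -
      from that obtain a b where ab: "f = J a" "g = J b" "testfn O' a" "testfn O' b" by blast
      then have "(%x. f x + c *\<^sub>R g x) = J (%x. a x + c * b x)"
        by (simp add: J_comb[OF testfn_smooth[OF ab(3)] testfn_smooth[OF ab(4)]] fun_eq_iff)
      then show ?thesis using testfn_comb[OF ab(3,4)] by blast
    qed
    show "?l (%x. f x + c *\<^sub>R g x) = ?l f + c * ?l g" if "f \<in> ?D" "g \<in> ?D" for f g c
      unfolding inner_add_right inner_scaleR_right
      using sqi_inner[OF q sD[OF that(1)]] sqi_inner[OF q sD[OF that(2)]] by simp
  qed (use sD l2_Cauchy_Schwarz[OF q] in auto)
  have "\<forall>k. \<exists>\<phi>. testfn O' \<phi> \<and> W k = J \<phi>" using W(1) by blast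
  from choice[OF this] obtain \<phi> where p: "!!k. testfn O' (\<phi> k)" "!!k. W k = J (\<phi> k)" by blast
  have HHw: "HH O' w" by (rule HH_I[OF W(2) p(1)]) (use W(3) p(2) in simp)
  define wh where "wh = (%x. if x \<in> O' then pr0 (w x) else 0)"
  note wh = HH_H10[OF O HHw wh_def]
  have key: "(LINT x|RS O'. JW O' u x \<bullet> q x) = H1ip O' u wh" if u: "H10 O' u" for u
  proof -
    note h = H10_HH[OF O u]
    have su: "sqi (RS O') (JW O' u)" using h(1) by (simp add: HH_def)
    obtain \<psi> where ps: "!!k::nat. testfn O' (\<psi> k)" "l2conv (RS O') (%k. J (\<psi> k)) (JW O' u)"
      using HH_seq[OF h(1)] by blast
    have js: "sqi (RS O') (J (\<psi> k))" for k by (rule sD) (use ps in blast)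
    have A: "(%k. LINT x|RS O'. J (\<psi> k) x \<bullet> q x) \<longlonglongrightarrow> (LINT x|RS O'. JW O' u x \<bullet> q x)"
      by (rule tendsto_integral_l2[OF js su ps(2) q])
    have B: "(%k. LINT x|RS O'. J (\<psi> k) x \<bullet> w x) \<longlonglongrightarrow> (LINT x|RS O'. JW O' u x \<bullet> w x)"
      by (rule tendsto_integral_l2[OF js su ps(2) W(2)])
    have "J (\<psi> k) \<in> ?D" for k using ps(1) by blast
    from W(4)[OF this] have "(LINT x|RS O'. J (\<psi> k) x \<bullet> q x) = (LINT x|RS O'. J (\<psi> k) x \<bullet> w x)" for k
      by (simp add: inner_commute)
    then have "(LINT x|RS O'. JW O' u x \<bullet> q x) = (LINT x|RS O'. JW O' u x \<bullet> w x)"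
      using LIMSEQ_unique[OF A] B by simp
    also have "\<dots> = H1ip O' u wh"
      unfolding H1ip_JW[OF Ob]
    proof (rule integral_cong_AE)
      have "sqi (RS O') (JW O' wh)" using H10_HH[OF O wh(1)] by (simp add: HH_def)
      then show "(%x. JW O' u x \<bullet> w x) \<in> borel_measurable (RS O')" "(%x. JW O' u x \<bullet> JW O' wh x) \<in> borel_measurable (RS O')"
        using su W(2) by (auto simp: sqi_def)
      show "AE x in RS O'. JW O' u x \<bullet> w x = JW O' u x \<bullet> JW O' wh x" using wh(2) by eventually_elim simp
    qed
    finally show ?thesis .
  qed
  show ?thesis using w[OF wh(1)] by (simp add: key v)
qed

section \<open>Estimates near the slip boundary\<close>

text \<open>A cutoff in y - \<alpha>(x) would be only as regular as \<alpha>. A polynomial with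
  nearby derivative and the same value at 0 replaces \<alpha> and stays within \<delta>/2 of it; the
  gap between the widths \<delta>/2 and 3 \<delta> absorbs this error.\<close>

lemma smooth_cutoff_near_curve:
  assumes d: "!!x. x \<in> {0..1} ==> (\<alpha> has_real_derivative \<alpha>' x) (at x within {0..1})" and c: "continuous_on {0..1} \<alpha>'"
  obtains C where "0 < C" "!!\<delta>. 0 < \<delta> ==> \<delta> <= 1 ==> \<exists>M. smooth M \<and>
      (\<forall>x y. x \<in> {0..1} --> \<bar>y - \<alpha> x\<bar> <= \<delta> / 2 --> M (x, y) = 1) \<and>
      (\<forall>x y. x \<in> {0..1} --> 3 * \<delta> <= \<bar>y - \<alpha> x\<bar> --> J M (x, y) = 0) \<and>
      (\<forall>p. 0 <= M p \<and> M p <= 1) \<and>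
      (\<forall>x y. x \<in> {0..1} --> \<bar>pd e1 M (x, y)\<bar> <= C / \<delta> \<and> \<bar>pd e2 M (x, y)\<bar> <= C / \<delta>)"
proof -
  obtain \<theta> d' C0 where t: "!!t. (\<theta> has_real_derivative d' t) (at t)" "!!t. \<bar>d' t\<bar> <= C0" "0 < C0"
    "!!t. 0 <= \<theta> t" "!!t. \<theta> t <= 1" "!!t. \<bar>t\<bar> <= 1 ==> \<theta> t = 1" "!!t. 2 <= \<bar>t\<bar> ==> \<theta> t = 0"
    "!!t. 2 <= \<bar>t\<bar> ==> d' t = 0" "!!f. smooth f ==> smooth (%x. \<theta> (f x))"
    by (rule smooth_cutoff_exists) (rule that, assumption+)
  have "compact (\<alpha>' ` {0..1})" by (intro compact_continuous_image c) simp
  then obtain A where "\<forall>y\<in>\<alpha>' ` {0..1}. norm y <= A" using compact_imp_bounded bounded_iff by blast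
  then have A: "\<bar>\<alpha>' x\<bar> <= A" if "x \<in> {0..1}" for x using that by auto
  have A0: "0 <= A" using A[of 0] by auto
  \<comment> \<open>C0 bounds the derivative of the profile and A + 1 the slope of the polynomial;
    neither depends on \<delta>.\<close>
  let ?C = "C0 * (A + 1)"
  show ?thesis
  proof (rule that[of ?C])
    show "0 < ?C" using t(3) A0 by simp
    fix \<delta> :: real assume \<delta>: "0 < \<delta>" "\<delta> <= 1"
    obtain q where q: "real_polynomial_function q" "!!x. x \<in> {0..1} ==> \<bar>\<alpha>' x - q x\<bar> < \<delta> / 2"
      using Stone_Weierstrass_real_polynomial_function[OF compact_Icc c, of "\<delta>/2"] \<delta> by auto
    obtain P where P: "real_polynomial_function P" "!!x. (P has_real_derivative q x) (at x)"
      using real_poly_antiderivative[OF q(1)] by blast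
    define a where "a x = P x + (\<alpha> 0 - P 0)" for x
    have ra: "real_polynomial_function a" unfolding a_def
      by (rule real_polynomial_function.intros(3)[OF P(1) real_polynomial_function.intros(2)])
    have da: "(a has_real_derivative q x) (at x)" for x unfolding a_def
      using DERIV_add[OF P(2) DERIV_const] by simp
    have close: "\<bar>a x - \<alpha> x\<bar> <= \<delta> / 2" if x: "x \<in> {0..1}" for x
    proof -
      have "norm ((a x - \<alpha> x) - (a 0 - \<alpha> 0)) <= \<delta> / 2 * norm (x - 0)"
      proof (rule field_differentiable_bound[of "{0..1}"])
        show "((%x. a x - \<alpha> x) has_field_derivative (q z - \<alpha>' z)) (at z within {0..1})" if "z \<in> {0..1}" for z
          by (intro DERIV_diff has_field_derivative_at_within[OF da] d that)
        show "norm (q z - \<alpha>' z) <= \<delta> / 2" if "z \<in> {0..1}" for z using q(2)[OF that] by (simp add: abs_minus_commute)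
      qed (use x in auto)
      also have "\<dots> <= \<delta> / 2 * 1" using x \<delta> by (intro mult_left_mono) auto
      finally show ?thesis by (simp add: a_def)
    qed
    have qb: "\<bar>q x\<bar> <= A + 1" if "x \<in> {0..1}" for x using q(2)[OF that] A[OF that] \<delta> by linarith
    let ?g = "%p::R2. (snd p - a (fst p)) / \<delta>"
    define M where "M p = \<theta> (?g p)" for p
    have smg: "smooth ?g"
      using smooth_cmult[OF smooth_diff[OF smooth_snd smooth_polynomial[OF ra smooth_fst]], of "1/\<delta>"] by simp
    have sm: "smooth M" unfolding M_def by (rule t(9)[OF smg])
    have pdM: "pd e M p = d' (?g p) * ((snd e - q (fst p) * fst e) / \<delta>)" for e p
    proof (rule pd_eqI)
      have 1: "((%x. a (fst x)) has_derivative (%v. q (fst p) * fst v)) (at p)"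
        using has_derivative_compose[OF bounded_linear_imp_has_derivative[OF bounded_linear_fst], of a "(*) (q (fst p))" p] da[of "fst p"]
        by (simp add: has_field_derivative_def)
      have 2: "(?g has_derivative (%v. (snd v - q (fst p) * fst v) / \<delta>)) (at p)"
        using has_derivative_mult_right[OF has_derivative_diff[OF bounded_linear_imp_has_derivative[OF bounded_linear_snd] 1], of "1/\<delta>"] by simp
      show "(M has_derivative (%v. d' (?g p) * ((snd v - q (fst p) * fst v) / \<delta>))) (at p)"
        unfolding M_def using has_derivative_compose[OF 2, of \<theta> "(*) (d' (?g p))"] t(1)[of "?g p"]
        by (simp add: has_field_derivative_def)
    qed
    have g1: "\<bar>?g (x, y)\<bar> <= 1" if "x \<in> {0..1}" "\<bar>y - \<alpha> x\<bar> <= \<delta> / 2" for x y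
    proof -
      have "\<bar>y - a x\<bar> <= \<delta>" using close[OF that(1)] that(2) by linarith
      then show ?thesis using \<delta> by (simp add: abs_divide)
    qed
    have g2: "2 <= \<bar>?g (x, y)\<bar>" if "x \<in> {0..1}" "3 * \<delta> <= \<bar>y - \<alpha> x\<bar>" for x y
    proof -
      have "2 * \<delta> <= \<bar>y - a x\<bar>" using close[OF that(1)] that(2) \<delta> by linarith
      then show ?thesis using \<delta> by (simp add: abs_divide field_simps)
    qed
    have pb: "\<bar>pd e1 M (x, y)\<bar> <= ?C / \<delta>" "\<bar>pd e2 M (x, y)\<bar> <= ?C / \<delta>" if x: "x \<in> {0..1}" for x y
    proof -
      have "\<bar>d' (?g (x, y))\<bar> * \<bar>q x\<bar> <= C0 * (A + 1)" "\<bar>d' (?g (x, y))\<bar> * 1 <= C0 * (A + 1)"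
        using t(2,3) qb[OF x] A0 by (auto intro!: mult_mono simp del: mult_1_right)
      then show "\<bar>pd e1 M (x, y)\<bar> <= ?C / \<delta>" "\<bar>pd e2 M (x, y)\<bar> <= ?C / \<delta>"
        unfolding pdM using \<delta> by (simp_all add: abs_mult divide_right_mono)
    qed
    show "\<exists>M. smooth M \<and>
      (\<forall>x y. x \<in> {0..1} --> \<bar>y - \<alpha> x\<bar> <= \<delta> / 2 --> M (x, y) = 1) \<and>
      (\<forall>x y. x \<in> {0..1} --> 3 * \<delta> <= \<bar>y - \<alpha> x\<bar> --> J M (x, y) = 0) \<and>
      (\<forall>p. 0 <= M p \<and> M p <= 1) \<and>
      (\<forall>x y. x \<in> {0..1} --> \<bar>pd e1 M (x, y)\<bar> <= ?C / \<delta> \<and> \<bar>pd e2 M (x, y)\<bar> <= ?C / \<delta>)"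
    proof (intro exI[of _ M] conjI allI impI sm)
      fix x y :: real assume x: "x \<in> {0..1}"
      show "M (x, y) = 1" if "\<bar>y - \<alpha> x\<bar> <= \<delta> / 2" unfolding M_def by (rule t(6)[OF g1[OF x that]])
      show "J M (x, y) = 0" if "3 * \<delta> <= \<bar>y - \<alpha> x\<bar>"
        using t(7,8)[OF g2[OF x that]] unfolding J_def pdM by (simp add: M_def zero_prod_def)
      show "\<bar>pd e1 M (x, y)\<bar> <= ?C / \<delta>" "\<bar>pd e2 M (x, y)\<bar> <= ?C / \<delta>" by (rule pb[OF x])+
    qed (auto simp: M_def t)
  qed
qed

section \<open>Strips, shifted traces, Lipschitz multipliers and the Poincare inequality\<close>

context holdall
begin

definition strip :: "(real => real) => real => R2 set" where
  "strip \<alpha> r = {x. 0 < fst x \<and> fst x < 1 \<and> \<bar>snd x - \<alpha> (fst x)\<bar> < r}"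

lemma strip_open: assumes "adm \<alpha>" shows "open (strip \<alpha> r)"
proof -
  define c where "c x = max 0 (min 1 x)" for x :: real
  have "continuous_on UNIV (%x. \<alpha> (c x))"
    by (rule continuous_on_compose2[of "{0..1}" \<alpha>])
       (use assms in \<open>auto simp: adm_def c_def intro!: continuous_intros\<close>)
  then have cc: "continuous_on UNIV (%x::R2. \<alpha> (c (fst x)))"
    by (rule continuous_on_compose2[of UNIV _ UNIV fst]) (auto intro: continuous_intros)
  have "strip \<alpha> r = {x. 0 < fst x} \<inter> {x. fst x < 1} \<inter> {x. \<bar>snd x - \<alpha> (c (fst x))\<bar> < r}"
    by (auto simp: strip_def c_def max_def min_def)
  also have "open \<dots>" by (intro open_Int open_Collect_less cc continuous_intros)
  finally show ?thesis .
qed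

lemma strip_bounded: assumes "adm \<alpha>" shows "bounded (strip \<alpha> r)"
proof (rule bounded_subset[of "{0..1} \<times> {amin - r..amax + r}"])
  show "bounded ({0..1::real} \<times> {amin - r..amax + r})" by (intro bounded_Times bounded_closed_interval)
  show "strip \<alpha> r \<subseteq> {0..1} \<times> {amin - r..amax + r}"
  proof
    fix x assume x: "x \<in> strip \<alpha> r"
    then have "amin <= \<alpha> (fst x)" "\<alpha> (fst x) <= amax" using assms by (auto simp: adm_def strip_def)
    then show "x \<in> {0..1} \<times> {amin - r..amax + r}" using x by (cases x) (auto simp: strip_def)
  qed
qed

lemma integrable_open_slice:
  fixes F :: "R2 => real"
  assumes "continuous_on UNIV F"
  shows "integrable lborel (%y. indicator {a<..<b} y * F (s, y))"
  by (rule integrable_interval_continuous[OF continuous_slice(1)[OF assms]])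

text \<open>At distance below r from the curve, the square of f is at most twice the squared trace
  plus 2 r times the slice integral of the squared vertical derivative; the slice has length 2
  r.\<close>

lemma Hardy_strip:
  assumes a: "adm \<alpha>" and p: "testfn O' f" and r: "0 < r"
  shows "(l2n (RS (strip \<alpha> r \<inter> O')) f)\<^sup>2 <= 4 * r * (l2n M1 (%s. f (s, \<alpha> s)))\<^sup>2 + 4 * r\<^sup>2 * (l2n (RS (strip \<alpha> r \<inter> O')) (pd e2 f))\<^sup>2"
proof -
  let ?P = "strip \<alpha> r"
  have f: "smooth f" by (rule testfn_smooth[OF p])
  have cf: "continuous_on UNIV f" and cd: "continuous_on UNIV (pd e2 f)"
    using f by (auto intro: smooth_continuous smooth_pd)
  have c2: "continuous_on UNIV (%x. (f x)\<^sup>2)" "continuous_on UNIV (%x. (pd e2 f x)\<^sup>2)" by (intro continuous_intros cf cd)+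
  have Pb: "?P \<in> sets borel" using strip_open[OF a] by simp
  have POb: "?P \<inter> O' \<in> sets borel" using Pb O_borel by blast
  have eq: "(l2n (RS (?P \<inter> O')) g)\<^sup>2 = (LINT x|lborel. indicator ?P x * (g x)\<^sup>2)" if "!!x. x \<notin> O' ==> g x = 0" for g :: "R2 => real"
  proof -
    have "(%x. indicator (?P \<inter> O') x *\<^sub>R (norm (g x))\<^sup>2) = (%x. indicator ?P x * (g x)\<^sup>2)"
      using that by (auto simp: indicator_def fun_eq_iff)
    then show ?thesis using POb by (simp add: l2n_power2 integral_restrict_space)
  qed
  have z: "x \<notin> O' ==> f x = 0" "x \<notin> O' ==> pd e2 f x = 0" for x
    using p supp_zero[of x f] pd_supp_zero[of x f] by (auto simp: testfn_def)
  have i1: "integrable lborel (%x. indicator ?P x * (f x)\<^sup>2)" and i2: "integrable lborel (%x. indicator ?P x * (pd e2 f x)\<^sup>2)"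
    by (rule integrable_indicator_continuous[OF Pb strip_bounded[OF a] c2(1)], rule integrable_indicator_continuous[OF Pb strip_bounded[OF a] c2(2)])
  have sl: "indicator ?P (s, y) = (indicator {\<alpha> s - r<..<\<alpha> s + r} y :: real)" if "0 < s" "s < 1" for s y
    using that by (auto simp: strip_def indicator_def)
  have si: "integrable M1 (%s. LINT y|lborel. indicator ?P (s, y) * (f (s, y))\<^sup>2)"
    "(LINT s|M1. (LINT y|lborel. indicator ?P (s, y) * (f (s, y))\<^sup>2)) = (LINT x|lborel. indicator ?P x * (f x)\<^sup>2)"
  proof -
    have zz: "indicator ?P (s, y) * (f (s, y))\<^sup>2 = 0" if "\<not> (0 < s \<and> s < 1)" for s y
      using that by (auto simp: strip_def indicator_def)
    show "integrable M1 (%s. LINT y|lborel. indicator ?P (s, y) * (f (s, y))\<^sup>2)"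
      "(LINT s|M1. (LINT y|lborel. indicator ?P (s, y) * (f (s, y))\<^sup>2)) = (LINT x|lborel. indicator ?P x * (f x)\<^sup>2)"
      by (rule slice_integral[OF i1], erule zz)+
  qed
  have it: "integrable M1 (%s. (f (s, \<alpha> s))\<^sup>2)" using sqi_integrable[OF trace_sqi[OF a cf]] by simp
  have "(LINT s|M1. (LINT y|lborel. indicator ?P (s, y) * (f (s, y))\<^sup>2) - 4 * r * (f (s, \<alpha> s))\<^sup>2) <= (LINT x|lborel. 4 * r\<^sup>2 * (indicator ?P x * (pd e2 f x)\<^sup>2))"
  proof (rule slice_bound)
    show "integrable lborel (%x. 4 * r\<^sup>2 * (indicator ?P x * (pd e2 f x)\<^sup>2))" using i2 by simp
    show "integrable M1 (%s. (LINT y|lborel. indicator ?P (s, y) * (f (s, y))\<^sup>2) - 4 * r * (f (s, \<alpha> s))\<^sup>2)" using si(1) it by simp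
    fix s :: real assume s: "0 < s" "s < 1"
    let ?a = "\<alpha> s"
    define D where "D = (LINT y|lborel. indicator {?a - r<..<?a + r} y * (pd e2 f (s, y))\<^sup>2)"
    have mono: "(LINT y|lborel. indicator {u<..<v} y * (pd e2 f (s, y))\<^sup>2) <= D" if "?a - r <= u" "v <= ?a + r" for u v
      unfolding D_def by (rule integral_mono[OF integrable_open_slice[OF c2(2)] integrable_open_slice[OF c2(2)]])
         (use that in \<open>auto simp: indicator_def\<close>)
    have D0: "0 <= D" unfolding D_def by (intro integral_nonneg_AE) auto
    have pt: "(f (s, y))\<^sup>2 <= 2 * (f (s, ?a))\<^sup>2 + 2 * r * D" if y: "y \<in> {?a - r<..<?a + r}" for y
    proof -
      have "(f (s, y) - f (s, ?a))\<^sup>2 <= r * D"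
      proof (cases "?a <= y")
        case True
        have "(f (s, y) - f (s, ?a))\<^sup>2 <= (y - ?a) * (LINT t|lborel. indicator {?a<..<y} t * (pd e2 f (s, t))\<^sup>2)"
          by (rule segment_Cauchy_Schwarz[OF has_derivative_slice2[OF f] continuous_slice(1)[OF cd] True])
        also have "\<dots> <= r * D" using y True r D0 by (intro mult_mono mono integral_nonneg_AE) auto
        finally show ?thesis .
      next
        case False
        then have le: "y <= ?a" by simp
        have "(f (s, ?a) - f (s, y))\<^sup>2 <= (?a - y) * (LINT t|lborel. indicator {y<..<?a} t * (pd e2 f (s, t))\<^sup>2)"
          by (rule segment_Cauchy_Schwarz[OF has_derivative_slice2[OF f] continuous_slice(1)[OF cd] le])
        also have "\<dots> <= r * D" using y le r D0 by (intro mult_mono mono integral_nonneg_AE) auto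
        finally show ?thesis by (simp add: power2_commute)
      qed
      moreover have "(f (s, y))\<^sup>2 <= 2 * (f (s, ?a))\<^sup>2 + 2 * (f (s, y) - f (s, ?a))\<^sup>2"
        using norm_add_power2_le[of "f (s, ?a)" "f (s, y) - f (s, ?a)"] by simp
      ultimately show ?thesis by linarith
    qed
    let ?I = "indicator {?a - r<..<?a + r} :: real => real"
    have "(LINT y|lborel. indicator ?P (s, y) * (f (s, y))\<^sup>2) = (LINT y|lborel. ?I y * (f (s, y))\<^sup>2)" by (simp add: sl[OF s])
    also have "\<dots> <= (LINT y|lborel. ?I y * (2 * (f (s, ?a))\<^sup>2 + 2 * r * D))"
      by (rule integral_mono[OF integrable_open_slice[OF c2(1)] integrable_interval_continuous[OF continuous_on_const]])
         (use pt in \<open>auto simp: indicator_def\<close>)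
    also have "\<dots> = 2 * r * (2 * (f (s, ?a))\<^sup>2 + 2 * r * D)" using r by simp
    finally have "(LINT y|lborel. indicator ?P (s, y) * (f (s, y))\<^sup>2) - 4 * r * (f (s, ?a))\<^sup>2 <= 4 * r\<^sup>2 * D"
      by (simp add: power2_eq_square algebra_simps)
    also have "\<dots> = (LINT y|lborel. 4 * r\<^sup>2 * (indicator ?P (s, y) * (pd e2 f (s, y))\<^sup>2))" by (simp add: D_def sl[OF s])
    finally show "(LINT y|lborel. indicator ?P (s, y) * (f (s, y))\<^sup>2) - 4 * r * (f (s, ?a))\<^sup>2 <= (LINT y|lborel. 4 * r\<^sup>2 * (indicator ?P (s, y) * (pd e2 f (s, y))\<^sup>2))" .
  qed (auto simp: indicator_def)
  then have "(LINT x|lborel. indicator ?P x * (f x)\<^sup>2) <= 4 * r * (LINT s|M1. (f (s, \<alpha> s))\<^sup>2) + 4 * r\<^sup>2 * (LINT x|lborel. indicator ?P x * (pd e2 f x)\<^sup>2)"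
    using si it by simp
  then show ?thesis using eq[OF z(1)] eq[OF z(2)] by (simp add: l2n_power2)
qed

text \<open>With zero trace the values gain a factor r over the derivatives, exactly what offsets a
  cutoff gradient of order 1/r.\<close>

lemma TT_Hardy:
  assumes a: "adm \<alpha>" and T: "TT \<alpha> V t" and t0: "AE s in M1. t s = 0" and r: "0 < r"
  shows "l2n (RS (strip \<alpha> r \<inter> O')) (%x. pr0 (V x)) <= 2 * r * l2n (RS (strip \<alpha> r \<inter> O')) (%x. pr2 (V x))"
proof -
  let ?S = "RS (strip \<alpha> r \<inter> O')"
  have Sb: "strip \<alpha> r \<inter> O' \<in> sets borel" "bounded (strip \<alpha> r \<inter> O')"
    using strip_open[OF a] bddO by auto
  obtain \<phi> where p: "!!k::nat. testfn O' (\<phi> k)" "l2conv RO (%k. J (\<phi> k)) V"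
    "l2conv M1 (%k s. \<phi> k (s, \<alpha> s)) t" using TT_seq[OF T] by blast
  have s: "sqi RO V" "sqi M1 t" using T by (auto simp: TT_def)
  have sV: "sqi ?S V" by (rule sqi_subset(1)[OF Sb(1) O_borel _ s(1)]) auto
  have sJ: "sqi ?S (J (\<phi> k))" for k by (rule sqi_J[OF Sb testfn_smooth[OF p(1)]])
  have l: "l2conv ?S (%k. J (\<phi> k)) V"
    by (rule Lim_null_comparison[OF _ p(2)]) (use sqi_subset(2)[OF Sb(1) O_borel _ sqi_diff[OF J_sqi[OF p(1)] s(1)]] in auto)
  have l0: "(%k. l2n ?S (\<phi> k)) \<longlonglongrightarrow> l2n ?S (%x. pr0 (V x))" "(%k. l2n ?S (pd e2 (\<phi> k))) \<longlonglongrightarrow> l2n ?S (%x. pr2 (V x))"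
  proof -
    have "l2conv ?S (%k x. pr0 (J (\<phi> k) x)) (%x. pr0 (V x))" "l2conv ?S (%k x. pr2 (J (\<phi> k) x)) (%x. pr2 (V x))"
      by (rule Lim_null_comparison[OF _ l], use sqi_pr(4,6)[OF sqi_diff[OF sJ sV]] in \<open>auto simp: pr_lin\<close>)+
    from l2n_tendsto[OF sqi_pr(1)[OF sJ] sqi_pr(1)[OF sV] this(1)] l2n_tendsto[OF sqi_pr(3)[OF sJ] sqi_pr(3)[OF sV] this(2)]
    show "(%k. l2n ?S (\<phi> k)) \<longlonglongrightarrow> l2n ?S (%x. pr0 (V x))" "(%k. l2n ?S (pd e2 (\<phi> k))) \<longlonglongrightarrow> l2n ?S (%x. pr2 (V x))"
      by (simp_all add: pr_J)
  qed
  have lt: "(%k. l2n M1 (%s. \<phi> k (s, \<alpha> s))) \<longlonglongrightarrow> 0"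
  proof -
    have "l2n M1 t = 0" using l2n_eq_0_iff[OF s(2)] t0 by simp
    then show ?thesis using l2n_tendsto[OF test_trace_sqi[OF a p(1)] s(2) p(3)] by simp
  qed
  have "(l2n ?S (%x. pr0 (V x)))\<^sup>2 <= 4 * r * 0\<^sup>2 + 4 * r\<^sup>2 * (l2n ?S (%x. pr2 (V x)))\<^sup>2"
  proof (rule LIMSEQ_le)
    show "(%k. (l2n ?S (\<phi> k))\<^sup>2) \<longlonglongrightarrow> (l2n ?S (%x. pr0 (V x)))\<^sup>2" by (intro tendsto_power l0)
    show "(%k. 4 * r * (l2n M1 (%s. \<phi> k (s, \<alpha> s)))\<^sup>2 + 4 * r\<^sup>2 * (l2n ?S (pd e2 (\<phi> k)))\<^sup>2) \<longlonglongrightarrow> 4 * r * 0\<^sup>2 + 4 * r\<^sup>2 * (l2n ?S (%x. pr2 (V x)))\<^sup>2"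
      by (intro tendsto_intros l0 lt)
  qed (use Hardy_strip[OF a p(1) r] in blast)
  then have "(l2n ?S (%x. pr0 (V x)))\<^sup>2 <= (2 * r * l2n ?S (%x. pr2 (V x)))\<^sup>2" by (simp add: power_mult_distrib)
  then show ?thesis by (rule power2_le_imp_le) (use r in simp)
qed

text \<open>Between the curves f changes by the integral of its vertical derivative over a segment
  of length at most c; Cauchy-Schwarz on the segment yields the rate sqrt c.\<close>

lemma shift_estimate:
  assumes a: "adm \<alpha>" "adm \<beta>" and p: "testfn O' f" and c: "!!s. 0 < s ==> s < 1 ==> \<bar>\<beta> s - \<alpha> s\<bar> <= c"
  shows "l2n M1 (%s. f (s, \<beta> s) - f (s, \<alpha> s)) <= sqrt c * l2n RO (J f)"
proof -
  have c0: "0 <= c" using c[of "1/2"] abs_ge_zero[of "\<beta> (1/2) - \<alpha> (1/2)"] by linarith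
  have f: "smooth f" by (rule testfn_smooth[OF p])
  have cf: "continuous_on UNIV f" and cd: "continuous_on UNIV (pd e2 f)"
    using f by (auto intro: smooth_continuous smooth_pd)
  have c2: "continuous_on UNIV (%x. (pd e2 f x)\<^sup>2)" by (intro continuous_intros cd)
  have K: "compact (supp f)" "supp f \<subseteq> O'" using p by (auto simp: testfn_def Cc_def)
  have i2: "integrable lborel (%x. (pd e2 f x)\<^sup>2)"
    by (rule integrable_compact_support[OF c2 K(1)]) (simp add: pd_supp_zero)
  obtain R where R: "0 < R" "!!x. x \<in> supp f ==> norm x < R" using compact_imp_bounded[OF K(1)] by (auto simp: bounded_pos_less)
  have zR: "pd e2 f (s, y) = 0" if "R <= \<bar>y\<bar>" for s y
  proof -
    have "(s, y) \<notin> supp f" using R(2)[of "(s, y)"] norm_snd_le[of y s] that by auto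
    then show ?thesis by (rule pd_supp_zero)
  qed
  have isl: "integrable lborel (%y. (pd e2 f (s, y))\<^sup>2)" for s
  proof -
    have "(%y. indicator {-R<..<R} y * (pd e2 f (s, y))\<^sup>2) = (%y. (pd e2 f (s, y))\<^sup>2)"
    proof
      fix y show "indicator {-R<..<R} y * (pd e2 f (s, y))\<^sup>2 = (pd e2 f (s, y))\<^sup>2"
        using zR[of y s] by (cases "R <= \<bar>y\<bar>") (auto simp: indicator_def)
    qed
    then show ?thesis using integrable_open_slice[OF c2, of "-R" R s] by simp
  qed
  have "(LINT s|M1. (f (s, \<beta> s) - f (s, \<alpha> s))\<^sup>2) <= (LINT x|lborel. c * (pd e2 f x)\<^sup>2)"
  proof (rule slice_bound)
    show "integrable M1 (%s. (f (s, \<beta> s) - f (s, \<alpha> s))\<^sup>2)"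
      using sqi_integrable[OF sqi_diff[OF trace_sqi[OF a(2) cf] trace_sqi[OF a(1) cf]]] by simp
    fix s :: real assume s: "0 < s" "s < 1"
    have main: "(f (s, v) - f (s, u))\<^sup>2 <= c * (LINT y|lborel. (pd e2 f (s, y))\<^sup>2)" if uv: "u <= v" "v - u <= c" for u v
    proof -
      have "(f (s, v) - f (s, u))\<^sup>2 <= (v - u) * (LINT t|lborel. indicator {u<..<v} t * (pd e2 f (s, t))\<^sup>2)"
        by (rule segment_Cauchy_Schwarz[OF has_derivative_slice2[OF f] continuous_slice(1)[OF cd] uv(1)])
      also have "\<dots> <= c * (LINT y|lborel. (pd e2 f (s, y))\<^sup>2)"
        using uv by (intro mult_mono integral_mono[OF integrable_open_slice[OF c2] isl] integral_nonneg_AE) (auto simp: indicator_def)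
      finally show ?thesis .
    qed
    show "(f (s, \<beta> s) - f (s, \<alpha> s))\<^sup>2 <= (LINT y|lborel. c * (pd e2 f (s, y))\<^sup>2)"
      using main[of "\<alpha> s" "\<beta> s"] main[of "\<beta> s" "\<alpha> s"] c[OF s] by (cases "\<alpha> s <= \<beta> s") (auto simp: power2_commute)
  qed (use i2 c0 in auto)
  then have "(l2n M1 (%s. f (s, \<beta> s) - f (s, \<alpha> s)))\<^sup>2 <= c * (l2n lborel (pd e2 f))\<^sup>2" by (simp add: l2n_power2)
  also have "l2n lborel (pd e2 f) = l2n RO (pd e2 f)"
    by (rule RS_l2n_supp[OF O_borel, symmetric]) (use K pd_supp_zero in blast)
  also have "c * (l2n RO (pd e2 f))\<^sup>2 <= c * (l2n RO (J f))\<^sup>2"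
    using sqi_pr(6)[OF J_sqi[OF p]] c0 by (intro mult_left_mono power_mono) (auto simp: pr_J)
  also have "\<dots> = (sqrt c * l2n RO (J f))\<^sup>2" using c0 by (simp add: power_mult_distrib)
  finally show ?thesis by (rule power2_le_imp_le) (simp add: c0)
qed

lemma TT_shift:
  assumes a: "adm \<alpha>" "adm \<beta>" and T: "TT \<alpha> V t" "TT \<beta> V t'" and c: "!!s. 0 < s ==> s < 1 ==> \<bar>\<beta> s - \<alpha> s\<bar> <= c"
  shows "l2n M1 (%s. t' s - t s) <= sqrt c * l2n RO V"
proof -
  have c0: "0 <= c" using c[of "1/2"] abs_ge_zero[of "\<beta> (1/2) - \<alpha> (1/2)"] by linarith
  obtain \<phi> where p: "!!k::nat. testfn O' (\<phi> k)" "l2conv RO (%k. J (\<phi> k)) V"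
    "l2conv M1 (%k s. \<phi> k (s, \<alpha> s)) t" using TT_seq[OF T(1)] by blast
  have s: "sqi RO V" "sqi M1 t" "sqi M1 t'" using T by (auto simp: TT_def)
  have st: "sqi M1 (%s. \<phi> k (s, \<alpha> s))" "sqi M1 (%s. \<phi> k (s, \<beta> s))" for k using test_trace_sqi[OF a(1) p(1)] test_trace_sqi[OF a(2) p(1)] by auto
  have b: "l2n M1 (%s. t' s - t s) <= Ct * l2n RO (%x. J (\<phi> k) x - V x) + sqrt c * l2n RO (J (\<phi> k)) + l2n M1 (%s. \<phi> k (s, \<alpha> s) - t s)" for k
  proof -
    have "l2n M1 (%s. t' s - t s) <= l2n M1 (%s. \<phi> k (s, \<beta> s) - t' s) + l2n M1 (%s. \<phi> k (s, \<beta> s) - t s)"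
      using l2n_triangle3[OF s(3) st(2) s(2), of k] l2n_minus_commute[of M1 t' "%s. \<phi> k (s, \<beta> s)"] by simp
    also have "l2n M1 (%s. \<phi> k (s, \<beta> s) - t s) <= l2n M1 (%s. \<phi> k (s, \<beta> s) - \<phi> k (s, \<alpha> s)) + l2n M1 (%s. \<phi> k (s, \<alpha> s) - t s)"
      by (rule l2n_triangle3[OF st(2,1) s(2)])
    finally show ?thesis using TT_test_diff[OF a(2) T(2) p(1), of k] shift_estimate[OF a p(1) c, of k] by linarith
  qed
  have "(%k. Ct * l2n RO (%x. J (\<phi> k) x - V x) + sqrt c * l2n RO (J (\<phi> k)) + l2n M1 (%s. \<phi> k (s, \<alpha> s) - t s)) \<longlonglongrightarrow> Ct * 0 + sqrt c * l2n RO V + 0"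
    by (intro tendsto_intros p l2n_tendsto[OF J_sqi[OF p(1)] s(1) p(2)])
  then have "l2n M1 (%s. t' s - t s) <= Ct * 0 + sqrt c * l2n RO V + 0"
    by (rule LIMSEQ_le_const) (use b in auto)
  then show ?thesis by simp
qed

text \<open>The a.e. derivative md is prescribed through difference quotients because these are what
  the approximants of \<open>lipschitz_smooth_approx\<close> follow; \<open>TT_mult_limit\<close>
  then applies.\<close>

lemma TT_lipschitz_mult:
  fixes m md :: "real => real"
  assumes a: "adm \<alpha>" and T: "TT \<alpha> V t" and lip: "!!x y. \<bar>m x - m y\<bar> <= L * \<bar>x - y\<bar>"
    and md: "md \<in> borel_measurable borel"
    and lim: "AE x in lborel. (%k. real (Suc k) * (m (x + 1 / real (Suc k)) - m x)) \<longlonglongrightarrow> md x"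
  shows "TT \<alpha> (%x. mulT (m (fst x), md (fst x), 0) (V x)) (%s. m s * t s)"
proof -
  have "0 <= \<bar>m 0 - m 1\<bar>" by simp
  also have "\<dots> <= L * \<bar>0 - 1\<bar>" by (rule lip)
  finally have L0: "0 <= L" by simp
  have cm: "continuous_on UNIV m"
    by (rule lipschitz_on_continuous_on[of L]) (use lip L0 in \<open>auto simp: lipschitz_on_def dist_real_def\<close>)
  obtain R0 where R0: "!!x. x \<in> O' ==> norm x <= R0" using bddO by (auto simp: bounded_iff)
  \<comment> \<open>At least 1, so that [-R, R] contains the parameters (0,1) of the curve as well
    as the first coordinates of \<open>O'\<close>.\<close>
  define R where "R = max 1 R0"
  have R: "1 <= R" "0 <= R" by (auto simp: R_def)
  have fO: "fst x \<in> {-R..R}" if "x \<in> O'" for x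
    using R0[OF that] norm_fst_le[of "fst x" "snd x"] by (auto simp: R_def abs_le_iff)
  obtain N q where N: "!!k::nat. real_polynomial_function (N k)" "!!k x. (N k has_real_derivative q k x) (at x)"
    "!!k x. x \<in> {-R..R} ==> \<bar>N k x - m x\<bar> <= (2 * R + L) / real (Suc k)"
    "!!k x. x \<in> {-R..R} ==> \<bar>q k x - real (Suc k) * (m (x + 1 / real (Suc k)) - m x)\<bar> <= 1 / real (Suc k)"
    using lipschitz_smooth_approx[OF lip R(2)] by blast
  have Dq: "\<bar>real (Suc k) * (m (x + 1 / real (Suc k)) - m x)\<bar> <= L" for k x
  proof -
    have "\<bar>real (Suc k) * (m (x + 1 / real (Suc k)) - m x)\<bar> <= real (Suc k) * (L * \<bar>x + 1 / real (Suc k) - x\<bar>)"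
      unfolding abs_mult by (intro mult_mono lip) auto
    then show ?thesis by simp
  qed
  have qb: "\<bar>q k x\<bar> <= L + 1" if "x \<in> {-R..R}" for k x
  proof -
    have "1 / real (Suc k) <= 1" by simp
    then show ?thesis using N(4)[OF that, of k] Dq[of k x] by linarith
  qed
  let ?B = "\<bar>m 0\<bar> + L * R + 2 * R + L"
  have Nb: "\<bar>N k x\<bar> <= ?B" if x: "x \<in> {-R..R}" for k x
  proof -
    have "\<bar>m x - m 0\<bar> <= L * R" by (rule order_trans[OF lip]) (use x L0 in \<open>auto intro!: mult_left_mono\<close>)
    moreover have "(2 * R + L) / real (Suc k) <= (2 * R + L) / 1" using R L0 by (intro divide_left_mono) auto
    then have "\<bar>N k x - m x\<bar> <= 2 * R + L" using N(3)[OF x, of k] by simp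
    ultimately show ?thesis by linarith
  qed
  have sJ: "smooth (%x. N k (fst x))" "J (%x. N k (fst x)) x = (N k (fst x), q k (fst x), 0)" for k x
    using smooth_poly_fst_J[OF N(1,2)] by auto
  have inv: "(%k. c / real (Suc k)) \<longlonglongrightarrow> 0" for c :: real
    using tendsto_mult_right_zero[OF LIMSEQ_inverse_real_of_nat, of c] by (simp add: divide_inverse)
  have Nl: "(%k. N k x) \<longlonglongrightarrow> m x" if "x \<in> {-R..R}" for x
    by (rule LIM_zero_cancel, rule Lim_null_comparison[OF _ inv[of "2 * R + L"]]) (use N(3)[OF that] in auto)
  show ?thesis
  proof (rule TT_mult_limit[OF a T, where M="%k x. N k (fst x)" and K="?B + (L + 1)"])
    show "smooth (%x. N k (fst x))" for k by (rule sJ(1))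
    have "(%x::R2. m (fst x)) \<in> borel_measurable borel" "(%x::R2. md (fst x)) \<in> borel_measurable borel"
      using measurable_compose[OF borel_measurable_continuous_onI[OF continuous_on_fst[OF continuous_on_id]]]
        borel_measurable_continuous_onI[OF cm] md by blast+
    then show "(%x. (m (fst x), md (fst x), 0::real)) \<in> borel_measurable RO"
      by (intro RS_measurable borel_measurable_Pair borel_measurable_const)
    show "m \<in> borel_measurable M1" by (rule M1_continuous_measurable[OF continuous_on_subset[OF cm]]) simp
    show "norm (J (%x. N k (fst x)) x) <= ?B + (L + 1)" if "x \<in> O'" for k x
    proof -
      have "norm (J (%x. N k (fst x)) x) <= \<bar>N k (fst x)\<bar> + \<bar>q k (fst x)\<bar>"
        unfolding sJ(2) using norm_Pair_le[of "N k (fst x)" "(q k (fst x), 0::real)"] norm_Pair_le[of "q k (fst x)" "0::real"] by simp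
      then show ?thesis using Nb[OF fO[OF that], of k] qb[OF fO[OF that], of k] by linarith
    qed
    show "\<bar>N k (fst (s, \<alpha> s))\<bar> <= ?B + (L + 1)" if "0 < s" "s < 1" for k s
    proof -
      have "s \<in> {-R..R}" using that R by auto
      then show ?thesis using Nb[of s k] L0 by simp
    qed
    have "AE x in (lborel :: R2 measure). (%k. real (Suc k) * (m (fst x + 1 / real (Suc k)) - m (fst x))) \<longlonglongrightarrow> md (fst x)"
      by (rule AE_lborel_fst[OF lim])
    then have "AE x in RO. (%k. real (Suc k) * (m (fst x + 1 / real (Suc k)) - m (fst x))) \<longlonglongrightarrow> md (fst x)"
      by (auto simp: RS_AE elim!: eventually_mono)
    moreover have "AE x in RO. x \<in> O'" by (simp add: RS_AE)
    ultimately show "AE x in RO. (%k. J (%x. N k (fst x)) x) \<longlonglongrightarrow> (m (fst x), md (fst x), 0)"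
    proof eventually_elim
      case (elim x)
      have "(%k. q k (fst x) - real (Suc k) * (m (fst x + 1 / real (Suc k)) - m (fst x))) \<longlonglongrightarrow> 0"
        by (rule Lim_null_comparison[OF _ inv[of 1]]) (use N(4)[OF fO[OF elim(2)]] in auto)
      from tendsto_add[OF this elim(1)] have "(%k. q k (fst x)) \<longlonglongrightarrow> md (fst x)" by simp
      then show ?case unfolding sJ(2) by (intro tendsto_Pair Nl fO elim tendsto_const)
    qed
    show "AE s in M1. (%k. N k (fst (s, \<alpha> s))) \<longlonglongrightarrow> m s"
      by (rule M1_AE_I) (use Nl R in auto)
  qed
qed

lemma top_in_Gam:
  assumes a: "adm \<alpha>" and s: "0 < s" "s < 1"
  shows "(s, \<omega>) \<in> Gam \<omega> \<alpha>"
proof -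
  have "\<alpha> s <= amax" using a s by (auto simp: adm_def)
  then have al: "\<alpha> s < \<omega>" using amax_\<omega> by simp
  \<comment> \<open>The index shifted by two keeps the points strictly between the curve and the top
    edge.\<close>
  have lim: "(%k. (s, \<omega> - (\<omega> - \<alpha> s) / real (Suc (Suc k)))) \<longlonglongrightarrow> (s, \<omega> - 0)"
  proof (intro tendsto_Pair tendsto_diff tendsto_const)
    have "(%k. (\<omega> - \<alpha> s) * inverse (real (Suc (Suc k)))) \<longlonglongrightarrow> 0"
      by (rule tendsto_mult_right_zero[OF LIMSEQ_Suc[OF LIMSEQ_inverse_real_of_nat]])
    then show "(%k. (\<omega> - \<alpha> s) / real (Suc (Suc k))) \<longlonglongrightarrow> 0" by (simp add: divide_inverse)
  qed
  have mem: "(s, \<omega> - (\<omega> - \<alpha> s) / real (Suc (Suc k))) \<in> Om' \<alpha>" for k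
  proof -
    have "(\<omega> - \<alpha> s) / real (Suc (Suc k)) < \<omega> - \<alpha> s" using al divide_strict_left_mono[of 1 "real (Suc (Suc k))" "\<omega> - \<alpha> s"] by simp
    moreover have "0 < (\<omega> - \<alpha> s) / real (Suc (Suc k))" using al by simp
    ultimately show ?thesis using s by (simp add: Om_def)
  qed
  have "(s, \<omega>) \<in> closure (Om' \<alpha>)"
    unfolding closure_sequential
    by (intro exI[of _ "%k. (s, \<omega> - (\<omega> - \<alpha> s) / real (Suc (Suc k)))"] conjI allI mem) (use lim in simp)
  moreover have "(s, \<omega>) \<notin> interior (Om' \<alpha>)" using interior_subset[of "Om' \<alpha>"] by (auto simp: Om_def)
  moreover have "(s, \<omega>) \<notin> closure (Sl \<alpha>)"
  proof -
    have "closed {x::R2. snd x <= amax}" by (intro closed_Collect_le continuous_intros)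
    moreover have "Sl \<alpha> \<subseteq> {x. snd x <= amax}" using a by (auto simp: Sl_def adm_def)
    ultimately have "closure (Sl \<alpha>) \<subseteq> {x. snd x <= amax}" by (simp add: closure_minimal)
    then show ?thesis using amax_\<omega> by auto
  qed
  ultimately show ?thesis by (simp add: Gam_def frontier_def)
qed

text \<open>Every vertical segment of the domain ends on the top edge, where f vanishes. Its length
  is at most \<open>\<omega> - amin\<close>, whence a constant independent of the curve.\<close>

lemma Poincare_smooth:
  assumes a: "adm \<alpha>" and f: "smooth f" and z: "!!s. 0 < s ==> s < 1 ==> f (s, \<omega>) = 0"
  shows "l2n (RS (Om' \<alpha>)) f <= (\<omega> - amin) * l2n (RS (Om' \<alpha>)) (pd e2 f)"
proof -
  let ?U = "Om' \<alpha>" and ?c = "\<omega> - amin"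
  have cf: "continuous_on UNIV f" and cd: "continuous_on UNIV (pd e2 f)"
    using f by (auto intro: smooth_continuous smooth_pd)
  have c2: "continuous_on UNIV (%x. (f x)\<^sup>2)" "continuous_on UNIV (%x. (pd e2 f x)\<^sup>2)" by (intro continuous_intros cf cd)+
  note U = Om_borel[OF a] Om_bounded[OF a]
  have i1: "integrable lborel (%x. indicator ?U x * (f x)\<^sup>2)" and i2: "integrable lborel (%x. indicator ?U x * (pd e2 f x)\<^sup>2)"
    by (rule integrable_indicator_continuous[OF U c2(1)], rule integrable_indicator_continuous[OF U c2(2)])
  have sl: "indicator ?U (s, y) = (indicator {\<alpha> s<..<\<omega>} y :: real)" if "0 < s" "s < 1" for s y
    using that by (auto simp: Om_def indicator_def)
  have si: "integrable M1 (%s. LINT y|lborel. indicator ?U (s, y) * (f (s, y))\<^sup>2)"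
    "(LINT s|M1. (LINT y|lborel. indicator ?U (s, y) * (f (s, y))\<^sup>2)) = (LINT x|lborel. indicator ?U x * (f x)\<^sup>2)"
  proof -
    have zz: "indicator ?U (s, y) * (f (s, y))\<^sup>2 = 0" if "\<not> (0 < s \<and> s < 1)" for s y
      using that by (auto simp: Om_def indicator_def)
    show "integrable M1 (%s. LINT y|lborel. indicator ?U (s, y) * (f (s, y))\<^sup>2)"
      "(LINT s|M1. (LINT y|lborel. indicator ?U (s, y) * (f (s, y))\<^sup>2)) = (LINT x|lborel. indicator ?U x * (f x)\<^sup>2)"
      by (rule slice_integral[OF i1], erule zz)+
  qed
  have al: "amin <= \<alpha> s" "\<alpha> s < \<omega>" if "0 < s" "s < 1" for s
  proof -
    have "amin <= \<alpha> s \<and> \<alpha> s <= amax" using a that by (auto simp: adm_def)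
    then show "amin <= \<alpha> s" "\<alpha> s < \<omega>" using amax_\<omega> by auto
  qed
  have c0: "0 <= ?c" using al[of "1/2"] by simp
  have "(LINT s|M1. (LINT y|lborel. indicator ?U (s, y) * (f (s, y))\<^sup>2)) <= (LINT x|lborel. ?c\<^sup>2 * (indicator ?U x * (pd e2 f x)\<^sup>2))"
  proof (rule slice_bound)
    show "integrable lborel (%x. ?c\<^sup>2 * (indicator ?U x * (pd e2 f x)\<^sup>2))" using i2 by simp
    fix s :: real assume s: "0 < s" "s < 1"
    define D where "D = (LINT y|lborel. indicator {\<alpha> s<..<\<omega>} y * (pd e2 f (s, y))\<^sup>2)"
    have D0: "0 <= D" unfolding D_def by (intro integral_nonneg_AE) auto
    have pt: "(f (s, y))\<^sup>2 <= ?c * D" if y: "y \<in> {\<alpha> s<..<\<omega>}" for y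
    proof -
      have "(f (s, \<omega>) - f (s, y))\<^sup>2 <= (\<omega> - y) * (LINT t|lborel. indicator {y<..<\<omega>} t * (pd e2 f (s, t))\<^sup>2)"
        by (rule segment_Cauchy_Schwarz[OF has_derivative_slice2[OF f] continuous_slice(1)[OF cd]]) (use y in simp)
      also have "\<dots> <= ?c * D" unfolding D_def
        using y al[OF s] c0 by (intro mult_mono integral_mono[OF integrable_open_slice[OF c2(2)] integrable_open_slice[OF c2(2)]] integral_nonneg_AE) (auto simp: indicator_def)
      finally show ?thesis using z[OF s] by simp
    qed
    have "(LINT y|lborel. indicator ?U (s, y) * (f (s, y))\<^sup>2) = (LINT y|lborel. indicator {\<alpha> s<..<\<omega>} y * (f (s, y))\<^sup>2)" by (simp add: sl[OF s])
    also have "\<dots> <= (LINT y|lborel. indicator {\<alpha> s<..<\<omega>} y * (?c * D))"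
      by (rule integral_mono[OF integrable_open_slice[OF c2(1)] integrable_interval_continuous[OF continuous_on_const]])
         (use pt in \<open>auto simp: indicator_def\<close>)
    also have "\<dots> = (\<omega> - \<alpha> s) * (?c * D)" using al[OF s] by simp
    also have "\<dots> <= ?c * (?c * D)" using al[OF s] c0 D0 by (intro mult_right_mono) auto
    also have "\<dots> = (LINT y|lborel. ?c\<^sup>2 * (indicator ?U (s, y) * (pd e2 f (s, y))\<^sup>2))" by (simp add: D_def sl[OF s] power2_eq_square)
    finally show "(LINT y|lborel. indicator ?U (s, y) * (f (s, y))\<^sup>2) <= (LINT y|lborel. ?c\<^sup>2 * (indicator ?U (s, y) * (pd e2 f (s, y))\<^sup>2))" .
  qed (use si in \<open>auto simp: indicator_def\<close>)
  then have "(l2n (RS ?U) f)\<^sup>2 <= ?c\<^sup>2 * (l2n (RS ?U) (pd e2 f))\<^sup>2"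
    using si(2) U(1) by (simp add: l2n_power2 integral_restrict_space)
  then have "(l2n (RS ?U) f)\<^sup>2 <= (?c * l2n (RS ?U) (pd e2 f))\<^sup>2" by (simp add: power_mult_distrib)
  then show ?thesis by (rule power2_le_imp_le) (use c0 in simp)
qed

text \<open>Members of \<open>W\<close> are limits of smooth functions whose supports avoid
  \<Gamma>, and \<Gamma> contains the open top edge.\<close>

lemma W_Poincare:
  assumes a: "adm \<alpha>" and w: "W \<omega> \<alpha> u"
  shows "l2n (RS (Om' \<alpha>)) u <= (\<omega> - amin) * l2n (RS (Om' \<alpha>)) (wd (Om' \<alpha>) u e2)"
proof -
  let ?U = "Om' \<alpha>"
  note U = Om_open[OF a] Om_bounded[OF a] and Ub = Om_borel[OF a]
  have u: "H1 ?U u" using w by (simp add: W_def)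
  obtain \<phi> where p: "!!k. Cc (\<phi> k)" "!!k. supp (\<phi> k) \<inter> Gam \<omega> \<alpha> = {}" "(%k. H1sq ?U (%x. \<phi> k x - u x)) \<longlonglongrightarrow> 0"
    using w unfolding W_def by blast
  have l: "l2conv (RS ?U) (%k. J (\<phi> k)) (JW ?U u)"
    by (rule sqrt_tendsto_0) (use p(3) H1sq_diff[OF U Cc_smooth[OF p(1)] u] in auto)
  have sV: "sqi (RS ?U) (JW ?U u)" by (rule H1_sqi_JW(1)[OF Ub u])
  have sJ: "sqi (RS ?U) (J (\<phi> k))" for k by (rule sqi_J[OF Ub U(2) Cc_smooth[OF p(1)]])
  have "l2conv (RS ?U) (%k x. pr0 (J (\<phi> k) x)) (%x. pr0 (JW ?U u x))" "l2conv (RS ?U) (%k x. pr2 (J (\<phi> k) x)) (%x. pr2 (JW ?U u x))"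
    by (rule Lim_null_comparison[OF _ l], use sqi_pr(4,6)[OF sqi_diff[OF sJ sV]] in \<open>auto simp: pr_lin\<close>)+
  from l2n_tendsto[OF sqi_pr(1)[OF sJ] sqi_pr(1)[OF sV] this(1)] l2n_tendsto[OF sqi_pr(3)[OF sJ] sqi_pr(3)[OF sV] this(2)]
  have "(%k. l2n (RS ?U) (\<phi> k)) \<longlonglongrightarrow> l2n (RS ?U) u" "(%k. l2n (RS ?U) (pd e2 (\<phi> k))) \<longlonglongrightarrow> l2n (RS ?U) (wd ?U u e2)"
    by (simp_all add: pr_J JW_def)
  moreover have "l2n (RS ?U) (\<phi> k) <= (\<omega> - amin) * l2n (RS ?U) (pd e2 (\<phi> k))" for k
    by (rule Poincare_smooth[OF a Cc_smooth[OF p(1)]]) (use p(2)[of k] top_in_Gam[OF a] supp_zero[of _ "\<phi> k"] in blast)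
  ultimately show ?thesis by (intro LIMSEQ_le[OF _ tendsto_mult_left]) auto
qed

lemma AE_off_graph: assumes "adm \<alpha>" shows "AE x in lborel. 0 < fst x \<and> fst x < 1 --> snd x \<noteq> \<alpha> (fst x)"
proof -
  let ?N = "\<Inter>k. strip \<alpha> (1 / real (Suc k))"
  have so: "strip \<alpha> r \<in> sets borel" for r using strip_open[OF assms] by simp
  have Nb: "?N \<in> sets borel" using so by auto
  have Ne: "?N = {x. 0 < fst x \<and> fst x < 1 \<and> snd x = \<alpha> (fst x)}"
  proof (intro equalityI subsetI)
    fix x assume "x \<in> ?N"
    then have x: "0 < fst x" "fst x < 1" "!!k::nat. \<bar>snd x - \<alpha> (fst x)\<bar> < 1 / real (Suc k)" by (auto simp: strip_def)
    have "snd x - \<alpha> (fst x) = 0"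
    proof (rule ccontr)
      assume "snd x - \<alpha> (fst x) \<noteq> 0"
      then obtain k where "inverse (real (Suc k)) < \<bar>snd x - \<alpha> (fst x)\<bar>" using reals_Archimedean[of "\<bar>snd x - \<alpha> (fst x)\<bar>"] by auto
      then show False using x(3)[of k] by (simp add: inverse_eq_divide)
    qed
    with x show "x \<in> {x. 0 < fst x \<and> fst x < 1 \<and> snd x = \<alpha> (fst x)}" by simp
  qed (auto simp: strip_def)
  have "emeasure (lborel \<Otimes>\<^sub>M lborel) ?N = (\<integral>\<^sup>+s. emeasure lborel (Pair s -` ?N) \<partial>lborel)"
    by (rule lborel.emeasure_pair_measure_alt) (use Nb in \<open>simp only: lborel_prod sets_lborel\<close>)
  also have "\<dots> = (\<integral>\<^sup>+(s::real). 0 \<partial>lborel)"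
  proof (intro nn_integral_cong)
    fix s :: real
    have "Pair s -` ?N \<subseteq> {\<alpha> s}" unfolding Ne by auto
    then show "emeasure lborel (Pair s -` ?N) = 0" by (rule emeasure_lborel_countable[OF countable_subset]) simp
  qed
  finally have "?N \<in> null_sets lborel" using Nb by (simp add: lborel_prod null_sets_def)
  then show ?thesis by (rule AE_I') (unfold Ne, auto)
qed

text \<open>Absolute continuity of the integral: over (0,1) the strips shrink to the graph, which is
  a null set.\<close>

lemma strip_small:
  assumes a: "adm \<alpha>" and V: "sqi RO (V :: R2 => 'b::euclidean_space)"
  shows "(%k. l2n (RS (strip \<alpha> (1 / real (Suc k)) \<inter> O')) V) \<longlonglongrightarrow> 0"
proof -
  let ?P = "%k. strip \<alpha> (1 / real (Suc k))"
  have Pb: "?P k \<in> sets borel" for k using strip_open[OF a] by simp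
  have eq: "l2n (RS (?P k \<inter> O')) V = l2n RO (%x. indicator (?P k) x *\<^sub>R V x)" for k
  proof -
    have "indicator (?P k \<inter> O') x *\<^sub>R (norm (V x))\<^sup>2 = indicator O' x *\<^sub>R (norm (indicator (?P k) x *\<^sub>R V x))\<^sup>2" for x
      by (auto simp: indicator_def)
    moreover have "?P k \<inter> O' \<in> sets borel" using Pb by auto
    ultimately show ?thesis by (simp add: l2n_def integral_restrict_space)
  qed
  show ?thesis unfolding eq
  proof (rule l2n_dominated[OF _ V])
    show "(%x. indicator (?P k) x *\<^sub>R V x) \<in> borel_measurable RO" for k
      by (rule borel_measurable_scaleR[OF RS_measurable[OF borel_measurable_indicator[OF Pb]] sqi_measurable[OF V]])
    show "AE x in RO. norm (indicator (?P k) x *\<^sub>R V x) <= norm (V x)" for k by (auto simp: indicator_def)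
    have "AE x in RO. 0 < fst x \<and> fst x < 1 --> snd x \<noteq> \<alpha> (fst x)"
      using AE_off_graph[OF a] by (auto simp: RS_AE elim!: eventually_mono)
    then show "AE x in RO. (%k. indicator (?P k) x *\<^sub>R V x) \<longlonglongrightarrow> 0"
    proof eventually_elim
      case (elim x)
      show ?case
      proof (cases "0 < fst x \<and> fst x < 1")
        case True
        then have "\<bar>snd x - \<alpha> (fst x)\<bar> > 0" using elim by simp
        then obtain k where k: "inverse (real (Suc k)) < \<bar>snd x - \<alpha> (fst x)\<bar>" using reals_Archimedean by blast
        have "indicator (?P j) x *\<^sub>R V x = 0" if "j \<ge> k" for j
        proof -
          have "1 / real (Suc j) <= 1 / real (Suc k)" using that by (intro divide_left_mono) auto
          then show ?thesis using k by (simp add: strip_def inverse_eq_divide)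
        qed
        then show ?thesis by (intro tendsto_eventually eventually_sequentiallyI[of k])
      next
        case False
        then have "(%k. indicator (?P k) x *\<^sub>R V x) = (%k. 0)" by (auto simp: strip_def indicator_def)
        then show ?thesis by (simp only: tendsto_const)
      qed
    qed
  qed
qed

end

section \<open>Admissible curves\<close>

definition clamp01 :: "real => real" where "clamp01 x = max 0 (min 1 x)"

lemma clamp01_in: "clamp01 x \<in> {0..1}" by (auto simp: clamp01_def)
lemma clamp01_id: "x \<in> {0..1} ==> clamp01 x = x" by (auto simp: clamp01_def)
lemma clamp01_lip: "\<bar>clamp01 x - clamp01 y\<bar> <= \<bar>x - y\<bar>" by (auto simp: clamp01_def)

text \<open>The derivative continued by constants beyond [0,1]: a multiplier has to be Lipschitz on
  the whole line, since \<open>O'\<close> may extend beyond 0 < x1 < 1.\<close>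

definition slope :: "(real => real) => real => real" where "slope a x = adv a (clamp01 x)"

text \<open>Almost everywhere the derivative of the Lipschitz function \<open>slope a\<close>; elsewhere \<open>lim\<close> may be a junk value.\<close>

definition slope' :: "(real => real) => real => real" where
  "slope' a x = lim (%k. real (Suc k) * (slope a (x + 1 / real (Suc k)) - slope a x))"

lemma slope_eq: "x \<in> {0..1} ==> slope a x = adv a x"
  by (simp add: slope_def clamp01_id)

text \<open>\<open>Uad\<close> only asserts that some derivative exists; uniqueness of derivatives
  within [0,1] identifies it with the chosen \<open>adv\<close>. The difference quotients of the
  slope converge a.e. inside (0,1) by the second order bound, and outside [0,1] because the slope is
  constant there.\<close>

lemma Uad_slope:
  assumes "a \<in> Uad amin amax C1 C2"
  shows "!!x. x \<in> {0..1} ==> (a has_real_derivative slope a x) (at x within {0..1})"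
    and "\<exists>L. \<forall>x y. \<bar>slope a x - slope a y\<bar> <= L * \<bar>x - y\<bar>"
    and "AE s in M1. \<bar>adv a s\<bar> <= C1"
    and "AE x in lborel. (%k. real (Suc k) * (slope a (x + 1 / real (Suc k)) - slope a x)) \<longlonglongrightarrow> slope' a x"
    and "AE x in lborel. 0 < x \<and> x < 1 --> \<bar>slope' a x\<bar> <= C2"
    and "\<forall>x\<in>{0..1}. amin <= a x \<and> a x <= amax"
proof -
  obtain a' L where a': "!!x. x \<in> {0..1} ==> (a has_real_derivative a' x) (at x within {0..1})"
    "L-lipschitz_on {0..1} a'" "\<forall>x\<in>{0..1}. amin <= a x \<and> a x <= amax"
    "AE x in lborel. x \<in> {0<..<1} --> \<bar>a' x\<bar> <= C1"
    "AE x in lborel. x \<in> {0<..<1} --> (\<exists>d. (a' has_real_derivative d) (at x) \<and> \<bar>d\<bar> <= C2)"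
    using assms unfolding Uad_def by blast
  have eq: "adv a x = a' x" if x: "x \<in> {0..1}" for x
  proof -
    have "(a has_real_derivative adv a x) (at x within {0..1})"
      unfolding adv_def by (rule someI[of "%d. (a has_real_derivative d) (at x within {0..1})", OF a'(1)[OF x]])
    then show ?thesis
      using vector_derivative_unique_within_closed_interval[of 0 1 x a "adv a x" "a' x"] a'(1)[OF x] x
      by (simp add: has_real_derivative_iff_has_vector_derivative)
  qed
  show "(a has_real_derivative slope a x) (at x within {0..1})" if "x \<in> {0..1}" for x
    using a'(1)[OF that] eq[OF that] by (simp add: slope_eq[OF that])
  show "\<forall>x\<in>{0..1}. amin <= a x \<and> a x <= amax" by fact
  show "AE s in M1. \<bar>adv a s\<bar> <= C1"
    unfolding M1_AE using a'(4) by eventually_elim (use eq in auto)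
  have L0: "0 <= L" using a'(2) by (simp add: lipschitz_on_def)
  have "\<bar>slope a x - slope a y\<bar> <= L * \<bar>x - y\<bar>" for x y
  proof -
    have "\<bar>a' (clamp01 x) - a' (clamp01 y)\<bar> <= L * \<bar>clamp01 x - clamp01 y\<bar>"
      using a'(2) clamp01_in by (auto simp: lipschitz_on_def dist_real_def)
    also have "\<dots> <= L * \<bar>x - y\<bar>" using L0 clamp01_lip by (intro mult_left_mono) auto
    finally show ?thesis by (simp add: slope_def eq[OF clamp01_in])
  qed
  then show "\<exists>L. \<forall>x y. \<bar>slope a x - slope a y\<bar> <= L * \<bar>x - y\<bar>" by blast
  have quot: "(%k. real (Suc k) * (slope a (x + 1 / real (Suc k)) - slope a x)) \<longlonglongrightarrow> d"
    if d: "(slope a has_real_derivative d) (at x)" for x d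
  proof -
    have l: "((%h. (slope a (x + h) - slope a x) / h) \<longlongrightarrow> d) (at 0)" using d by (simp add: DERIV_def)
    have "filterlim (%k. 1 / real (Suc k)) (at 0) sequentially"
      unfolding filterlim_at using LIMSEQ_inverse_real_of_nat by (auto simp: inverse_eq_divide)
    from filterlim_compose[OF l this] show ?thesis by (simp add: mult.commute)
  qed
  have inner: "(slope a has_real_derivative d) (at x)" if "(a' has_real_derivative d) (at x)" "0 < x" "x < 1" for x d
    by (rule has_field_derivative_transform_within_open[OF that(1), of "{0<..<1}"]) (use that eq slope_eq in auto)
  have ne: "AE x in lborel. x \<noteq> 0 \<and> x \<noteq> (1::real)"
    using AE_lborel_singleton[of "0::real"] AE_lborel_singleton[of "1::real"] by eventually_elim auto
  show "AE x in lborel. (%k. real (Suc k) * (slope a (x + 1 / real (Suc k)) - slope a x)) \<longlonglongrightarrow> slope' a x"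
    using a'(5) ne
  proof eventually_elim
    case (elim x)
    have "\<exists>d. (slope a has_real_derivative d) (at x)"
    proof (cases "0 < x \<and> x < 1")
      case True then show ?thesis using elim(1) inner by auto
    next
      case False
      have c: "((%y. c) has_real_derivative 0) (at x)" for c :: real by simp
      show ?thesis
      proof (cases "x < 0")
        case True
        have "(slope a has_real_derivative 0) (at x)"
          by (rule has_field_derivative_transform_within_open[OF c[of "adv a 0"], of "{..<0}"]) (use True in \<open>auto simp: slope_def clamp01_def\<close>)
        then show ?thesis by blast
      next
        case nl: False
        then have "1 < x" using False elim(2) by auto
        then have "(slope a has_real_derivative 0) (at x)"
          by (intro has_field_derivative_transform_within_open[OF c[of "adv a 1"], of "{1<..}"]) (auto simp: slope_def clamp01_def)
        then show ?thesis by blast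
      qed
    qed
    then obtain d where d: "(slope a has_real_derivative d) (at x)" by blast
    show ?case unfolding slope'_def limI[OF quot[OF d]] by (rule quot[OF d])
  qed
  show "AE x in lborel. 0 < x \<and> x < 1 --> \<bar>slope' a x\<bar> <= C2"
    using a'(5)
  proof eventually_elim
    case (elim x)
    show ?case
    proof
      assume x: "0 < x \<and> x < 1"
      then obtain d where d: "(a' has_real_derivative d) (at x)" "\<bar>d\<bar> <= C2" using elim by auto
      have "slope' a x = d" unfolding slope'_def by (rule limI[OF quot[OF inner[OF d(1)]]]) (use x in auto)
      then show "\<bar>slope' a x\<bar> <= C2" using d by simp
    qed
  qed
qed

lemma slope_continuous:
  assumes "a \<in> Uad amin amax C1 C2" shows "continuous_on S (slope a)"
proof -
  obtain L where L: "!!x y. \<bar>slope a x - slope a y\<bar> <= L * \<bar>x - y\<bar>" using Uad_slope(2)[OF assms] by blast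
  have "0 <= \<bar>slope a 0 - slope a 1\<bar>" by simp
  also have "\<dots> <= L * \<bar>0 - 1\<bar>" by (rule L)
  finally have "0 <= L" by simp
  then show ?thesis
    by (intro lipschitz_on_continuous_on[of L]) (use L in \<open>auto simp: lipschitz_on_def dist_real_def\<close>)
qed

lemma slope'_measurable: assumes "a \<in> Uad amin amax C1 C2" shows "slope' a \<in> borel_measurable borel"
proof -
  have [measurable]: "slope a \<in> borel_measurable borel" by (rule borel_measurable_continuous_onI[OF slope_continuous[OF assms]])
  show ?thesis unfolding slope'_def by (intro borel_measurable_lim_metric) measurable
qed

lemma adv_measurable: assumes "a \<in> Uad amin amax C1 C2" shows "adv a \<in> borel_measurable M1"
proof -
  have "continuous_on {0..1} (adv a)"
    using slope_continuous[OF assms, of "{0..1}"] by (rule continuous_on_eq) (simp add: slope_eq)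
  then show ?thesis by (rule M1_continuous_measurable)
qed

text \<open>An argument with three thirds of e: a norm bound carries weak convergence from the Y k
  to their strong limit q.\<close>

lemma l2_weak_dense:
  fixes \<sigma> :: "nat => 'a => 'b::euclidean_space"
  assumes s: "!!n. sqi M (\<sigma> n)" "sqi M \<sigma>0" and K: "!!n. l2n M (\<sigma> n) <= K"
    and D: "!!k::nat. sqi M (Y k)" "!!k. (%n. LINT x|M. \<sigma> n x \<bullet> Y k x) \<longlonglongrightarrow> (LINT x|M. \<sigma>0 x \<bullet> Y k x)"
    and q: "sqi M q" "l2conv M Y q"
  shows "(%n. LINT x|M. \<sigma> n x \<bullet> q x) \<longlonglongrightarrow> (LINT x|M. \<sigma>0 x \<bullet> q x)"
proof (rule LIMSEQ_I)
  fix e :: real assume e: "0 < e"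
  define B where "B = K + l2n M \<sigma>0 + 1"
  have K0: "0 <= K" using K[of 0] l2n_nonneg order_trans by blast
  have B: "0 < B" "K <= B" "l2n M \<sigma>0 <= B" using K0 by (auto simp: B_def add_nonneg_pos)
  have "eventually (%k. l2n M (%x. Y k x - q x) < e / (3 * B)) sequentially"
    using order_tendstoD(2)[OF q(2), of "e / (3 * B)"] e B by simp
  then obtain k where k: "l2n M (%x. Y k x - q x) < e / (3 * B)" by (auto simp: eventually_sequentially)
  have small: "\<bar>(LINT x|M. \<tau> x \<bullet> Y k x) - (LINT x|M. \<tau> x \<bullet> q x)\<bar> < e / 3" if t: "sqi M \<tau>" "l2n M \<tau> <= B" for \<tau>
  proof -
    have "(LINT x|M. \<tau> x \<bullet> Y k x) - (LINT x|M. \<tau> x \<bullet> q x) = (LINT x|M. \<tau> x \<bullet> (Y k x - q x))"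
      unfolding inner_diff_right by (rule Bochner_Integration.integral_diff[symmetric]) (intro sqi_inner t D q)+
    also have "\<bar>\<dots>\<bar> <= l2n M \<tau> * l2n M (%x. Y k x - q x)" by (rule l2_Cauchy_Schwarz[OF t(1) sqi_diff[OF D(1) q(1)]])
    also have "\<dots> <= B * l2n M (%x. Y k x - q x)" by (intro mult_right_mono t) auto
    also have "\<dots> < B * (e / (3 * B))" using k B by (intro mult_strict_left_mono) auto
    finally show ?thesis using B by simp
  qed
  have "eventually (%n. \<bar>(LINT x|M. \<sigma> n x \<bullet> Y k x) - (LINT x|M. \<sigma>0 x \<bullet> Y k x)\<bar> < e / 3) sequentially"
    using tendstoD[OF D(2)[of k], of "e/3"] e by (simp add: dist_real_def)
  then obtain N where N: "!!n. n \<ge> N ==> \<bar>(LINT x|M. \<sigma> n x \<bullet> Y k x) - (LINT x|M. \<sigma>0 x \<bullet> Y k x)\<bar> < e / 3"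
    by (auto simp: eventually_sequentially)
  have "norm ((LINT x|M. \<sigma> n x \<bullet> q x) - (LINT x|M. \<sigma>0 x \<bullet> q x)) < e" if "n \<ge> N" for n
  proof -
    have "\<bar>a' - b'\<bar> < e" if "\<bar>a - b\<bar> < e / 3" "\<bar>a - a'\<bar> < e / 3" "\<bar>b - b'\<bar> < e / 3" for a a' b b' :: real
      using that by linarith
    from this[OF N[OF \<open>n \<ge> N\<close>] small[OF s(1) order_trans[OF K B(2)]] small[OF s(2) B(3)]] show ?thesis by simp
  qed
  then show "\<exists>no. \<forall>n\<ge>no. norm ((LINT x|M. \<sigma> n x \<bullet> q x) - (LINT x|M. \<sigma>0 x \<bullet> q x)) < e" by blast
qed

text \<open>A functional on arbitrary functions that integrates any square integrable representative against \<open>h\<close>;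
  integrating directly would not be invariant under a.e. equality, since \<open>lborel\<close> is not complete.\<close>

definition l2fun :: "(real => real) => (real => real) => real" where
  "l2fun h t = (let P = (%t'. sqi M1 t' \<and> (AE s in M1. t s = t' s)) in
     if Ex P then (LINT s|M1. Eps P s * h s) else 0)"

lemma l2fun_cong: assumes "AE s in M1. t1 s = t2 s" shows "l2fun h t1 = l2fun h t2"
proof -
  have "(AE s in M1. t1 s = t' s) \<longleftrightarrow> (AE s in M1. t2 s = t' s)" for t'
  proof
    assume "AE s in M1. t1 s = t' s" with assms show "AE s in M1. t2 s = t' s" by eventually_elim simp
  next
    assume "AE s in M1. t2 s = t' s" with assms show "AE s in M1. t1 s = t' s" by eventually_elim simp
  qed
  then show ?thesis by (simp add: l2fun_def)
qed

lemma l2fun_eq: assumes t: "sqi M1 t" and h: "sqi M1 h" shows "l2fun h t = (LINT s|M1. t s * h s)"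
proof -
  let ?P = "%t'. sqi M1 t' \<and> (AE s in M1. t s = t' s)"
  have ex: "Ex ?P" using t by (intro exI[of _ t]) simp
  then have P: "?P (Eps ?P)" by (rule someI_ex)
  have "(LINT s|M1. Eps ?P s * h s) = (LINT s|M1. t s * h s)"
    by (rule integral_cong_AE) (use P t h in \<open>auto simp: sqi_def elim!: eventually_mono\<close>)
  then show ?thesis using ex by (simp add: l2fun_def)
qed

section \<open>Hold-all representatives, bilinear forms and functionals on one domain\<close>

context holdall
begin

lemma Uad_adm: "a \<in> Uad amin amax C1 C2 ==> Om' a \<subseteq> O' ==> adm a"
  unfolding adm_def
  using DERIV_continuous_on[of "{0..1}" a "slope a"] Uad_slope(1)[of a amin amax C1 C2] Uad_slope(6)[of a amin amax C1 C2] by blast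

lemma JW_pr0: "pr0 (JW U u x) = u x" by (simp add: JW_def)

lemma H10_TT: assumes "adm \<beta>" "H10 O' v" shows "TT \<beta> (JW O' v) (tr' \<beta> v)"
proof -
  obtain t where "TT \<beta> (JW O' v) t" using TT_exists[OF assms(1) H10_HH(1)[OF openO bddO assms(2)]] by blast
  then show ?thesis by (rule TT_tr(3)[OF assms(1)]) (simp add: JW_pr0)
qed

lemma H10_sqi: "H10 O' v ==> sqi RO (JW O' v)"
  using H10_HH(1)[OF openO bddO] by (simp add: HH_def)

lemma H10_JW_Om:
  assumes "adm \<beta>" "H10 O' v" shows "H1 (Om' \<beta>) v" "AE x in RS (Om' \<beta>). JW (Om' \<beta>) v x = JW O' v x"
  by (rule TT_trace_rel(2,3)[OF assms(1) H10_TT[OF assms]], simp add: JW_pr0)+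

lemma tr_sqi: "adm \<beta> ==> H10 O' v ==> sqi M1 (tr' \<beta> v)"
  using H10_TT by (auto simp: TT_def)

text \<open>Functions agreeing on the domain satisfy the same trace relation, so their chosen traces
  are equal as functions and not merely a.e.\<close>

lemma tr_cong: assumes "!!x. x \<in> Om' \<beta> ==> u x = w x" shows "tr' \<beta> u = tr' \<beta> w"
proof -
  have "H1sq (Om' \<beta>) (%x. \<phi> x - u x) = H1sq (Om' \<beta>) (%x. \<phi> x - w x)" for \<phi>
  proof -
    have w: "wd (Om' \<beta>) (%x. \<phi> x - u x) = wd (Om' \<beta>) (%x. \<phi> x - w x)" by (rule wd_cong) (simp add: assms)
    show ?thesis unfolding H1sq_def H1ip_def intg_def set_lebesgue_integral_def w
      by (intro Bochner_Integration.integral_cong refl) (use assms in \<open>auto simp: indicator_def\<close>)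
  qed
  then have "trace_rel \<omega> \<beta> u = trace_rel \<omega> \<beta> w" by (simp add: trace_rel_def fun_eq_iff)
  then show ?thesis by (simp add: tr_def)
qed

lemma tr_comb:
  assumes a: "adm \<beta>" and "H10 O' v" "H10 O' w" and z: "!!x. x \<in> Om' \<beta> ==> z x = v x + c * w x"
  shows "AE s in M1. tr' \<beta> z s = tr' \<beta> v s + c * tr' \<beta> w s"
  by (rule TT_tr(1)[OF a TT_comb[OF a H10_TT[OF a assms(2)] H10_TT[OF a assms(3)], of c]])
     (simp add: z pr_lin JW_pr0)

lemma H10_comb:
  assumes "H10 O' v" "H10 O' w"
  shows "H10 O' (%x. v x + c * w x)" "AE x in RO. JW O' (%x. v x + c * w x) x = JW O' v x + c *\<^sub>R JW O' w x"
proof -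
  have h: "HH O' (%x. JW O' v x + c *\<^sub>R JW O' w x)"
    unfolding HH_def
  proof (intro conjI allI impI)
    show "sqi RO (%x. JW O' v x + c *\<^sub>R JW O' w x)" by (intro sqi_add sqi_scaleR H10_sqi assms)
    fix \<epsilon> :: real assume e: "0 < \<epsilon>"
    have c1: "0 < 1 + \<bar>c\<bar>" by (simp add: add_pos_nonneg)
    define \<delta> where "\<delta> = \<epsilon> / (1 + \<bar>c\<bar>)"
    have d: "0 < \<delta>" "(1 + \<bar>c\<bar>) * \<delta> = \<epsilon>" using e c1 by (auto simp: \<delta>_def)
    obtain \<phi> where p: "testfn O' \<phi>" "l2n RO (%x. J \<phi> x - JW O' v x) < \<delta>"
      using H10_HH(1)[OF openO bddO assms(1)] d(1) unfolding HH_def by blast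
    obtain \<psi> where q: "testfn O' \<psi>" "l2n RO (%x. J \<psi> x - JW O' w x) < \<delta>"
      using H10_HH(1)[OF openO bddO assms(2)] d(1) unfolding HH_def by blast
    have "l2n RO (%x. J (%x. \<phi> x + c * \<psi> x) x - (JW O' v x + c *\<^sub>R JW O' w x)) = l2n RO (%x. (J \<phi> x - JW O' v x) + c *\<^sub>R (J \<psi> x - JW O' w x))"
      by (simp add: J_comb[OF testfn_smooth[OF p(1)] testfn_smooth[OF q(1)]] algebra_simps)
    also have "\<dots> <= l2n RO (%x. J \<phi> x - JW O' v x) + \<bar>c\<bar> * l2n RO (%x. J \<psi> x - JW O' w x)"
      using l2n_triangle[OF sqi_diff[OF J_sqi[OF p(1)] H10_sqi[OF assms(1)]] sqi_scaleR[OF sqi_diff[OF J_sqi[OF q(1)] H10_sqi[OF assms(2)]], of c]]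
      by (simp add: l2n_scaleR)
    also have "\<dots> < \<delta> + \<bar>c\<bar> * \<delta>" using p(2) q(2) mult_left_mono[of "l2n RO (%x. J \<psi> x - JW O' w x)" \<delta> "\<bar>c\<bar>"] by simp
    finally show "\<exists>\<phi>. testfn O' \<phi> \<and> l2n RO (%x. J \<phi> x - (JW O' v x + c *\<^sub>R JW O' w x)) < \<epsilon>"
      using testfn_comb[OF p(1) q(1), of c] d(2) by (intro exI[of _ "%x. \<phi> x + c * \<psi> x"]) (simp add: distrib_right)
  qed
  have e: "(%x. v x + c * w x) = (%x. if x \<in> O' then pr0 (JW O' v x + c *\<^sub>R JW O' w x) else 0)"
    using assms by (auto simp: H10_def pr_lin JW_pr0 fun_eq_iff)
  show "H10 O' (%x. v x + c * w x)" "AE x in RO. JW O' (%x. v x + c * w x) x = JW O' v x + c *\<^sub>R JW O' w x"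
    by (rule HH_H10[OF openO bddO h e])+
qed

lemma H10_zero: "H10 O' (%x. 0)" "AE x in RO. JW O' (%x. 0) x = 0"
proof -
  have h: "HH O' (%x. 0)" unfolding HH_def
    by (intro conjI allI impI sqi_zero exI[of _ "%x. 0"] testfn_zero) (simp add: J_def pd_def zero_prod_def l2n_def)
  have e: "(%x. 0) = (%x. if x \<in> O' then pr0 0 else 0)" by (auto simp: pr0_def fun_eq_iff)
  show "H10 O' (%x. 0)" "AE x in RO. JW O' (%x. 0) x = 0" by (rule HH_H10[OF openO bddO h e])+
qed

lemma JW_zero_norm: "adm \<beta> ==> l2n (RS (Om' \<beta>)) (JW O' (%x. 0)) = 0"
proof -
  assume a: "adm \<beta>"
  have "l2n (RS (Om' \<beta>)) (JW O' (%x. 0)) <= l2n RO (JW O' (%x. 0))"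
    by (rule sqi_subset(2)[OF Om_borel[OF a] O_borel Om_sub[OF a] H10_sqi[OF H10_zero(1)]])
  also have "\<dots> = 0" using l2n_eq_0_iff[OF H10_sqi[OF H10_zero(1)]] H10_zero(2) by simp
  finally show ?thesis using l2n_nonneg[of "RS (Om' \<beta>)" "JW O' (%x. 0)"] by linarith
qed

lemma TT_H10:
  assumes a: "adm \<beta>" and T: "TT \<beta> V t"
  defines "u \<equiv> (%x. if x \<in> O' then pr0 (V x) else 0)"
  shows "H10 O' u" "AE x in RO. JW O' u x = V x" "AE s in M1. tr' \<beta> u s = t s"
proof -
  show "H10 O' u" "AE x in RO. JW O' u x = V x"
    by (rule HH_H10[OF openO bddO TT_HH[OF T]], simp add: u_def)+
  show "AE s in M1. tr' \<beta> u s = t s"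
    by (rule TT_tr(1)[OF a T]) (use Om_sub[OF a] in \<open>auto simp: u_def\<close>)
qed

lemma RS_sub_integral:
  fixes F :: "R2 => real"
  assumes "U \<in> sets borel" "U \<subseteq> O'"
  shows "(LINT x|RS U. F x) = (LINT x|RO. indicator U x * F x)"
proof -
  have "(%x. indicator U x *\<^sub>R F x) = (%x. indicator O' x *\<^sub>R (indicator U x * F x))"
    using assms(2) by (auto simp: indicator_def fun_eq_iff)
  then show ?thesis
    using assms(1) integral_restrict_space[of U lborel F] integral_restrict_space[of O' lborel "%x. indicator U x * F x"] O_borel by auto
qed

definition Ju :: "(R2 => R2) => R2 => (real \<times> real \<times> real) \<times> (real \<times> real \<times> real)" where
  "Ju v x = (JW O' (c1 v) x, JW O' (c2 v) x)"

text \<open>The density of a(u,v) - b(v,p) - (f,v) against the jets of v: -f acts on the values, and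
  the gradient of u minus p times the identity acts on the gradients.\<close>

definition Qf :: "(R2 => R2) => (R2 => R2) => (R2 => real) => R2 => (real \<times> real \<times> real) \<times> (real \<times> real \<times> real)" where
  "Qf f u p x = ((- fst (f x), pr1 (JW O' (c1 u) x) - p x, pr2 (JW O' (c1 u) x)),
                 (- snd (f x), pr1 (JW O' (c2 u) x), pr2 (JW O' (c2 u) x) - p x))"

lemma sqi_Pair:
  fixes f :: "'c => 'd::euclidean_space" and g :: "'c => 'e::euclidean_space"
  assumes "sqi M f" "sqi M g" shows "sqi M (%x. (f x, g x))"
proof -
  have "(norm (f x, g x))\<^sup>2 = (norm (f x))\<^sup>2 + (norm (g x))\<^sup>2" for x by (simp add: norm_Pair)
  then show ?thesis using assms unfolding sqi_def by (auto intro!: borel_measurable_Pair)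
qed

lemma Ju_sqi: "H10v O' v ==> sqi RO (Ju v)"
  unfolding Ju_def H10v_def by (intro sqi_Pair H10_sqi) auto

lemma Qf_sqi:
  assumes "H10v O' u" "sqi RO p" "sqi RO (%x. fst (f x))" "sqi RO (%x. snd (f x))"
  shows "sqi RO (Qf f u p)"
proof -
  have h: "sqi RO (JW O' (c1 u))" "sqi RO (JW O' (c2 u))" using assms(1) H10_sqi by (auto simp: H10v_def)
  show ?thesis unfolding Qf_def
    by (intro sqi_Pair sqi_uminus sqi_diff sqi_pr(2)[OF h(1)] sqi_pr(3)[OF h(1)] sqi_pr(2)[OF h(2)] sqi_pr(3)[OF h(2)] assms)
qed

lemma form_eq:
  assumes a: "adm \<beta>" and u: "H10v O' u" and v: "H10v O' v" and p: "sqi RO p"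
    and f: "sqi RO (%x. fst (f x))" "sqi RO (%x. snd (f x))"
  shows "aform (Om' \<beta>) u v - bform (Om' \<beta>) v p - fform (Om' \<beta>) f v =
     (LINT x|RO. indicator (Om' \<beta>) x * (Qf f u p x \<bullet> Ju v x))"
proof -
  let ?U = "Om' \<beta>"
  note Ub = Om_borel[OF a] and Us = Om_sub[OF a]
  have h: "H10 O' (c1 u)" "H10 O' (c2 u)" "H10 O' (c1 v)" "H10 O' (c2 v)" using u v by (auto simp: H10v_def)
  have sq: "sqi (RS ?U) (%x. q (JW O' w x))" if "H10 O' w" "q = pr0 \<or> q = pr1 \<or> q = pr2" for q w
    using sqi_pr(1-3)[OF sqi_subset(1)[OF Ub O_borel Us H10_sqi[OF that(1)]]] that(2) by auto
  have sp: "sqi (RS ?U) p" "sqi (RS ?U) (%x. fst (f x))" "sqi (RS ?U) (%x. snd (f x))"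
    using sqi_subset(1)[OF Ub O_borel Us] p f by auto
  have ae: "AE x in RS ?U. wd ?U w e1 x = pr1 (JW O' w x)" "AE x in RS ?U. wd ?U w e2 x = pr2 (JW O' w x)" if "H10 O' w" for w
    using H10_JW_Om(2)[OF a that] by (eventually_elim, metis JW_def pr_simps)+
  have mw: "wd ?U w e1 \<in> borel_measurable (RS ?U)" "wd ?U w e2 \<in> borel_measurable (RS ?U)" if "H10 O' w" for w
    using H1_sqi_JW(3,4)[OF Ub H10_JW_Om(1)[OF a that]] by (auto simp: wdrel_RS[OF Ub] sqi_def)
  have m1: "sqi (RS ?U) (%x. pr1 (JW O' w x))" "sqi (RS ?U) (%x. pr2 (JW O' w x))" "sqi (RS ?U) w" if "H10 O' w" for w
    using sq[OF that, of pr1] sq[OF that, of pr2] sq[OF that, of pr0] by (auto simp: JW_pr0)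
  have mm: "(%x. pr1 (JW O' w x)) \<in> borel_measurable (RS ?U)" "(%x. pr2 (JW O' w x)) \<in> borel_measurable (RS ?U)" if "H10 O' w" for w
    using m1[OF that] by (auto simp: sqi_def)
  note [measurable] = mw[OF h(1)] mw[OF h(2)] mw[OF h(3)] mw[OF h(4)] mm[OF h(1)] mm[OF h(2)] mm[OF h(3)] mm[OF h(4)]
    sqi_measurable[OF sp(1)]
  define Fa where "Fa x = pr1 (JW O' (c1 u) x) * pr1 (JW O' (c1 v) x) + pr2 (JW O' (c1 u) x) * pr2 (JW O' (c1 v) x) +
      pr1 (JW O' (c2 u) x) * pr1 (JW O' (c2 v) x) + pr2 (JW O' (c2 u) x) * pr2 (JW O' (c2 v) x)" for x
  define Fb where "Fb x = p x * (pr1 (JW O' (c1 v) x) + pr2 (JW O' (c2 v) x))" for x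
  define Ff where "Ff x = fst (f x) * fst (v x) + snd (f x) * snd (v x)" for x
  have A: "aform ?U u v = (LINT x|RS ?U. Fa x)"
    unfolding aform_def RS_intg[OF Ub] Fa_def
  proof (rule integral_cong_AE)
    show "AE x in RS ?U. wd ?U (c1 u) e1 x * wd ?U (c1 v) e1 x + wd ?U (c1 u) e2 x * wd ?U (c1 v) e2 x +
      wd ?U (c2 u) e1 x * wd ?U (c2 v) e1 x + wd ?U (c2 u) e2 x * wd ?U (c2 v) e2 x =
      pr1 (JW O' (c1 u) x) * pr1 (JW O' (c1 v) x) + pr2 (JW O' (c1 u) x) * pr2 (JW O' (c1 v) x) +
      pr1 (JW O' (c2 u) x) * pr1 (JW O' (c2 v) x) + pr2 (JW O' (c2 u) x) * pr2 (JW O' (c2 v) x)"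
      using ae[OF h(1)] ae[OF h(2)] ae[OF h(3)] ae[OF h(4)] by eventually_elim simp
  qed measurable
  have B: "bform ?U v p = (LINT x|RS ?U. Fb x)"
    unfolding bform_def RS_intg[OF Ub] Fb_def
  proof (rule integral_cong_AE)
    show "AE x in RS ?U. p x * (wd ?U (c1 v) e1 x + wd ?U (c2 v) e2 x) = p x * (pr1 (JW O' (c1 v) x) + pr2 (JW O' (c2 v) x))"
      using ae[OF h(3)] ae[OF h(4)] by eventually_elim simp
  qed measurable
  have F: "fform ?U f v = (LINT x|RS ?U. Ff x)" unfolding fform_def RS_intg[OF Ub] Ff_def ..
  have sv: "sqi (RS ?U) (%x. fst (v x))" "sqi (RS ?U) (%x. snd (v x))" using m1(3)[OF h(3)] m1(3)[OF h(4)] by (auto simp: c1_def c2_def)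
  have iA: "integrable (RS ?U) Fa" unfolding Fa_def
    by (intro Bochner_Integration.integrable_add sqi_mult m1 h)
  have iB: "integrable (RS ?U) Fb" unfolding Fb_def
    by (intro sqi_mult sp sqi_add m1 h)
  have iF: "integrable (RS ?U) Ff" unfolding Ff_def
    by (intro Bochner_Integration.integrable_add sqi_mult sp sv)
  have "aform ?U u v - bform ?U v p - fform ?U f v = (LINT x|RS ?U. Fa x - Fb x - Ff x)"
    unfolding A B F using iA iB iF by simp
  also have "\<dots> = (LINT x|RS ?U. Qf f u p x \<bullet> Ju v x)"
  proof (rule Bochner_Integration.integral_cong[OF refl])
    fix x
    show "Fa x - Fb x - Ff x = Qf f u p x \<bullet> Ju v x"
      by (simp add: Ju_def JW_def Qf_def Fa_def Fb_def Ff_def c1_def c2_def algebra_simps)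
  qed
  also have "\<dots> = (LINT x|RO. indicator ?U x * (Qf f u p x \<bullet> Ju v x))" by (rule RS_sub_integral[OF Ub Us])
  finally show ?thesis .
qed

lemma zero_extension:
  assumes a: "adm \<beta>" and s: "sqi (RS (Om' \<beta>)) q" shows "sqi RO (%x. if x \<in> Om' \<beta> then q x else (0::real))"
proof -
  have e: "(%x. indicator O' x *\<^sub>R (if x \<in> Om' \<beta> then q x else 0)) = (%x. indicator (Om' \<beta>) x *\<^sub>R q x)"
    "(%x. indicator O' x *\<^sub>R (norm (if x \<in> Om' \<beta> then q x else 0))\<^sup>2) = (%x. indicator (Om' \<beta>) x *\<^sub>R (norm (q x))\<^sup>2)"
    using Om_sub[OF a] by (auto simp: indicator_def fun_eq_iff)
  show ?thesis using s Om_borel[OF a] O_borel e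
    unfolding sqi_def by (simp only: borel_measurable_restrict_space_iff integrable_restrict_space sets.Int_space_eq2 sets_lborel)
qed

text \<open>\<open>Hm12\<close> grants linearity only on traces of \<open>W\<close>. A combination
  with both coefficients zero gives the value 0 at the zero function, and invariance under a.e.
  equality extends this to t.\<close>

lemma Hm12_zero:
  assumes \<mu>: "Hm12 \<omega> \<beta> \<mu>" and w: "W \<omega> \<beta> w" and t: "AE s in M1. t s = 0" shows "\<mu> t = 0"
proof -
  have "\<mu> (%s. 0 * tr' \<beta> w s + 0 * tr' \<beta> w s) = 0 * \<mu> (tr' \<beta> w) + 0 * \<mu> (tr' \<beta> w)"
    using \<mu> w unfolding Hm12_def by blast
  moreover have "\<forall>t1 t2. (AE s in lborel. s \<in> {0<..<1} --> t1 s = t2 s) --> \<mu> t1 = \<mu> t2" using \<mu> unfolding Hm12_def by blast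
  from mp[OF spec[OF spec[OF this], of t "%s. 0"] t[unfolded M1_AE]] have "\<mu> t = \<mu> (%s. 0)" .
  ultimately show ?thesis by simp
qed

lemma W_norm:
  assumes a: "adm \<beta>" and w: "H10 O' w'" "!!x. x \<in> Om' \<beta> ==> w x = w' x"
  shows "l2n (RS (Om' \<beta>)) (JW O' w') = sqrt (H1sq (Om' \<beta>) w)"
proof -
  note Ub = Om_borel[OF a]
  have ae: "H1 (Om' \<beta>) w" "AE x in RS (Om' \<beta>). JW (Om' \<beta>) w x = JW O' w' x"
    by (rule TT_trace_rel(2,3)[OF a H10_TT[OF a w(1)]], simp add: JW_pr0 w)+
  have "l2n (RS (Om' \<beta>)) (JW O' w') = l2n (RS (Om' \<beta>)) (JW (Om' \<beta>) w)"
    by (rule l2n_cong_AE[symmetric]) (use ae H1_sqi_JW(1)[OF Ub ae(1)] sqi_subset(1)[OF Ub O_borel Om_sub[OF a] H10_sqi[OF w(1)]] in \<open>auto simp: sqi_def\<close>)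
  then show ?thesis by (simp add: H1sq_JW[OF Ub])
qed

text \<open>An L2 density acts as an element of H^{-1/2}; the constraint on the normal trace can
  then be tested with the normal trace itself.\<close>

lemma Hm12_l2fun:
  assumes a: "adm \<beta>" and Wr: "!!w. W \<omega> \<beta> w ==> \<exists>w'. H10 O' w' \<and> (\<forall>x\<in>Om' \<beta>. w x = w' x)" and h: "sqi M1 h"
  shows "Hm12 \<omega> \<beta> (l2fun h)"
  unfolding Hm12_def
proof (intro conjI allI impI)
  fix t1 t2 :: "real => real" assume "AE s in lborel. s \<in> {0<..<1} --> t1 s = t2 s"
  then show "l2fun h t1 = l2fun h t2" by (intro l2fun_cong) (simp add: M1_AE)
next
  have tw: "sqi M1 (tr' \<beta> w)" if "W \<omega> \<beta> w" for w
    using Wr[OF that] tr_sqi[OF a] tr_cong by metis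
  fix w1 w2 and c d :: real assume w: "W \<omega> \<beta> w1" "W \<omega> \<beta> w2"
  show "l2fun h (%s. c * tr' \<beta> w1 s + d * tr' \<beta> w2 s) = c * l2fun h (tr' \<beta> w1) + d * l2fun h (tr' \<beta> w2)"
    using sqi_mult[OF tw[OF w(1)] h] sqi_mult[OF tw[OF w(2)] h]
    by (simp add: l2fun_eq[OF sqi_add[OF sqi_cmult[OF tw[OF w(1)]] sqi_cmult[OF tw[OF w(2)]]] h] l2fun_eq[OF tw[OF w(1)] h] l2fun_eq[OF tw[OF w(2)] h] distrib_right mult.assoc)
next
  show "\<exists>C. \<forall>w. W \<omega> \<beta> w --> \<bar>l2fun h (tr' \<beta> w)\<bar> <= C * sqrt (H1sq (Om' \<beta>) w)"
  proof (intro exI[of _ "l2n M1 h * Ct"] allI impI)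
    fix w assume "W \<omega> \<beta> w"
    then obtain w' where w': "H10 O' w'" "!!x. x \<in> Om' \<beta> ==> w x = w' x" using Wr by blast
    have e: "tr' \<beta> w = tr' \<beta> w'" by (rule tr_cong) (rule w')
    have T: "TT \<beta> (JW O' w') (tr' \<beta> w)" unfolding e by (rule H10_TT[OF a w'(1)])
    have t: "sqi M1 (tr' \<beta> w)" using T by (simp add: TT_def)
    have "l2n (RS (Om' \<beta>)) (JW O' w') = sqrt (H1sq (Om' \<beta>) w)" by (rule W_norm[OF a w'(1)], erule w'(2))
    then have n: "l2n M1 (tr' \<beta> w) <= Ct * sqrt (H1sq (Om' \<beta>) w)" using TT_bound[OF a T] by simp
    have "\<bar>l2fun h (tr' \<beta> w)\<bar> <= l2n M1 (tr' \<beta> w) * l2n M1 h"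
      unfolding l2fun_eq[OF t h] by (rule l2_Cauchy_Schwarz_real[OF t h])
    also have "\<dots> <= (Ct * sqrt (H1sq (Om' \<beta>) w)) * l2n M1 h" by (intro mult_right_mono n) simp
    finally show "\<bar>l2fun h (tr' \<beta> w)\<bar> <= l2n M1 h * Ct * sqrt (H1sq (Om' \<beta>) w)" by (simp add: mult_ac)
  qed
qed

section \<open>Density of the traces in L2(0,1)\<close>

lemma Gam_away:
  assumes a: "adm \<alpha>" and x: "0 < fst x" "fst x < 1" "snd x < \<omega>" shows "x \<notin> Gam \<omega> \<alpha>"
proof
  assume g: "x \<in> Gam \<omega> \<alpha>"
  have nU: "x \<notin> Om' \<alpha>" using g interior_open[OF Om_open[OF a]] by (auto simp: Gam_def frontier_def)
  have le: "snd x <= \<alpha> (fst x)" using nU x by (cases x) (auto simp: Om_def)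
  have "\<alpha> (fst x) <= snd x"
  proof -
    have "x \<in> closure (Om' \<alpha>)" using g by (auto simp: Gam_def frontier_def)
    then obtain f where f: "!!n. f n \<in> Om' \<alpha>" "f \<longlonglongrightarrow> x" by (auto simp: closure_sequential)
    have in01: "fst (f n) \<in> {0..1}" for n using f(1)[of n] by (cases "f n") (auto simp: Om_def)
    have "(%n. \<alpha> (fst (f n))) \<longlonglongrightarrow> \<alpha> (fst x)"
      by (rule continuous_on_tendsto_compose[of "{0..1}" \<alpha>]) (use a x in01 tendsto_fst[OF f(2)] in \<open>auto simp: adm_def\<close>)
    moreover have "\<alpha> (fst (f n)) <= snd (f n)" for n using f(1)[of n] by (cases "f n") (auto simp: Om_def)
    ultimately show ?thesis using LIMSEQ_le[OF _ tendsto_snd[OF f(2)]] by blast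
  qed
  with le have "x \<in> Sl \<alpha>" using x unfolding Sl_def by (intro CollectI exI[of _ "fst x"]) (auto simp: prod_eq_iff)
  then show False using g closure_subset[of "Sl \<alpha>"] by (auto simp: Gam_def)
qed

text \<open>Its support projects into a compact subset of (c, d) and stays below
  \<open>\<omega>\<close>, so it avoids \<Gamma>. Below the curve it may leave \<open>O'\<close>, of
  which only the inclusion of the domain is known; hence membership in \<open>W\<close> and not a
  test function of \<open>O'\<close>.\<close>

lemma bump_in_W:
  fixes k :: nat
  assumes a: "adm \<alpha>" and ab: "0 <= c" "d <= 1"
  defines "\<phi> \<equiv> (%x::R2. plateau k (bmp c d (fst x)) * bmp (amin - 1) ((amax + \<omega>) / 2) (snd x))"
  shows "W \<omega> \<alpha> \<phi>" "Cc \<phi>"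
proof -
  let ?y = "(amax + \<omega>) / 2"
  have sm: "smooth \<phi>" unfolding \<phi>_def by (intro smooth_mult smooth_plateau smooth_bmp smooth_fst smooth_snd)
  have cb: "continuous_on UNIV (bmp c d)"
    using continuous_slice(2)[OF smooth_continuous[OF smooth_bmp[OF smooth_fst, of c d]], of UNIV 0] by simp
  let ?K = "{t. 0 < k \<and> 1 / real k <= bmp c d t}"
  have Kc: "closed ?K" by (intro closed_Collect_conj closed_Collect_const closed_Collect_le continuous_intros cb)
  have K01: "?K \<subseteq> {t. c < t \<and> t < d}"
  proof
    fix t assume "t \<in> ?K"
    then have "0 < bmp c d t" by (auto intro: less_le_trans[of 0 "1 / real k"])
    then show "t \<in> {t. c < t \<and> t < d}" by (simp add: bmp_pos_iff)
  qed
  have Kcomp: "compact ?K"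
    unfolding compact_eq_bounded_closed
  proof
    show "bounded ?K" by (rule bounded_subset[OF bounded_closed_interval[of c d]]) (use K01 in auto)
  qed (rule Kc)
  have nz: "{x. \<phi> x \<noteq> 0} \<subseteq> ?K \<times> {amin - 1..?y}"
  proof
    fix x assume "x \<in> {x. \<phi> x \<noteq> 0}"
    then have 1: "plateau k (bmp c d (fst x)) \<noteq> 0" and 2: "bmp (amin - 1) ?y (snd x) \<noteq> 0" by (auto simp: \<phi>_def)
    have "0 < bmp (amin - 1) ?y (snd x)" using 2 bmp_nonneg[of "amin - 1" ?y "snd x"] by linarith
    then have "snd x \<in> {amin - 1..?y}" by (auto simp: bmp_pos_iff)
    moreover have "fst x \<in> ?K" using plateau_nonzero[OF 1] by auto
    ultimately show "x \<in> ?K \<times> {amin - 1..?y}" by (cases x) auto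
  qed
  have cs: "compact (supp \<phi>)" "supp \<phi> \<subseteq> ?K \<times> {amin - 1..?y}"
    using compact_supp_subset[OF nz compact_Times[OF Kcomp compact_Icc]] by auto
  show cc: "Cc \<phi>" using sm cs by (simp add: Cc_def)
  have "supp \<phi> \<inter> Gam \<omega> \<alpha> = {}"
  proof -
    have "x \<notin> Gam \<omega> \<alpha>" if "x \<in> supp \<phi>" for x
    proof (rule Gam_away[OF a])
      have "fst x \<in> ?K" "snd x <= ?y" using that cs(2) by auto
      then show "0 < fst x" "fst x < 1" "snd x < \<omega>" using K01 ab amax_\<omega> by auto
    qed
    then show ?thesis by blast
  qed
  moreover have "H1sq (Om' \<alpha>) (%x. \<phi> x - \<phi> x) = 0"
    unfolding H1sq_diff[OF Om_open[OF a] Om_bounded[OF a] sm smooth_H1(1)[OF Om_open[OF a] Om_bounded[OF a] sm]]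
    using smooth_H1(2)[OF Om_open[OF a] Om_bounded[OF a] sm]
    by (subst l2n_cong_AE[of _ _ "%x. 0"])
       (auto intro!: sqi_measurable[OF sqi_diff[OF sqi_J[OF Om_borel[OF a] Om_bounded[OF a] sm] H1_sqi_JW(1)[OF Om_borel[OF a] smooth_H1(1)[OF Om_open[OF a] Om_bounded[OF a] sm]]]])
  ultimately show "W \<omega> \<alpha> \<phi>"
    unfolding W_def using smooth_H1(1)[OF Om_open[OF a] Om_bounded[OF a] sm] cc by (intro conjI exI[of _ "%k. \<phi>"]) auto
qed

text \<open>On the curve the bumps of \<open>bump_in_W\<close> are plateaus in s times one positive
  weight. Hence q times this weight has zero integral over every interval, and the weight can be
  divided out.\<close>

lemma trace_orthogonal_zero:
  assumes a: "adm \<alpha>" and Wr: "!!w. W \<omega> \<alpha> w ==> \<exists>w'. H10 O' w' \<and> (\<forall>x\<in>Om' \<alpha>. w x = w' x)"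
    and q: "sqi M1 q" and z: "!!V t. TT \<alpha> V t ==> (LINT s|M1. q s * t s) = 0"
  shows "AE s in M1. q s = 0"
proof -
  let ?y = "(amax + \<omega>) / 2"
  let ?\<rho> = "%s. bmp (amin - 1) ?y (\<alpha> s)"
  have rho: "0 < ?\<rho> s" if "0 < s" "s < 1" for s
  proof -
    have "amin <= \<alpha> s \<and> \<alpha> s <= amax" using a that by (auto simp: adm_def)
    then show ?thesis using amax_\<omega> by (simp add: bmp_pos_iff)
  qed
  have crho: "continuous_on {0..1} ?\<rho>"
    using trace_continuous[OF a smooth_continuous[OF smooth_bmp[OF smooth_snd]], of "amin - 1" ?y] by simp
  have srho: "sqi M1 ?\<rho>" by (rule M1_continuous_sqi[OF crho])
  have iq: "integrable M1 (%s. q s * ?\<rho> s)" by (rule sqi_mult[OF q srho])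
  have test: "(LINT s|M1. (q s * ?\<rho> s) * plateau k (bmp c d s)) = 0" if cd: "0 <= c" "d <= 1" for k c d
  proof -
    define \<phi> where "\<phi> = (%x::R2. plateau k (bmp c d (fst x)) * bmp (amin - 1) ?y (snd x))"
    have w: "W \<omega> \<alpha> \<phi>" "Cc \<phi>" unfolding \<phi>_def by (rule bump_in_W[OF a cd])+
    obtain w' where w': "H10 O' w'" "!!x. x \<in> Om' \<alpha> ==> \<phi> x = w' x" using Wr[OF w(1)] by blast
    have T: "TT \<alpha> (JW O' w') (tr' \<alpha> w')" by (rule H10_TT[OF a w'(1)])
    have st: "sqi M1 (%s. \<phi> (s, \<alpha> s))" by (rule trace_sqi[OF a smooth_continuous[OF Cc_smooth[OF w(2)]]])
    \<comment> \<open>The constant sequence \<open>\<phi>\<close> serves as the approximation,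
      because it coincides with w' on the domain.\<close>
    have "trace_rel \<omega> \<alpha> w' (%s. \<phi> (s, \<alpha> s))"
      unfolding trace_rel_def M1_L2S
    proof (intro conjI exI[of _ "%k. \<phi>"] allI st w(2))
      have e: "wd (Om' \<alpha>) (%x. \<phi> x - w' x) = wd (Om' \<alpha>) (%x. 0)" by (rule wd_cong) (simp add: w')
      have "H1sq (Om' \<alpha>) (%x. \<phi> x - w' x) = H1sq (Om' \<alpha>) (%x. 0)"
        unfolding H1sq_def H1ip_def intg_def set_lebesgue_integral_def e
        by (intro Bochner_Integration.integral_cong refl) (use w' in \<open>auto simp: indicator_def\<close>)
      also have "\<dots> = 0"
      proof -
        have "AE x in RS (Om' \<alpha>). JW (Om' \<alpha>) (%x. 0) x = 0"
          using smooth_H1(2)[OF Om_open[OF a] Om_bounded[OF a] smooth_const[of 0]] by (simp add: J_def pd_def zero_prod_def)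
        then show ?thesis
          using l2n_eq_0_iff[OF H1_sqi_JW(1)[OF Om_borel[OF a] smooth_H1(1)[OF Om_open[OF a] Om_bounded[OF a] smooth_const[of 0]]]]
          by (simp add: H1sq_JW[OF Om_borel[OF a]])
      qed
      finally show "(%k. H1sq (Om' \<alpha>) (%x. \<phi> x - w' x)) \<longlonglongrightarrow> 0" by simp
      show "(%k::nat. LBINT s:{0<..<1}. (\<phi> (s, \<alpha> s) - \<phi> (s, \<alpha> s))\<^sup>2) \<longlonglongrightarrow> 0" by (simp add: set_lebesgue_integral_def)
    qed
    then have "AE s in M1. tr' \<alpha> w' s = \<phi> (s, \<alpha> s)"
      using trace_rel_unique[OF a H10_JW_Om(1)[OF a w'(1)] TT_tr(2)[OF a T]] by (simp add: JW_pr0)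
    then have "(LINT s|M1. q s * \<phi> (s, \<alpha> s)) = (LINT s|M1. q s * tr' \<alpha> w' s)"
      using sqi_measurable[OF q] sqi_measurable[OF st] sqi_measurable[OF tr_sqi[OF a w'(1)]]
      by (intro integral_cong_AE) (auto elim!: eventually_mono)
    also have "\<dots> = 0" by (rule z[OF T])
    finally show ?thesis by (simp add: \<phi>_def mult_ac)
  qed
  define F where "F s = indicator {0<..<1} s * (q s * ?\<rho> s)" for s :: real
  have iF: "integrable lborel F" using iq by (simp add: F_def[abs_def] integrable_restrict_space)
  have "AE s in lborel. F s = 0"
  proof (rule AE_zero_of_box_integrals[OF iF])
    fix c d :: real
    \<comment> \<open>Clipped to (0,1): F vanishes elsewhere, and the bumps are admissible only over
      subintervals of (0,1).\<close>
    let ?c = "max 0 c" and ?d = "min 1 d"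
    have e: "indicator (box c d) s *\<^sub>R F s = indicator {?c<..<?d} s * F s" for s by (auto simp: F_def indicator_def)
    have lim: "(%k. plateau k (bmp ?c ?d s)) \<longlonglongrightarrow> indicator {?c<..<?d} s" for s
    proof -
      have "(if 0 < bmp ?c ?d s then 1 else 0) = (indicator {?c<..<?d} s :: real)" by (simp add: bmp_pos_iff indicator_def)
      then show ?thesis using plateau_tendsto[OF bmp_nonneg, of ?c ?d s] by (simp only:)
    qed
    have pm: "(%s. plateau k (bmp ?c ?d s)) \<in> borel_measurable borel" for k
    proof -
      have "continuous_on UNIV (%x::R2. plateau k (bmp ?c ?d (fst x)))"
        by (intro smooth_continuous smooth_plateau smooth_bmp smooth_fst)
      from continuous_slice(2)[OF this, of UNIV 0] show ?thesis by (simp add: borel_measurable_continuous_onI)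
    qed
    have "(%k. LINT s|lborel. plateau k (bmp ?c ?d s) * F s) \<longlonglongrightarrow> (LINT s|lborel. indicator {?c<..<?d} s * F s)"
    proof (rule integral_dominated_convergence[where w="%s. norm (F s)"])
      show "AE s in lborel. (%k. plateau k (bmp ?c ?d s) * F s) \<longlonglongrightarrow> indicator {?c<..<?d} s * F s"
        by (intro AE_I2 tendsto_mult_right lim)
      show "AE s in lborel. norm (plateau k (bmp ?c ?d s) * F s) <= norm (F s)" for k
        using plateau_bounds[of k] by (auto simp: abs_mult intro!: mult_left_le_one_le)
      show "(%s. plateau k (bmp ?c ?d s) * F s) \<in> borel_measurable lborel" for k
        using borel_measurable_integrable[OF iF] pm[of k] by simp
      show "(%s. indicator {?c<..<?d} s * F s) \<in> borel_measurable lborel" using borel_measurable_integrable[OF iF] by simp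
    qed (use iF in auto)
    moreover have "(LINT s|lborel. plateau k (bmp ?c ?d s) * F s) = 0" for k
    proof -
      have "(LINT s|lborel. plateau k (bmp ?c ?d s) * F s) = (LINT s|M1. (q s * ?\<rho> s) * plateau k (bmp ?c ?d s))"
        by (simp add: F_def integral_restrict_space mult_ac)
      also have "\<dots> = 0" by (rule test) auto
      finally show ?thesis .
    qed
    ultimately have "(LINT s|lborel. indicator {?c<..<?d} s * F s) = 0" by (simp add: LIMSEQ_const_iff)
    then show "(LINT x:box c d|lborel. F x) = 0" by (simp only: set_lebesgue_integral_def e)
  qed
  then have "AE s in M1. q s * ?\<rho> s = 0" unfolding M1_AE by eventually_elim (auto simp: F_def)
  moreover have "AE s in M1. 0 < ?\<rho> s" by (rule M1_AE_I) (rule rho)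
  ultimately show ?thesis by eventually_elim auto
qed

end

section \<open>Varying domains\<close>

lemma l2n_mono_set:
  fixes F :: "R2 => 'b::euclidean_space"
  assumes "U \<in> sets borel" "S \<in> sets borel" "sqi (RS U) F" "sqi (RS S) F" "!!x. x \<in> U ==> x \<notin> S ==> F x = 0"
  shows "l2n (RS U) F <= l2n (RS S) F"
proof -
  have i: "integrable lborel (%x. indicator U x *\<^sub>R (norm (F x))\<^sup>2)" "integrable lborel (%x. indicator S x *\<^sub>R (norm (F x))\<^sup>2)"
    using assms(1-4) by (simp_all add: sqi_def integrable_restrict_space)
  have "(LINT x|lborel. indicator U x *\<^sub>R (norm (F x))\<^sup>2) <= (LINT x|lborel. indicator S x *\<^sub>R (norm (F x))\<^sup>2)"
    by (rule integral_mono[OF i]) (use assms(5) in \<open>auto simp: indicator_def\<close>)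
  then show ?thesis using assms(1,2) by (simp add: l2n_def integral_restrict_space)
qed

text \<open>Keeps apart the term with the derivatives of the multiplier: it meets only the value
  component of w, the one that Hardy's inequality makes small.\<close>

lemma mulT_norm_split: "norm (mulT m w) <= \<bar>pr0 m\<bar> * norm w + (\<bar>pr1 m\<bar> + \<bar>pr2 m\<bar>) * \<bar>pr0 w\<bar>"
proof -
  have "norm (mulT m w) <= \<bar>pr0 m\<bar> * norm w + (\<bar>pr1 m * pr0 w\<bar> + \<bar>pr2 m * pr0 w\<bar>)"
    unfolding mulT_alt
    using norm_triangle_ineq[of "pr0 m *\<^sub>R w" "(0, pr1 m * pr0 w, pr2 m * pr0 w)"]
      norm_Pair_le[of 0 "(pr1 m * pr0 w, pr2 m * pr0 w)"] norm_Pair_le[of "pr1 m * pr0 w" "pr2 m * pr0 w"]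
    by simp
  then show ?thesis by (simp add: abs_mult algebra_simps)
qed

lemma mulT_add: "mulT m (w + w') = mulT m w + mulT m w'"
  by (simp add: mulT_def pr_lin algebra_simps)

definition C0conv :: "(nat => real => real) => (real => real) => bool" where
  "C0conv \<alpha>s \<alpha> \<longleftrightarrow> (\<forall>\<epsilon>>0. \<forall>\<^sub>F n in sequentially. \<forall>s. 0 < s --> s < 1 --> \<bar>\<alpha>s n s - \<alpha> s\<bar> <= \<epsilon>)"

lemma sqi_norm: "sqi M F ==> sqi M (%x. norm (F x))"
  using measurable_compose[OF sqi_measurable borel_measurable_norm, of M F] by (simp add: sqi_def)

context holdall
begin

text \<open>A point off the limit graph lies, for large n, on the same side of the n-th curve as of
  the limit curve. The graph is a null set and q dominates.\<close>

lemma indicator_Om_conv: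
  fixes q :: "R2 => 'b::euclidean_space"
  assumes a: "!!n. adm (\<alpha>s n)" "adm \<alpha>" and c: "C0conv \<alpha>s \<alpha>" and q: "sqi RO q"
  shows "l2conv RO (%n x. indicator (Om' (\<alpha>s n)) x *\<^sub>R q x) (%x. indicator (Om' \<alpha>) x *\<^sub>R q x)"
proof (rule l2n_dominated[OF _ q])
  have im: "(%x. indicator (Om' \<beta>) x *\<^sub>R q x) \<in> borel_measurable RO" if "adm \<beta>" for \<beta>
    by (rule borel_measurable_scaleR[OF RS_measurable[OF borel_measurable_indicator[OF Om_borel[OF that]]] sqi_measurable[OF q]])
  show "(%x. indicator (Om' (\<alpha>s n)) x *\<^sub>R q x - indicator (Om' \<alpha>) x *\<^sub>R q x) \<in> borel_measurable RO" for n
    by (intro borel_measurable_diff im a)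
  show "AE x in RO. norm (indicator (Om' (\<alpha>s n)) x *\<^sub>R q x - indicator (Om' \<alpha>) x *\<^sub>R q x) <= norm (q x)" for n
    by (rule AE_I2) (auto simp: indicator_def)
  have "AE x in RO. 0 < fst x \<and> fst x < 1 --> snd x \<noteq> \<alpha> (fst x)"
    using AE_off_graph[OF a(2)] by (auto simp: RS_AE elim!: eventually_mono)
  then show "AE x in RO. (%n. indicator (Om' (\<alpha>s n)) x *\<^sub>R q x - indicator (Om' \<alpha>) x *\<^sub>R q x) \<longlonglongrightarrow> 0"
  proof eventually_elim
    case (elim x)
    obtain s y where x: "x = (s, y)" by fastforce
    show ?case
    proof (cases "0 < s \<and> s < 1")
      case True
      define \<epsilon> where "\<epsilon> = \<bar>y - \<alpha> s\<bar> / 2"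
      have e: "0 < \<epsilon>" using elim True by (auto simp: x \<epsilon>_def)
      have "\<forall>\<^sub>F n in sequentially. \<forall>s. 0 < s --> s < 1 --> \<bar>\<alpha>s n s - \<alpha> s\<bar> <= \<epsilon>" using c e by (simp add: C0conv_def)
      then have "\<forall>\<^sub>F n in sequentially. indicator (Om' (\<alpha>s n)) x *\<^sub>R q x - indicator (Om' \<alpha>) x *\<^sub>R q x = 0"
      proof eventually_elim
        case (elim n)
        then have "\<bar>\<alpha>s n s - \<alpha> s\<bar> <= \<bar>y - \<alpha> s\<bar> / 2" using True by (auto simp: \<epsilon>_def)
        then have "\<alpha>s n s < y \<longleftrightarrow> \<alpha> s < y" using e unfolding \<epsilon>_def by (cases "\<alpha> s < y"; simp add: abs_if split: if_splits; linarith)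
        then show ?case by (simp add: x Om_def indicator_def)
      qed
      then show ?thesis by (rule tendsto_eventually)
    next
      case False
      then have "(%n. indicator (Om' (\<alpha>s n)) x *\<^sub>R q x - indicator (Om' \<alpha>) x *\<^sub>R q x) = (%n. 0)"
        by (auto simp: x Om_def indicator_def)
      then show ?thesis by (simp only: tendsto_const)
    qed
  qed
qed

lemma trace_shift_conv:
  assumes a: "!!n. adm (\<alpha>s n)" "adm \<alpha>" and c: "C0conv \<alpha>s \<alpha>" and v: "H10 O' v"
  shows "l2conv M1 (%n. tr' (\<alpha>s n) v) (tr' \<alpha> v)"
proof (rule LIMSEQ_I)
  fix e :: real assume e: "0 < e"
  define B where "B = l2n RO (JW O' v) + 1"
  have B: "0 < B" "l2n RO (JW O' v) < B" by (auto simp: B_def add_nonneg_pos)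
  define \<epsilon> where "\<epsilon> = (e / (2 * B))\<^sup>2"
  have ep: "0 < \<epsilon>" "sqrt \<epsilon> = e / (2 * B)" using e B by (auto simp: \<epsilon>_def)
  have "\<forall>\<^sub>F n in sequentially. \<forall>s. 0 < s --> s < 1 --> \<bar>\<alpha>s n s - \<alpha> s\<bar> <= \<epsilon>" using c ep(1) by (simp add: C0conv_def)
  then obtain N where N: "!!n s. n \<ge> N ==> 0 < s ==> s < 1 ==> \<bar>\<alpha>s n s - \<alpha> s\<bar> <= \<epsilon>" by (auto simp: eventually_sequentially)
  have "norm (l2n M1 (%s. tr' (\<alpha>s n) v s - tr' \<alpha> v s) - 0) < e" if "n \<ge> N" for n
  proof -
    have "l2n M1 (%s. tr' (\<alpha>s n) v s - tr' \<alpha> v s) <= sqrt \<epsilon> * l2n RO (JW O' v)"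
      by (rule TT_shift[OF a(2) a(1) H10_TT[OF a(2) v] H10_TT[OF a(1) v] N[OF that]])
    also have "\<dots> <= (e / (2 * B)) * B" unfolding ep(2) using B e by (intro mult_left_mono) auto
    also have "\<dots> < e" using B e by simp
    finally show ?thesis by simp
  qed
  then show "\<exists>no. \<forall>n\<ge>no. norm (l2n M1 (%s. tr' (\<alpha>s n) v s - tr' \<alpha> v s) - 0) < e" by blast
qed

text \<open>The difference splits into the trace of \<open>v n - v0\<close> on the moving curve and
  the traces of the fixed \<open>v0\<close> on two curves. The former is weakly null with bounded
  jets, so Rellich gives strong L2 convergence, and the trace estimate with a small height turns
  this into convergence of traces.\<close>

lemma trace_strong_conv:
  assumes a: "!!n. adm (\<alpha>s n)" "adm \<alpha>" and c: "C0conv \<alpha>s \<alpha>" and v: "!!n. H10 O' (v n)" "H10 O' v0"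
    and K: "!!n. l2n RO (JW O' (v n)) <= K"
    and w: "!!q. sqi RO q ==> (%n. LINT x|RO. JW O' (v n) x \<bullet> q x) \<longlonglongrightarrow> (LINT x|RO. JW O' v0 x \<bullet> q x)"
  shows "l2conv M1 (%n. tr' (\<alpha>s n) (v n)) (tr' \<alpha> v0)"
proof -
  define Z where "Z n x = JW O' (v n) x + (-1) *\<^sub>R JW O' v0 x" for n x
  have T: "TT (\<alpha>s n) (Z n) (%s. tr' (\<alpha>s n) (v n) s + (-1) * tr' (\<alpha>s n) v0 s)" for n
    unfolding Z_def by (rule TT_comb[OF a(1) H10_TT[OF a(1) v(1)] H10_TT[OF a(1) v(2)]])
  have sZ: "sqi RO (Z n)" for n using T[of n] by (simp add: TT_def)
  \<comment> \<open>Rellich compactness is available for test functions, hence a replacement at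
    distance below 1/(n+1).\<close>
  have "\<forall>n. \<exists>\<phi>. testfn O' \<phi> \<and> l2n RO (%x. J \<phi> x - Z n x) < 1 / real (Suc n)"
    using TT_HH[OF T] unfolding HH_def by simp
  from choice[OF this] obtain \<phi> where p: "!!n. testfn O' (\<phi> n)" "!!n. l2n RO (%x. J (\<phi> n) x - Z n x) < 1 / real (Suc n)" by blast
  have inv: "(%n. B / real (Suc n)) \<longlonglongrightarrow> 0" for B :: real
    using tendsto_mult_right_zero[OF LIMSEQ_inverse_real_of_nat, of B] by (simp add: divide_inverse)
  let ?K = "K + l2n RO (JW O' v0) + 1"
  have Kp: "l2n RO (J (\<phi> n)) <= ?K" for n
  proof -
    have "l2n RO (J (\<phi> n)) <= l2n RO (%x. J (\<phi> n) x - Z n x) + l2n RO (Z n)"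
      using l2n_triangle[OF sqi_diff[OF J_sqi[OF p(1)[of n]] sZ[of n]] sZ[of n]] by simp
    moreover have "l2n RO (Z n) <= l2n RO (JW O' (v n)) + l2n RO (JW O' v0)"
      using l2n_triangle_diff[OF H10_sqi[OF v(1)[of n]] H10_sqi[OF v(2)]] by (simp add: Z_def[abs_def])
    moreover have "1 / real (Suc n) <= 1" by simp
    ultimately show ?thesis using p(2)[of n] K[of n] by linarith
  qed
  have weak: "(%n. LINT x|RO. \<phi> n x * q x) \<longlonglongrightarrow> 0" if q: "sqi RO q" for q
  proof -
    let ?q = "%x. (q x, 0, 0) :: real \<times> real \<times> real"
    have sq: "sqi RO ?q" by (intro sqi_Pair q sqi_zero)
    have "(%n. (LINT x|RO. JW O' (v n) x \<bullet> ?q x) - (LINT x|RO. JW O' v0 x \<bullet> ?q x)) \<longlonglongrightarrow> 0"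
      using LIM_zero[OF w[OF sq]] .
    moreover have "(LINT x|RO. JW O' (v n) x \<bullet> ?q x) - (LINT x|RO. JW O' v0 x \<bullet> ?q x) = (LINT x|RO. Z n x \<bullet> ?q x)" for n
      unfolding Z_def inner_add_left
      by (subst Bochner_Integration.integral_add)
         (auto intro!: sqi_inner[OF H10_sqi[OF v(1)] sq] sqi_inner[OF H10_sqi[OF v(2)] sq])
    ultimately have A: "(%n. LINT x|RO. Z n x \<bullet> ?q x) \<longlonglongrightarrow> 0" by simp
    have B: "(%n. (LINT x|RO. J (\<phi> n) x \<bullet> ?q x) - (LINT x|RO. Z n x \<bullet> ?q x)) \<longlonglongrightarrow> 0"
    proof (rule Lim_null_comparison[OF _ inv[of "l2n RO ?q"]], rule always_eventually, rule allI)
      fix n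
      have "(LINT x|RO. J (\<phi> n) x \<bullet> ?q x) - (LINT x|RO. Z n x \<bullet> ?q x) = (LINT x|RO. (J (\<phi> n) x - Z n x) \<bullet> ?q x)"
        unfolding inner_diff_left by (rule Bochner_Integration.integral_diff[symmetric]) (intro sqi_inner J_sqi p sZ sq)+
      also have "\<bar>\<dots>\<bar> <= l2n RO (%x. J (\<phi> n) x - Z n x) * l2n RO ?q"
        by (rule l2_Cauchy_Schwarz[OF sqi_diff[OF J_sqi[OF p(1)] sZ] sq])
      also have "\<dots> <= 1 / real (Suc n) * l2n RO ?q" using p(2)[of n] by (intro mult_right_mono) auto
      finally show "norm ((LINT x|RO. J (\<phi> n) x \<bullet> ?q x) - (LINT x|RO. Z n x \<bullet> ?q x)) <= l2n RO ?q / real (Suc n)" by simp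
    qed
    have "(%n. LINT x|RO. J (\<phi> n) x \<bullet> ?q x) \<longlonglongrightarrow> 0" using tendsto_add[OF B A] by simp
    then show ?thesis by (simp add: J_def)
  qed
  have L: "(%n. l2n RO (\<phi> n)) \<longlonglongrightarrow> 0"
    by (rule Rellich_testfn[OF O_borel bddO p(1) Kp weak])
  have te: "h * (l2n M1 (%s. \<phi> n (s, \<alpha>s n s)))\<^sup>2 <= 2 * (l2n RO (\<phi> n))\<^sup>2 + 2 * h\<^sup>2 * ?K\<^sup>2" if h: "0 < h" "h <= \<omega> - amax" for h n
  proof -
    have s: "sqi RO (\<phi> n)" "sqi RO (pd e2 (\<phi> n))" by (rule sqi_testfn[OF O_borel bddO p(1)])+
    have "l2n (RS (Om' (\<alpha>s n))) (\<phi> n) <= l2n RO (\<phi> n)"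
      by (rule sqi_subset(2)[OF Om_borel[OF a(1)] O_borel Om_sub[OF a(1)] s(1)])
    moreover have "l2n (RS (Om' (\<alpha>s n))) (pd e2 (\<phi> n)) <= l2n RO (pd e2 (\<phi> n))"
      by (rule sqi_subset(2)[OF Om_borel[OF a(1)] O_borel Om_sub[OF a(1)] s(2)])
    moreover have "l2n RO (pd e2 (\<phi> n)) <= ?K"
      using sqi_pr(6)[OF J_sqi[OF p(1)], of n] Kp[of n] by (simp add: pr_J)
    ultimately have "2 * (l2n (RS (Om' (\<alpha>s n))) (\<phi> n))\<^sup>2 + 2 * h\<^sup>2 * (l2n (RS (Om' (\<alpha>s n))) (pd e2 (\<phi> n)))\<^sup>2
        <= 2 * (l2n RO (\<phi> n))\<^sup>2 + 2 * h\<^sup>2 * ?K\<^sup>2"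
      by (intro add_mono mult_left_mono power_mono) auto
    with trace_estimate[OF a(1) testfn_smooth[OF p(1)] h, of n n] show ?thesis by linarith
  qed
  have K0: "0 < ?K" using order_trans[OF l2n_nonneg K[of 0]] by (simp add: add_nonneg_pos)
  have tr0: "(%n. l2n M1 (%s. \<phi> n (s, \<alpha>s n s))) \<longlonglongrightarrow> 0"
  proof (rule sqrt_tendsto_0[OF LIMSEQ_I])
    fix e :: real assume e: "0 < e"
    \<comment> \<open>Keeps the derivative part \<open>2 * h * ?K^2\<close> of the trace estimate at
      most e / 2 for all n at once.\<close>
    define h where "h = min (\<omega> - amax) (e / (4 * ?K\<^sup>2))"
    have h: "0 < h" "h <= \<omega> - amax" using e amax_\<omega> K0 by (auto simp: h_def)
    have hK: "2 * h * ?K\<^sup>2 <= e / 2"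
    proof -
      have "2 * h * ?K\<^sup>2 <= 2 * (e / (4 * ?K\<^sup>2)) * ?K\<^sup>2" by (intro mult_right_mono mult_left_mono) (auto simp: h_def)
      also have "\<dots> = e / 2" using K0 by simp
      finally show ?thesis .
    qed
    have "(%n. 2 / h * (l2n RO (\<phi> n))\<^sup>2) \<longlonglongrightarrow> 2 / h * 0\<^sup>2" by (intro tendsto_intros L)
    then have "eventually (%n. 2 / h * (l2n RO (\<phi> n))\<^sup>2 < e / 2) sequentially" using e by (intro order_tendstoD(2)) auto
    then obtain N where N: "!!n. n \<ge> N ==> 2 / h * (l2n RO (\<phi> n))\<^sup>2 < e / 2" by (auto simp: eventually_sequentially)
    have "norm ((l2n M1 (%s. \<phi> n (s, \<alpha>s n s)))\<^sup>2 - 0) < e" if "n \<ge> N" for n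
    proof -
      have "(l2n M1 (%s. \<phi> n (s, \<alpha>s n s)))\<^sup>2 <= (2 * (l2n RO (\<phi> n))\<^sup>2 + 2 * h\<^sup>2 * ?K\<^sup>2) / h"
        using te[OF h, of n] h by (simp add: pos_le_divide_eq mult.commute)
      also have "\<dots> = 2 / h * (l2n RO (\<phi> n))\<^sup>2 + 2 * h * ?K\<^sup>2" using h by (simp add: add_divide_distrib power2_eq_square)
      finally show ?thesis using N[OF that] hK by simp
    qed
    then show "\<exists>no. \<forall>n\<ge>no. norm ((l2n M1 (%s. \<phi> n (s, \<alpha>s n s)))\<^sup>2 - 0) < e" by blast
  qed simp
  have b: "l2n M1 (%s. tr' (\<alpha>s n) (v n) s - tr' \<alpha> v0 s) \<le>
     Ct / real (Suc n) + l2n M1 (%s. \<phi> n (s, \<alpha>s n s)) + l2n M1 (%s. tr' (\<alpha>s n) v0 s - tr' \<alpha> v0 s)" for n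
  proof -
    let ?d = "%s. tr' (\<alpha>s n) (v n) s + (-1) * tr' (\<alpha>s n) v0 s"
    have sd: "sqi M1 ?d" using T[of n] by (simp add: TT_def)
    note st = tr_sqi[OF a(1) v(1), of n n] tr_sqi[OF a(1) v(2), of n] tr_sqi[OF a(2) v(2)]
    have "l2n M1 ?d <= l2n M1 (%s. \<phi> n (s, \<alpha>s n s)) + l2n M1 (%s. \<phi> n (s, \<alpha>s n s) - ?d s)"
      using l2n_triangle_diff[OF test_trace_sqi[OF a(1) p(1)] sqi_diff[OF test_trace_sqi[OF a(1) p(1)] sd], of n n n n] by simp
    also have "l2n M1 (%s. \<phi> n (s, \<alpha>s n s) - ?d s) <= Ct * l2n RO (%x. J (\<phi> n) x - Z n x)" by (rule TT_test_diff[OF a(1) T p(1)])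
    also have "\<dots> <= Ct * (1 / real (Suc n))" using p(2)[of n] Ct_pos by (intro mult_left_mono) auto
    finally have "l2n M1 ?d <= Ct / real (Suc n) + l2n M1 (%s. \<phi> n (s, \<alpha>s n s))" by simp
    moreover have "l2n M1 (%s. tr' (\<alpha>s n) (v n) s - tr' \<alpha> v0 s) <= l2n M1 ?d + l2n M1 (%s. tr' (\<alpha>s n) v0 s - tr' \<alpha> v0 s)"
      using l2n_triangle3[OF st] by simp
    ultimately show ?thesis by linarith
  qed
  have G: "(%n. Ct / real (Suc n) + l2n M1 (%s. \<phi> n (s, \<alpha>s n s)) + l2n M1 (%s. tr' (\<alpha>s n) v0 s - tr' \<alpha> v0 s)) \<longlonglongrightarrow> 0 + 0 + 0"
    by (intro tendsto_add inv tr0 trace_shift_conv[OF a c v(2)])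
  show ?thesis by (rule Lim_null_comparison[OF always_eventually G[unfolded add_0_right]]) (use b in simp)
qed

lemma TT_slope_mult:
  assumes a: "adm \<beta>" and T: "TT \<beta> V t" and U: "c \<in> Uad amin amax C1 C2"
  shows "TT \<beta> (%x. mulT (slope c (fst x), slope' c (fst x), 0) (V x)) (%s. slope c s * t s)"
proof -
  obtain L where "!!x y. \<bar>slope c x - slope c y\<bar> <= L * \<bar>x - y\<bar>" using Uad_slope(2)[OF U] by blast
  then show ?thesis by (rule TT_lipschitz_mult[OF a T _ slope'_measurable[OF U] Uad_slope(4)[OF U]])
qed

lemma TT_smooth_mult:
  assumes a: "adm \<beta>" and T: "TT \<beta> V t" and M: "smooth M"
  shows "TT \<beta> (%x. mulT (J M x) (V x)) (%s. M (s, \<beta> s) * t s)"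
proof -
  have "compact (J M ` closure O')"
    using bddO by (intro compact_continuous_image continuous_on_subset[OF J_continuous[OF M]]) auto
  then obtain K1 where K1: "\<forall>y\<in>J M ` closure O'. norm y <= K1" using compact_imp_bounded bounded_iff by blast
  have "compact ((%s. M (s, \<beta> s)) ` {0..1})"
    by (intro compact_continuous_image trace_continuous[OF a smooth_continuous[OF M]]) simp
  then obtain K2 where K2: "\<forall>y\<in>(%s. M (s, \<beta> s)) ` {0..1}. norm y <= K2" using compact_imp_bounded bounded_iff by blast
  show ?thesis
  proof (rule TT_mult_limit[OF a T, where M="%k. M" and K="max K1 K2"])
    show "J M \<in> borel_measurable RO" by (rule RS_measurable[OF borel_measurable_continuous_onI[OF J_continuous[OF M]]])
    show "(%s. M (s, \<beta> s)) \<in> borel_measurable M1" by (rule M1_continuous_measurable[OF trace_continuous[OF a smooth_continuous[OF M]]])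
    show "norm (J M x) <= max K1 K2" if "x \<in> O'" for x using K1 closure_subset[of O'] that by (meson imageI le_max_iff_disj subsetD)
    show "\<bar>M (s, \<beta> s)\<bar> <= max K1 K2" if "0 < s" "s < 1" for s using K2[rule_format, of "M (s, \<beta> s)"] that by (auto simp: le_max_iff_disj)
  qed (use M in auto)
qed

text \<open>The order of choices decides. The strip is fixed first, so that the fixed jets Z and V1
  are small on it; this also fixes the factor 1/\<delta> of the cutoff gradient. Only then is n
  taken large, to make the slopes close to order \<eta>. The second derivatives stay apart by up to
  2 C2 for every n, and only the thinness of the strip compensates for that.\<close>

lemma corrector:
  assumes U: "!!n. \<alpha>s n \<in> Uad amin amax C1 C2" "\<alpha> \<in> Uad amin amax C1 C2" and a: "!!n. adm (\<alpha>s n)" "adm \<alpha>"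
    and c: "C1conv \<alpha>s \<alpha>" and v: "H10 O' v1" "H10 O' v2"
    and z: "AE s in M1. adv \<alpha> s * tr' \<alpha> v1 s - tr' \<alpha> v2 s = 0" and e: "0 < \<epsilon>" and C2: "0 < C2"
  shows "\<forall>\<^sub>F n in sequentially. \<exists>y. H10 O' y \<and>
     (AE s in M1. tr' (\<alpha>s n) y s = adv (\<alpha>s n) s * tr' (\<alpha>s n) v1 s - tr' (\<alpha>s n) v2 s) \<and>
     l2n (RS (Om' (\<alpha>s n))) (JW O' y) <= \<epsilon>"
proof -
  obtain C where C: "0 < C" and cut: "!!\<delta>. 0 < \<delta> ==> \<delta> <= 1 ==> \<exists>M. smooth M \<and>
      (\<forall>x y. x \<in> {0..1} --> \<bar>y - \<alpha> x\<bar> <= \<delta> / 2 --> M (x, y) = 1) \<and>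
      (\<forall>x y. x \<in> {0..1} --> 3 * \<delta> <= \<bar>y - \<alpha> x\<bar> --> J M (x, y) = 0) \<and>
      (\<forall>p. 0 <= M p \<and> M p <= 1) \<and>
      (\<forall>x y. x \<in> {0..1} --> \<bar>pd e1 M (x, y)\<bar> <= C / \<delta> \<and> \<bar>pd e2 M (x, y)\<bar> <= C / \<delta>)"
    using smooth_cutoff_near_curve[OF Uad_slope(1)[OF U(2)] slope_continuous[OF U(2)]] by metis
  define V1 where "V1 = JW O' v1"
  define V2 where "V2 = JW O' v2"
  have sV: "sqi RO V1" "sqi RO V2" using H10_sqi v by (auto simp: V1_def V2_def)
  \<comment> \<open>The jet of b' v1 - v2, the normal defect relative to a curve b, as a function on
    all of \<open>O'\<close>. For b = \<alpha> its trace on S(\<alpha>) is zero.\<close>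
  define Zf where "Zf b x = mulT (slope b (fst x), slope' b (fst x), 0) (V1 x) + (-1) *\<^sub>R V2 x" for b x
  have TZ: "TT \<beta> (Zf b) (%s. slope b s * tr' \<beta> v1 s + (-1) * tr' \<beta> v2 s)" if "adm \<beta>" "b \<in> Uad amin amax C1 C2" for b \<beta>
    unfolding Zf_def V1_def V2_def by (rule TT_comb[OF that(1) TT_slope_mult[OF that(1) H10_TT[OF that(1) v(1)] that(2)] H10_TT[OF that(1) v(2)]])
  define Z where "Z = Zf \<alpha>"
  have sZ: "sqi RO Z" using TZ[OF a(2) U(2)] by (simp add: TT_def Z_def)
  have z0: "AE s in M1. slope \<alpha> s * tr' \<alpha> v1 s + (-1) * tr' \<alpha> v2 s = 0"
  proof -
    have "AE s in M1. slope \<alpha> s = adv \<alpha> s" by (rule M1_AE_I) (simp add: slope_eq)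
    with z show ?thesis by eventually_elim simp
  qed
  \<comment> \<open>Here 12 C is the cutoff gradient bound 2 C / \<delta> times the Hardy factor 2 r
    with r = 3 \<delta>; 2 C2 bounds the difference of the second derivatives of the curves.\<close>
  have "(%k. (1 + 12 * C) * l2n (RS (strip \<alpha> (1 / real (Suc k)) \<inter> O')) Z + 2 * C2 * l2n (RS (strip \<alpha> (1 / real (Suc k)) \<inter> O')) V1) \<longlonglongrightarrow> (1 + 12 * C) * 0 + 2 * C2 * 0"
    by (intro tendsto_add tendsto_mult tendsto_const strip_small[OF a(2)] sZ sV)
  then have "\<forall>\<^sub>F k in sequentially. (1 + 12 * C) * l2n (RS (strip \<alpha> (1 / real (Suc k)) \<inter> O')) Z + 2 * C2 * l2n (RS (strip \<alpha> (1 / real (Suc k)) \<inter> O')) V1 < \<epsilon> / 2"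
    using e by (intro order_tendstoD(2)) auto
  then obtain k where k: "(1 + 12 * C) * l2n (RS (strip \<alpha> (1 / real (Suc k)) \<inter> O')) Z + 2 * C2 * l2n (RS (strip \<alpha> (1 / real (Suc k)) \<inter> O')) V1 < \<epsilon> / 2"
    by (auto simp: eventually_sequentially)
  define r where "r = 1 / real (Suc k)"
  define \<delta> where "\<delta> = r / 3"
  have r: "0 < r" "r = 3 * \<delta>" and d: "0 < \<delta>" "\<delta> <= 1"
  proof -
    show "0 < r" by (simp add: r_def)
    then show "r = 3 * \<delta>" "0 < \<delta>" by (simp_all add: \<delta>_def)
    have "r <= 1" by (simp add: r_def)
    then show "\<delta> <= 1" by (simp add: \<delta>_def)
  qed
  define S where "S = strip \<alpha> r \<inter> O'"
  have Sb: "S \<in> sets borel" "S \<subseteq> O'" using strip_open[OF a(2)] openO by (auto simp: S_def)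
  have kS: "(1 + 12 * C) * l2n (RS S) Z + 2 * C2 * l2n (RS S) V1 < \<epsilon> / 2" using k by (simp add: S_def r_def)
  obtain M where M: "smooth M" "!!x y. x \<in> {0..1} ==> \<bar>y - \<alpha> x\<bar> <= \<delta> / 2 ==> M (x, y) = 1"
      "!!x y. x \<in> {0..1} ==> 3 * \<delta> <= \<bar>y - \<alpha> x\<bar> ==> J M (x, y) = 0"
      "!!p. 0 <= M p \<and> M p <= 1"
      "!!x y. x \<in> {0..1} ==> \<bar>pd e1 M (x, y)\<bar> <= C / \<delta> \<and> \<bar>pd e2 M (x, y)\<bar> <= C / \<delta>"
    using cut[OF d] by blast
  \<comment> \<open>Collects what multiplies the slope difference \<eta>, including 1/\<delta>,
    which is already fixed when n is chosen.\<close>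
  define B where "B = (1 + 2 * C / \<delta>) * (l2n RO V1 + 1)"
  have B: "0 < B" using C d by (auto simp: B_def intro!: mult_pos_pos add_pos_nonneg add_nonneg_pos)
  define \<eta> where "\<eta> = \<epsilon> / (2 * B)"
  have eta: "0 < \<eta>" "\<eta> * B = \<epsilon> / 2" using e B by (auto simp: \<eta>_def)
  have "\<forall>\<^sub>F n in sequentially. \<forall>x\<in>{0..1}. \<bar>\<alpha>s n x - \<alpha> x\<bar> <= min (\<delta> / 2) \<eta> \<and> \<bar>adv (\<alpha>s n) x - adv \<alpha> x\<bar> <= min (\<delta> / 2) \<eta>"
    using c[unfolded C1conv_def, rule_format, of "min (\<delta> / 2) \<eta>"] d eta by simp
  then show ?thesis
  proof eventually_elim
    case (elim n)
    let ?b = "\<alpha>s n"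
    note T1 = TT_smooth_mult[OF a(1) TZ[OF a(1) U(1)] M(1), of n n]
    define Y where "Y x = mulT (J M x) (Zf ?b x)" for x
    have TY: "TT ?b Y (%s. M (s, ?b s) * (slope ?b s * tr' ?b v1 s + (-1) * tr' ?b v2 s))"
      unfolding Y_def by (rule T1)
    define y where "y = (%x. if x \<in> O' then pr0 (Y x) else 0)"
    have y: "H10 O' y" "AE x in RO. JW O' y x = Y x" "AE s in M1. tr' ?b y s = M (s, ?b s) * (slope ?b s * tr' ?b v1 s + (-1) * tr' ?b v2 s)"
      unfolding y_def by (rule TT_H10[OF a(1) TY])+
    have "AE s in M1. M (s, ?b s) = 1 \<and> slope ?b s = adv ?b s"
      by (rule M1_AE_I) (use elim M(2) slope_eq in auto)
    with y(3) have ty: "AE s in M1. tr' ?b y s = adv ?b s * tr' ?b v1 s - tr' ?b v2 s" by eventually_elim simp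
    have sY: "sqi RO Y" using TY by (simp add: TT_def)
    note Ub = Om_borel[OF a(1)[of n]] and Us = Om_sub[OF a(1)[of n]]
    have sYS: "sqi (RS S) Y" by (rule sqi_subset(1)[OF Sb(1) O_borel Sb(2) sY])
    have sZS: "sqi (RS S) Z" by (rule sqi_subset(1)[OF Sb(1) O_borel Sb(2) sZ])
    have sVS: "sqi (RS S) V1" by (rule sqi_subset(1)[OF Sb(1) O_borel Sb(2) sV(1)])
    have "AE x in RS (Om' ?b). JW O' y x = Y x" using y(2) Us Ub by (auto simp: RS_AE elim!: eventually_mono)
    then have "l2n (RS (Om' ?b)) (JW O' y) = l2n (RS (Om' ?b)) Y"
      using sqi_subset(1)[OF Ub O_borel Us H10_sqi[OF y(1)]] sqi_subset(1)[OF Ub O_borel Us sY]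
      by (intro l2n_cong_AE) (auto simp: sqi_def)
    also have "\<dots> <= l2n (RS S) Y"
    proof (rule l2n_mono_set[OF Ub Sb(1) sqi_subset(1)[OF Ub O_borel Us sY] sYS])
      fix x assume x: "x \<in> Om' ?b" "x \<notin> S"
      have "x \<in> O'" using x Us by blast
      then have "J M x = 0" using x M(3)[of "fst x" "snd x"] r by (cases x) (auto simp: S_def strip_def Om_def)
      then show "Y x = 0" by (simp add: Y_def mulT_def pr0_def pr1_def pr2_def zero_prod_def)
    qed
    also have "\<dots> <= \<epsilon>"
    proof -
      let ?c2 = "2 * C2 + \<eta> * (1 + 2 * C / \<delta>)"
      have AES: "AE x in RS S. x \<in> S" using Sb by (simp add: RS_AE)
      have b2: "AE x in RS S. 0 < fst x \<and> fst x < 1 --> \<bar>slope' b (fst x)\<bar> <= C2" if "b \<in> Uad amin amax C1 C2" for b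
        using AE_lborel_fst[OF Uad_slope(5)[OF that]] Sb(1) by (auto simp: RS_AE elim!: eventually_mono)
      have pt: "AE x in RS S. norm (Y x) <= norm (Z x) + (2 * C / \<delta>) * \<bar>pr0 (Z x)\<bar> + ?c2 * norm (V1 x)"
        using AES b2[OF U(1)[of n]] b2[OF U(2)]
      proof eventually_elim
        case (elim x)
        have x: "0 < fst x" "fst x < 1" using elim(1) by (auto simp: S_def strip_def)
        then have x01: "fst x \<in> {0..1}" by simp
        \<comment> \<open>The change of the defect when the limit slope is replaced by the n-th one.
          Hardy's inequality is applied to Z alone; the values of X carry the factor \<eta>, and its
          derivatives are handled by the small norm of V1 on the strip.\<close>
        define X where "X = mulT (slope ?b (fst x) - slope \<alpha> (fst x), slope' ?b (fst x) - slope' \<alpha> (fst x), 0) (V1 x)"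
        have dec: "Zf ?b x = Z x + X"
          unfolding Z_def Zf_def X_def
          using mulT_diff(2)[of "(slope ?b (fst x), slope' ?b (fst x), 0)" "(slope \<alpha> (fst x), slope' \<alpha> (fst x), 0)" "V1 x"] by simp
        have mu: "\<bar>slope ?b (fst x) - slope \<alpha> (fst x)\<bar> <= \<eta>"
          using \<open>\<forall>x\<in>{0..1}. \<bar>\<alpha>s n x - \<alpha> x\<bar> <= min (\<delta> / 2) \<eta> \<and> \<bar>adv (\<alpha>s n) x - adv \<alpha> x\<bar> <= min (\<delta> / 2) \<eta>\<close> x01
          by (auto simp: slope_eq)
        have mud: "\<bar>slope' ?b (fst x) - slope' \<alpha> (fst x)\<bar> <= 2 * C2" using elim(2,3) x by linarith
        have nX: "norm X <= (\<eta> + 2 * C2) * norm (V1 x)"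
        proof -
          have "norm X <= \<bar>slope ?b (fst x) - slope \<alpha> (fst x)\<bar> * norm (V1 x) + \<bar>slope' ?b (fst x) - slope' \<alpha> (fst x)\<bar> * \<bar>pr0 (V1 x)\<bar>"
            unfolding X_def using mulT_norm_split[of "(slope ?b (fst x) - slope \<alpha> (fst x), slope' ?b (fst x) - slope' \<alpha> (fst x), 0)" "V1 x"] by simp
          also have "\<dots> <= \<eta> * norm (V1 x) + 2 * C2 * norm (V1 x)"
            using C2 by (intro add_mono mult_mono mu mud pr_norm) (auto simp: eta less_imp_le)
          finally show ?thesis by (simp add: algebra_simps)
        qed
        have nX0: "\<bar>pr0 X\<bar> <= \<eta> * norm (V1 x)"
          unfolding X_def mulT_def using eta by (simp add: abs_mult) (intro mult_mono mu pr_norm, auto)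
        have jm: "norm (mulT (J M x) w) <= norm w + (2 * C / \<delta>) * \<bar>pr0 w\<bar>" for w
        proof -
          have m0: "\<bar>pr0 (J M x)\<bar> <= 1" using M(4)[of x] by (simp add: pr_J)
          have m12: "\<bar>pr1 (J M x)\<bar> + \<bar>pr2 (J M x)\<bar> <= 2 * C / \<delta>" using M(5)[OF x01, of "snd x"] by (simp add: pr_J)
          have "norm (mulT (J M x) w) <= \<bar>pr0 (J M x)\<bar> * norm w + (\<bar>pr1 (J M x)\<bar> + \<bar>pr2 (J M x)\<bar>) * \<bar>pr0 w\<bar>" by (rule mulT_norm_split)
          also have "\<dots> <= 1 * norm w + (2 * C / \<delta>) * \<bar>pr0 w\<bar>" by (intro add_mono mult_right_mono m0 m12) auto
          finally show ?thesis by simp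
        qed
        have "norm (Y x) <= norm (mulT (J M x) (Z x)) + norm (mulT (J M x) X)"
          unfolding Y_def dec mulT_add by (rule norm_triangle_ineq)
        also have "\<dots> <= (norm (Z x) + (2 * C / \<delta>) * \<bar>pr0 (Z x)\<bar>) + ((\<eta> + 2 * C2) * norm (V1 x) + (2 * C / \<delta>) * (\<eta> * norm (V1 x)))"
          using C d by (intro add_mono order_trans[OF jm] nX mult_left_mono nX0 order_refl) auto
        also have "\<dots> = norm (Z x) + (2 * C / \<delta>) * \<bar>pr0 (Z x)\<bar> + ?c2 * norm (V1 x)" by (simp add: algebra_simps)
        finally show ?case .
      qed
      have sn: "sqi (RS S) (%x. norm (Z x))" "sqi (RS S) (%x. (2 * C / \<delta>) * \<bar>pr0 (Z x)\<bar>)" "sqi (RS S) (%x. ?c2 * norm (V1 x))"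
      proof -
        show "sqi (RS S) (%x. norm (Z x))" by (rule sqi_norm[OF sZS])
        show "sqi (RS S) (%x. (2 * C / \<delta>) * \<bar>pr0 (Z x)\<bar>)" using sqi_cmult[OF sqi_norm[OF sqi_pr(1)[OF sZS]], of "2 * C / \<delta>"] by (simp only: real_norm_def)
        show "sqi (RS S) (%x. ?c2 * norm (V1 x))" by (rule sqi_cmult[OF sqi_norm[OF sVS]])
      qed
      let ?G = "%x. norm (Z x) + (2 * C / \<delta>) * \<bar>pr0 (Z x)\<bar> + ?c2 * norm (V1 x)"
      have c2p: "0 <= ?c2" "0 <= 2 * C / \<delta>" using C2 C d eta by auto
      have "l2n (RS S) Y <= 1 * l2n (RS S) ?G"
        by (rule l2n_le[OF sqi_measurable[OF sYS] sqi_add[OF sqi_add[OF sn(1,2)] sn(3)]])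
           (use pt in eventually_elim, use c2p in auto)
      also have "\<dots> <= l2n (RS S) (%x. norm (Z x)) + l2n (RS S) (%x. (2 * C / \<delta>) * \<bar>pr0 (Z x)\<bar>) + l2n (RS S) (%x. ?c2 * norm (V1 x))"
        using l2n_triangle[OF sqi_add[OF sn(1,2)] sn(3)] l2n_triangle[OF sn(1,2)] by simp
      also have "\<dots> = l2n (RS S) Z + (2 * C / \<delta>) * l2n (RS S) (%x. pr0 (Z x)) + ?c2 * l2n (RS S) V1"
      proof -
        have "l2n (RS S) (%x. norm (Z x)) = l2n (RS S) Z" "l2n (RS S) (%x. \<bar>pr0 (Z x)\<bar>) = l2n (RS S) (%x. pr0 (Z x))" "l2n (RS S) (%x. norm (V1 x)) = l2n (RS S) V1"
          by (simp_all add: l2n_def)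
        then show ?thesis by (simp only: l2n_cmult abs_of_nonneg[OF c2p(1)] abs_of_nonneg[OF c2p(2)])
      qed
      also have "\<dots> <= l2n (RS S) Z + (2 * C / \<delta>) * (2 * r * l2n (RS S) Z) + ?c2 * l2n (RS S) V1"
      proof -
        have "l2n (RS S) (%x. pr0 (Z x)) <= 2 * r * l2n (RS S) (%x. pr2 (Z x))"
          unfolding S_def Z_def by (rule TT_Hardy[OF a(2) TZ[OF a(2) U(2)] z0 r(1)])
        also have "\<dots> <= 2 * r * l2n (RS S) Z" using sqi_pr(6)[OF sZS] r by (intro mult_left_mono) auto
        finally show ?thesis using c2p by (intro add_mono mult_left_mono order_refl) auto
      qed
      also have "\<dots> = ((1 + 12 * C) * l2n (RS S) Z + 2 * C2 * l2n (RS S) V1) + \<eta> * ((1 + 2 * C / \<delta>) * l2n (RS S) V1)"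
        using d by (simp add: r(2) algebra_simps)
      also have "\<dots> <= \<epsilon> / 2 + \<eta> * B"
      proof -
        have "l2n (RS S) V1 <= l2n RO V1 + 1" using sqi_subset(2)[OF Sb(1) O_borel Sb(2) sV(1)] by simp
        then have "(1 + 2 * C / \<delta>) * l2n (RS S) V1 <= B" unfolding B_def using C d by (intro mult_left_mono) (auto simp: add_nonneg_nonneg)
        then show ?thesis using kS eta by (intro add_mono mult_left_mono) auto
      qed
      finally show ?thesis using eta by simp
    qed
    finally show ?case using y(1) ty by blast
  qed
qed

end

section \<open>Bounds for the solutions\<close>

lemma component_sqi:
  assumes U: "a \<in> Uad amin amax C1 C2" and t: "sqi M1 t1" "sqi M1 t2"
  shows "sqi M1 (%s. (t1 s * adv a s - t2 s) / sqrt (1 + (adv a s)\<^sup>2))" (is "sqi M1 ?\<nu>")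
    "sqi M1 (%s. (t1 s + t2 s * adv a s) / sqrt (1 + (adv a s)\<^sup>2))" (is "sqi M1 ?\<tau>")
proof -
  note [measurable] = adv_measurable[OF U] sqi_measurable[OF t(1)] sqi_measurable[OF t(2)]
  have s: "sqi M1 (%s. \<bar>t1 s\<bar> + \<bar>t2 s\<bar>)" using sqi_add[OF sqi_norm[OF t(1)] sqi_norm[OF t(2)]] by simp
  have d: "\<bar>x\<bar> / sqrt (1 + x\<^sup>2) <= 1" "1 / sqrt (1 + x\<^sup>2) <= 1" "0 < sqrt (1 + x\<^sup>2)" for x :: real
  proof -
    show p: "0 < sqrt (1 + x\<^sup>2)" by (simp add: add_pos_nonneg)
    have "\<bar>x\<bar> = sqrt (x\<^sup>2)" by simp
    also have "\<dots> <= sqrt (1 + x\<^sup>2)" by (intro real_sqrt_le_mono) simp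
    finally show "\<bar>x\<bar> / sqrt (1 + x\<^sup>2) <= 1" using p by simp
    show "1 / sqrt (1 + x\<^sup>2) <= 1" using p by simp
  qed
  have b: "\<bar>(x * b + y) / sqrt (1 + b\<^sup>2)\<bar> <= \<bar>x\<bar> + \<bar>y\<bar>" for x y b :: real
  proof -
    have "\<bar>(x * b + y) / sqrt (1 + b\<^sup>2)\<bar> <= (\<bar>x\<bar> * \<bar>b\<bar> + \<bar>y\<bar>) / sqrt (1 + b\<^sup>2)"
      using d(3)[of b] abs_triangle_ineq[of "x * b" y] by (simp add: abs_divide abs_mult divide_right_mono)
    also have "\<dots> = \<bar>x\<bar> * (\<bar>b\<bar> / sqrt (1 + b\<^sup>2)) + \<bar>y\<bar> * (1 / sqrt (1 + b\<^sup>2))" by (simp add: add_divide_distrib)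
    also have "\<dots> <= \<bar>x\<bar> * 1 + \<bar>y\<bar> * 1" by (intro add_mono mult_left_mono d) auto
    finally show ?thesis by simp
  qed
  show "sqi M1 ?\<nu>"
  proof (rule sqi_bound[OF _ s, of _ 1])
    show "AE s in M1. norm (?\<nu> s) <= 1 * norm (\<bar>t1 s\<bar> + \<bar>t2 s\<bar>)" using b[of "t1 _" "adv a _" "- t2 _"] by auto
  qed measurable
  show "sqi M1 ?\<tau>"
  proof (rule sqi_bound[OF _ s, of _ 1])
    show "AE s in M1. norm (?\<tau> s) <= 1 * norm (\<bar>t1 s\<bar> + \<bar>t2 s\<bar>)" using b[of "t2 _" "adv a _" "t1 _"] by (auto simp: add.commute)
  qed measurable
qed

section \<open>The sequence of solutions and its energy bound\<close>

locale slip = holdall amin amax \<omega> O' for amin amax \<omega> :: real and O' :: "R2 set" +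
  fixes C1 C2 gmin gmax :: real and f :: "R2 => R2" and g :: "real => real"
    and \<pi> :: "(real => real) => (R2 => R2) => (R2 => R2)"
    and \<alpha>s :: "nat => real => real" and \<alpha> :: "real => real"
    and us :: "nat => R2 => R2" and ps :: "nat => R2 => real"
    and \<sigma>ns :: "nat => (real => real) => real" and \<sigma>ts :: "nat => real => real"
    and ubar :: "R2 => R2" and pbar :: "R2 => real"
  assumes C2: "0 < C2"
    and fL2: "L2 UNIV (c1 f)" "L2 UNIV (c2 f)"
    and gcont: "continuous_on {0..} g"
    and gbnd: "0 < gmin" "\<forall>x\<ge>0. gmin <= g x \<and> g x <= gmax"
    and hold: "\<forall>a\<in>Uad amin amax C1 C2. Om \<omega> a \<subseteq> O'"
    and Wrestr: "\<forall>a\<in>Uad amin amax C1 C2. \<forall>v.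
                   W \<omega> a v \<longleftrightarrow> (\<exists>w. H10 O' w \<and> (\<forall>x\<in>Om \<omega> a. v x = w x))"
    and ext: "\<forall>a\<in>Uad amin amax C1 C2. \<forall>v. Vsp \<omega> a v -->
                 H10v O' (\<pi> a v) \<and> (\<forall>x\<in>Om \<omega> a. \<pi> a v x = v x)"
    and extbnd: "\<exists>M. \<forall>a\<in>Uad amin amax C1 C2. \<forall>v. Vsp \<omega> a v -->
                 H1sqv O' (\<pi> a v) <= M * H1sqv (Om \<omega> a) v"
    and Ua: "!!n. \<alpha>s n \<in> Uad amin amax C1 C2" "\<alpha> \<in> Uad amin amax C1 C2"
    and conv: "C1conv \<alpha>s \<alpha>"
    and sol: "!!n. Msol \<omega> f g (\<alpha>s n) (us n) (ps n) (\<sigma>ns n) (\<sigma>ts n)"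
    and ulim: "H10v O' ubar"
              "\<forall>w. H10v O' w -->
                   (%n. H1ipv O' (\<pi> (\<alpha>s n) (us n)) w) \<longlonglongrightarrow> H1ipv O' ubar w"
    and plim: "L20 O' pbar"
              "\<forall>q. L20 O' q -->
                   (%n. intg O' (%x. (if x \<in> Om \<omega> (\<alpha>s n) then ps n x else 0) * q x))
                     \<longlonglongrightarrow> intg O' (%x. pbar x * q x)"
begin

lemma ad: "adm (\<alpha>s n)" "adm \<alpha>"
  using Uad_adm[OF Ua(1)] Uad_adm[OF Ua(2)] hold Ua by auto

lemma Wr: "\<beta> \<in> Uad amin amax C1 C2 ==> W \<omega> \<beta> w ==> \<exists>w'. H10 O' w' \<and> (\<forall>x\<in>Om' \<beta>. w x = w' x)"
  using Wrestr by blast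

lemma C0: "C0conv \<alpha>s \<alpha>"
  unfolding C0conv_def
proof (intro allI impI)
  fix \<epsilon> :: real assume "0 < \<epsilon>"
  then have "\<forall>\<^sub>F n in sequentially. \<forall>x\<in>{0..1}. \<bar>\<alpha>s n x - \<alpha> x\<bar> <= \<epsilon> \<and> \<bar>adv (\<alpha>s n) x - adv \<alpha> x\<bar> <= \<epsilon>"
    using conv unfolding C1conv_def by blast
  then show "\<forall>\<^sub>F n in sequentially. \<forall>s. 0 < s --> s < 1 --> \<bar>\<alpha>s n s - \<alpha> s\<bar> <= \<epsilon>" by eventually_elim auto
qed

lemma fsq: "sqi RO (%x. fst (f x))" "sqi RO (%x. snd (f x))"
proof -
  have "sqi (RS UNIV) (c1 f)" "sqi (RS UNIV) (c2 f)" using fL2 by (auto simp: RS_L2)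
  from sqi_subset(1)[OF O_borel _ _ this(1)] sqi_subset(1)[OF O_borel _ _ this(2)]
  show "sqi RO (%x. fst (f x))" "sqi RO (%x. snd (f x))" by (auto simp: c1_def c2_def)
qed

lemma vnu_sqi: "\<beta> \<in> Uad amin amax C1 C2 ==> sqi M1 (tr' \<beta> (c1 v)) ==> sqi M1 (tr' \<beta> (c2 v)) ==> sqi M1 (vnu' \<beta> v)"
  and vtau_sqi: "\<beta> \<in> Uad amin amax C1 C2 ==> sqi M1 (tr' \<beta> (c1 v)) ==> sqi M1 (tr' \<beta> (c2 v)) ==> sqi M1 (vtau' \<beta> v)"
  using component_sqi[of \<beta> amin amax C1 C2 "tr' \<beta> (c1 v)" "tr' \<beta> (c2 v)"] by (simp_all add: vnu_def[abs_def] vtau_def[abs_def])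

lemma solD:
  shows "W \<omega> (\<alpha>s n) (c1 (us n))" "W \<omega> (\<alpha>s n) (c2 (us n))" "L20 (Om' (\<alpha>s n)) (ps n)" "Hm12 \<omega> (\<alpha>s n) (\<sigma>ns n)"
    "\<sigma>ts n \<in> Kset g (%s. \<bar>vtau' (\<alpha>s n) (us n) s\<bar>)"
    "!!v. Wv \<omega> (\<alpha>s n) v ==> aform (Om' (\<alpha>s n)) (us n) v - bform (Om' (\<alpha>s n)) v (ps n) - \<sigma>ns n (vnu' (\<alpha>s n) v)
       - ipS (\<alpha>s n) (\<sigma>ts n) (vtau' (\<alpha>s n) v) = fform (Om' (\<alpha>s n)) f v"
    "!!q. L20 (Om' (\<alpha>s n)) q ==> bform (Om' (\<alpha>s n)) (us n) q = 0"
    "!!\<mu>. Hm12 \<omega> (\<alpha>s n) \<mu> ==> \<mu> (vnu' (\<alpha>s n) (us n)) = 0"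
    "!!\<mu>. \<mu> \<in> Kset g (%s. \<bar>vtau' (\<alpha>s n) (us n) s\<bar>) ==> ipS (\<alpha>s n) (%s. \<mu> s + \<sigma>ts n s) (vtau' (\<alpha>s n) (us n)) <= 0"
  using sol[of n] unfolding Msol_def Wv_def by blast+

lemma us_tr_sqi: "sqi M1 (tr' (\<alpha>s n) (c1 (us n)))" "sqi M1 (tr' (\<alpha>s n) (c2 (us n)))"
  using Wr[OF Ua(1) solD(1)] Wr[OF Ua(1) solD(2)] tr_sqi[OF ad(1)] tr_cong by metis+

text \<open>Makes the extension operators applicable, since they act on fields with vanishing normal
  trace.\<close>

lemma us_vnu: "AE s in M1. vnu' (\<alpha>s n) (us n) s = 0"
proof -
  let ?h = "vnu' (\<alpha>s n) (us n)"
  have s: "sqi M1 ?h" by (rule vnu_sqi[OF Ua(1) us_tr_sqi])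
  have "l2fun ?h ?h = 0" by (rule solD(8)[OF Hm12_l2fun[OF ad(1) Wr[OF Ua(1)] s]])
  then have "(LINT x|M1. ?h x * ?h x) = 0" by (simp add: l2fun_eq[OF s s])
  then have "l2n M1 ?h = 0" by (simp add: l2n_def power2_eq_square)
  then show ?thesis using l2n_eq_0_iff[OF s] by simp
qed

lemma us_Vsp: "Vsp \<omega> (\<alpha>s n) (us n)"
  unfolding Vsp_def Wv_def using solD(1,2) us_vnu by (simp add: M1_AE)

definition uu :: "nat => R2 => R2" where "uu n = \<pi> (\<alpha>s n) (us n)"

lemma uu: "H10v O' (uu n)" "x \<in> Om' (\<alpha>s n) ==> uu n x = us n x"
  using ext Ua(1) us_Vsp[of n] by (auto simp: uu_def)

lemma uuH: "H10 O' (c1 (uu n))" "H10 O' (c2 (uu n))" using uu(1) by (auto simp: H10v_def)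
lemma ubH: "H10 O' (c1 ubar)" "H10 O' (c2 ubar)" using ulim(1) by (auto simp: H10v_def)

lemma uu_tr: "tr' (\<alpha>s n) (c1 (us n)) = tr' (\<alpha>s n) (c1 (uu n))" "tr' (\<alpha>s n) (c2 (us n)) = tr' (\<alpha>s n) (c2 (uu n))"
  by (rule tr_cong, simp add: uu(2) c1_def c2_def)+

lemma uu_wd: "wd (Om' (\<alpha>s n)) (c1 (us n)) = wd (Om' (\<alpha>s n)) (c1 (uu n))" "wd (Om' (\<alpha>s n)) (c2 (us n)) = wd (Om' (\<alpha>s n)) (c2 (uu n))"
  by (rule wd_cong, simp add: uu(2) c1_def c2_def)+

lemma uu_comp: "vnu' (\<alpha>s n) (us n) = vnu' (\<alpha>s n) (uu n)" "vtau' (\<alpha>s n) (us n) = vtau' (\<alpha>s n) (uu n)"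
  by (simp_all add: vnu_def[abs_def] vtau_def[abs_def] uu_tr)

lemma ipS_vtau: "ipS \<beta> \<sigma> (vtau' \<beta> v) = (LINT s|M1. \<sigma> s * (tr' \<beta> (c1 v) s + adv \<beta> s * tr' \<beta> (c2 v) s))"
  unfolding ipS_def M1_integral
proof (intro Bochner_Integration.integral_cong refl)
  fix s
  have "0 < sqrt (1 + (adv \<beta> s)\<^sup>2)" by (simp add: add_pos_nonneg)
  then show "\<sigma> s * vtau' \<beta> v s * sqrt (1 + (adv \<beta> s)\<^sup>2) = \<sigma> s * (tr' \<beta> (c1 v) s + adv \<beta> s * tr' \<beta> (c2 v) s)"
    by (simp add: vtau_def mult.commute)
qed

text \<open>Testing with the solution itself removes the pressure and normal terms, and the
  multiplier 0 in the slip inequality gives the friction term a favourable sign. Poincare bounds the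
  energy by the force, and the uniform extension bound carries this to the hold-all.\<close>

lemma energy_bound: "\<exists>K. \<forall>n. l2n RO (JW O' (c1 (uu n))) <= K \<and> l2n RO (JW O' (c2 (uu n))) <= K"
proof -
  obtain M where M: "!!a v. a \<in> Uad amin amax C1 C2 ==> Vsp \<omega> a v ==> H1sqv O' (\<pi> a v) <= M * H1sqv (Om' a) v"
    using extbnd by blast
  define F where "F = l2n RO (%x. fst (f x)) + l2n RO (%x. snd (f x))"
  define c where "c = \<omega> - amin"
  have F0: "0 <= F" by (simp add: F_def)
  have c0: "0 <= c"
  proof -
    have "amin <= \<alpha> 0 \<and> \<alpha> 0 <= amax" using ad(2) by (simp add: adm_def)
    then show ?thesis using amax_\<omega> by (simp add: c_def)
  qed
  \<comment> \<open>c is the Poincare constant, 2 c F bounds the square root of the gradient energy,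
    and c^2 + 1 passes to the full H^1 norm. The absolute value is taken because M is not known to
    be nonnegative.\<close>
  define B where "B = \<bar>M\<bar> * ((c\<^sup>2 + 1) * (2 * c * F)\<^sup>2)"
  have "l2n RO (JW O' (c1 (uu n))) <= sqrt B \<and> l2n RO (JW O' (c2 (uu n))) <= sqrt B" for n
  proof -
    let ?U = "Om' (\<alpha>s n)" and ?u = "us n"
    note Ub = Om_borel[OF ad(1)[of n]]
    have H: "H1 ?U (c1 ?u)" "H1 ?U (c2 ?u)" using solD(1,2)[of n] by (auto simp: W_def)
    define D where "D w e = l2n (RS ?U) (wd ?U w e)" for w e
    have sq: "sqi (RS ?U) (wd ?U w e1)" "sqi (RS ?U) (wd ?U w e2)" "sqi (RS ?U) w" if "H1 ?U w" for w
      using H1_sqi_JW(2-4)[OF Ub that] by (auto simp: wdrel_RS[OF Ub])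
    have it: "integrable (RS ?U) (%x. wd ?U w e1 x * wd ?U w e1 x)" "integrable (RS ?U) (%x. wd ?U w e2 x * wd ?U w e2 x)" if "H1 ?U w" for w
      using sq[OF that] sqi_mult by blast+
    have Dsq: "(LINT x|RS ?U. wd ?U w e x * wd ?U w e x) = (D w e)\<^sup>2" for w e unfolding D_def l2n_power2 by (simp add: power2_eq_square)
    define S where "S = (D (c1 ?u) e1)\<^sup>2 + (D (c1 ?u) e2)\<^sup>2 + (D (c2 ?u) e1)\<^sup>2 + (D (c2 ?u) e2)\<^sup>2"
    have aS: "aform ?U ?u ?u = S"
      unfolding aform_def RS_intg[OF Ub] S_def using it[OF H(1)] it[OF H(2)] by (simp add: Dsq)
    have S0: "0 <= S" by (simp add: S_def)
    have Dle: "D (c1 ?u) e2 <= sqrt S" "D (c2 ?u) e2 <= sqrt S" by (rule real_le_rsqrt, simp add: S_def)+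
    have pc: "l2n (RS ?U) (c1 ?u) <= c * D (c1 ?u) e2" "l2n (RS ?U) (c2 ?u) <= c * D (c2 ?u) e2"
      using W_Poincare[OF ad(1) solD(1)] W_Poincare[OF ad(1) solD(2)] by (auto simp: c_def D_def)
    have zK: "(%s. 0) \<in> Kset g (%s. \<bar>vtau' (\<alpha>s n) (us n) s\<bar>)"
    proof -
      have "0 <= g \<bar>x\<bar>" for x using gbnd(1) gbnd(2)[rule_format, of "\<bar>x\<bar>"] by simp
      then show ?thesis by (simp add: Kset_def M1_L2S)
    qed
    have "S - 0 - 0 - ipS (\<alpha>s n) (\<sigma>ts n) (vtau' (\<alpha>s n) ?u) = fform ?U f ?u"
      using solD(6)[of n ?u, unfolded Wv_def, OF conjI[OF solD(1,2)]]
      unfolding aS solD(7)[OF solD(3)] solD(8)[OF solD(4)] .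
    moreover have "ipS (\<alpha>s n) (\<sigma>ts n) (vtau' (\<alpha>s n) ?u) <= 0" using solD(9)[OF zK] by simp
    ultimately have "S <= fform ?U f ?u" by simp
    also have "\<dots> <= F * (c * sqrt S)"
    proof -
      have sf: "sqi (RS ?U) (%x. fst (f x))" "sqi (RS ?U) (%x. snd (f x))"
        using sqi_subset(1)[OF Ub O_borel Om_sub[OF ad(1)]] fsq by auto
      have nf: "l2n (RS ?U) (%x. fst (f x)) <= l2n RO (%x. fst (f x))" "l2n (RS ?U) (%x. snd (f x)) <= l2n RO (%x. snd (f x))"
        using sqi_subset(2)[OF Ub O_borel Om_sub[OF ad(1)]] fsq by auto
      have su: "sqi (RS ?U) (%x. fst (?u x))" "sqi (RS ?U) (%x. snd (?u x))" using sq(3)[OF H(1)] sq(3)[OF H(2)] by (auto simp: c1_def c2_def)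
      have nu: "l2n (RS ?U) (%x. fst (?u x)) <= c * sqrt S" "l2n (RS ?U) (%x. snd (?u x)) <= c * sqrt S"
        using pc mult_left_mono[OF Dle(1) c0] mult_left_mono[OF Dle(2) c0] by (auto simp: c1_def c2_def)
      have "fform ?U f ?u = (LINT x|RS ?U. fst (f x) * fst (?u x)) + (LINT x|RS ?U. snd (f x) * snd (?u x))"
        unfolding fform_def RS_intg[OF Ub] using sqi_mult[OF sf(1) su(1)] sqi_mult[OF sf(2) su(2)] by simp
      also have "\<dots> <= l2n RO (%x. fst (f x)) * (c * sqrt S) + l2n RO (%x. snd (f x)) * (c * sqrt S)"
      proof (rule add_mono)
        show "(LINT x|RS ?U. fst (f x) * fst (?u x)) <= l2n RO (%x. fst (f x)) * (c * sqrt S)"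
          using l2_Cauchy_Schwarz_real[OF sf(1) su(1)] mult_mono[OF nf(1) nu(1)] by (simp add: abs_le_iff)
        show "(LINT x|RS ?U. snd (f x) * snd (?u x)) <= l2n RO (%x. snd (f x)) * (c * sqrt S)"
          using l2_Cauchy_Schwarz_real[OF sf(2) su(2)] mult_mono[OF nf(2) nu(2)] by (simp add: abs_le_iff)
      qed
      finally show ?thesis by (simp add: F_def distrib_right)
    qed
    finally have Sle: "S <= (c * F) * sqrt S" by (simp add: mult_ac)
    have "sqrt S <= c * F"
    proof (cases "S = 0")
      case False
      then have "0 < sqrt S" using S0 by simp
      moreover have "sqrt S * sqrt S <= (c * F) * sqrt S" using Sle S0 by simp
      ultimately show ?thesis by (rule mult_right_le_imp_le[rotated])
    qed (use c0 F0 in simp)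
    then have "(sqrt S)\<^sup>2 <= (2 * c * F)\<^sup>2" using S0 mult_nonneg_nonneg[OF c0 F0] by (intro power_mono) (simp_all only: mult.assoc, auto)
    then have SB: "S <= (2 * c * F)\<^sup>2" using S0 by simp
    have hs: "H1sq ?U w = (l2n (RS ?U) w)\<^sup>2 + (D w e1)\<^sup>2 + (D w e2)\<^sup>2" if "H1 ?U w" for w
      unfolding H1sq_def H1ip_def RS_intg[OF Ub] using it[OF that] sqi_mult[OF sq(3)[OF that] sq(3)[OF that]]
      by (simp add: Dsq l2n_power2) (simp add: power2_eq_square)
    have "H1sqv ?U ?u = H1sq ?U (c1 ?u) + H1sq ?U (c2 ?u)" by (simp add: H1sqv_def H1ipv_def H1sq_def)
    also have "\<dots> = (l2n (RS ?U) (c1 ?u))\<^sup>2 + (l2n (RS ?U) (c2 ?u))\<^sup>2 + S" by (simp add: hs H S_def)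
    also have "\<dots> <= (c * D (c1 ?u) e2)\<^sup>2 + (c * D (c2 ?u) e2)\<^sup>2 + S" using pc by (intro add_mono power_mono order_refl) auto
    also have "\<dots> <= c\<^sup>2 * S + S"
    proof -
      have "c\<^sup>2 * ((D (c1 ?u) e2)\<^sup>2 + (D (c2 ?u) e2)\<^sup>2) <= c\<^sup>2 * S" by (intro mult_left_mono) (auto simp: S_def)
      then show ?thesis by (simp add: power_mult_distrib distrib_left)
    qed
    also have "\<dots> = (c\<^sup>2 + 1) * S" by (simp add: distrib_right)
    also have "\<dots> <= (c\<^sup>2 + 1) * (2 * c * F)\<^sup>2" using SB by (intro mult_left_mono) auto
    finally have h1: "H1sqv ?U ?u <= (c\<^sup>2 + 1) * (2 * c * F)\<^sup>2" .
    have h0: "0 <= H1sqv ?U ?u" by (simp add: H1sqv_def H1ipv_def flip: H1sq_def) (simp add: H1sq_JW[OF Ub])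
    have "H1sqv O' (uu n) <= M * H1sqv ?U ?u" unfolding uu_def by (rule M[OF Ua(1) us_Vsp])
    also have "\<dots> <= \<bar>M\<bar> * H1sqv ?U ?u" using h0 by (intro mult_right_mono) auto
    also have "\<dots> <= B" unfolding B_def using h1 by (intro mult_left_mono) auto
    finally have "(l2n RO (JW O' (c1 (uu n))))\<^sup>2 + (l2n RO (JW O' (c2 (uu n))))\<^sup>2 <= B"
      by (simp add: H1sqv_def H1ipv_def H1sq_JW[OF O_borel] flip: H1sq_def)
    then show ?thesis
      by (intro conjI real_le_rsqrt) (smt (verit) zero_le_power2)+
  qed
  then show ?thesis by blast
qed

lemma H1ip_zero: assumes "H10 O' u" shows "H1ip O' u (%x. 0) = 0"
proof -
  have "(LINT x|RO. JW O' u x \<bullet> JW O' (%x. 0) x) = (LINT x|RO. 0)"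
    by (rule integral_cong_AE)
       (use H10_zero(2) H10_sqi[OF assms] H10_sqi[OF H10_zero(1)] in \<open>auto simp: sqi_def elim!: eventually_mono\<close>)
  then show ?thesis by (simp add: H1ip_JW)
qed

text \<open>Testing with (w, 0) and (0, w) separates the components;
  \<open>H10_weak_convergence\<close> then admits arbitrary L2 test functions.\<close>

lemma uu_weak:
  assumes q: "sqi RO q"
  shows "(%n. LINT x|RO. JW O' (c1 (uu n)) x \<bullet> q x) \<longlonglongrightarrow> (LINT x|RO. JW O' (c1 ubar) x \<bullet> q x)"
    "(%n. LINT x|RO. JW O' (c2 (uu n)) x \<bullet> q x) \<longlonglongrightarrow> (LINT x|RO. JW O' (c2 ubar) x \<bullet> q x)"
proof -
  have "(%n. H1ip O' (c1 (uu n)) w) \<longlonglongrightarrow> H1ip O' (c1 ubar) w" if "H10 O' w" for w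
  proof -
    have "H10v O' (%x. (w x, 0))" using that H10_zero(1) by (simp add: H10v_def c1_def c2_def)
    then have "(%n. H1ipv O' (uu n) (%x. (w x, 0))) \<longlonglongrightarrow> H1ipv O' ubar (%x. (w x, 0))" using ulim(2) by (simp add: uu_def)
    moreover have "c1 (%x. (w x, 0)) = w" "c2 (%x. (w x, 0)) = (%x. 0)" by (simp_all add: c1_def c2_def)
    ultimately show ?thesis by (simp add: H1ipv_def H1ip_zero[OF uuH(2)] H1ip_zero[OF ubH(2)])
  qed
  then show "(%n. LINT x|RO. JW O' (c1 (uu n)) x \<bullet> q x) \<longlonglongrightarrow> (LINT x|RO. JW O' (c1 ubar) x \<bullet> q x)"
    by (rule H10_weak_convergence[OF openO bddO uuH(1) ubH(1) _ q])
  have "(%n. H1ip O' (c2 (uu n)) w) \<longlonglongrightarrow> H1ip O' (c2 ubar) w" if "H10 O' w" for w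
  proof -
    have "H10v O' (%x. (0, w x))" using that H10_zero(1) by (simp add: H10v_def c1_def c2_def)
    then have "(%n. H1ipv O' (uu n) (%x. (0, w x))) \<longlonglongrightarrow> H1ipv O' ubar (%x. (0, w x))" using ulim(2) by (simp add: uu_def)
    moreover have "c2 (%x. (0, w x)) = w" "c1 (%x. (0, w x)) = (%x. 0)" by (simp_all add: c1_def c2_def)
    ultimately show ?thesis by (simp add: H1ipv_def H1ip_zero[OF uuH(1)] H1ip_zero[OF ubH(1)])
  qed
  then show "(%n. LINT x|RO. JW O' (c2 (uu n)) x \<bullet> q x) \<longlonglongrightarrow> (LINT x|RO. JW O' (c2 ubar) x \<bullet> q x)"
    by (rule H10_weak_convergence[OF openO bddO uuH(2) ubH(2) _ q])
qed

section \<open>Weak limits of the pressures and of the volume terms\<close>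

definition pp :: "nat => R2 => real" where "pp n x = (if x \<in> Om' (\<alpha>s n) then ps n x else 0)"

lemma O_finite: "finite_measure RO" by (rule RS_finite[OF O_borel bddO])

lemma const_sqi: "sqi RO (%x. c::real)"
  by (rule sqi_continuous[OF O_borel bddO]) simp

lemma pbar_sqi: "sqi RO pbar" "(LINT x|RO. pbar x) = 0"
  using plim(1) by (auto simp: L20_def RS_L2 RS_intg)

lemma pp_sqi: "sqi RO (pp n)" "(LINT x|RO. pp n x) = 0"
proof -
  note Ub = Om_borel[OF ad(1)[of n]] and Us = Om_sub[OF ad(1)[of n]]
  have s: "sqi (RS (Om' (\<alpha>s n))) (ps n)" "(LINT x|RS (Om' (\<alpha>s n)). ps n x) = 0"
    using solD(3)[of n] by (auto simp: L20_def RS_L2[OF Ub] RS_intg[OF Ub])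
  show "sqi RO (pp n)" unfolding pp_def[abs_def] by (rule zero_extension[OF ad(1) s(1)])
  have "(LINT x|RO. pp n x) = (LINT x|RO. indicator (Om' (\<alpha>s n)) x * ps n x)"
    by (intro Bochner_Integration.integral_cong refl) (simp add: pp_def indicator_def)
  then show "(LINT x|RO. pp n x) = 0" using s(2) RS_sub_integral[OF Ub Us, of "ps n"] by simp
qed

text \<open>Convergence is given only against functions of mean zero. Subtracting the mean of q
  leaves the integrals unchanged because the pressures and their limit have mean zero.\<close>

lemma pp_weak:
  assumes q: "sqi RO q" shows "(%n. LINT x|RO. pp n x * q x) \<longlonglongrightarrow> (LINT x|RO. pbar x * q x)"
proof -
  define m where "m = measure RO (space RO)"
  define c where "c = (LINT x|RO. q x) / m"
  have iq: "integrable RO q" by (rule integrable_L1_of_sqi(1)[OF O_finite q])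
  interpret finite_measure "RO" by (rule O_finite)
  have "(LINT x|RO. q x - c) = 0"
  proof (cases "m = 0")
    \<comment> \<open>On a null hold-all set the division yields 0, and the integral of q vanishes
      as well.\<close>
    case True
    have "\<bar>LINT x|RO. q x\<bar> <= (LINT x|RO. norm (q x))" using integral_norm_bound[of "RO" q] by simp
    also have "\<dots> <= 0" using integrable_L1_of_sqi(2)[OF O_finite q] True by (simp add: m_def)
    finally show ?thesis using iq True by (simp add: c_def)
  next
    case False
    have "measure RO O' = m" by (simp add: m_def)
    then show ?thesis using iq False by (simp add: c_def)
  qed
  then have "L20 O' (%x. q x - c)" by (simp add: L20_def RS_L2 RS_intg sqi_diff[OF q const_sqi])
  then have "(%n. LINT x|RO. pp n x * (q x - c)) \<longlonglongrightarrow> (LINT x|RO. pbar x * (q x - c))"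
    using plim(2) by (simp add: RS_intg pp_def)
  moreover have "(LINT x|RO. p x * (q x - c)) = (LINT x|RO. p x * q x)" if "sqi RO p" "(LINT x|RO. p x) = 0" for p
    unfolding right_diff_distrib using sqi_mult[OF that(1) q] sqi_mult[OF that(1) const_sqi[of c]] that(2) by simp
  ultimately show ?thesis by (simp add: pp_sqi pbar_sqi)
qed

text \<open>Convergent pairings are bounded, so the uniform boundedness principle applies.\<close>

lemma pp_bound: obtains K where "!!n. l2n RO (pp n) <= K"
proof (rule l2_weak_bounded[OF O_finite pp_sqi(1)])
  show "Bseq (%n. LINT x|RO. pp n x \<bullet> q x)" if "sqi RO q" for q
    using convergent_imp_Bseq[OF convergentI[OF pp_weak[OF that]]] by simp
qed (use that in blast)

lemma ind_sqi:
  fixes q :: "R2 => 'b::euclidean_space"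
  assumes "adm \<beta>" "sqi RO q"
  shows "sqi RO (%x. indicator (Om' \<beta>) x *\<^sub>R q x)" "l2n RO (%x. indicator (Om' \<beta>) x *\<^sub>R q x) <= l2n RO q"
proof -
  have m: "(%x. indicator (Om' \<beta>) x *\<^sub>R q x) \<in> borel_measurable RO"
    by (rule borel_measurable_scaleR[OF RS_measurable[OF borel_measurable_indicator[OF Om_borel[OF assms(1)]]] sqi_measurable[OF assms(2)]])
  show "sqi RO (%x. indicator (Om' \<beta>) x *\<^sub>R q x)"
    by (rule sqi_bound[OF m assms(2), of 1]) (auto simp: indicator_def)
  show "l2n RO (%x. indicator (Om' \<beta>) x *\<^sub>R q x) <= l2n RO q"
    using l2n_le[OF m assms(2), of 1] by (simp add: indicator_def)
qed

text \<open>Tested with the part of \<open>pbar\<close> outside the limit domain, the n-th pressure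
  sees only points of the n-th domain outside the limit domain, and these contribute nothing in the
  limit. That part is therefore orthogonal to itself.\<close>

lemma pbar_off: "AE x in RO. x \<notin> Om' \<alpha> --> pbar x = 0"
proof -
  obtain K where K: "!!n. l2n RO (pp n) <= K" using pp_bound by blast
  define q where "q x = pbar x - indicator (Om' \<alpha>) x *\<^sub>R pbar x" for x
  have q: "sqi RO q" unfolding q_def by (intro sqi_diff pbar_sqi ind_sqi ad)
  have z: "indicator (Om' \<alpha>) x *\<^sub>R q x = 0" for x by (auto simp: q_def indicator_def)
  have L: "l2conv RO (%n x. indicator (Om' (\<alpha>s n)) x *\<^sub>R q x) (%x. 0)"
    using indicator_Om_conv[OF ad C0 q] unfolding z .
  have "(%n. LINT x|RO. pp n x \<bullet> (indicator (Om' (\<alpha>s n)) x *\<^sub>R q x)) \<longlonglongrightarrow> 0"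
    by (rule l2_weak_strong[OF pp_sqi(1) K _ ind_sqi(1)[OF ad(1) q] sqi_zero L]) simp
  moreover have "(LINT x|RO. pp n x \<bullet> (indicator (Om' (\<alpha>s n)) x *\<^sub>R q x)) = (LINT x|RO. pp n x * q x)" for n
    by (intro Bochner_Integration.integral_cong refl) (auto simp: pp_def indicator_def)
  ultimately have "(%n. LINT x|RO. pp n x * q x) \<longlonglongrightarrow> 0" by simp
  then have "(LINT x|RO. pbar x * q x) = 0" using LIMSEQ_unique[OF pp_weak[OF q]] by blast
  moreover have "(LINT x|RO. pbar x * q x) = (LINT x|RO. (norm (q x))\<^sup>2)"
    by (intro Bochner_Integration.integral_cong refl) (auto simp: q_def indicator_def power2_eq_square)
  ultimately have "l2n RO q = 0" by (simp add: l2n_def)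
  then have "AE x in RO. q x = 0" using l2n_eq_0_iff[OF q] by simp
  then show ?thesis by eventually_elim (auto simp: q_def indicator_def)
qed

definition QQ :: "nat => R2 => (real \<times> real \<times> real) \<times> (real \<times> real \<times> real)" where
  "QQ n x = indicator (Om' (\<alpha>s n)) x *\<^sub>R Qf f (uu n) (pp n) x"

definition Q0 :: "R2 => (real \<times> real \<times> real) \<times> (real \<times> real \<times> real)" where
  "Q0 x = indicator (Om' \<alpha>) x *\<^sub>R Qf f ubar pbar x"

lemma QQ_sqi: "sqi RO (QQ n)" "sqi RO Q0"
  unfolding QQ_def[abs_def] Q0_def[abs_def] by (intro ind_sqi ad Qf_sqi uu ulim pp_sqi pbar_sqi fsq)+

lemma l2n_Pair_le:
  fixes F :: "R2 => 'c::euclidean_space" and G :: "R2 => 'd::euclidean_space"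
  assumes "sqi M F" "sqi M G" shows "l2n M (%x. (F x, G x)) <= l2n M F + l2n M G"
proof (rule power2_le_imp_le)
  have "(l2n M (%x. (F x, G x)))\<^sup>2 = (l2n M F)\<^sup>2 + (l2n M G)\<^sup>2"
    unfolding l2n_power2 using assms by (simp add: sqi_def norm_Pair)
  also have "\<dots> <= (l2n M F + l2n M G)\<^sup>2" by (simp add: power2_sum)
  finally show "(l2n M (%x. (F x, G x)))\<^sup>2 <= (l2n M F + l2n M G)\<^sup>2" .
qed simp

lemma QQ_bound: obtains K where "0 < K" "!!n. l2n RO (QQ n) <= K"
proof -
  obtain K1 where K1: "!!n. l2n RO (JW O' (c1 (uu n))) <= K1" "!!n. l2n RO (JW O' (c2 (uu n))) <= K1"
    using energy_bound by blast
  obtain K2 where K2: "!!n. l2n RO (pp n) <= K2" using pp_bound by blast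
  let ?F = "l2n RO (%x. fst (f x)) + l2n RO (%x. snd (f x))"
  have "l2n RO (QQ n) <= \<bar>?F + 4 * K1 + 2 * K2\<bar> + 1" for n
  proof -
    note h = H10_sqi[OF uuH(1)[of n]] H10_sqi[OF uuH(2)[of n]] and p = pp_sqi(1)[of n]
    note s = sqi_uminus[OF fsq(1)] sqi_diff[OF sqi_pr(2)[OF h(1)] p] sqi_pr(3)[OF h(1)]
      sqi_uminus[OF fsq(2)] sqi_pr(2)[OF h(2)] sqi_diff[OF sqi_pr(3)[OF h(2)] p]
    have "l2n RO (QQ n) <= l2n RO (Qf f (uu n) (pp n))"
      unfolding QQ_def[abs_def] by (rule ind_sqi(2)[OF ad(1) Qf_sqi[OF uu(1) p fsq]])
    also have "\<dots> <= (l2n RO (%x. - fst (f x)) + (l2n RO (%x. pr1 (JW O' (c1 (uu n)) x) - pp n x) + l2n RO (%x. pr2 (JW O' (c1 (uu n)) x))))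
       + (l2n RO (%x. - snd (f x)) + (l2n RO (%x. pr1 (JW O' (c2 (uu n)) x)) + l2n RO (%x. pr2 (JW O' (c2 (uu n)) x) - pp n x)))"
      unfolding Qf_def
      by (intro order_trans[OF l2n_Pair_le] add_mono order_refl sqi_Pair s)
    also have "\<dots> <= \<bar>?F + 4 * K1 + 2 * K2\<bar> + 1"
      using l2n_triangle_diff[OF sqi_pr(2)[OF h(1)] p] l2n_triangle_diff[OF sqi_pr(3)[OF h(2)] p]
        sqi_pr(5,6)[OF h(1)] sqi_pr(5,6)[OF h(2)] K1(1)[of n] K1(2)[of n] K2[of n]
        l2n_scaleR[of "RO" "-1" "%x. fst (f x)"] l2n_scaleR[of "RO" "-1" "%x. snd (f x)"] by simp
    finally show ?thesis .
  qed
  then show ?thesis by (intro that[of "\<bar>?F + 4 * K1 + 2 * K2\<bar> + 1"]) auto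
qed

lemma uu_ind_conv:
  assumes q: "sqi RO q"
  shows "(%n. LINT x|RO. JW O' (c1 (uu n)) x \<bullet> (indicator (Om' (\<alpha>s n)) x *\<^sub>R q x)) \<longlonglongrightarrow> (LINT x|RO. JW O' (c1 ubar) x \<bullet> (indicator (Om' \<alpha>) x *\<^sub>R q x))"
    "(%n. LINT x|RO. JW O' (c2 (uu n)) x \<bullet> (indicator (Om' (\<alpha>s n)) x *\<^sub>R q x)) \<longlonglongrightarrow> (LINT x|RO. JW O' (c2 ubar) x \<bullet> (indicator (Om' \<alpha>) x *\<^sub>R q x))"
proof -
  obtain K where K: "!!n. l2n RO (JW O' (c1 (uu n))) <= K" "!!n. l2n RO (JW O' (c2 (uu n))) <= K" using energy_bound by blast
  note i = ind_sqi(1)[OF ad(1) q] ind_sqi(1)[OF ad(2) q] indicator_Om_conv[OF ad C0 q]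
  show "(%n. LINT x|RO. JW O' (c1 (uu n)) x \<bullet> (indicator (Om' (\<alpha>s n)) x *\<^sub>R q x)) \<longlonglongrightarrow> (LINT x|RO. JW O' (c1 ubar) x \<bullet> (indicator (Om' \<alpha>) x *\<^sub>R q x))"
    by (rule l2_weak_strong[OF H10_sqi[OF uuH(1)] K(1) uu_weak(1)[OF i(2)] i])
  show "(%n. LINT x|RO. JW O' (c2 (uu n)) x \<bullet> (indicator (Om' (\<alpha>s n)) x *\<^sub>R q x)) \<longlonglongrightarrow> (LINT x|RO. JW O' (c2 ubar) x \<bullet> (indicator (Om' \<alpha>) x *\<^sub>R q x))"
    by (rule l2_weak_strong[OF H10_sqi[OF uuH(2)] K(2) uu_weak(2)[OF i(2)] i])
qed

text \<open>The coefficients converge weakly and the indicators strongly, so the indicators are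
  moved onto the test function. The pressure vanishes outside its domain already and is treated
  without indicator.\<close>

lemma QQ_weak:
  assumes q: "sqi RO q"
  shows "(%n. LINT x|RO. QQ n x \<bullet> q x) \<longlonglongrightarrow> (LINT x|RO. Q0 x \<bullet> q x)"
proof -
  define qa where "qa x = (0::real, pr1 (fst (q x)), pr2 (fst (q x)))" for x
  define qb where "qb x = (0::real, pr1 (snd (q x)), pr2 (snd (q x)))" for x
  define qp where "qp x = pr1 (fst (q x)) + pr2 (snd (q x))" for x
  define qf where "qf x = fst (f x) * pr0 (fst (q x)) + snd (f x) * pr0 (snd (q x))" for x
  have nfs: "norm (fst y) <= norm y" "norm (snd y) <= norm y" for y :: "(real \<times> real \<times> real) \<times> (real \<times> real \<times> real)"
    using norm_fst_le[of "fst y" "snd y"] norm_snd_le[of "snd y" "fst y"] by simp_all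
  have fq: "sqi RO (%x. fst (q x))" "sqi RO (%x. snd (q x))"
  proof -
    show "sqi RO (%x. fst (q x))"
      by (rule sqi_bound[OF measurable_compose[OF sqi_measurable[OF q] borel_measurable_continuous_onI[OF continuous_on_fst[OF continuous_on_id]]] q, of 1])
         (simp add: nfs)
    show "sqi RO (%x. snd (q x))"
      by (rule sqi_bound[OF measurable_compose[OF sqi_measurable[OF q] borel_measurable_continuous_onI[OF continuous_on_snd[OF continuous_on_id]]] q, of 1])
         (simp add: nfs)
  qed
  have sq: "sqi RO qa" "sqi RO qb" "sqi RO qp"
    unfolding qa_def qb_def qp_def by (intro sqi_Pair sqi_zero sqi_add sqi_pr fq)+
  have iqf: "integrable RO qf" unfolding qf_def by (intro Bochner_Integration.integrable_add sqi_mult fsq sqi_pr fq)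
  have split: "(LINT x|RO. (indicator (Om' \<beta>) x *\<^sub>R Qf f u p x) \<bullet> q x) =
     (LINT x|RO. JW O' (c1 u) x \<bullet> (indicator (Om' \<beta>) x *\<^sub>R qa x)) + (LINT x|RO. JW O' (c2 u) x \<bullet> (indicator (Om' \<beta>) x *\<^sub>R qb x))
     - (LINT x|RO. p x * qp x) - (LINT x|RO. indicator (Om' \<beta>) x * qf x)"
    if a: "adm \<beta>" and u: "H10v O' u" and p: "sqi RO p" and pz: "AE x in RO. x \<notin> Om' \<beta> --> p x = 0" for \<beta> u p
  proof -
    have h: "H10 O' (c1 u)" "H10 O' (c2 u)" using u by (auto simp: H10v_def)
    let ?i = "indicator (Om' \<beta>) :: R2 => real"
    have i1: "integrable RO (%x. JW O' (c1 u) x \<bullet> (?i x *\<^sub>R qa x))" by (rule sqi_inner[OF H10_sqi[OF h(1)] ind_sqi(1)[OF a sq(1)]])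
    have i2: "integrable RO (%x. JW O' (c2 u) x \<bullet> (?i x *\<^sub>R qb x))" by (rule sqi_inner[OF H10_sqi[OF h(2)] ind_sqi(1)[OF a sq(2)]])
    have i3: "integrable RO (%x. p x * qp x)" by (rule sqi_mult[OF p sq(3)])
    have i4: "integrable RO (%x. ?i x * qf x)"
    proof (rule Bochner_Integration.integrable_bound[OF iqf])
      show "(%x. ?i x * qf x) \<in> borel_measurable RO"
        by (rule borel_measurable_times[OF RS_measurable[OF borel_measurable_indicator[OF Om_borel[OF a]]] borel_measurable_integrable[OF iqf]])
    qed (auto simp: indicator_def)
    have "(LINT x|RO. (?i x *\<^sub>R Qf f u p x) \<bullet> q x) = (LINT x|RO. JW O' (c1 u) x \<bullet> (?i x *\<^sub>R qa x) + JW O' (c2 u) x \<bullet> (?i x *\<^sub>R qb x) - p x * qp x - ?i x * qf x)"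
    proof (rule integral_cong_AE)
      show "(%x. (?i x *\<^sub>R Qf f u p x) \<bullet> q x) \<in> borel_measurable RO"
        by (rule borel_measurable_integrable[OF sqi_inner[OF ind_sqi(1)[OF a Qf_sqi[OF u p fsq]] q]])
      show "(%x. JW O' (c1 u) x \<bullet> (?i x *\<^sub>R qa x) + JW O' (c2 u) x \<bullet> (?i x *\<^sub>R qb x) - p x * qp x - ?i x * qf x) \<in> borel_measurable RO"
        by (intro borel_measurable_integrable Bochner_Integration.integrable_add Bochner_Integration.integrable_diff i1 i2 i3 i4)
      show "AE x in RO. (?i x *\<^sub>R Qf f u p x) \<bullet> q x = JW O' (c1 u) x \<bullet> (?i x *\<^sub>R qa x) + JW O' (c2 u) x \<bullet> (?i x *\<^sub>R qb x) - p x * qp x - ?i x * qf x"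
        using pz
      proof eventually_elim
        case (elim x)
        obtain q1 q2 q3 r1 r2 r3 where qx: "q x = ((q1, q2, q3), (r1, r2, r3))" by (metis prod.exhaust)
        show ?case using elim
          by (cases "x \<in> Om' \<beta>") (auto simp: Qf_def qa_def qb_def qp_def qf_def qx JW_def algebra_simps)
      qed
    qed
    then show ?thesis using i1 i2 i3 i4 by simp
  qed
  have fi: "(%n. LINT x|RO. a x \<bullet> (indicator (Om' (\<alpha>s n)) x *\<^sub>R b x)) \<longlonglongrightarrow> (LINT x|RO. a x \<bullet> (indicator (Om' \<alpha>) x *\<^sub>R b x))"
    if "sqi RO a" "sqi RO b" for a b :: "R2 => real"
    by (rule l2_weak_strong[OF that(1) order_refl tendsto_const ind_sqi(1)[OF ad(1) that(2)] ind_sqi(1)[OF ad(2) that(2)] indicator_Om_conv[OF ad C0 that(2)]])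
  have qfe: "(LINT x|RO. indicator (Om' \<beta>) x * qf x) = (LINT x|RO. fst (f x) \<bullet> (indicator (Om' \<beta>) x *\<^sub>R pr0 (fst (q x)))) + (LINT x|RO. snd (f x) \<bullet> (indicator (Om' \<beta>) x *\<^sub>R pr0 (snd (q x))))" if a: "adm \<beta>" for \<beta>
    unfolding qf_def
      Bochner_Integration.integral_add[OF sqi_inner[OF fsq(1) ind_sqi(1)[OF a sqi_pr(1)[OF fq(1)]]] sqi_inner[OF fsq(2) ind_sqi(1)[OF a sqi_pr(1)[OF fq(2)]]], symmetric]
    by (intro Bochner_Integration.integral_cong refl) (simp add: algebra_simps)
  have L4: "(%n. LINT x|RO. indicator (Om' (\<alpha>s n)) x * qf x) \<longlonglongrightarrow> (LINT x|RO. indicator (Om' \<alpha>) x * qf x)"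
    unfolding qfe[OF ad(1)] qfe[OF ad(2)] by (intro tendsto_add fi fsq sqi_pr fq)
  have "AE x in RO. x \<notin> Om' (\<alpha>s n) --> pp n x = 0" for n by (simp add: pp_def)
  note sp = split[OF ad(1) uu(1) pp_sqi(1) this] split[OF ad(2) ulim(1) pbar_sqi(1) pbar_off]
  show ?thesis unfolding QQ_def Q0_def sp
    by (intro tendsto_diff tendsto_add uu_ind_conv sq pp_weak[OF sq(3)] L4)
qed

section \<open>The limit multipliers\<close>

lemma sigma_seq:
  shows "sqi M1 (\<sigma>ts n)" "AE s in M1. \<bar>\<sigma>ts n s\<bar> <= g \<bar>vtau' (\<alpha>s n) (uu n) s\<bar>" "l2n M1 (\<sigma>ts n) <= l2n M1 (%s. gmax)"
proof -
  show s: "sqi M1 (\<sigma>ts n)" and b: "AE s in M1. \<bar>\<sigma>ts n s\<bar> <= g \<bar>vtau' (\<alpha>s n) (uu n) s\<bar>"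
    using solD(5)[of n] by (auto simp: Kset_def M1_L2S M1_AE uu_comp)
  have "l2n M1 (\<sigma>ts n) <= 1 * l2n M1 (%s. gmax)"
  proof (rule l2n_le[OF sqi_measurable[OF s]])
    show "sqi M1 (%s. gmax)" by (rule M1_continuous_sqi) simp
    show "AE s in M1. norm (\<sigma>ts n s) <= 1 * norm gmax"
      using b
    proof eventually_elim
      case (elim s) then show ?case using gbnd(2)[rule_format, of "\<bar>vtau' (\<alpha>s n) (uu n) s\<bar>"] by simp linarith
    qed
  qed simp
  then show "l2n M1 (\<sigma>ts n) <= l2n M1 (%s. gmax)" by simp
qed

lemma adv_mult:
  assumes U: "\<beta> \<in> Uad amin amax C1 C2" and t: "sqi M1 t"
  shows "sqi M1 (%s. adv \<beta> s * t s)" "l2n M1 (%s. adv \<beta> s * t s) <= \<bar>C1\<bar> * l2n M1 t"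
proof -
  have m: "(%s. adv \<beta> s * t s) \<in> borel_measurable M1" by (rule borel_measurable_times[OF adv_measurable[OF U] sqi_measurable[OF t]])
  have b: "AE s in M1. norm (adv \<beta> s * t s) <= \<bar>C1\<bar> * norm (t s)"
    using Uad_slope(3)[OF U]
  proof eventually_elim
    case (elim s) then have "\<bar>adv \<beta> s\<bar> <= \<bar>C1\<bar>" by linarith
    then show ?case by (simp add: abs_mult mult_right_mono)
  qed
  show "sqi M1 (%s. adv \<beta> s * t s)" by (rule sqi_bound[OF m t b])
  show "l2n M1 (%s. adv \<beta> s * t s) <= \<bar>C1\<bar> * l2n M1 t" by (rule l2n_le[OF m t b]) simp
qed

lemma adv_lim: assumes "0 < s" "s < 1" shows "(%n. adv (\<alpha>s n) s) \<longlonglongrightarrow> adv \<alpha> s"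
proof (rule LIMSEQ_I)
  fix e :: real assume "0 < e"
  then have "\<forall>\<^sub>F n in sequentially. \<forall>x\<in>{0..1}. \<bar>\<alpha>s n x - \<alpha> x\<bar> <= e / 2 \<and> \<bar>adv (\<alpha>s n) x - adv \<alpha> x\<bar> <= e / 2"
    using conv[unfolded C1conv_def] half_gt_zero by blast
  then have "\<forall>\<^sub>F n in sequentially. norm (adv (\<alpha>s n) s - adv \<alpha> s) < e"
  proof eventually_elim
    case (elim n)
    then have "\<bar>adv (\<alpha>s n) s - adv \<alpha> s\<bar> <= e / 2" using assms by auto
    then show ?case using \<open>0 < e\<close> by simp
  qed
  then show "\<exists>no. \<forall>n\<ge>no. norm (adv (\<alpha>s n) s - adv \<alpha> s) < e" by (simp add: eventually_sequentially)
qed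

text \<open>The slopes converge pointwise and are a.e. bounded by C1, so they preserve strong L2
  convergence.\<close>

lemma adv_mult_conv:
  assumes t: "!!n. sqi M1 (t n)" "sqi M1 t0" "l2conv M1 t t0"
  shows "l2conv M1 (%n s. adv (\<alpha>s n) s * t n s) (%s. adv \<alpha> s * t0 s)"
proof -
  have d: "l2conv M1 (%n s. adv (\<alpha>s n) s * t0 s) (%s. adv \<alpha> s * t0 s)"
  proof (rule l2n_dominated)
    show "(%s. adv (\<alpha>s n) s * t0 s - adv \<alpha> s * t0 s) \<in> borel_measurable M1" for n
      by (rule sqi_measurable[OF sqi_diff[OF adv_mult(1)[OF Ua(1) t(2)] adv_mult(1)[OF Ua(2) t(2)]]])
    show "sqi M1 (%s. (2 * \<bar>C1\<bar>) * t0 s)" by (rule sqi_cmult[OF t(2)])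
    show "AE s in M1. norm (adv (\<alpha>s n) s * t0 s - adv \<alpha> s * t0 s) <= norm ((2 * \<bar>C1\<bar>) * t0 s)" for n
      using Uad_slope(3)[OF Ua(1)[of n]] Uad_slope(3)[OF Ua(2)]
    proof eventually_elim
      case (elim s) then have "\<bar>adv (\<alpha>s n) s - adv \<alpha> s\<bar> <= 2 * \<bar>C1\<bar>" by linarith
      then show ?case by (simp add: abs_mult mult_right_mono flip: left_diff_distrib)
    qed
    show "AE s in M1. (%n. adv (\<alpha>s n) s * t0 s - adv \<alpha> s * t0 s) \<longlonglongrightarrow> 0"
    proof (rule M1_AE_I)
      fix s :: real assume "0 < s" "s < 1"
      from tendsto_diff[OF tendsto_mult[OF adv_lim[OF this] tendsto_const[of "t0 s"]] tendsto_const[of "adv \<alpha> s * t0 s"]]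
      show "(%n. adv (\<alpha>s n) s * t0 s - adv \<alpha> s * t0 s) \<longlonglongrightarrow> 0" by simp
    qed
  qed
  have G: "(%n. \<bar>C1\<bar> * l2n M1 (%s. t n s - t0 s) + l2n M1 (%s. adv (\<alpha>s n) s * t0 s - adv \<alpha> s * t0 s)) \<longlonglongrightarrow> \<bar>C1\<bar> * 0 + 0"
    by (intro tendsto_intros t d)
  have "l2n M1 (%s. adv (\<alpha>s n) s * t n s - adv \<alpha> s * t0 s) <= \<bar>C1\<bar> * l2n M1 (%s. t n s - t0 s) + l2n M1 (%s. adv (\<alpha>s n) s * t0 s - adv \<alpha> s * t0 s)" for n
    using l2n_triangle3[OF adv_mult(1)[OF Ua(1)[of n] t(1)[of n]] adv_mult(1)[OF Ua(1)[of n] t(2)] adv_mult(1)[OF Ua(2) t(2)]]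
      adv_mult(2)[OF Ua(1)[of n] sqi_diff[OF t(1)[of n] t(2)]] by (simp add: right_diff_distrib)
  then show ?thesis by (intro Lim_null_comparison[OF always_eventually G[simplified]]) simp
qed

text \<open>The tangential component of \<open>v\<close> times the arc-length density \<open>\<surd>(1 + \<beta>'\<^sup>2)\<close>.\<close>

definition bt :: "(real => real) => (R2 => R2) => real => real" where
  "bt \<beta> v s = tr' \<beta> (c1 v) s + adv \<beta> s * tr' \<beta> (c2 v) s"

text \<open>The weak formulation tested with \<open>v\<close>, all terms but the normal multiplier; \<open>Q\<close> collects the volume terms as coefficients of the jet of \<open>v\<close>.\<close>

definition FF :: "(R2 => (real \<times> real \<times> real) \<times> (real \<times> real \<times> real)) => (real => real) => (real => real) => (R2 => R2) => real" where
  "FF Q \<sigma> \<beta> v = (LINT x|RO. Q x \<bullet> Ju v x) - (LINT s|M1. \<sigma> s * bt \<beta> v s)"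

lemma H10v_D: "H10v O' v ==> H10 O' (c1 v)" "H10v O' v ==> H10 O' (c2 v)" by (auto simp: H10v_def)

lemma c_comb: "c1 (%x. v x + c *\<^sub>R w x) = (%x. c1 v x + c * c1 w x)" "c2 (%x. v x + c *\<^sub>R w x) = (%x. c2 v x + c * c2 w x)"
  by (auto simp: c1_def c2_def)

lemma c_Pair: "c1 (%x. (p x, q x)) = p" "c2 (%x. (p x, q x)) = q" by (auto simp: c1_def c2_def)

lemma H10v_comb: assumes "H10v O' v" "H10v O' w" shows "H10v O' (%x. v x + c *\<^sub>R w x)"
  using H10_comb(1)[OF H10v_D(1)[OF assms(1)] H10v_D(1)[OF assms(2)]] H10_comb(1)[OF H10v_D(2)[OF assms(1)] H10v_D(2)[OF assms(2)]]
  by (simp add: H10v_def c_comb)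

lemma bt_sqi: "\<beta> \<in> Uad amin amax C1 C2 ==> adm \<beta> ==> H10v O' v ==> sqi M1 (bt \<beta> v)"
  unfolding bt_def by (intro sqi_add adv_mult tr_sqi H10v_D)

lemma bt_conv:
  assumes v: "!!n. H10v O' (v n)" "H10v O' v0"
    and c: "l2conv M1 (%n. tr' (\<alpha>s n) (c1 (v n))) (tr' \<alpha> (c1 v0))"
      "l2conv M1 (%n. tr' (\<alpha>s n) (c2 (v n))) (tr' \<alpha> (c2 v0))"
  shows "l2conv M1 (%n. bt (\<alpha>s n) (v n)) (bt \<alpha> v0)"
proof -
  note h = H10v_D[OF v(1)] H10v_D[OF v(2)]
  have G: "(%n. l2n M1 (%s. tr' (\<alpha>s n) (c1 (v n)) s - tr' \<alpha> (c1 v0) s) + l2n M1 (%s. adv (\<alpha>s n) s * tr' (\<alpha>s n) (c2 (v n)) s - adv \<alpha> s * tr' \<alpha> (c2 v0) s)) \<longlonglongrightarrow> 0 + 0"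
    by (intro tendsto_add c adv_mult_conv tr_sqi ad h)
  have "l2n M1 (%s. bt (\<alpha>s n) (v n) s - bt \<alpha> v0 s) <= l2n M1 (%s. tr' (\<alpha>s n) (c1 (v n)) s - tr' \<alpha> (c1 v0) s) + l2n M1 (%s. adv (\<alpha>s n) s * tr' (\<alpha>s n) (c2 (v n)) s - adv \<alpha> s * tr' \<alpha> (c2 v0) s)" for n
    using l2n_triangle[OF sqi_diff[OF tr_sqi[OF ad(1)[of n] h(1)[of n]] tr_sqi[OF ad(2) h(3)]]
      sqi_diff[OF adv_mult(1)[OF Ua(1)[of n] tr_sqi[OF ad(1)[of n] h(2)[of n]]] adv_mult(1)[OF Ua(2) tr_sqi[OF ad(2) h(4)]]]] by (simp add: bt_def algebra_simps)
  then show ?thesis by (intro Lim_null_comparison[OF always_eventually G[simplified]]) simp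
qed

lemma bt_shift_conv: "H10v O' v ==> l2conv M1 (%n. bt (\<alpha>s n) v) (bt \<alpha> v)"
  by (intro bt_conv trace_shift_conv[OF ad C0] H10v_D)

lemma FF_lin:
  assumes U: "\<beta> \<in> Uad amin amax C1 C2" and a: "adm \<beta>" and Q: "sqi RO Q" and s: "sqi M1 \<sigma>" and v: "H10v O' v" and w: "H10v O' w"
  shows "FF Q \<sigma> \<beta> (%x. v x + c *\<^sub>R w x) = FF Q \<sigma> \<beta> v + c * FF Q \<sigma> \<beta> w"
proof -
  let ?z = "%x. v x + c *\<^sub>R w x"
  note z = H10v_comb[OF v w, of c]
  have j: "AE x in RO. Ju ?z x = Ju v x + c *\<^sub>R Ju w x"
    using H10_comb(2)[OF H10v_D(1)[OF v] H10v_D(1)[OF w], of c] H10_comb(2)[OF H10v_D(2)[OF v] H10v_D(2)[OF w], of c]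
    by eventually_elim (simp add: Ju_def c_comb)
  have "(LINT x|RO. Q x \<bullet> Ju ?z x) = (LINT x|RO. Q x \<bullet> Ju v x + c * (Q x \<bullet> Ju w x))"
  proof (rule integral_cong_AE)
    show "(%x. Q x \<bullet> Ju ?z x) \<in> borel_measurable RO" by (rule borel_measurable_integrable[OF sqi_inner[OF Q Ju_sqi[OF z]]])
    show "(%x. Q x \<bullet> Ju v x + c * (Q x \<bullet> Ju w x)) \<in> borel_measurable RO"
      by (intro borel_measurable_integrable Bochner_Integration.integrable_add integrable_mult_right sqi_inner Q Ju_sqi v w)
    show "AE x in RO. Q x \<bullet> Ju ?z x = Q x \<bullet> Ju v x + c * (Q x \<bullet> Ju w x)"
      using j by eventually_elim (simp add: inner_add_right)
  qed
  also have "\<dots> = (LINT x|RO. Q x \<bullet> Ju v x) + c * (LINT x|RO. Q x \<bullet> Ju w x)"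
    using sqi_inner[OF Q Ju_sqi[OF v]] sqi_inner[OF Q Ju_sqi[OF w]] by simp
  finally have 1: "(LINT x|RO. Q x \<bullet> Ju ?z x) = (LINT x|RO. Q x \<bullet> Ju v x) + c * (LINT x|RO. Q x \<bullet> Ju w x)" .
  have b: "AE s in M1. bt \<beta> ?z s = bt \<beta> v s + c * bt \<beta> w s"
    using tr_comb[OF a H10v_D(1)[OF v] H10v_D(1)[OF w] refl, of c] tr_comb[OF a H10v_D(2)[OF v] H10v_D(2)[OF w] refl, of c]
    by eventually_elim (simp add: bt_def c_comb algebra_simps)
  have "(LINT x|M1. \<sigma> x * bt \<beta> ?z x) = (LINT x|M1. \<sigma> x * bt \<beta> v x + c * (\<sigma> x * bt \<beta> w x))"
  proof (rule integral_cong_AE)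
    show "(%x. \<sigma> x * bt \<beta> ?z x) \<in> borel_measurable M1" by (rule borel_measurable_integrable[OF sqi_mult[OF s bt_sqi[OF U a z]]])
    show "(%x. \<sigma> x * bt \<beta> v x + c * (\<sigma> x * bt \<beta> w x)) \<in> borel_measurable M1"
      by (intro borel_measurable_integrable Bochner_Integration.integrable_add integrable_mult_right sqi_mult s bt_sqi U a v w)
    show "AE x in M1. \<sigma> x * bt \<beta> ?z x = \<sigma> x * bt \<beta> v x + c * (\<sigma> x * bt \<beta> w x)"
      using b by eventually_elim (simp add: algebra_simps)
  qed
  also have "\<dots> = (LINT x|M1. \<sigma> x * bt \<beta> v x) + c * (LINT x|M1. \<sigma> x * bt \<beta> w x)"
    using sqi_mult[OF s bt_sqi[OF U a v]] sqi_mult[OF s bt_sqi[OF U a w]] by simp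
  finally show ?thesis unfolding FF_def 1 by (simp add: algebra_simps)
qed

section \<open>The normal functional on asymptotically tangential fields\<close>

definition NN :: "(real => real) => (R2 => R2) => real" where
  "NN \<beta> v = l2n (RS (Om' \<beta>)) (JW O' (c1 v)) + l2n (RS (Om' \<beta>)) (JW O' (c2 v))"

text \<open>Q vanishes off the domain and traces are controlled from the domain, so only norms over
  the domain enter. A corrector that is small there changes the functional by little.\<close>

lemma FF_bound:
  assumes U: "\<beta> \<in> Uad amin amax C1 C2" and a: "adm \<beta>" and Q: "sqi RO Q" and s: "sqi M1 \<sigma>" and v: "H10v O' v"
    and off: "!!x. x \<notin> Om' \<beta> ==> Q x = 0" and K: "l2n RO Q <= K" "l2n M1 \<sigma> <= G"
  shows "\<bar>FF Q \<sigma> \<beta> v\<bar> <= (K + G * (Ct * (1 + \<bar>C1\<bar>))) * NN \<beta> v"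
proof -
  let ?U = "Om' \<beta>"
  note Ub = Om_borel[OF a] and Us = Om_sub[OF a] and h = H10v_D[OF v]
  have sQ: "sqi (RS ?U) Q" "l2n (RS ?U) Q <= l2n RO Q" by (rule sqi_subset[OF Ub O_borel Us Q])+
  have sj: "sqi (RS ?U) (JW O' (c1 v))" "sqi (RS ?U) (JW O' (c2 v))" by (rule sqi_subset(1)[OF Ub O_borel Us H10_sqi[OF h(1)]], rule sqi_subset(1)[OF Ub O_borel Us H10_sqi[OF h(2)]])
  have "(LINT x|RO. Q x \<bullet> Ju v x) = (LINT x|RO. indicator ?U x * (Q x \<bullet> Ju v x))"
    by (intro Bochner_Integration.integral_cong refl) (auto simp: indicator_def off)
  also have "\<dots> = (LINT x|RS ?U. Q x \<bullet> Ju v x)" by (rule RS_sub_integral[OF Ub Us, symmetric])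
  finally have "\<bar>LINT x|RO. Q x \<bullet> Ju v x\<bar> <= l2n (RS ?U) Q * l2n (RS ?U) (Ju v)"
    using l2_Cauchy_Schwarz[OF sQ(1) sqi_subset(1)[OF Ub O_borel Us Ju_sqi[OF v]]] by simp
  also have "\<dots> <= K * NN \<beta> v"
    using sQ(2) K(1) l2n_Pair_le[OF sj] order_trans[OF l2n_nonneg K(1)] by (intro mult_mono) (auto simp: NN_def Ju_def[abs_def])
  finally have 1: "\<bar>LINT x|RO. Q x \<bullet> Ju v x\<bar> <= K * NN \<beta> v" .
  have "l2n M1 (bt \<beta> v) <= l2n M1 (tr' \<beta> (c1 v)) + l2n M1 (%s. adv \<beta> s * tr' \<beta> (c2 v) s)"
    unfolding bt_def by (rule l2n_triangle[OF tr_sqi[OF a h(1)] adv_mult(1)[OF U tr_sqi[OF a h(2)]]])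
  also have "\<dots> <= l2n M1 (tr' \<beta> (c1 v)) + \<bar>C1\<bar> * l2n M1 (tr' \<beta> (c2 v))" using adv_mult(2)[OF U tr_sqi[OF a h(2)]] by simp
  also have "\<dots> <= Ct * l2n (RS ?U) (JW O' (c1 v)) + \<bar>C1\<bar> * (Ct * l2n (RS ?U) (JW O' (c2 v)))"
    by (intro add_mono mult_left_mono TT_bound[OF a] H10_TT[OF a] h) auto
  also have "\<dots> <= Ct * (1 + \<bar>C1\<bar>) * NN \<beta> v"
  proof -
    have "0 <= Ct * \<bar>C1\<bar> * l2n (RS ?U) (JW O' (c1 v))" "0 <= Ct * l2n (RS ?U) (JW O' (c2 v))" using Ct_pos by auto
    then show ?thesis by (simp add: NN_def algebra_simps)
  qed
  finally have b: "l2n M1 (bt \<beta> v) <= Ct * (1 + \<bar>C1\<bar>) * NN \<beta> v" .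
  have "\<bar>LINT s|M1. \<sigma> s * bt \<beta> v s\<bar> <= l2n M1 \<sigma> * l2n M1 (bt \<beta> v)" by (rule l2_Cauchy_Schwarz_real[OF s bt_sqi[OF U a v]])
  also have "\<dots> <= G * (Ct * (1 + \<bar>C1\<bar>) * NN \<beta> v)" using K(2) b order_trans[OF l2n_nonneg K(2)] by (intro mult_mono) auto
  finally show ?thesis using 1 unfolding FF_def by (simp add: algebra_simps)
qed

abbreviation En :: "nat => (R2 => R2) => real" where "En n \<equiv> FF (QQ n) (\<sigma>ts n) (\<alpha>s n)"

lemma En_eq: assumes v: "H10v O' v" shows "\<sigma>ns n (vnu' (\<alpha>s n) v) = En n v"
proof -
  let ?U = "Om' (\<alpha>s n)"
  have "Wv \<omega> (\<alpha>s n) v" unfolding Wv_def using Wrestr Ua(1) H10v_D[OF v] by blast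
  note e = solD(6)[OF this]
  have "aform ?U (us n) v = aform ?U (uu n) v" by (simp add: aform_def uu_wd)
  moreover have "bform ?U v (ps n) = bform ?U v (pp n)"
    unfolding bform_def intg_def set_lebesgue_integral_def
    by (intro Bochner_Integration.integral_cong refl) (auto simp: pp_def indicator_def)
  moreover have "(LINT x|RO. QQ n x \<bullet> Ju v x) = (LINT x|RO. indicator ?U x * (Qf f (uu n) (pp n) x \<bullet> Ju v x))" by (simp add: QQ_def)
  ultimately show ?thesis using e form_eq[OF ad(1)[of n] uu(1)[of n] v pp_sqi(1)[of n] fsq] by (simp add: FF_def bt_def ipS_vtau)
qed

lemma En_zero: "H10v O' v ==> AE s in M1. vnu' (\<alpha>s n) v s = 0 ==> En n v = 0"
  using Hm12_zero[OF solD(4) solD(1)] En_eq by metis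

lemma vnu_zero_iff: "vnu' \<beta> v s = 0 \<longleftrightarrow> adv \<beta> s * tr' \<beta> (c1 v) s - tr' \<beta> (c2 v) s = 0"
proof -
  have "0 < sqrt (1 + (adv \<beta> s)\<^sup>2)" by (simp add: add_pos_nonneg)
  then show ?thesis by (simp add: vnu_def mult.commute)
qed

text \<open>The corrector turns \<open>v\<close> into a field tangential to the \<open>n\<close>-th curve at a vanishing cost in \<open>H\<^sup>1(\<Omega>(\<alpha>\<^sub>n))\<close>.\<close>

lemma En_lim0: assumes v: "H10v O' v" and z: "AE s in M1. vnu' \<alpha> v s = 0" shows "(%n. En n v) \<longlonglongrightarrow> 0"
proof (rule LIMSEQ_I)
  fix e :: real assume e: "0 < e"
  obtain K where K: "0 < K" "!!n. l2n RO (QQ n) <= K" using QQ_bound by blast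
  define B where "B = K + l2n M1 (%s. gmax) * (Ct * (1 + \<bar>C1\<bar>))"
  have B: "0 < B" unfolding B_def using K(1) Ct_pos by (intro add_pos_nonneg) auto
  have z': "AE s in M1. adv \<alpha> s * tr' \<alpha> (c1 v) s - tr' \<alpha> (c2 v) s = 0" using z by (simp add: vnu_zero_iff)
  have "\<forall>\<^sub>F n in sequentially. norm (En n v - 0) < e"
    using corrector[OF Ua ad conv H10v_D[OF v] z' _ C2, of "e / (2 * B)"] e B
  proof (simp, elim eventually_mono)
    fix n assume "\<exists>y. H10 O' y \<and> (AE s in M1. tr' (\<alpha>s n) y s = adv (\<alpha>s n) s * tr' (\<alpha>s n) (c1 v) s - tr' (\<alpha>s n) (c2 v) s) \<and>
      l2n (RS (Om' (\<alpha>s n))) (JW O' y) <= e / (2 * B)"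
    then obtain y where y: "H10 O' y" "AE s in M1. tr' (\<alpha>s n) y s = adv (\<alpha>s n) s * tr' (\<alpha>s n) (c1 v) s - tr' (\<alpha>s n) (c2 v) s"
      "l2n (RS (Om' (\<alpha>s n))) (JW O' y) <= e / (2 * B)" by blast
    \<comment> \<open>The normal trace is proportional to \<alpha>_n' v1 - v2, so adding the defect
      to the second component alone cancels it.\<close>
    let ?y = "%x. (0, y x)"
    have hy: "H10v O' ?y" using y(1) H10_zero(1) by (simp add: H10v_def c_Pair)
    let ?w = "%x. v x + 1 *\<^sub>R ?y x"
    have hw: "H10v O' ?w" by (rule H10v_comb[OF v hy])
    have "AE s in M1. vnu' (\<alpha>s n) ?w s = 0"
      using y(2) tr_comb[OF ad(1)[of n] H10v_D(2)[OF v] y(1) refl, of 1]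
      unfolding vnu_zero_iff c_comb c_Pair by eventually_elim simp
    then have "En n ?w = 0" by (rule En_zero[OF hw])
    then have "En n v = - En n ?y" using FF_lin[OF Ua(1)[of n] ad(1)[of n] QQ_sqi(1)[of n] sigma_seq(1)[of n] v hy, of 1] by simp
    then have "\<bar>En n v\<bar> <= B * NN (\<alpha>s n) ?y"
      unfolding B_def using FF_bound[OF Ua(1)[of n] ad(1)[of n] QQ_sqi(1)[of n] sigma_seq(1)[of n] hy _ K(2)[of n] sigma_seq(3)[of n]] by (simp add: QQ_def)
    also have "NN (\<alpha>s n) ?y <= e / (2 * B)" using y(3) by (simp add: NN_def c_Pair JW_zero_norm[OF ad(1)])
    finally show "\<bar>En n v\<bar> < e" using B e by simp
  qed
  then show "\<exists>no. \<forall>n\<ge>no. norm (En n v - 0) < e" by (simp add: eventually_sequentially)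
qed

section \<open>The weak limit of the tangential multipliers\<close>

lemma tangential_field:
  assumes T: "TT \<alpha> V t"
  obtains v where "H10v O' v" "AE s in M1. vnu' \<alpha> v s = 0" "AE s in M1. bt \<alpha> v s = (1 + (adv \<alpha> s)\<^sup>2) * t s"
proof -
  obtain w1 where w1: "H10 O' w1" "AE s in M1. tr' \<alpha> w1 s = t s" using TT_H10[OF ad(2) T] by blast
  obtain w2 where w2: "H10 O' w2" "AE s in M1. tr' \<alpha> w2 s = slope \<alpha> s * t s" using TT_H10[OF ad(2) TT_slope_mult[OF ad(2) T Ua(2)]] by blast
  have se: "AE s in M1. slope \<alpha> s = adv \<alpha> s" by (rule M1_AE_I) (simp add: slope_eq)
  show ?thesis
  proof (rule that[of "%x. (w1 x, w2 x)"])
    show "H10v O' (%x. (w1 x, w2 x))" using w1 w2 by (simp add: H10v_def c_Pair)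
    show "AE s in M1. vnu' \<alpha> (%x. (w1 x, w2 x)) s = 0" unfolding vnu_zero_iff c_Pair
      using w1(2) w2(2) se by eventually_elim simp
    show "AE s in M1. bt \<alpha> (%x. (w1 x, w2 x)) s = (1 + (adv \<alpha> s)\<^sup>2) * t s" unfolding bt_def c_Pair
      using w1(2) w2(2) se by eventually_elim (simp add: power2_eq_square algebra_simps)
  qed
qed

lemma QQ_Ju_conv: "H10v O' v ==> (%n. LINT x|RO. QQ n x \<bullet> Ju v x) \<longlonglongrightarrow> (LINT x|RO. Q0 x \<bullet> Ju v x)"
  by (rule QQ_weak[OF Ju_sqi])

lemma weight_sqi: assumes "sqi M1 t" shows "sqi M1 (%s. (1 + (adv \<alpha> s)\<^sup>2) * t s)"
  using sqi_add[OF assms adv_mult(1)[OF Ua(2) adv_mult(1)[OF Ua(2) assms]]] by (simp add: algebra_simps power2_eq_square)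

text \<open>On a tangential field the normal term tends to zero and the volume terms converge, so
  the slip term, the only one left, converges too. Its n-th tangential component may then be
  replaced by the limit one, as the multipliers are bounded.\<close>

lemma sigma_seq_trace_convergent:
  assumes T: "TT \<alpha> V t" shows "convergent (%n. LINT s|M1. \<sigma>ts n s * ((1 + (adv \<alpha> s)\<^sup>2) * t s))"
proof -
  obtain v where v: "H10v O' v" "AE s in M1. vnu' \<alpha> v s = 0" "AE s in M1. bt \<alpha> v s = (1 + (adv \<alpha> s)\<^sup>2) * t s"
    using tangential_field[OF T] by blast
  let ?d = "%s. (1 + (adv \<alpha> s)\<^sup>2) * t s"
  have tq: "sqi M1 t" using T by (simp add: TT_def)
  note sb = bt_sqi[OF Ua(1) ad(1) v(1)] bt_sqi[OF Ua(2) ad(2) v(1)]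
  have "(%n. (LINT x|RO. QQ n x \<bullet> Ju v x) - En n v) \<longlonglongrightarrow> (LINT x|RO. Q0 x \<bullet> Ju v x) - 0"
    by (intro tendsto_diff QQ_Ju_conv En_lim0 v)
  then have 1: "(%n. LINT s|M1. \<sigma>ts n s * bt (\<alpha>s n) v s) \<longlonglongrightarrow> (LINT x|RO. Q0 x \<bullet> Ju v x)" by (simp add: FF_def)
  have "(%n. LINT s|M1. \<sigma>ts n s \<bullet> (bt (\<alpha>s n) v s - bt \<alpha> v s)) \<longlonglongrightarrow> 0"
    by (rule l2_weak_strong[OF sigma_seq(1) sigma_seq(3), where ?g0.0="%s. 0"]) (use sqi_diff[OF sb] bt_shift_conv[OF v(1)] in auto)
  then have 2: "(%n. LINT s|M1. \<sigma>ts n s * (bt (\<alpha>s n) v s - bt \<alpha> v s)) \<longlonglongrightarrow> 0" by simp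
  have e: "(LINT s|M1. \<sigma>ts n s * ?d s) = (LINT s|M1. \<sigma>ts n s * bt (\<alpha>s n) v s) - (LINT s|M1. \<sigma>ts n s * (bt (\<alpha>s n) v s - bt \<alpha> v s))" for n
  proof -
    have "(LINT s|M1. \<sigma>ts n s * ?d s) = (LINT s|M1. \<sigma>ts n s * bt \<alpha> v s)"
    proof (rule integral_cong_AE)
      show "(%s. \<sigma>ts n s * ?d s) \<in> borel_measurable M1" by (rule borel_measurable_integrable[OF sqi_mult[OF sigma_seq(1) weight_sqi[OF tq]]])
      show "(%s. \<sigma>ts n s * bt \<alpha> v s) \<in> borel_measurable M1" by (rule borel_measurable_integrable[OF sqi_mult[OF sigma_seq(1) sb(2)]])
      show "AE s in M1. \<sigma>ts n s * ?d s = \<sigma>ts n s * bt \<alpha> v s" using v(3) by eventually_elim simp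
    qed
    then show ?thesis unfolding right_diff_distrib using sqi_mult[OF sigma_seq(1)[of n] sb(1)[of n]] sqi_mult[OF sigma_seq(1)[of n] sb(2)] by simp
  qed
  show ?thesis unfolding e by (rule convergentI[OF tendsto_diff[OF 1 2]])
qed

text \<open>The limit exists on the set D of weighted traces and is represented there by some
  \<sigma>. A second application of the Riesz lemma, to the functional given by an arbitrary q,
  shows that D is dense: the projection of q differs from q by something orthogonal to all
  traces.\<close>

lemma sigma_tau_exists: "\<exists>\<sigma>. sqi M1 \<sigma> \<and> (\<forall>q. sqi M1 q --> (%n. LINT s|M1. \<sigma>ts n s * q s) \<longlonglongrightarrow> (LINT s|M1. \<sigma> s * q s))"
proof -
  define D where "D = {d. \<exists>V t. TT \<alpha> V t \<and> d = (%s. (1 + (adv \<alpha> s)\<^sup>2) * t s)}"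
  have ne: "D \<noteq> {}" using H10_TT[OF ad(2) H10_zero(1)] by (auto simp: D_def)
  have Ds: "sqi M1 d" if "d \<in> D" for d using that weight_sqi by (auto simp: D_def TT_def)
  have comb: "(%x. d x + c *\<^sub>R d' x) \<in> D" if d: "d \<in> D" "d' \<in> D" for d d' c
  proof -
    obtain V t V' t' where t: "TT \<alpha> V t" "d = (%s. (1 + (adv \<alpha> s)\<^sup>2) * t s)" "TT \<alpha> V' t'" "d' = (%s. (1 + (adv \<alpha> s)\<^sup>2) * t' s)"
      using d by (auto simp: D_def)
    have "(%x. d x + c *\<^sub>R d' x) = (%s. (1 + (adv \<alpha> s)\<^sup>2) * (t s + c * t' s))" by (simp add: t algebra_simps)
    then show ?thesis unfolding D_def using TT_comb[OF ad(2) t(1,3), of c] by blast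
  qed
  define l where "l d = lim (%n. LINT s|M1. \<sigma>ts n s * d s)" for d
  have lc: "(%n. LINT s|M1. \<sigma>ts n s * d s) \<longlonglongrightarrow> l d" if "d \<in> D" for d
    unfolding l_def using that sigma_seq_trace_convergent by (auto simp: D_def convergent_LIMSEQ_iff)
  have lin: "l (%x. d x + c *\<^sub>R d' x) = l d + c * l d'" if d: "d \<in> D" "d' \<in> D" for d d' c
  proof (rule LIMSEQ_unique[OF lc[OF comb[OF d]]])
    have e: "(LINT s|M1. \<sigma>ts n s * (d s + c *\<^sub>R d' s)) = (LINT s|M1. \<sigma>ts n s * d s) + c * (LINT s|M1. \<sigma>ts n s * d' s)" for n
      using sqi_mult[OF sigma_seq(1)[of n] Ds[OF d(1)]] sqi_mult[OF sigma_seq(1)[of n] Ds[OF d(2)]] by (simp add: distrib_left mult.left_commute[of _ c])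
    show "(%n. LINT s|M1. \<sigma>ts n s * (d s + c *\<^sub>R d' s)) \<longlonglongrightarrow> l d + c * l d'"
      unfolding e by (intro tendsto_intros lc d)
  qed
  have bd: "\<bar>l d\<bar> <= l2n M1 (%s. gmax) * l2n M1 d" if "d \<in> D" for d
  proof (rule LIMSEQ_le_const2[OF tendsto_rabs[OF lc[OF that]]], intro exI[of _ 0] allI impI)
    fix n
    show "\<bar>LINT s|M1. \<sigma>ts n s * d s\<bar> <= l2n M1 (%s. gmax) * l2n M1 d"
      by (rule order_trans[OF l2_Cauchy_Schwarz_real[OF sigma_seq(1) Ds[OF that]] mult_right_mono[OF sigma_seq(3) l2n_nonneg]])
  qed
  obtain \<sigma> where \<sigma>: "sqi M1 \<sigma>" "!!d. d \<in> D ==> (LINT x|M1. \<sigma> x \<bullet> d x) = l d"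
    by (rule l2_Riesz[OF M1_finite ne Ds comb lin bd]) blast+
  have "(%n. LINT s|M1. \<sigma>ts n s * q s) \<longlonglongrightarrow> (LINT s|M1. \<sigma> s * q s)" if q: "sqi M1 q" for q
  proof -
    have lin': "(LINT s|M1. q s * (d s + c *\<^sub>R d' s)) = (LINT s|M1. q s * d s) + c * (LINT s|M1. q s * d' s)" if d: "d \<in> D" "d' \<in> D" for d d' c
      using sqi_mult[OF q Ds[OF d(1)]] sqi_mult[OF q Ds[OF d(2)]] by (simp add: distrib_left mult.left_commute[of _ c])
    \<comment> \<open>What matters is the sequence Y from D: it converges to the projection w, which
      turns out to equal q.\<close>
    obtain w Y where w: "!!k::nat. Y k \<in> D" "sqi M1 w" "l2conv M1 Y w"
      "!!d. d \<in> D ==> (LINT x|M1. w x \<bullet> d x) = (LINT s|M1. q s * d s)"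
      by (rule l2_Riesz[OF M1_finite ne Ds comb lin' l2_Cauchy_Schwarz_real[OF q Ds]]) blast+
    have "AE s in M1. (1 + (adv \<alpha> s)\<^sup>2) * (w s - q s) = 0"
    proof (rule trace_orthogonal_zero[OF ad(2) Wr[OF Ua(2)] weight_sqi[OF sqi_diff[OF w(2) q]]])
      fix V t assume T: "TT \<alpha> V t"
      let ?d = "%s. (1 + (adv \<alpha> s)\<^sup>2) * t s"
      have d: "?d \<in> D" using T by (auto simp: D_def)
      have "(LINT s|M1. (1 + (adv \<alpha> s)\<^sup>2) * (w s - q s) * t s) = (LINT s|M1. w s * ?d s - q s * ?d s)"
        by (intro Bochner_Integration.integral_cong refl) (simp add: algebra_simps)
      also have "\<dots> = 0" using w(4)[OF d] sqi_mult[OF w(2) Ds[OF d]] sqi_mult[OF q Ds[OF d]] by simp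
      finally show "(LINT s|M1. (1 + (adv \<alpha> s)\<^sup>2) * (w s - q s) * t s) = 0" .
    qed
    then have wq: "AE s in M1. w s = q s"
    proof eventually_elim
      case (elim s)
      have "0 < 1 + (adv \<alpha> s)\<^sup>2" by (simp add: add_pos_nonneg)
      then show ?case using elim by simp
    qed
    have "l2n M1 (%x. Y k x - w x) = l2n M1 (%x. Y k x - q x)" for k
      by (rule l2n_cong_AE[OF sqi_measurable[OF sqi_diff[OF Ds[OF w(1)] w(2)]] sqi_measurable[OF sqi_diff[OF Ds[OF w(1)] q]]])
         (use wq in eventually_elim, simp)
    then have Yq: "l2conv M1 Y q" using w(3) by simp
    have "(%n. LINT x|M1. \<sigma>ts n x \<bullet> Y k x) \<longlonglongrightarrow> (LINT x|M1. \<sigma> x \<bullet> Y k x)" for k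
      unfolding \<sigma>(2)[OF w(1)] using lc[OF w(1)[of k]] by simp
    from l2_weak_dense[OF sigma_seq(1) \<sigma>(1) sigma_seq(3) Ds[OF w(1)] this q Yq] show ?thesis by simp
  qed
  then show ?thesis using \<sigma>(1) by blast
qed

end

text \<open>Tested with the positive part of F0 - h0. A bound that moves with n survives because it
  converges strongly.\<close>

lemma weak_limit_le:
  fixes F :: "nat => 'a => real"
  assumes F: "!!n. sqi M (F n)" "sqi M F0" "!!q. sqi M q ==> (%n. LINT x|M. F n x * q x) \<longlonglongrightarrow> (LINT x|M. F0 x * q x)"
    and h: "!!n. sqi M (h n)" "sqi M h0" "l2conv M h h0" and le: "!!n. AE x in M. F n x <= h n x"
  shows "AE x in M. F0 x <= h0 x"
proof -
  define q where "q x = max 0 (F0 x - h0 x)" for x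
  note d = sqi_diff[OF F(2) h(2)]
  have q: "sqi M q"
  proof (rule sqi_bound[OF _ d, of _ 1])
    have [measurable]: "F0 \<in> borel_measurable M" "h0 \<in> borel_measurable M" using F(2) h(2) by (auto simp: sqi_def)
    show "q \<in> borel_measurable M" unfolding q_def by measurable
  qed (auto simp: q_def)
  have "(LINT x|M. F0 x * q x) <= (LINT x|M. h0 x * q x)"
  proof (rule LIMSEQ_le[OF F(3)[OF q]])
    show "(%n. LINT x|M. h n x * q x) \<longlonglongrightarrow> (LINT x|M. h0 x * q x)" using tendsto_integral_l2[OF h q] by simp
    show "\<exists>N. \<forall>n\<ge>N. (LINT x|M. F n x * q x) <= (LINT x|M. h n x * q x)"
    proof (intro exI[of _ 0] allI impI integral_mono_AE sqi_mult F h q)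
      fix n show "AE x in M. F n x * q x <= h n x * q x" using le[of n] by eventually_elim (auto simp: q_def intro: mult_right_mono)
    qed
  qed
  then have "(LINT x|M. (F0 x - h0 x) * q x) <= 0" unfolding left_diff_distrib using sqi_mult[OF F(2) q] sqi_mult[OF h(2) q] by simp
  moreover have "(LINT x|M. (F0 x - h0 x) * q x) = (l2n M q)\<^sup>2"
    unfolding l2n_power2 by (intro Bochner_Integration.integral_cong refl) (auto simp: q_def max_def power2_eq_square)
  ultimately have "l2n M q = 0" by simp
  then have "AE x in M. q x = 0" using l2n_eq_0_iff[OF q] by simp
  then show ?thesis by eventually_elim (auto simp: q_def)
qed

section \<open>The limit normal multiplier\<close>

context slip
begin

definition sigma_tau :: "real => real" where
  "sigma_tau = (SOME \<sigma>. sqi M1 \<sigma> \<and> (\<forall>q. sqi M1 q --> (%n. LINT s|M1. \<sigma>ts n s * q s) \<longlonglongrightarrow> (LINT s|M1. \<sigma> s * q s)))"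

lemma sigma_tau: "sqi M1 sigma_tau" "sqi M1 q ==> (%n. LINT s|M1. \<sigma>ts n s * q s) \<longlonglongrightarrow> (LINT s|M1. sigma_tau s * q s)"
  using someI_ex[OF sigma_tau_exists] unfolding sigma_tau_def by blast+

lemma sigma_tau_strong:
  assumes "!!n. sqi M1 (q n)" "sqi M1 q0" "l2conv M1 q q0"
  shows "(%n. LINT s|M1. \<sigma>ts n s * q n s) \<longlonglongrightarrow> (LINT s|M1. sigma_tau s * q0 s)"
  using l2_weak_strong[OF sigma_seq(1) sigma_seq(3) _ assms, where L="(LINT s|M1. sigma_tau s * q0 s)"] sigma_tau(2)[OF assms(2)] by simp

abbreviation E0 :: "(R2 => R2) => real" where "E0 \<equiv> FF Q0 sigma_tau \<alpha>"

lemma sigma_tau_bt_conv: assumes v: "H10v O' v" shows "(%n. LINT s|M1. \<sigma>ts n s * bt (\<alpha>s n) v s) \<longlonglongrightarrow> (LINT s|M1. sigma_tau s * bt \<alpha> v s)"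
  by (rule sigma_tau_strong[OF bt_sqi[OF Ua(1) ad(1) v] bt_sqi[OF Ua(2) ad(2) v] bt_shift_conv[OF v]])

lemma E0_conv: "H10v O' v ==> (%n. En n v) \<longlonglongrightarrow> E0 v"
  unfolding FF_def by (intro tendsto_diff QQ_Ju_conv sigma_tau_bt_conv)

lemma E0_zero: "H10v O' v ==> AE s in M1. vnu' \<alpha> v s = 0 ==> E0 v = 0"
  using LIMSEQ_unique[OF E0_conv En_lim0] by blast

lemma vnu_comb:
  assumes v: "H10v O' v" and w: "H10v O' w"
  shows "AE s in M1. vnu' \<alpha> (%x. v x + c *\<^sub>R w x) s = vnu' \<alpha> v s + c * vnu' \<alpha> w s"
  using tr_comb[OF ad(2) H10v_D(1)[OF v] H10v_D(1)[OF w] refl, of c] tr_comb[OF ad(2) H10v_D(2)[OF v] H10v_D(2)[OF w] refl, of c]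
  by eventually_elim (simp add: vnu_def c_comb add_divide_distrib[symmetric] algebra_simps)

lemmas E0_lin = FF_lin[OF Ua(2) ad(2) QQ_sqi(2) sigma_tau(1)]

text \<open>By \<open>E0_zero\<close> the value \<open>E0 v\<close> depends on the normal trace of \<open>v\<close> only.\<close>

definition sigma_nu :: "(real => real) => real" where
  "sigma_nu t = (let P = (%v. H10v O' v \<and> (AE s in M1. vnu' \<alpha> v s = t s)) in if Ex P then E0 (Eps P) else 0)"

lemma sigma_nu_eq: assumes v: "H10v O' v" "AE s in M1. vnu' \<alpha> v s = t s" shows "sigma_nu t = E0 v"
proof -
  let ?P = "%v. H10v O' v \<and> (AE s in M1. vnu' \<alpha> v s = t s)"
  have P: "?P (Eps ?P)" by (rule someI[of ?P v]) (use v in simp)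
  let ?w = "Eps ?P"
  have w: "H10v O' ?w" "AE s in M1. vnu' \<alpha> ?w s = t s" using P by blast+
  have "AE s in M1. vnu' \<alpha> (%x. ?w x + (-1) *\<^sub>R v x) s = 0"
    using vnu_comb[OF w(1) v(1), of "-1"] w(2) v(2) by eventually_elim simp
  then have "E0 (%x. ?w x + (-1) *\<^sub>R v x) = 0" by (rule E0_zero[OF H10v_comb[OF w(1) v(1)]])
  then have "E0 ?w = E0 v" using E0_lin[OF w(1) v(1), of "-1"] by linarith
  moreover have "Ex ?P" using v by blast
  ultimately show ?thesis unfolding sigma_nu_def Let_def by presburger
qed

text \<open>\<open>Hm12\<close> requires this for all functions, traces or not; the predicates under
  the choice operator coincide, so the chosen fields do too.\<close>

lemma sigma_nu_cong: assumes "AE s in M1. t1 s = t2 s" shows "sigma_nu t1 = sigma_nu t2"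
proof -
  have "(H10v O' v \<and> (AE s in M1. vnu' \<alpha> v s = t1 s)) = (H10v O' v \<and> (AE s in M1. vnu' \<alpha> v s = t2 s))" for v
  proof (intro conj_cong refl iffI)
    assume "AE s in M1. vnu' \<alpha> v s = t1 s" with assms show "AE s in M1. vnu' \<alpha> v s = t2 s" by eventually_elim simp
  next
    assume "AE s in M1. vnu' \<alpha> v s = t2 s" with assms show "AE s in M1. vnu' \<alpha> v s = t1 s" by eventually_elim simp
  qed
  then show ?thesis unfolding sigma_nu_def by presburger
qed

text \<open>The second component of the outward normal is -1 / sqrt(1 + \<alpha>'^2), so the field
  (0, - sqrt(1 + \<alpha>'^2) w) has normal component w. The norm bound is what makes
  \<open>sigma_nu\<close> bounded on traces.\<close>

lemma normal_field:
  obtains C where "!!w. H10 O' w ==> \<exists>v. H10v O' v \<and> (AE s in M1. vnu' \<alpha> v s = tr' \<alpha> w s) \<and> NN \<alpha> v <= C * l2n (RS (Om' \<alpha>)) (JW O' w)"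
proof -
  let ?s = "slope \<alpha>"
  obtain L where L: "!!x y. \<bar>?s x - ?s y\<bar> <= L * \<bar>x - y\<bar>" using Uad_slope(2)[OF Ua(2)] by blast
  have L0: "0 <= L" using order_trans[OF abs_ge_zero L[of 1 0]] by simp
  define r where "r x = sqrt (1 + (?s x)\<^sup>2)" for x
  define m where "m x = - r x" for x
  define md where "md x = - (?s x * slope' \<alpha> x / r x)" for x
  have r1: "1 <= r x" for x by (simp add: r_def)
  have rs: "\<bar>?s x\<bar> <= r x" for x unfolding r_def by (rule real_le_rsqrt) simp
  \<comment> \<open>Conjugate factorisation: r inherits the Lipschitz constant of the slope, and its
    difference quotients are those of the slope times a convergent factor.\<close>
  have rd: "(r x - r y) = (?s x - ?s y) * ((?s x + ?s y) / (r x + r y))" for x y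
  proof -
    have "(r x - r y) * (r x + r y) = (?s x - ?s y) * (?s x + ?s y)"
      by (simp add: r_def algebra_simps flip: power2_eq_square)
    moreover have "0 < r x + r y" using r1[of x] r1[of y] by simp
    ultimately show ?thesis by (simp add: field_simps)
  qed
  have q1: "\<bar>(?s x + ?s y) / (r x + r y)\<bar> <= 1" for x y
    using rs[of x] rs[of y] r1[of x] r1[of y] by (simp add: abs_divide)
  have lip: "\<bar>m x - m y\<bar> <= L * \<bar>x - y\<bar>" for x y
  proof -
    have "\<bar>m x - m y\<bar> = \<bar>?s x - ?s y\<bar> * \<bar>(?s x + ?s y) / (r x + r y)\<bar>"
      using rd[of x y] by (simp add: m_def flip: abs_mult) (simp add: abs_minus_commute)
    also have "\<dots> <= \<bar>?s x - ?s y\<bar> * 1" by (intro mult_left_mono q1) simp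
    finally show ?thesis using L[of x y] by simp
  qed
  have cs: "continuous_on UNIV ?s" by (rule slope_continuous[OF Ua(2)])
  have cr: "continuous_on UNIV r" unfolding r_def by (intro continuous_intros cs)
  note [measurable] = borel_measurable_continuous_onI[OF cs] borel_measurable_continuous_onI[OF cr] slope'_measurable[OF Ua(2)]
  have mdm: "md \<in> borel_measurable borel" unfolding md_def by measurable
  have lim: "AE x in lborel. (%k. real (Suc k) * (m (x + 1 / real (Suc k)) - m x)) \<longlonglongrightarrow> md x"
    using Uad_slope(4)[OF Ua(2)]
  proof eventually_elim
    case (elim x)
    have t: "(%k. x + 1 / real (Suc k)) \<longlonglongrightarrow> x" using tendsto_add[OF tendsto_const[of x] LIMSEQ_inverse_real_of_nat] by (simp add: inverse_eq_divide)
    have "isCont ?s x" "isCont r x" using cs cr by (simp_all add: continuous_on_eq_continuous_at)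
    note ts = isCont_tendsto_compose[OF this(1) t] isCont_tendsto_compose[OF this(2) t]
    have "(%k. - ((real (Suc k) * (?s (x + 1 / real (Suc k)) - ?s x)) * ((?s (x + 1 / real (Suc k)) + ?s x) / (r (x + 1 / real (Suc k)) + r x)))) \<longlonglongrightarrow> - (slope' \<alpha> x * ((?s x + ?s x) / (r x + r x)))"
      using r1[of x] by (intro tendsto_minus tendsto_mult tendsto_divide tendsto_add elim ts tendsto_const) simp
    moreover have "- (slope' \<alpha> x * ((?s x + ?s x) / (r x + r x))) = md x" using r1[of x] by (simp add: md_def field_simps)
    moreover have "- ((real (Suc k) * (?s (x + 1 / real (Suc k)) - ?s x)) * ((?s (x + 1 / real (Suc k)) + ?s x) / (r (x + 1 / real (Suc k)) + r x))) = real (Suc k) * (m (x + 1 / real (Suc k)) - m x)" for k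
      unfolding m_def minus_diff_minus rd mult_minus_right mult.assoc ..
    ultimately show ?case by simp
  qed
  have mdL: "AE x in lborel. \<bar>md x\<bar> <= L"
    using lim
  proof eventually_elim
    case (elim x)
    show ?case
    proof (rule LIMSEQ_le_const2[OF tendsto_rabs[OF elim]], intro exI[of _ 0] allI impI)
      fix k
      have "\<bar>m (x + 1 / real (Suc k)) - m x\<bar> <= L * (1 / real (Suc k))" using lip[of "x + 1 / real (Suc k)" x] by simp
      then have "real (Suc k) * \<bar>m (x + 1 / real (Suc k)) - m x\<bar> <= real (Suc k) * (L * (1 / real (Suc k)))" by (intro mult_left_mono) auto
      then show "\<bar>real (Suc k) * (m (x + 1 / real (Suc k)) - m x)\<bar> <= L" by (simp add: abs_mult)
    qed
  qed
  have mB: "\<bar>m x\<bar> <= \<bar>m 0\<bar> + L" if "0 < x" "x < 1" for x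
    using lip[of x 0] that mult_left_mono[of x 1 L] L0 by simp
  \<comment> \<open>The factor 3 stems from \<open>mulT_norm\<close>; on (0,1) the multiplier is at
    most |m 0| + L, and its derivative is a.e. at most L.\<close>
  define C where "C = 3 * (\<bar>m 0\<bar> + L + L)"
  have "\<exists>v. H10v O' v \<and> (AE s in M1. vnu' \<alpha> v s = tr' \<alpha> w s) \<and> NN \<alpha> v <= C * l2n (RS (Om' \<alpha>)) (JW O' w)" if w: "H10 O' w" for w
  proof -
    let ?V = "%x. mulT (m (fst x), md (fst x), 0) (JW O' w x)"
    have T: "TT \<alpha> ?V (%s. m s * tr' \<alpha> w s)" by (rule TT_lipschitz_mult[OF ad(2) H10_TT[OF ad(2) w] lip mdm lim])
    obtain y where y: "H10 O' y" "AE x in RO. JW O' y x = ?V x" "AE s in M1. tr' \<alpha> y s = m s * tr' \<alpha> w s"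
      using TT_H10[OF ad(2) T] by blast
    let ?v = "%x. (0, y x)"
    have v: "H10v O' ?v" using y(1) H10_zero(1) by (simp add: H10v_def c_Pair)
    have z: "AE s in M1. tr' \<alpha> (%x. 0) s = 0"
    proof -
      have "l2n M1 (tr' \<alpha> (%x. 0)) <= Ct * 0" using TT_bound[OF ad(2) H10_TT[OF ad(2) H10_zero(1)]] JW_zero_norm[OF ad(2)] by simp
      then have "l2n M1 (tr' \<alpha> (%x. 0)) = 0" using l2n_nonneg[of M1 "tr' \<alpha> (%x. 0)"] by linarith
      then show ?thesis using l2n_eq_0_iff[OF tr_sqi[OF ad(2) H10_zero(1)]] by simp
    qed
    have se: "AE s in M1. r s = sqrt (1 + (adv \<alpha> s)\<^sup>2)" by (rule M1_AE_I) (simp add: r_def slope_eq)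
    have nu: "AE s in M1. vnu' \<alpha> ?v s = tr' \<alpha> w s"
      using y(3) z se
    proof eventually_elim
      case (elim s)
      have "vnu' \<alpha> ?v s = r s * tr' \<alpha> w s / r s" unfolding vnu_def c_Pair elim(1,2) by (simp add: m_def elim(3))
      then show ?case using r1[of s] by simp
    qed
    have Us: "AE x in RS (Om' \<alpha>). JW O' y x = ?V x" using y(2) Om_sub[OF ad(2)] unfolding RS_AE[OF O_borel] RS_AE[OF Om_borel[OF ad(2)]]
      by (auto elim!: eventually_mono)
    have md2: "AE x in RS (Om' \<alpha>). \<bar>md (fst x)\<bar> <= L" unfolding RS_AE[OF Om_borel[OF ad(2)]] using AE_lborel_fst[OF mdL] by (auto elim!: eventually_mono)
    have in1: "AE x in RS (Om' \<alpha>). 0 < fst x \<and> fst x < 1" unfolding RS_AE[OF Om_borel[OF ad(2)]] by (auto simp: Om_def)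
    have sy: "sqi (RS (Om' \<alpha>)) (JW O' y)" "sqi (RS (Om' \<alpha>)) (JW O' w)"
      by (rule sqi_subset(1)[OF Om_borel[OF ad(2)] O_borel Om_sub[OF ad(2)] H10_sqi], fact)+
    have "l2n (RS (Om' \<alpha>)) (JW O' y) <= C * l2n (RS (Om' \<alpha>)) (JW O' w)"
    proof (rule l2n_le[OF sqi_measurable[OF sy(1)] sy(2)])
      show "AE x in RS (Om' \<alpha>). norm (JW O' y x) <= C * norm (JW O' w x)"
        using Us md2 in1
      proof eventually_elim
        case (elim x)
        have "norm (m (fst x), md (fst x), 0::real) <= \<bar>m (fst x)\<bar> + \<bar>md (fst x)\<bar>"
          using norm_Pair_le[of "m (fst x)" "(md (fst x), 0::real)"] norm_Pair_le[of "md (fst x)" "0::real"] by simp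
        also have "\<dots> <= \<bar>m 0\<bar> + L + L" using mB[of "fst x"] elim by simp
        finally have n: "norm (m (fst x), md (fst x), 0::real) <= \<bar>m 0\<bar> + L + L" .
        have "norm (JW O' y x) <= 3 * norm (m (fst x), md (fst x), 0::real) * norm (JW O' w x)" unfolding elim(1) by (rule mulT_norm)
        also have "\<dots> <= C * norm (JW O' w x)" unfolding C_def using n by (intro mult_right_mono) auto
        finally show ?case .
      qed
      show "0 <= C" using L0 by (simp add: C_def)
    qed
    then have "NN \<alpha> ?v <= C * l2n (RS (Om' \<alpha>)) (JW O' w)" by (simp add: NN_def c_Pair JW_zero_norm[OF ad(2)])
    with v nu show ?thesis by blast
  qed
  then show ?thesis by (rule that)
qed

lemma sigma_nu_Hm12: "Hm12 \<omega> \<alpha> sigma_nu"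
  unfolding Hm12_def
proof (intro conjI allI impI)
  fix t1 t2 :: "real => real" assume "AE s in lborel. s \<in> {0<..<1} --> t1 s = t2 s"
  then show "sigma_nu t1 = sigma_nu t2" by (intro sigma_nu_cong) (simp add: M1_AE)
next
  obtain C where C: "!!w. H10 O' w ==> \<exists>v. H10v O' v \<and> (AE s in M1. vnu' \<alpha> v s = tr' \<alpha> w s) \<and> NN \<alpha> v <= C * l2n (RS (Om' \<alpha>)) (JW O' w)"
    using normal_field by blast
  have ext': "\<exists>v. H10v O' v \<and> (AE s in M1. vnu' \<alpha> v s = tr' \<alpha> w s) \<and> NN \<alpha> v <= C * sqrt (H1sq (Om' \<alpha>) w)" if w: "W \<omega> \<alpha> w" for w
  proof -
    obtain w' where w': "H10 O' w'" "!!x. x \<in> Om' \<alpha> ==> w x = w' x" using Wr[OF Ua(2) w] by blast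
    have e: "tr' \<alpha> w = tr' \<alpha> w'" by (rule tr_cong) (rule w')
    have n: "l2n (RS (Om' \<alpha>)) (JW O' w') = sqrt (H1sq (Om' \<alpha>) w)" by (rule W_norm[OF ad(2) w'(1)], erule w'(2))
    show ?thesis using C[OF w'(1)] unfolding e n .
  qed
  show "sigma_nu (%s. a * tr' \<alpha> w1 s + b * tr' \<alpha> w2 s) = a * sigma_nu (tr' \<alpha> w1) + b * sigma_nu (tr' \<alpha> w2)" if w: "W \<omega> \<alpha> w1" "W \<omega> \<alpha> w2" for w1 w2 a b
  proof -
    obtain v1 where v1: "H10v O' v1" "AE s in M1. vnu' \<alpha> v1 s = tr' \<alpha> w1 s" using ext'[OF w(1)] by blast
    obtain v2 where v2: "H10v O' v2" "AE s in M1. vnu' \<alpha> v2 s = tr' \<alpha> w2 s" using ext'[OF w(2)] by blast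
    \<comment> \<open>Represents a v1 as v1 + (a - 1) v1, because the linearity lemma has
      coefficient one on the first field.\<close>
    let ?p = "%x. v1 x + (a - 1) *\<^sub>R v1 x"
    have p: "H10v O' ?p" by (rule H10v_comb[OF v1(1) v1(1)])
    have "AE s in M1. vnu' \<alpha> (%x. ?p x + b *\<^sub>R v2 x) s = a * tr' \<alpha> w1 s + b * tr' \<alpha> w2 s"
      using vnu_comb[OF p v2(1), of b] vnu_comb[OF v1(1) v1(1), of "a - 1"] v1(2) v2(2) by eventually_elim (simp add: algebra_simps)
    from sigma_nu_eq[OF H10v_comb[OF p v2(1)] this] show ?thesis
      unfolding sigma_nu_eq[OF v1] sigma_nu_eq[OF v2] E0_lin[OF p v2(1)] E0_lin[OF v1(1) v1(1)] by (simp add: algebra_simps)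
  qed
  let ?K = "l2n RO Q0 + l2n M1 sigma_tau * (Ct * (1 + \<bar>C1\<bar>))"
  show "\<exists>C. \<forall>w. W \<omega> \<alpha> w --> \<bar>sigma_nu (tr' \<alpha> w)\<bar> <= C * sqrt (H1sq (Om' \<alpha>) w)"
  proof (intro exI[of _ "?K * C"] allI impI)
    fix w assume w: "W \<omega> \<alpha> w"
    obtain v where v: "H10v O' v" "AE s in M1. vnu' \<alpha> v s = tr' \<alpha> w s" "NN \<alpha> v <= C * sqrt (H1sq (Om' \<alpha>) w)" using ext'[OF w] by blast
    have "\<bar>E0 v\<bar> <= ?K * NN \<alpha> v" by (rule FF_bound[OF Ua(2) ad(2) QQ_sqi(2) sigma_tau(1) v(1) _ order_refl order_refl]) (simp add: Q0_def)
    also have "\<dots> <= ?K * (C * sqrt (H1sq (Om' \<alpha>) w))" using Ct_pos by (intro mult_left_mono v(3)) auto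
    finally show "\<bar>sigma_nu (tr' \<alpha> w)\<bar> <= ?K * C * sqrt (H1sq (Om' \<alpha>) w)" by (simp add: sigma_nu_eq[OF v(1,2)] mult.assoc)
  qed
qed

section \<open>Passage to the limit in the slip condition\<close>

lemma ub_trace_conv:
  "l2conv M1 (%n. tr' (\<alpha>s n) (c1 (uu n))) (tr' \<alpha> (c1 ubar))"
  "l2conv M1 (%n. tr' (\<alpha>s n) (c2 (uu n))) (tr' \<alpha> (c2 ubar))"
proof -
  obtain K where K: "!!n. l2n RO (JW O' (c1 (uu n))) <= K" "!!n. l2n RO (JW O' (c2 (uu n))) <= K" using energy_bound by blast
  show "l2conv M1 (%n. tr' (\<alpha>s n) (c1 (uu n))) (tr' \<alpha> (c1 ubar))"
    by (rule trace_strong_conv[OF ad C0 uuH(1) ubH(1) K(1) uu_weak(1)])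
  show "l2conv M1 (%n. tr' (\<alpha>s n) (c2 (uu n))) (tr' \<alpha> (c2 ubar))"
    by (rule trace_strong_conv[OF ad C0 uuH(2) ubH(2) K(2) uu_weak(2)])
qed

lemma ub_vnu: "AE s in M1. vnu' \<alpha> ubar s = 0"
proof -
  let ?a = "%n s. adv (\<alpha>s n) s * tr' (\<alpha>s n) (c1 (uu n)) s" and ?b = "%n. tr' (\<alpha>s n) (c2 (uu n))"
  let ?aa = "%s. adv \<alpha> s * tr' \<alpha> (c1 ubar) s" and ?bb = "tr' \<alpha> (c2 ubar)"
  note t = tr_sqi[OF ad(1) uuH(1)] tr_sqi[OF ad(1) uuH(2)] tr_sqi[OF ad(2) ubH(1)] tr_sqi[OF ad(2) ubH(2)]
  have sa: "sqi M1 (?a n)" "sqi M1 ?aa" for n by (intro adv_mult Ua t)+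
  have ab: "AE s in M1. ?a n s = ?b n s" for n using us_vnu[of n] unfolding uu_comp vnu_zero_iff by eventually_elim simp
  have "l2n M1 (%s. ?aa s - ?bb s) <= l2n M1 (%s. ?a n s - ?aa s) + l2n M1 (%s. ?b n s - ?bb s)" for n
  proof -
    have "l2n M1 (%s. ?a n s - ?bb s) = l2n M1 (%s. ?b n s - ?bb s)"
      by (rule l2n_cong_AE[OF sqi_measurable[OF sqi_diff[OF sa(1) t(4)]] sqi_measurable[OF sqi_diff[OF t(2) t(4)]]])
         (use ab[of n] in eventually_elim, simp)
    then show ?thesis using l2n_triangle3[OF sa(2) sa(1)[of n] t(4)] l2n_minus_commute[of M1 ?aa "?a n"] by simp
  qed
  moreover have "(%n. l2n M1 (%s. ?a n s - ?aa s) + l2n M1 (%s. ?b n s - ?bb s)) \<longlonglongrightarrow> 0 + 0"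
    by (intro tendsto_add adv_mult_conv t ub_trace_conv)
  ultimately have "l2n M1 (%s. ?aa s - ?bb s) <= 0 + 0" by (intro LIMSEQ_le_const) auto
  then have "l2n M1 (%s. ?aa s - ?bb s) = 0" using l2n_nonneg[of M1 "%s. ?aa s - ?bb s"] by linarith
  then show ?thesis using l2n_eq_0_iff[OF sqi_diff[OF sa(2) t(4)]] unfolding vnu_zero_iff by simp
qed

definition hh :: "nat => real => real" where "hh n s = g \<bar>vtau' (\<alpha>s n) (uu n) s\<bar>"
definition h0 :: "real => real" where "h0 s = g \<bar>vtau' \<alpha> ubar s\<bar>"

lemma g_abs_continuous: "continuous_on UNIV (%x. g \<bar>x\<bar>)"
  by (rule continuous_on_compose2[OF gcont]) (auto intro!: continuous_intros)

lemma hh_bounds: "gmin <= hh n s" "hh n s <= gmax" "gmin <= h0 s" "h0 s <= gmax"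
  using gbnd(2) by (auto simp: hh_def h0_def)

lemma hh_sqi: "sqi M1 (hh n)" "sqi M1 h0"
proof -
  have gm: "(%x. g \<bar>x\<bar>) \<in> borel_measurable borel" by (rule borel_measurable_continuous_onI[OF g_abs_continuous])
  have b: "norm (hh n s) <= gmax" "norm (h0 s) <= gmax" for s using hh_bounds(1,2)[of n s] hh_bounds(3,4)[of s] gbnd(1) by auto
  have "sqi M1 (vtau' (\<alpha>s n) (uu n))" "sqi M1 (vtau' \<alpha> ubar)"
    by (intro vtau_sqi Ua tr_sqi ad uuH ubH)+
  from this[THEN sqi_measurable, THEN measurable_compose, OF gm]
  have m: "hh n \<in> borel_measurable M1" "h0 \<in> borel_measurable M1" unfolding hh_def[abs_def] h0_def[abs_def] by auto
  show "sqi M1 (hh n)" "sqi M1 h0" by (rule M1_bounded_sqi[OF m(1), of gmax], simp add: b[unfolded real_norm_def], rule M1_bounded_sqi[OF m(2), of gmax], simp add: b[unfolded real_norm_def])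
qed

lemma vtau_bt: "vtau' \<beta> v s = bt \<beta> v s / sqrt (1 + (adv \<beta> s)\<^sup>2)" by (simp add: vtau_def bt_def mult.commute)

lemma bt_uu_conv: "l2conv M1 (%n. bt (\<alpha>s n) (uu n)) (bt \<alpha> ubar)"
  by (rule bt_conv[OF uu(1) ulim(1) ub_trace_conv])

lemmas bt_uu_sqi = bt_sqi[OF Ua(1) ad(1) uu(1)] and bt_ub_sqi = bt_sqi[OF Ua(2) ad(2) ulim(1)]

text \<open>A subsequence is enough: \<open>sigma_tau\<close> is the weak limit of the full sequence
  already, and the relations to be proved concern limits only.\<close>

lemma threshold_subseq: obtains r :: "nat => nat" where "strict_mono r" "AE s in M1. (%n. hh (r n) s) \<longlonglongrightarrow> h0 s"
proof -
  obtain r :: "nat => nat" where r: "strict_mono r" "AE s in M1. (%n. bt (\<alpha>s (r n)) (uu (r n)) s) \<longlonglongrightarrow> bt \<alpha> ubar s"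
    by (rule l2_AE_subseq[OF bt_uu_sqi bt_ub_sqi bt_uu_conv])
  have "AE s in M1. 0 < s \<and> s < 1" by (rule M1_AE_I) simp
  with r(2) have "AE s in M1. (%n. hh (r n) s) \<longlonglongrightarrow> h0 s"
  proof eventually_elim
    case (elim s)
    have a: "(%n. adv (\<alpha>s (r n)) s) \<longlonglongrightarrow> adv \<alpha> s" using LIMSEQ_subseq_LIMSEQ[OF adv_lim r(1)] elim(2) by (simp add: o_def)
    have "sqrt (1 + (adv \<alpha> s)\<^sup>2) \<noteq> 0" by (simp add: add_pos_nonneg less_imp_neq[THEN not_sym])
    then have "(%n. vtau' (\<alpha>s (r n)) (uu (r n)) s) \<longlonglongrightarrow> vtau' \<alpha> ubar s"
      unfolding vtau_bt by (intro tendsto_intros a elim(1))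
    moreover have "isCont (%x. g \<bar>x\<bar>) (vtau' \<alpha> ubar s)" using g_abs_continuous by (simp add: continuous_on_eq_continuous_at)
    ultimately show ?case unfolding hh_def h0_def by (rule isCont_tendsto_compose[rotated])
  qed
  with r(1) show ?thesis by (rule that)
qed

lemma sigma_tau_Kset: "sigma_tau \<in> Kset g (%s. \<bar>vtau' \<alpha> ubar s\<bar>)"
proof -
  obtain r where r: "strict_mono r" "AE s in M1. (%n. hh (r n) s) \<longlonglongrightarrow> h0 s" using threshold_subseq .
  \<comment> \<open>The thresholds are bounded by \<open>gmax\<close>, so a.e. convergence improves
    to strong L2 convergence.\<close>
  have hc: "l2conv M1 (%n. hh (r n)) h0"
  proof (rule l2n_dominated)
    show "(%s. hh (r n) s - h0 s) \<in> borel_measurable M1" for n by (rule sqi_measurable[OF sqi_diff[OF hh_sqi]])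
    show "sqi M1 (%s. gmax)" by (rule M1_continuous_sqi) simp
    show "AE s in M1. norm (hh (r n) s - h0 s) <= norm gmax" for n
    proof (rule AE_I2)
      fix s show "norm (hh (r n) s - h0 s) <= norm gmax" using hh_bounds(1,2)[of "r n" s] hh_bounds(3,4)[of s] gbnd(1) by simp
    qed
    show "AE s in M1. (%n. hh (r n) s - h0 s) \<longlonglongrightarrow> 0"
      using r(2)
    proof eventually_elim
      case (elim s) from tendsto_diff[OF elim tendsto_const[of "h0 s"]] show ?case by simp
    qed
  qed
  have w: "(%n. LINT s|M1. \<sigma>ts (r n) s * q s) \<longlonglongrightarrow> (LINT s|M1. sigma_tau s * q s)" if "sqi M1 q" for q
    using LIMSEQ_subseq_LIMSEQ[OF sigma_tau(2)[OF that] r(1)] by (simp add: o_def)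
  have w': "(%n. LINT s|M1. - \<sigma>ts (r n) s * q s) \<longlonglongrightarrow> (LINT s|M1. - sigma_tau s * q s)" if "sqi M1 q" for q
    using tendsto_minus[OF w[OF that]] by simp
  have b: "AE s in M1. \<sigma>ts n s <= hh n s" "AE s in M1. - \<sigma>ts n s <= hh n s" for n
    using sigma_seq(2)[of n] by (eventually_elim, simp add: hh_def)+
  have "AE s in M1. sigma_tau s <= h0 s" by (rule weak_limit_le[OF sigma_seq(1) sigma_tau(1) w hh_sqi hc b(1)])
  moreover have "AE s in M1. - sigma_tau s <= h0 s"
    by (rule weak_limit_le[OF sqi_uminus[OF sigma_seq(1)] sqi_uminus[OF sigma_tau(1)] w' hh_sqi hc b(2)])
  ultimately have "AE s in M1. \<bar>sigma_tau s\<bar> <= h0 s" by eventually_elim simp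
  then show ?thesis using sigma_tau(1) by (simp add: Kset_def M1_L2S M1_AE h0_def)
qed

text \<open>The admissible set moves with n, so \<mu> has to be approximated strongly by multipliers
  admissible for the n-th problem. The lower bound \<open>gmin\<close> keeps the quotients of
  thresholds bounded. The products pass to the limit because the tangential components converge
  strongly.\<close>

lemma sigma_tau_inequality:
  assumes mu: "\<mu> \<in> Kset g (%s. \<bar>vtau' \<alpha> ubar s\<bar>)" shows "ipS \<alpha> (%s. \<mu> s + sigma_tau s) (vtau' \<alpha> ubar) <= 0"
proof -
  have m: "sqi M1 \<mu>" "AE s in M1. \<bar>\<mu> s\<bar> <= h0 s" using mu by (auto simp: Kset_def M1_L2S M1_AE h0_def)
  obtain r where r: "strict_mono r" "AE s in M1. (%n. hh (r n) s) \<longlonglongrightarrow> h0 s" using threshold_subseq .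
  have h0p: "0 < h0 s" for s using hh_bounds(3)[of s] gbnd(1) by simp
  \<comment> \<open>rescaled so as to be admissible for the \<open>n\<close>-th threshold\<close>
  define mn where "mn n s = \<mu> s * (hh (r n) s / h0 s)" for n s
  let ?B = "gmax / gmin"
  have ratio: "0 <= hh (r n) s / h0 s" "hh (r n) s / h0 s <= ?B" "1 <= ?B" for n s
    using hh_bounds(1,2)[of "r n" s] hh_bounds(3,4)[of s] gbnd(1) by (auto intro!: frac_le divide_nonneg_nonneg simp: le_divide_eq_1)
  have mnm: "mn n \<in> borel_measurable M1" for n
    unfolding mn_def using m(1) hh_sqi(1)[of "r n"] hh_sqi(2) by (intro borel_measurable_times borel_measurable_divide sqi_measurable)
  have mna: "\<bar>mn n s\<bar> = \<bar>\<mu> s\<bar> * (hh (r n) s / h0 s)" for n s unfolding mn_def abs_mult by (simp only: abs_of_nonneg[OF ratio(1)])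
  have mnb: "norm (mn n s) <= ?B * norm (\<mu> s)" for n s
    using mult_left_mono[OF ratio(2)[of n s], of "\<bar>\<mu> s\<bar>"] by (simp add: mna mult.commute)
  have mns: "sqi M1 (mn n)" and mnn: "l2n M1 (mn n) <= ?B * l2n M1 \<mu>" for n
    by (rule sqi_bound[OF mnm m(1), where K="?B"], use mnb in simp, rule l2n_le[OF mnm m(1)], use mnb ratio(3) in simp_all)
  have mnc: "l2conv M1 mn \<mu>"
  proof (rule l2n_dominated)
    show "(%s. mn n s - \<mu> s) \<in> borel_measurable M1" for n by (rule sqi_measurable[OF sqi_diff[OF mns m(1)]])
    show "sqi M1 (%s. (?B + 1) * \<mu> s)" by (rule sqi_cmult[OF m(1)])
    show "AE s in M1. norm (mn n s - \<mu> s) <= norm ((?B + 1) * \<mu> s)" for n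
    proof (rule AE_I2)
      fix s
      have "norm (mn n s - \<mu> s) <= (?B + 1) * \<bar>\<mu> s\<bar>" using norm_triangle_ineq4[of "mn n s" "\<mu> s"] mnb[of n s] by (simp add: distrib_right)
      then show "norm (mn n s - \<mu> s) <= norm ((?B + 1) * \<mu> s)" using ratio(3) by (simp add: abs_mult)
    qed
    show "AE s in M1. (%n. mn n s - \<mu> s) \<longlonglongrightarrow> 0"
      using r(2)
    proof eventually_elim
      case (elim s)
      have "(%n. \<mu> s * (hh (r n) s / h0 s) - \<mu> s) \<longlonglongrightarrow> \<mu> s * (h0 s / h0 s) - \<mu> s"
        using h0p[of s] by (intro tendsto_intros elim) simp
      then show ?case using h0p[of s] by (simp add: mn_def)
    qed
  qed
  let ?T = "%n. bt (\<alpha>s n) (uu n)" and ?TT = "bt \<alpha> ubar"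
  have Tr: "l2conv M1 (%n. ?T (r n)) ?TT" using LIMSEQ_subseq_LIMSEQ[OF bt_uu_conv r(1)] by (simp add: o_def)
  have c1: "(%n. LINT s|M1. mn n s * ?T (r n) s) \<longlonglongrightarrow> (LINT s|M1. \<mu> s * ?TT s)"
    using l2_weak_strong[OF mns mnn tendsto_integral_l2[OF mns m(1) mnc bt_ub_sqi] bt_uu_sqi bt_ub_sqi Tr] by simp
  have c2: "(%n. LINT s|M1. \<sigma>ts (r n) s * ?T (r n) s) \<longlonglongrightarrow> (LINT s|M1. sigma_tau s * ?TT s)"
    using LIMSEQ_subseq_LIMSEQ[OF sigma_tau_strong[OF bt_uu_sqi bt_ub_sqi bt_uu_conv] r(1)] by (simp add: o_def)
  have "(LINT s|M1. mn n s * ?T (r n) s) + (LINT s|M1. \<sigma>ts (r n) s * ?T (r n) s) <= 0" for n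
  proof -
    have "AE s in M1. \<bar>mn n s\<bar> <= hh (r n) s"
      using m(2)
    proof eventually_elim
      case (elim s)
      have "\<bar>mn n s\<bar> <= h0 s * (hh (r n) s / h0 s)" unfolding mna by (intro mult_right_mono elim ratio)
      then show ?case using h0p[of s] by simp
    qed
    then have "mn n \<in> Kset g (%s. \<bar>vtau' (\<alpha>s (r n)) (us (r n)) s\<bar>)" using mns[of n] by (simp add: Kset_def M1_L2S M1_AE hh_def uu_comp)
    from solD(9)[OF this] have "(LINT s|M1. (mn n s + \<sigma>ts (r n) s) * ?T (r n) s) <= 0" by (simp add: uu_comp ipS_vtau bt_def)
    then show ?thesis unfolding distrib_right using sqi_mult[OF mns[of n] bt_uu_sqi[of "r n"]] sqi_mult[OF sigma_seq(1)[of "r n"] bt_uu_sqi[of "r n"]] by simp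
  qed
  then have "(LINT s|M1. \<mu> s * ?TT s) + (LINT s|M1. sigma_tau s * ?TT s) <= 0" by (intro LIMSEQ_le_const2[OF tendsto_add[OF c1 c2]]) auto
  then have "(LINT s|M1. (\<mu> s + sigma_tau s) * ?TT s) <= 0" unfolding distrib_right using sqi_mult[OF m(1) bt_ub_sqi] sqi_mult[OF sigma_tau(1) bt_ub_sqi] by simp
  then show ?thesis by (simp add: ipS_vtau bt_def)
qed

section \<open>Incompressibility and the equation in the limit\<close>

definition dvg :: "(R2 => R2) => R2 => real" where "dvg v x = pr1 (JW O' (c1 v) x) + pr2 (JW O' (c2 v) x)"

lemma dvg_sqi: "H10v O' v ==> sqi RO (dvg v)"
  unfolding dvg_def by (intro sqi_add sqi_pr H10_sqi H10v_D)

lemma ind_mult_integrable: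
  assumes "adm \<beta>" "sqi RO p" "sqi RO q" shows "integrable RO (%x. indicator (Om' \<beta>) x * (p x * q x :: real))"
  using sqi_mult[OF ind_sqi(1)[OF assms(1,2)] assms(3)] by (simp add: mult.assoc)

text \<open>The difference of \<open>form_eq\<close> for the pressures 0 and q with the same field;
  the viscous and force terms cancel.\<close>

lemma bform_eq:
  assumes a: "adm \<beta>" and v: "H10v O' v" and q: "sqi RO q"
  shows "bform (Om' \<beta>) v q = (LINT x|RO. indicator (Om' \<beta>) x * (q x * dvg v x))"
proof -
  let ?i = "indicator (Om' \<beta>) :: R2 => real"
  have int: "integrable RO (%x. ?i x * (Qf f v p x \<bullet> Ju v x))" if "sqi RO p" for p
    using sqi_inner[OF ind_sqi(1)[OF a Qf_sqi[OF v that fsq]] Ju_sqi[OF v]] by simp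
  have "bform (Om' \<beta>) v (%x. 0) = 0" by (simp add: bform_def intg_def)
  then have "bform (Om' \<beta>) v q = (LINT x|RO. ?i x * (Qf f v (%x. 0) x \<bullet> Ju v x)) - (LINT x|RO. ?i x * (Qf f v q x \<bullet> Ju v x))"
    using form_eq[OF a v v q fsq] form_eq[OF a v v sqi_zero fsq] by linarith
  also have "\<dots> = (LINT x|RO. ?i x * (Qf f v (%x. 0) x \<bullet> Ju v x) - ?i x * (Qf f v q x \<bullet> Ju v x))"
    by (rule Bochner_Integration.integral_diff[OF int[OF sqi_zero] int[OF q], symmetric])
  also have "\<dots> = (LINT x|RO. ?i x * (q x * dvg v x))"
    by (intro Bochner_Integration.integral_cong refl) (simp add: Qf_def Ju_def dvg_def JW_def algebra_simps)
  finally show ?thesis .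
qed

lemma dvg_conv:
  assumes q: "sqi RO q"
  shows "(%n. LINT x|RO. indicator (Om' (\<alpha>s n)) x * (q x * dvg (uu n) x)) \<longlonglongrightarrow> (LINT x|RO. indicator (Om' \<alpha>) x * (q x * dvg ubar x))"
proof -
  define qa where "qa x = (0::real, q x, 0::real)" for x
  define qb where "qb x = (0::real, 0::real, q x)" for x
  have s: "sqi RO qa" "sqi RO qb" unfolding qa_def qb_def by (intro sqi_Pair sqi_zero q)+
  have e: "(LINT x|RO. indicator (Om' \<beta>) x * (q x * dvg v x)) =
     (LINT x|RO. JW O' (c1 v) x \<bullet> (indicator (Om' \<beta>) x *\<^sub>R qa x)) + (LINT x|RO. JW O' (c2 v) x \<bullet> (indicator (Om' \<beta>) x *\<^sub>R qb x))"
    if "adm \<beta>" "H10v O' v" for \<beta> v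
    unfolding Bochner_Integration.integral_add[OF sqi_inner[OF H10_sqi[OF H10v_D(1)[OF that(2)]] ind_sqi(1)[OF that(1) s(1)]]
        sqi_inner[OF H10_sqi[OF H10v_D(2)[OF that(2)]] ind_sqi(1)[OF that(1) s(2)]], symmetric]
    by (intro Bochner_Integration.integral_cong refl) (simp add: qa_def qb_def dvg_def JW_def algebra_simps)
  show ?thesis unfolding e[OF ad(1) uu(1)] e[OF ad(2) ulim(1)] by (intro tendsto_add uu_ind_conv s)
qed

lemma ind_integral_conv:
  fixes q :: "R2 => real"
  assumes q: "sqi RO q"
  shows "(%n. LINT x|RO. indicator (Om' (\<alpha>s n)) x * q x) \<longlonglongrightarrow> (LINT x|RO. indicator (Om' \<alpha>) x * q x)"
  using tendsto_integral_l2[OF ind_sqi(1)[OF ad(1) q] ind_sqi(1)[OF ad(2) q] indicator_Om_conv[OF ad C0 q] const_sqi[of 1]] by simp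

text \<open>A test function with mean zero on the limit domain need not have mean zero on the n-th
  one. Its mean there has to be removed, and the correction disappears in the limit because the
  domains converge.\<close>

lemma ub_divfree: assumes "L20 (Om' \<alpha>) q" shows "bform (Om' \<alpha>) ubar q = 0"
proof -
  let ?U = "Om' \<alpha>"
  define q0 where "q0 x = (if x \<in> ?U then q x else 0)" for x
  have q: "sqi (RS ?U) q" "(LINT x|RS ?U. q x) = 0" using assms by (auto simp: L20_def RS_L2[OF Om_borel[OF ad(2)]] RS_intg[OF Om_borel[OF ad(2)]])
  have s: "sqi RO q0" unfolding q0_def by (rule zero_extension[OF ad(2) q(1)])
  define a :: "nat => real" where "a n = (LINT x|RO. indicator (Om' (\<alpha>s n)) x * 1)" for n
  define b :: "nat => real" where "b n = (LINT x|RO. indicator (Om' (\<alpha>s n)) x * q0 x)" for n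
  define m :: real where "m = (LINT x|RO. indicator ?U x * 1)"
  define I where "I p = (LINT x|RO. indicator ?U x * (p x * dvg ubar x))" for p
  have ac: "a \<longlonglongrightarrow> m" unfolding a_def m_def by (rule ind_integral_conv[OF const_sqi])
  have bc: "b \<longlonglongrightarrow> 0"
  proof -
    have "(LINT x|RO. indicator ?U x * q0 x) = (LINT x|RO. indicator ?U x * q x)"
      by (intro Bochner_Integration.integral_cong refl) (simp add: q0_def indicator_def)
    also have "\<dots> = 0" using q(2) RS_sub_integral[OF Om_borel[OF ad(2)] Om_sub[OF ad(2)], of q] by simp
    finally show ?thesis using ind_integral_conv[OF s] by (simp add: b_def[abs_def])
  qed
  have "a n * (LINT x|RO. indicator (Om' (\<alpha>s n)) x * (q0 x * dvg (uu n) x)) = b n * (LINT x|RO. indicator (Om' (\<alpha>s n)) x * (1 * dvg (uu n) x))" for n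
  proof -
    let ?V = "Om' (\<alpha>s n)" and ?i = "indicator (Om' (\<alpha>s n)) :: R2 => real"
    note Vb = Om_borel[OF ad(1)[of n]] and Vs = Om_sub[OF ad(1)[of n]]
    \<comment> \<open>mean zero on \<open>\<Omega>(\<alpha>\<^sub>n)\<close> without dividing by its measure\<close>
    let ?p = "%x. a n * q0 x - b n"
    have p: "sqi RO ?p" by (intro sqi_diff sqi_cmult s const_sqi)
    have i: "integrable RO (%x. ?i x * q0 x)" "integrable RO (%x. ?i x)"
      using ind_mult_integrable[OF ad(1)[of n] s const_sqi[of 1]] ind_mult_integrable[OF ad(1)[of n] const_sqi[of 1] const_sqi[of 1]] by auto
    have "(LINT x|RS ?V. ?p x) = (LINT x|RO. a n * (?i x * q0 x) - b n * ?i x)"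
      unfolding RS_sub_integral[OF Vb Vs] by (intro Bochner_Integration.integral_cong refl) (simp add: algebra_simps)
    also have "\<dots> = a n * b n - b n * a n" using i by (simp add: a_def b_def)
    finally have "L20 ?V ?p" using sqi_subset(1)[OF Vb O_borel Vs p] by (simp add: L20_def RS_L2[OF Vb] RS_intg[OF Vb])
    from solD(7)[OF this] have "bform ?V (uu n) ?p = 0" by (simp add: bform_def uu_wd)
    then have "(LINT x|RO. ?i x * (?p x * dvg (uu n) x)) = 0" using bform_eq[OF ad(1)[of n] uu(1)[of n] p] by simp
    moreover have "(LINT x|RO. ?i x * (?p x * dvg (uu n) x)) = (LINT x|RO. a n * (?i x * (q0 x * dvg (uu n) x)) - b n * (?i x * (1 * dvg (uu n) x)))"
      by (intro Bochner_Integration.integral_cong refl) (simp add: algebra_simps)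
    ultimately show ?thesis
      using ind_mult_integrable[OF ad(1)[of n] s dvg_sqi[OF uu(1)[of n]]] ind_mult_integrable[OF ad(1)[of n] const_sqi[of 1] dvg_sqi[OF uu(1)[of n]]] by simp
  qed
  then have "m * I q0 = 0 * I (%x. 1)"
    unfolding I_def using LIMSEQ_unique[OF tendsto_mult[OF ac dvg_conv[OF s]]] tendsto_mult[OF bc dvg_conv[OF const_sqi[of 1]]] by simp
  then have "m = 0 \<or> I q0 = 0" by simp
  \<comment> \<open>On a domain of measure zero the integral vanishes trivially.\<close>
  moreover have "I q0 = 0" if "m = 0"
  proof -
    have "AE x in RO. indicator ?U x * 1 = (0::real)"
      using that integral_nonneg_eq_0_iff_AE[OF ind_mult_integrable[OF ad(2) const_sqi[of 1] const_sqi[of 1]]] by (simp add: m_def)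
    then have "AE x in RO. indicator ?U x * (q0 x * dvg ubar x) = 0" by eventually_elim simp
    then show ?thesis unfolding I_def by (rule integral_eq_zero_AE)
  qed
  ultimately have "I q0 = 0" by blast
  moreover have "bform ?U ubar q = bform ?U ubar q0"
    unfolding bform_def intg_def set_lebesgue_integral_def
    by (intro Bochner_Integration.integral_cong refl) (simp add: q0_def indicator_def)
  ultimately show ?thesis using bform_eq[OF ad(2) ulim(1) s] by (simp add: I_def)
qed

lemma pbar_L20: "L20 (Om' \<alpha>) pbar"
proof -
  note Ub = Om_borel[OF ad(2)] and Us = Om_sub[OF ad(2)]
  have "(LINT x|RS (Om' \<alpha>). pbar x) = (LINT x|RO. indicator (Om' \<alpha>) x * pbar x)" by (rule RS_sub_integral[OF Ub Us])
  also have "\<dots> = (LINT x|RO. pbar x)"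
  proof (rule integral_cong_AE)
    show "(%x. indicator (Om' \<alpha>) x * pbar x) \<in> borel_measurable RO" using sqi_measurable[OF ind_sqi(1)[OF ad(2) pbar_sqi(1)]] by simp
    show "pbar \<in> borel_measurable RO" by (rule sqi_measurable[OF pbar_sqi(1)])
    show "AE x in RO. indicator (Om' \<alpha>) x * pbar x = pbar x" using pbar_off by eventually_elim (auto simp: indicator_def)
  qed
  finally show ?thesis using sqi_subset(1)[OF Ub O_borel Us pbar_sqi(1)] pbar_sqi(2) by (simp add: L20_def RS_L2[OF Ub] RS_intg[OF Ub])
qed

text \<open>The test field is exchanged for a hold-all representative that agrees with it on the
  domain. No term changes, since chosen weak derivatives and traces depend on the values in the
  domain only.\<close>

lemma limit_equation:
  assumes v: "Wv \<omega> \<alpha> v"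
  shows "aform (Om' \<alpha>) ubar v - bform (Om' \<alpha>) v pbar - sigma_nu (vnu' \<alpha> v) - ipS \<alpha> sigma_tau (vtau' \<alpha> v) = fform (Om' \<alpha>) f v"
proof -
  let ?U = "Om' \<alpha>"
  have "W \<omega> \<alpha> (c1 v)" "W \<omega> \<alpha> (c2 v)" using v by (auto simp: Wv_def)
  then obtain v1 v2 where h: "H10 O' v1" "\<forall>x\<in>?U. c1 v x = v1 x" "H10 O' v2" "\<forall>x\<in>?U. c2 v x = v2 x" using Wr[OF Ua(2)] by blast
  let ?w = "%x. (v1 x, v2 x)"
  have w: "H10v O' ?w" using h by (simp add: H10v_def c_Pair)
  have d: "wd ?U (c1 v) = wd ?U (c1 ?w)" "wd ?U (c2 v) = wd ?U (c2 ?w)" by (rule wd_cong, simp add: h c_Pair)+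
  have t: "tr' \<alpha> (c1 v) = tr' \<alpha> (c1 ?w)" "tr' \<alpha> (c2 v) = tr' \<alpha> (c2 ?w)" by (rule tr_cong, simp add: h c_Pair)+
  have "aform ?U ubar v = aform ?U ubar ?w" "bform ?U v pbar = bform ?U ?w pbar" by (simp_all add: aform_def bform_def d)
  moreover have "fform ?U f v = fform ?U f ?w" unfolding fform_def intg_def set_lebesgue_integral_def
    by (intro Bochner_Integration.integral_cong refl) (use h in \<open>auto simp: indicator_def c1_def c2_def\<close>)
  moreover have "vnu' \<alpha> v = vnu' \<alpha> ?w" "vtau' \<alpha> v = vtau' \<alpha> ?w" by (simp_all add: vnu_def[abs_def] vtau_def[abs_def] t)
  moreover have "sigma_nu (vnu' \<alpha> ?w) = E0 ?w" by (rule sigma_nu_eq[OF w]) simp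
  moreover have "(LINT x|RO. Q0 x \<bullet> Ju ?w x) = (LINT x|RO. indicator ?U x * (Qf f ubar pbar x \<bullet> Ju ?w x))" by (simp add: Q0_def)
  ultimately show ?thesis using form_eq[OF ad(2) ulim(1) w pbar_sqi(1) fsq] by (simp add: FF_def bt_def ipS_vtau)
qed

lemma limit_Msol: "Msol \<omega> f g \<alpha> ubar pbar sigma_nu sigma_tau"
  unfolding Msol_def
proof (intro conjI ballI allI impI pbar_L20 sigma_nu_Hm12 sigma_tau_Kset limit_equation ub_divfree sigma_tau_inequality)
  show "Wv \<omega> \<alpha> ubar" unfolding Wv_def using Wrestr Ua(2) ubH by blast
  show "\<mu> (vnu' \<alpha> ubar) = 0" if "Hm12 \<omega> \<alpha> \<mu>" for \<mu>
    using Hm12_zero[OF that _ ub_vnu] Wrestr Ua(2) ubH by blast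
qed

lemma limit_multipliers:
  assumes v: "H10v O' v"
  shows "(%n. \<sigma>ns n (vnu' (\<alpha>s n) v)) \<longlonglongrightarrow> sigma_nu (vnu' \<alpha> v)"
    "(%n. ipS (\<alpha>s n) (\<sigma>ts n) (vtau' (\<alpha>s n) v)) \<longlonglongrightarrow> ipS \<alpha> sigma_tau (vtau' \<alpha> v)"
proof -
  have "sigma_nu (vnu' \<alpha> v) = E0 v" by (rule sigma_nu_eq[OF v]) simp
  then show "(%n. \<sigma>ns n (vnu' (\<alpha>s n) v)) \<longlonglongrightarrow> sigma_nu (vnu' \<alpha> v)" using E0_conv[OF v] by (simp add: En_eq[OF v])
  show "(%n. ipS (\<alpha>s n) (\<sigma>ts n) (vtau' (\<alpha>s n) v)) \<longlonglongrightarrow> ipS \<alpha> sigma_tau (vtau' \<alpha> v)" using sigma_tau_bt_conv[OF v] by (simp add: ipS_vtau bt_def)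
qed

end

theorem theorem7:
  fixes amin amax C1 C2 \<omega> gmin gmax :: real
    and f :: "R2 \<Rightarrow> R2" and g :: "real \<Rightarrow> real"
    and Oh :: "R2 set"
    and \<pi> :: "(real \<Rightarrow> real) \<Rightarrow> (R2 \<Rightarrow> R2) \<Rightarrow> (R2 \<Rightarrow> R2)"
    and \<alpha>s :: "nat \<Rightarrow> real \<Rightarrow> real" and \<alpha> :: "real \<Rightarrow> real"
    and us :: "nat \<Rightarrow> R2 \<Rightarrow> R2" and ps :: "nat \<Rightarrow> R2 \<Rightarrow> real"
    and \<sigma>ns :: "nat \<Rightarrow> (real \<Rightarrow> real) \<Rightarrow> real" and \<sigma>ts :: "nat \<Rightarrow> real \<Rightarrow> real"
    and ubar :: "R2 \<Rightarrow> R2" and pbar :: "R2 \<Rightarrow> real"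
  assumes pos: "0 < amin" "amin < amax" "0 < C1" "0 < C2" "amax < \<omega>"
    and fL2: "L2 UNIV (c1 f)" "L2 UNIV (c2 f)"
    and gcont: "continuous_on {0..} g"
    and gbnd: "0 < gmin" "\<forall>x\<ge>0. gmin \<le> g x \<and> g x \<le> gmax"
    and hold: "open Oh" "bounded Oh" "\<forall>a\<in>Uad amin amax C1 C2. Om \<omega> a \<subseteq> Oh"
    and Wrestr: "\<forall>a\<in>Uad amin amax C1 C2. \<forall>v.
                   W \<omega> a v \<longleftrightarrow> (\<exists>w. H10 Oh w \<and> (\<forall>x\<in>Om \<omega> a. v x = w x))"
    and ext: "\<forall>a\<in>Uad amin amax C1 C2. \<forall>v. Vsp \<omega> a v \<longrightarrow>
                 H10v Oh (\<pi> a v) \<and> (\<forall>x\<in>Om \<omega> a. \<pi> a v x = v x)"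
    and extlin: "\<forall>a\<in>Uad amin amax C1 C2. \<forall>v w c d. Vsp \<omega> a v \<longrightarrow> Vsp \<omega> a w \<longrightarrow>
                 \<pi> a (\<lambda>x. c *\<^sub>R v x + d *\<^sub>R w x) = (\<lambda>x. c *\<^sub>R \<pi> a v x + d *\<^sub>R \<pi> a w x)"
    and extbnd: "\<exists>M. \<forall>a\<in>Uad amin amax C1 C2. \<forall>v. Vsp \<omega> a v \<longrightarrow>
                 H1sqv Oh (\<pi> a v) \<le> M * H1sqv (Om \<omega> a) v"
    and adm: "\<forall>n. \<alpha>s n \<in> Uad amin amax C1 C2" "\<alpha> \<in> Uad amin amax C1 C2"
    and conv: "C1conv \<alpha>s \<alpha>"
    and sol: "\<forall>n. Msol \<omega> f g (\<alpha>s n) (us n) (ps n) (\<sigma>ns n) (\<sigma>ts n)"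
    and ulim: "H10v Oh ubar"
              "\<forall>w. H10v Oh w \<longrightarrow>
                   (\<lambda>n. H1ipv Oh (\<pi> (\<alpha>s n) (us n)) w) \<longlonglongrightarrow> H1ipv Oh ubar w"
    and plim: "L20 Oh pbar"
              "\<forall>q. L20 Oh q \<longrightarrow>
                   (\<lambda>n. intg Oh (\<lambda>x. (if x \<in> Om \<omega> (\<alpha>s n) then ps n x else 0) * q x))
                     \<longlonglongrightarrow> intg Oh (\<lambda>x. pbar x * q x)"
  shows "\<exists>\<sigma>n \<sigma>t. Hm12 \<omega> \<alpha> \<sigma>n \<and> L2S \<sigma>t \<and>
           (\<forall>v. H10v Oh v \<longrightarrow>
              (\<lambda>n. \<sigma>ns n (vnu \<omega> (\<alpha>s n) v)) \<longlonglongrightarrow> \<sigma>n (vnu \<omega> \<alpha> v) \<and>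
              (\<lambda>n. ipS (\<alpha>s n) (\<sigma>ts n) (vtau \<omega> (\<alpha>s n) v)) \<longlonglongrightarrow> ipS \<alpha> \<sigma>t (vtau \<omega> \<alpha> v)) \<and>
           Msol \<omega> f g \<alpha> ubar pbar \<sigma>n \<sigma>t"
proof -
  interpret slip amin amax \<omega> Oh C1 C2 gmin gmax f g \<pi> \<alpha>s \<alpha> us ps \<sigma>ns \<sigma>ts ubar pbar
    by unfold_locales (use pos hold fL2 gcont gbnd Wrestr ext extbnd adm conv sol ulim plim in auto)
  show ?thesis using sigma_nu_Hm12 sigma_tau(1) limit_multipliers limit_Msol by (intro exI[of _ sigma_nu] exI[of _ sigma_tau]) (simp add: M1_L2S)
qed

end
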